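(* Let $0\leq \alpha,\beta<\infty$ and $1\leq r\leq \infty$. (A) Let $0<q<\infty$. The operator $\mathcal R_{\alpha,\beta}^*:L^r(\mathbb S^1)\to L^q(\mathbb R^2)$ is bounded provided that $\alpha+\beta>\frac{2}{q}-\frac{1}{2}$ and at least one of the following conditions holds: (i) $\max\{\alpha,\beta\}\geq \frac{1}{q}$ and $2\min\{\alpha,\beta\}>\frac{2}{q}-\frac{1}{r'}$; (ii) $\max\{\alpha,\beta\}<\frac{1}{q}$ and $\alpha+\beta+\min\{\alpha,\beta\}>\frac{3}{q}-\frac{1}{r'}$. If additionally $1<r\leq q$, then (still under $\alpha+\beta>\frac{2}{q}-\frac{1}{2}$) the operator is also bounded if one of the following holds: (iii) $\max\{\alpha,\beta\}>\frac{1}{q}$ and $2\min\{\alpha,\beta\}=\frac{2}{q}-\frac{1}{r'}$; (iv) $\max\{\alpha,\beta\}<\frac{1}{q}$ and $\alpha+\beta+\min\{\alpha,\beta\}=\frac{3}{q}-\frac{1}{r'}$. (B) If $q=\infty$, the operator $\mathcal R_{\alpha,\beta}^*:L^r(\mathbb S^1)\to L^\infty(\mathbb R^2)$ is bounded for all $r\in[1,\infty]$ and $\alpha,\beta\in[0,\infty)$. (C) These conditions are optimal: for $0<q<\infty$, if $\mathcal R_{\alpha,\beta}^*:L^r(\mathbb S^1)\to L^q(\mathbb R^2)$ is bounded, then $\alpha+\beta>\frac{2}{q}-\frac{1}{2}$ and either (i) holds, or (ii) holds, or $1<r\leq q$ and one of (iii), (iv) holds.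
   Context: $\mathbb S^1=\{\xi\in\mathbb R^2:|\xi|=1\}$ with canonical surface measure $\sigma$. The Fourier extension operator is $(\mathcal R^*F)(x,y)=\frac{1}{2\pi}\int_{\mathbb S^1}e^{i(x,y)\cdot\omega}F(\omega)\,d\sigma(\omega)$ for $(x,y)\in\mathbb R^2$, $F\in L^1(\mathbb S^1)$. The weighted operator is $(\mathcal R_{\alpha,\beta}^*F)(x,y)=(\mathcal R^*F)(x,y)(1+|x|)^{-\alpha}(1+|y|)^{-\beta}$ for $x,y\in\mathbb R$. $r'$ denotes the conjugate exponent, $\frac1r+\frac1{r'}=1$, with $\frac1\infty=0$. For $0<q<1$, $L^q$ is equipped with its usual quasi-norm. Bounded means there is $C>0$ with $\|\mathcal R_{\alpha,\beta}^*F\|_{L^q(\mathbb R^2)}\leq C\|F\|_{L^r(\mathbb S^1)}$ for all $F\in L^r(\mathbb S^1)$. *)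

theory Defs
  imports "HOL-Analysis.Analysis" "HOL-Probability.Essential_Supremum"
begin

text \<open>
  Arc length measure on the unit circle, carried by the circle itself with its Borel sigma-algebra.
\<close>

definition circle_measure :: "(real \<times> real) measure" where
  "circle_measure =
     distr (restrict_space lborel {0..<2 * pi}) (restrict_space borel (sphere 0 1))
       (\<lambda>t. (cos t, sin t))"

text \<open>
  The pushforward is along a measurable map; otherwise \<^const>\<open>distr\<close> would be the null measure.
\<close>

lemma measurable_circle_param:
  "(\<lambda>t. (cos t, sin t)) \<in> restrict_space lborel {0..<2 * pi} \<rightarrow>\<^sub>M
     restrict_space borel (sphere (0 :: real \<times> real) 1)"
proof (rule measurable_restrict_space2)
  show "(\<lambda>t. (cos t, sin t)) \<in> space (restrict_space lborel {0..<2 * pi}) \<rightarrow>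
      sphere (0 :: real \<times> real) 1"
    by (auto simp: norm_Pair)
  show "(\<lambda>t. (cos t, sin t) :: real \<times> real) \<in>
      restrict_space lborel {0..<2 * pi} \<rightarrow>\<^sub>M borel"
    by (intro measurable_restrict_space1 borel_measurable_continuous_onI)
       (auto intro!: continuous_intros
         simp: measurable_lborel1 borel_measurable_continuous_onI)
qed

lemma emeasure_circle_measure: "emeasure circle_measure (sphere 0 1) = ennreal (2 * pi)"
proof -
  have "emeasure circle_measure (sphere 0 1) =
      emeasure (restrict_space lborel {0..<2 * pi})
        ((\<lambda>t. (cos t, sin t)) -` sphere (0 :: real \<times> real) 1
          \<inter> space (restrict_space lborel {0..<2 * pi}))"
    unfolding circle_measure_def
    by (rule emeasure_distr[OF measurable_circle_param]) (auto simp: sets_restrict_space)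
  also have "(\<lambda>t. (cos t, sin t)) -` sphere (0 :: real \<times> real) 1
      \<inter> space (restrict_space lborel {0..<2 * pi}) = {0..<2 * pi}"
    by (auto simp: norm_Pair space_restrict_space)
  finally show ?thesis
    by (simp add: emeasure_restrict_space)
qed

text \<open>
  The (quasi-)norm of \<open>L\<^sup>p\<close> for \<open>0 < p \<le> \<infinity>\<close>, as an extended number. The library has no real powers
  on \<^typ>\<open>ennreal\<close>, so an infinite integral is treated separately.
\<close>

definition Lp_norm :: "'a measure \<Rightarrow> ennreal \<Rightarrow> ('a \<Rightarrow> complex) \<Rightarrow> ennreal" where
  "Lp_norm M p f =
     (if p = \<infinity> then esssup M (\<lambda>x. ennreal (cmod (f x)))
      else let I = (\<integral>\<^sup>+ x. ennreal (cmod (f x) powr enn2real p) \<partial>M)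
           in if I = \<infinity> then \<infinity> else ennreal (enn2real I powr (1 / enn2real p)))"

definition Lp_space :: "'a measure \<Rightarrow> ennreal \<Rightarrow> ('a \<Rightarrow> complex) set" where
  "Lp_space M p = {f \<in> borel_measurable M. Lp_norm M p f < \<infinity>}"

definition extension_op :: "(real \<times> real \<Rightarrow> complex) \<Rightarrow> real \<times> real \<Rightarrow> complex" where
  "extension_op F z =
     1 / (2 * of_real pi) *
     (\<integral>\<omega>. exp (\<i> * of_real (z \<bullet> \<omega>)) * F \<omega> \<partial>circle_measure)"

definition weighted_extension_op ::
    "real \<Rightarrow> real \<Rightarrow> (real \<times> real \<Rightarrow> complex) \<Rightarrow> real \<times> real \<Rightarrow> complex" where
  "weighted_extension_op \<alpha> \<beta> F =
     (\<lambda>(x, y). extension_op F (x, y) *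
        of_real ((1 + \<bar>x\<bar>) powr (- \<alpha>) * (1 + \<bar>y\<bar>) powr (- \<beta>)))"

definition bounded_Lp_op ::
    "'a measure \<Rightarrow> ennreal \<Rightarrow> 'b measure \<Rightarrow> ennreal \<Rightarrow>
     (('a \<Rightarrow> complex) \<Rightarrow> 'b \<Rightarrow> complex) \<Rightarrow> bool" where
  "bounded_Lp_op M r N q T \<longleftrightarrow>
     (\<exists>C>0. \<forall>F\<in>Lp_space M r.
        T F \<in> Lp_space N q \<and> Lp_norm N q (T F) \<le> ennreal C * Lp_norm M r F)"

definition weighted_extension_bounded :: "real \<Rightarrow> real \<Rightarrow> ennreal \<Rightarrow> ennreal \<Rightarrow> bool" where
  "weighted_extension_bounded \<alpha> \<beta> r q \<longleftrightarrow>
     bounded_Lp_op circle_measure r lborel q (weighted_extension_op \<alpha> \<beta>)"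

end

theory Submission imports Defs "HOL-Probability.Probability"
begin

text \<open>
  Sufficiency. Let \<open>F\<close> be bounded by 1 with small \<open>L\<^sup>1\<close> norm \<open>a\<close>. Restricted to a line parallel to an axis, the
  extension of \<open>F\<close> is a one-dimensional Fourier transform whose density has the Jacobian \<open>\<bar>sin\<bar>\<close>, and its square is the
  Fourier transform of the push-forward of \<open>F \<otimes> F\<close> under \<open>(\<omega>, \<omega>') \<mapsto> \<omega> + \<omega>'\<close>, with Jacobian \<open>\<bar>\<omega> \<times> \<omega>'\<bar>\<close>.
  Cutting dyadically at small Jacobian gives \<open>L\<^sup>p\<close> bounds for \<open>p > 2\<close> on lines and for \<open>p > 4\<close> in the plane, with
  the power of \<open>a\<close> predicted by the Knapp example. Together with an energy bound on boxes they give the sharp power of \<open>a\<close>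
  in the weighted norm. A general \<open>F\<close> is split into the levels of its rearrangement; the pieces are summed trivially in the
  strict cases, and by interpolating in \<open>q\<close> between neighbouring exponents in the endpoint cases \<open>1 < r \<le> q\<close>.

  Necessity. The constant function forces \<open>\<alpha> + \<beta> > 2/q - 1/2\<close>, because its extension is a Bessel function of size
  \<open>\<bar>z\<bar> powr (-1/2)\<close> on average. Indicators of caps of width \<open>1/X\<close> around the coordinate axes force the remaining
  inequalities. At an endpoint, random signs on caps of different sizes, whose extensions are large on disjoint boxes, exclude
  \<open>q < r\<close>; a logarithm in the mass of the weight excludes \<open>r = 1\<close> and \<open>max \<alpha> \<beta> = 1/q\<close>.
\<close>

text \<open>For \<open>q < 1\<close> the triangle inequality fails in L^q. Pieces are therefore
  summed pointwise, at the cost of a geometric weight (\<open>powr_suminf_le\<close>,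
  \<open>powr_suminf_two_sided_le\<close>), and Hoelder's inequality is replaced by pointwise
  inequalities between powers. On a dyadic shell of the Jacobian the L^2 bound does not improve as
  the Jacobian shrinks; only the sup bound does. A positive power of the sup bound has to be spent,
  so \<open>p = 2\<close> on lines and \<open>p = 4\<close> in the plane are not reached. Estimates
  for functions bounded by 1 with mass \<open>a\<close> take the form a^(A - B/q). \<open>B\<close>
  is 3 when the Knapp box of sides 1/a and 1/a^2 counts as a whole and 2 when only its long side
  does; \<open>A\<close> collects the amplitude and the size of the weight on the box. For 1/r < A -
  B/q the levels decay geometrically. For equality all levels weigh the same: their sizes form a
  sequence that is controlled in l^r and needed in l^q. This is how r \<le> q enters, and n caps of
  equal weight with random signs show that it must.\<close>

abbreviation (input) "Ext \<equiv> extension_op"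

abbreviation (input) "\<sigma> \<equiv> circle_measure"

abbreviation lebesgue_nn_integral (binder "LEB " 10) where
 "lebesgue_nn_integral f \<equiv> nn_integral (lborel :: 'a::euclidean_space measure) f"

abbreviation circle_nn_integral (binder "ARC " 10) where
 "circle_nn_integral f \<equiv> nn_integral \<sigma> f"

section \<open>Plancherel estimates by Gaussian regularisation\<close>

lemma gaussian_ft_std:
 fixes t :: real
 shows "(\<integral>x. exp (\<i> * of_real (x * t)) * of_real (exp (- x\<^sup>2 / 2)) \<partial>lborel)
     = complex_of_real (sqrt (2 * pi) * exp (- t\<^sup>2 / 2))"
proof -
 have "complex_of_real (exp (- t\<^sup>2 / 2)) = char std_normal_distribution t" by (simp add: char_std_normal_distribution)
 also have "... = (\<integral>x. of_real (std_normal_density x) * iexp (t * x) \<partial>lborel)" unfolding char_def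
  by (subst integral_density) (auto simp: scaleR_conv_of_real)
 also have "... = (\<integral>x. complex_of_real (1 / sqrt (2 * pi)) *
   (exp (\<i> * of_real (x * t)) * of_real (exp (- x\<^sup>2 / 2))) \<partial>lborel)" by (intro Bochner_Integration.integral_cong)
   (auto simp: std_normal_density_def algebra_simps)
 also have "... = complex_of_real (1 / sqrt (2 * pi)) *
   (\<integral>x. exp (\<i> * of_real (x * t)) * of_real (exp (- x\<^sup>2 / 2)) \<partial>lborel)" by simp
 finally show ?thesis by (simp add: field_simps)
qed

lemma gaussian_nn_integral:
 fixes m R :: real
 assumes "R > 0"
 shows "(LEB x. ennreal (exp (- (R\<^sup>2 * (x - m)\<^sup>2 / 2)))) = ennreal (sqrt (2 * pi) / R)"
proof -
 have "(LEB x. ennreal (sqrt (2 * pi) / R * normal_density m (1 / R) x))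
   = ennreal (sqrt (2 * pi) / R) * (LEB x. ennreal (normal_density m (1 / R) x))"
  using assms by (subst nn_integral_cmult[symmetric]) (auto intro!: nn_integral_cong simp: ennreal_mult'[symmetric])
 also have "(LEB x. ennreal (normal_density m (1 / R) x)) = 1" using assms by (subst nn_integral_eq_integral) (auto simp: integrable_normal_density)
 also have "(\<lambda>x. ennreal (sqrt (2 * pi) / R * normal_density m (1 / R) x))
   = (\<lambda>x. ennreal (exp (- (R\<^sup>2 * (x - m)\<^sup>2 / 2))))"
  using assms by (auto simp: normal_density_def field_simps real_sqrt_divide real_sqrt_mult)
 finally show ?thesis by simp
qed

text \<open>The power \<open>R ^ 1\<close>, the inner product and the norm match the shape
  \<open>c * R ^ d\<close> in which \<open>plancherel_schur\<close> asks for a Gaussian transform,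
  here with \<open>d = 1\<close>; the plane has \<open>d = 2\<close>.\<close>

lemma gaussian_ft_real:
 fixes t R :: real
 assumes R: "R > 0"
 shows "(\<integral>x. exp (\<i> * of_real (x \<bullet> t)) * of_real (exp (- (norm x)\<^sup>2 / (2 * R\<^sup>2))) \<partial>lborel)
     = complex_of_real (sqrt (2 * pi) * R ^ 1 * exp (- (R\<^sup>2 * (norm t)\<^sup>2 / 2)))"
proof -
 have "(\<integral>x. exp (\<i> * of_real (x \<bullet> t)) * of_real (exp (- (norm x)\<^sup>2 / (2 * R\<^sup>2))) \<partial>lborel)
   = \<bar>R\<bar> *\<^sub>R (\<integral>x. exp (\<i> * of_real ((0 + R * x) \<bullet> t)) *
     of_real (exp (- (norm (0 + R * x))\<^sup>2 / (2 * R\<^sup>2))) \<partial>lborel)"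
  using R by (subst lborel_integral_real_affine[where c = R and t = 0]) auto
 also have "(\<lambda>x. exp (\<i> * of_real ((0 + R * x) \<bullet> t)) * complex_of_real (exp (- (norm (0 + R * x))\<^sup>2 / (2 * R\<^sup>2))))
  = (\<lambda>x. exp (\<i> * of_real (x * (R * t))) * of_real (exp (- x\<^sup>2 / 2)))"
  using R by (auto simp: fun_eq_iff power_mult_distrib mult_ac)
 also have "(\<integral>x. exp (\<i> * of_real (x * (R * t))) * of_real (exp (- x\<^sup>2 / 2)) \<partial>lborel)
   = complex_of_real (sqrt (2 * pi) * exp (- (R * t)\<^sup>2 / 2))" by (rule gaussian_ft_std)
 finally show ?thesis using R by (simp add: scaleR_conv_of_real power_mult_distrib)
qed

lemma gaussian_integrable:
 fixes R :: real
 assumes R: "R > 0"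
 shows "integrable lborel (\<lambda>x::real. exp (- (norm x)\<^sup>2 / (2 * R\<^sup>2)))"
proof -
 have "(LEB x. ennreal (exp (- ((1/R)\<^sup>2 * (x - 0)\<^sup>2 / 2)))) < \<infinity>" using R by (subst gaussian_nn_integral) auto
 also have "(\<lambda>x. exp (- ((1/R)\<^sup>2 * (x - 0)\<^sup>2 / 2))) = (\<lambda>x. exp (- (norm x)\<^sup>2 / (2 * R\<^sup>2)))"
  by (auto simp: fun_eq_iff power_divide field_simps)
 finally show ?thesis by (intro integrableI_nonneg) auto
qed

lemma integrable_product_real:
 fixes f g :: "real \<Rightarrow> 'b::{real_normed_field, banach, second_countable_topology}"
 assumes f: "integrable lborel f" and g: "integrable lborel g"
 shows "integrable (lborel :: (real \<times> real) measure) (\<lambda>z. f (fst z) * g (snd z))"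
  and "(\<integral>z. f (fst z) * g (snd z) \<partial>(lborel :: (real \<times> real) measure))
   = (\<integral>x. f x \<partial>lborel) * (\<integral>y. g y \<partial>lborel)"
proof -
 have [measurable]: "f \<in> borel_measurable borel" "g \<in> borel_measurable borel" using f g by (auto dest: borel_measurable_integrable)
 have 1: "integrable (lborel \<Otimes>\<^sub>M lborel) (\<lambda>z. f (fst z) * g (snd z))" by (rule lborel_pair.Fubini_integrable)
   (use f g in \<open>auto simp: norm_mult intro!: integrable_mult_left integrable_norm\<close>)
 show "integrable (lborel :: (real \<times> real) measure) (\<lambda>z. f (fst z) * g (snd z))" using 1 by (simp add: lborel_prod)
 have "(\<integral>z. f (fst z) * g (snd z) \<partial>(lborel \<Otimes>\<^sub>M lborel)) = (\<integral>x. \<integral>y. f x * g y \<partial>lborel \<partial>lborel)"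
  using lborel_pair.integral_fst'[OF 1] by simp
 then show "(\<integral>z. f (fst z) * g (snd z) \<partial>(lborel :: (real \<times> real) measure))
   = (\<integral>x. f x \<partial>lborel) * (\<integral>y. g y \<partial>lborel)" using f g by (simp add: lborel_prod)
qed

lemma gaussian_ft_prod:
 fixes t :: "real \<times> real" and R :: real
 assumes R: "R > 0"
 shows "(\<integral>x. exp (\<i> * of_real (x \<bullet> t)) * of_real (exp (- (norm x)\<^sup>2 / (2 * R\<^sup>2))) \<partial>lborel)
     = complex_of_real (2 * pi * R ^ 2 * exp (- (R\<^sup>2 * (norm t)\<^sup>2 / 2)))"
  and "integrable lborel (\<lambda>x :: real \<times> real. exp (- (norm x)\<^sup>2 / (2 * R\<^sup>2)))"
proof -
 let ?g = "\<lambda>t x. exp (\<i> * of_real (x \<bullet> t)) * complex_of_real (exp (- (norm (x::real))\<^sup>2 / (2 * R\<^sup>2)))"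
 have *: "(\<lambda>x :: real \<times> real. exp (- (norm x)\<^sup>2 / (2 * R\<^sup>2)))
   = (\<lambda>x. exp (- (norm (fst x))\<^sup>2 / (2 * R\<^sup>2)) * exp (- (norm (snd x))\<^sup>2 / (2 * R\<^sup>2)))"
  using R by (auto simp: fun_eq_iff norm_Pair exp_add[symmetric] field_simps)
 show "integrable lborel (\<lambda>x :: real \<times> real. exp (- (norm x)\<^sup>2 / (2 * R\<^sup>2)))"
  unfolding * by (intro integrable_product_real gaussian_integrable R)
 have int: "integrable lborel (?g s)" for s by (rule Bochner_Integration.integrable_bound[OF gaussian_integrable[OF R]])
   (auto simp: norm_mult)
 have "(\<lambda>x. exp (\<i> * of_real (x \<bullet> t)) * complex_of_real (exp (- (norm x)\<^sup>2 / (2 * R\<^sup>2))))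
  = (\<lambda>x. ?g (fst t) (fst x) * ?g (snd t) (snd x))" using R unfolding *[THEN fun_cong]
  by (cases t) (auto simp: fun_eq_iff inner_prod_def exp_add[symmetric] algebra_simps simp flip: of_real_mult exp_of_real)
 then have "(\<integral>x. exp (\<i> * of_real (x \<bullet> t)) * of_real (exp (- (norm x)\<^sup>2 / (2 * R\<^sup>2))) \<partial>lborel)
  = (\<integral>x. ?g (fst t) x \<partial>lborel) * (\<integral>x. ?g (snd t) x \<partial>lborel)"
  using integrable_product_real(2)[OF int int] by simp
 also have "... = complex_of_real ((sqrt (2 * pi) * R ^ 1 * exp (- (R\<^sup>2 * (norm (fst t))\<^sup>2 / 2))) *
   (sqrt (2 * pi) * R ^ 1 * exp (- (R\<^sup>2 * (norm (snd t))\<^sup>2 / 2))))" by (simp only: gaussian_ft_real[OF R] of_real_mult)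
 also have "(sqrt (2 * pi) * R ^ 1 * exp (- (R\<^sup>2 * (norm (fst t))\<^sup>2 / 2))) *
   (sqrt (2 * pi) * R ^ 1 * exp (- (R\<^sup>2 * (norm (snd t))\<^sup>2 / 2)))
  = (sqrt (2 * pi))\<^sup>2 * R ^ 2 * (exp (- (R\<^sup>2 * (norm (fst t))\<^sup>2 / 2)) * exp (- (R\<^sup>2 * (norm (snd t))\<^sup>2 / 2)))"
  by (simp add: power2_eq_square mult_ac)
 also have "exp (- (R\<^sup>2 * (norm (fst t))\<^sup>2 / 2)) * exp (- (R\<^sup>2 * (norm (snd t))\<^sup>2 / 2))
   = exp (- (R\<^sup>2 * (norm t)\<^sup>2 / 2))" by (cases t) (simp add: norm_Pair exp_add[symmetric] algebra_simps add_divide_distrib)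
 also have "(sqrt (2 * pi))\<^sup>2 = 2 * pi" by simp
 finally show "(\<integral>x. exp (\<i> * of_real (x \<bullet> t)) * of_real (exp (- (norm x)\<^sup>2 / (2 * R\<^sup>2))) \<partial>lborel)
     = complex_of_real (2 * pi * R ^ 2 * exp (- (R\<^sup>2 * (norm t)\<^sup>2 / 2)))" .
qed

lemma borel_measurable_cnj [measurable (raw)]:
 "f \<in> borel_measurable M \<Longrightarrow> (\<lambda>x. cnj (f x)) \<in> borel_measurable M"
 by (rule borel_measurable_continuous_on[of cnj]) (auto intro: continuous_intros)

text \<open>A Schur test in which \<open>J\<close> compensates the degeneration of \<open>ph\<close>: it is a Jacobian of \<open>ph\<close> on the circle or its square.\<close>

theorem plancherel_schur:
 fixes M :: "'a measure" and ph :: "'a \<Rightarrow> 'v::euclidean_space" and h :: "'a \<Rightarrow> complex"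
  and J :: "'a \<Rightarrow> real" and c K :: real and d :: nat
 assumes "finite_measure M"
  and [measurable]: "ph \<in> borel_measurable M" "h \<in> borel_measurable M" "J \<in> borel_measurable M"
  and J: "\<And>om. J om \<ge> 0" "\<And>om. h om \<noteq> 0 \<Longrightarrow> J om > 0"
  and h: "\<And>om. cmod (h om) \<le> B"
  and c: "c \<ge> 0" and K: "K \<ge> 0"
  and gauss: "\<And>R. R > 0 \<Longrightarrow> integrable lborel (\<lambda>z::'v. exp (- (norm z)\<^sup>2 / (2 * R\<^sup>2)))"
   "\<And>R t. R > 0 \<Longrightarrow> (\<integral>z. exp (\<i> * of_real (z \<bullet> t)) * of_real (exp (- (norm z)\<^sup>2 / (2 * R\<^sup>2))) \<partial>lborel)
     = complex_of_real (c * R ^ d * exp (- (R\<^sup>2 * (norm (t::'v))\<^sup>2 / 2)))"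
  and push: "\<And>R p. R > 0 \<Longrightarrow>
   (\<integral>\<^sup>+om. ennreal (J om * exp (- (R\<^sup>2 * (norm (ph om - p))\<^sup>2 / 2))) \<partial>M) \<le> ennreal (K / R ^ d)"
 shows "(LEB z. ennreal ((cmod (\<integral>om. exp (\<i> * of_real (z \<bullet> ph om)) * h om \<partial>M))\<^sup>2))
   \<le> ennreal (c * K) * (\<integral>\<^sup>+om. ennreal ((cmod (h om))\<^sup>2 / J om) \<partial>M)"
proof -
 interpret M: finite_measure M by fact
 interpret MM: pair_sigma_finite M M ..
 interpret MM': finite_measure "M \<Otimes>\<^sub>M M" by (intro finite_measure_pair_measure assms)
 interpret Q: pair_sigma_finite "lborel :: 'v measure" "M \<Otimes>\<^sub>M M" ..
 have B: "B \<ge> 0" using h[of undefined] norm_ge_zero order_trans by blast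
 define G where "G z = (\<integral>om. exp (\<i> * of_real (z \<bullet> ph om)) * h om \<partial>M)" for z
 have [measurable]: "G \<in> borel_measurable borel" unfolding G_def by measurable
 define I where "I = (\<integral>\<^sup>+om. ennreal ((cmod (h om))\<^sup>2 / J om) \<partial>M)"
 have intG: "integrable M (\<lambda>om. exp (\<i> * of_real (z \<bullet> ph om)) * h om)" for z
  by (rule M.integrable_const_bound[where B = B]) (auto simp: norm_mult h)
 have hint: "integrable M (\<lambda>om. cmod (h om))" by (rule M.integrable_const_bound[where B = B]) (auto simp: h)
 have Gb: "cmod (G z) \<le> B * measure M (space M)" for z
 proof -
  have "cmod (G z) \<le> (\<integral>om. B \<partial>M)" unfolding G_def by (rule integral_norm_bound[THEN order_trans], rule integral_mono)
    (use hint h in \<open>auto simp: norm_mult\<close>)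
  then show ?thesis by (simp add: mult.commute)
 qed
 have main: "(LEB z. ennreal ((cmod (G z))\<^sup>2 * exp (- (norm z)\<^sup>2 / (2 * R\<^sup>2)))) \<le> ennreal (c * K) * I"
  if R: "R > 0" for R
 proof -
  \<comment> \<open>The Gaussian factor makes Fubini legitimate. Integrated against the oscillation
    it yields the kernel \<open>W\<close>, which localises to pairs whose phases differ by about
    1/R.\<close>
  define g where "g z = exp (- (norm (z::'v))\<^sup>2 / (2 * R\<^sup>2))" for z
  define W where "W p q = exp (- (R\<^sup>2 * (norm (ph p - ph q))\<^sup>2 / 2))" for p q
  have [measurable]: "g \<in> borel_measurable borel" unfolding g_def by measurable
  have gint: "integrable lborel g" unfolding g_def by (rule gauss(1)[OF R])
  define f where "f z p = exp (\<i> * of_real (z \<bullet> (ph (fst p) - ph (snd p)))) *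
   of_real (g z) * (h (fst p) * cnj (h (snd p)))" for z p
  have fm[measurable]: "(\<lambda>(z, p). f z p) \<in> borel_measurable (lborel \<Otimes>\<^sub>M (M \<Otimes>\<^sub>M M))"
   unfolding f_def by measurable
  have fn: "norm (f z p) \<le> B\<^sup>2 * g z" for z p unfolding f_def power2_eq_square using mult_mono[OF h h B norm_ge_zero, of "fst p" "snd p"]
   by (auto simp: norm_mult g_def mult.commute)
  have fint: "integrable (lborel \<Otimes>\<^sub>M (M \<Otimes>\<^sub>M M)) (\<lambda>(z, p). f z p)"
  proof (rule Q.Fubini_integrable)
   show "(\<lambda>(z, p). f z p) \<in> borel_measurable (lborel \<Otimes>\<^sub>M (M \<Otimes>\<^sub>M M))" by measurable
   have i: "integrable (M \<Otimes>\<^sub>M M) (f z)" for z by (rule MM'.integrable_const_bound[where B = "B\<^sup>2 * g z"]) (auto simp: fn)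
   then show "AE z in lborel. integrable (M \<Otimes>\<^sub>M M) (\<lambda>p. case (z, p) of (z, p) \<Rightarrow> f z p)" by simp
   show "integrable lborel (\<lambda>z. \<integral>p. norm (case (z, p) of (z, p) \<Rightarrow> f z p) \<partial>(M \<Otimes>\<^sub>M M))"
   proof (rule Bochner_Integration.integrable_bound)
    show "integrable lborel (\<lambda>z. B\<^sup>2 * g z * measure (M \<Otimes>\<^sub>M M) (space (M \<Otimes>\<^sub>M M)))" using gint by simp
    show "AE z in lborel. norm (\<integral>p. norm (case (z, p) of (z, p) \<Rightarrow> f z p) \<partial>(M \<Otimes>\<^sub>M M))
      \<le> norm (B\<^sup>2 * g z * measure (M \<Otimes>\<^sub>M M) (space (M \<Otimes>\<^sub>M M)))"
    proof (rule AE_I2)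
     fix z
     have "(\<integral>p. norm (f z p) \<partial>(M \<Otimes>\<^sub>M M)) \<le> (\<integral>p. B\<^sup>2 * g z \<partial>(M \<Otimes>\<^sub>M M))"
      by (rule integral_mono) (use i fn in auto)
     then show "norm (\<integral>p. norm (case (z, p) of (z, p) \<Rightarrow> f z p) \<partial>(M \<Otimes>\<^sub>M M))
      \<le> norm (B\<^sup>2 * g z * measure (M \<Otimes>\<^sub>M M) (space (M \<Otimes>\<^sub>M M)))" by (simp add: mult_ac)
    qed
   qed (simp)
  qed
  have GG: "G z * cnj (G z) * of_real (g z) = (\<integral>p. f z p \<partial>(M \<Otimes>\<^sub>M M))" for z
  proof -
   let ?u = "\<lambda>om. exp (\<i> * of_real (z \<bullet> ph om)) * h om"
   have i: "integrable (M \<Otimes>\<^sub>M M) (\<lambda>p. f z p)"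
    by (rule MM'.integrable_const_bound[where B = "B\<^sup>2 * g z"]) (auto simp: fn)
   have "(\<integral>p. f z p \<partial>(M \<Otimes>\<^sub>M M)) = (\<integral>x. \<integral>y. f z (x, y) \<partial>M \<partial>M)"
    using MM.integral_fst'[OF i] by simp
   also have "... = (\<integral>x. \<integral>y. of_real (g z) * ?u x * cnj (?u y) \<partial>M \<partial>M)" unfolding f_def
    by (simp add: inner_diff_right exp_diff exp_minus algebra_simps exp_cnj divide_inverse flip: exp_minus)
   also have "... = (\<integral>x. of_real (g z) * ?u x * cnj (G z) \<partial>M)"
    unfolding G_def integral_cnj[symmetric] by (simp del: complex_cnj_mult integral_cnj)
   also have "... = of_real (g z) * G z * cnj (G z)" using intG[of z] by (simp add: G_def)
   finally show ?thesis by (simp add: mult_ac)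
  qed
  let ?k = "\<lambda>p. of_real (c * R ^ d * W (fst p) (snd p)) * (h (fst p) * cnj (h (snd p)))"
  have inner: "(\<integral>z. f z p \<partial>lborel) = ?k p" for p
   unfolding f_def g_def W_def using gauss(2)[OF R, of "ph (fst p) - ph (snd p)"] by simp
  have "(\<integral>z. (cmod (G z))\<^sup>2 * g z \<partial>lborel) = (\<integral>z. \<integral>p. f z p \<partial>(M \<Otimes>\<^sub>M M) \<partial>lborel)"
   by (simp only: GG[symmetric] complex_norm_square[symmetric] of_real_mult[symmetric] integral_complex_of_real)
  also have "... = (\<integral>p. \<integral>z. f z p \<partial>lborel \<partial>(M \<Otimes>\<^sub>M M))"
   by (rule Q.Fubini_integral[OF fint, symmetric])
  also have "... = (\<integral>p. ?k p \<partial>(M \<Otimes>\<^sub>M M))" by (simp add: inner)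
  finally have eq: "of_real (\<integral>z. (cmod (G z))\<^sup>2 * g z \<partial>lborel) = (\<integral>p. ?k p \<partial>(M \<Otimes>\<^sub>M M))" .
  have "(LEB z. ennreal ((cmod (G z))\<^sup>2 * g z)) = ennreal (\<integral>z. (cmod (G z))\<^sup>2 * g z \<partial>lborel)"
  proof (rule nn_integral_eq_integral)
   show "integrable lborel (\<lambda>z. (cmod (G z))\<^sup>2 * g z)"
   proof (rule Bochner_Integration.integrable_bound)
    show "integrable lborel (\<lambda>z. (B * measure M (space M))\<^sup>2 * g z)" using gint by simp
    show "AE z in lborel. norm ((cmod (G z))\<^sup>2 * g z) \<le> norm ((B * measure M (space M))\<^sup>2 * g z)"
     using Gb by (intro AE_I2) (auto simp: g_def intro!: mult_right_mono power_mono)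
   qed simp
  qed (auto simp: g_def)
  also have "... \<le> ennreal (cmod (\<integral>p. ?k p \<partial>(M \<Otimes>\<^sub>M M)))"
   unfolding eq[symmetric] by (intro ennreal_leI) simp
  also have "... \<le> (\<integral>\<^sup>+p. norm (?k p) \<partial>(M \<Otimes>\<^sub>M M))"
  proof (rule integral_norm_bound_ennreal)
   have "norm (?k p) \<le> c * R ^ d * B\<^sup>2" for p
   proof -
    have "norm (?k p) = (c * R ^ d) * (W (fst p) (snd p) * (cmod (h (fst p)) * cmod (h (snd p))))"
     using c R by (simp add: norm_mult norm_power W_def)
    also have "... \<le> (c * R ^ d) * (1 * (B * B))" using c R B h by (intro mult_left_mono mult_mono) (auto simp: W_def)
    finally show ?thesis by (simp add: power2_eq_square)
   qed
   then show "integrable (M \<Otimes>\<^sub>M M) ?k" unfolding W_def by (intro MM'.integrable_const_bound[where B = "c * R ^ d * B\<^sup>2"]) auto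
  qed
  also have "... \<le> (\<integral>\<^sup>+p. ennreal (c * R ^ d / 2) *
    (ennreal ((cmod (h (fst p)))\<^sup>2 / J (fst p)) * ennreal (J (snd p) * W (fst p) (snd p)) +
    ennreal ((cmod (h (snd p)))\<^sup>2 / J (snd p)) * ennreal (J (fst p) * W (fst p) (snd p))) \<partial>(M \<Otimes>\<^sub>M M))"
  proof (rule nn_integral_mono)
   fix p :: "'a \<times> 'a"
   define a b where "a = fst p" and "b = snd p"
   have W0: "W a b > 0" by (simp add: W_def)
   \<comment> \<open>Weighted arithmetic-geometric mean. The weights \<open>J\<close> are placed so
     that the variable left free in each summand is integrated against its own Jacobian, which is
     what \<open>push\<close> controls.\<close>
   have "cmod (h a) * cmod (h b) \<le> ((cmod (h a))\<^sup>2 / J a * J b + (cmod (h b))\<^sup>2 / J b * J a) / 2"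
   proof (cases "h a = 0 \<or> h b = 0")
    case True
    then show ?thesis using J by auto
   next
    case False
    then have Ja: "J a > 0" and Jb: "J b > 0" using J by auto
    have "0 \<le> (cmod (h a) * J b - cmod (h b) * J a)\<^sup>2" by simp
    then have "2 * (cmod (h a) * cmod (h b)) * (J a * J b) \<le> (cmod (h a))\<^sup>2 * (J b * J b) + (cmod (h b))\<^sup>2 * (J a * J a)"
     by (simp add: power2_diff power_mult_distrib algebra_simps power2_eq_square)
    then show ?thesis using Ja Jb by (simp add: field_simps)
   qed
   then have "c * R ^ d * W a b * (cmod (h a) * cmod (h b))
     \<le> c * R ^ d * W a b * (((cmod (h a))\<^sup>2 / J a * J b + (cmod (h b))\<^sup>2 / J b * J a) / 2)"
    using c R W0 by (intro mult_left_mono) auto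
   also have "... = (c * R ^ d / 2) * ((cmod (h a))\<^sup>2 / J a * (J b * W a b) + (cmod (h b))\<^sup>2 / J b * (J a * W a b))"
    by (simp add: algebra_simps)
   finally have "norm (?k p) \<le> (c * R ^ d / 2) * ((cmod (h a))\<^sup>2 / J a * (J b * W a b) + (cmod (h b))\<^sup>2 / J b * (J a * W a b))"
    using c R W0 by (simp add: norm_mult norm_power a_def b_def)
   then have "ennreal (norm (?k p)) \<le> ennreal ((c * R ^ d / 2) * ((cmod (h a))\<^sup>2 / J a * (J b * W a b) + (cmod (h b))\<^sup>2 / J b * (J a * W a b)))"
    by (rule ennreal_leI)
   also have "... = ennreal (c * R ^ d / 2) *
    (ennreal ((cmod (h a))\<^sup>2 / J a) * ennreal (J b * W a b) +
    ennreal ((cmod (h b))\<^sup>2 / J b) * ennreal (J a * W a b))"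
   proof -
    have "ennreal (t * (u * v + x * y)) = ennreal t * (ennreal u * ennreal v + ennreal x * ennreal y)"
     if "0 \<le> t" "0 \<le> u" "0 \<le> v" "0 \<le> x" "0 \<le> y" for t u v x y :: real using that by (simp add: ennreal_mult ennreal_plus)
    note * = this
    show ?thesis by (rule *) (use c R W0 J in auto)
   qed
   finally show "ennreal (norm (?k p)) \<le> ennreal (c * R ^ d / 2) *
    (ennreal ((cmod (h (fst p)))\<^sup>2 / J (fst p)) * ennreal (J (snd p) * W (fst p) (snd p)) +
    ennreal ((cmod (h (snd p)))\<^sup>2 / J (snd p)) * ennreal (J (fst p) * W (fst p) (snd p)))" by (simp add: a_def b_def)
  qed
  also have "... = ennreal (c * R ^ d / 2) *
   ((\<integral>\<^sup>+p. ennreal ((cmod (h (fst p)))\<^sup>2 / J (fst p)) * ennreal (J (snd p) * W (fst p) (snd p)) \<partial>(M \<Otimes>\<^sub>M M)) +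
    (\<integral>\<^sup>+p. ennreal ((cmod (h (snd p)))\<^sup>2 / J (snd p)) * ennreal (J (fst p) * W (fst p) (snd p)) \<partial>(M \<Otimes>\<^sub>M M)))"
   unfolding W_def by (simp add: nn_integral_cmult nn_integral_add)
  also have "(\<integral>\<^sup>+p. ennreal ((cmod (h (fst p)))\<^sup>2 / J (fst p)) * ennreal (J (snd p) * W (fst p) (snd p)) \<partial>(M \<Otimes>\<^sub>M M))
    = (\<integral>\<^sup>+x. \<integral>\<^sup>+y. ennreal ((cmod (h x))\<^sup>2 / J x) * ennreal (J y * W x y) \<partial>M \<partial>M)"
   unfolding W_def by (subst M.nn_integral_fst[symmetric]) auto
  also have "... = (\<integral>\<^sup>+x. ennreal ((cmod (h x))\<^sup>2 / J x) * (\<integral>\<^sup>+y. ennreal (J y * W x y) \<partial>M) \<partial>M)"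
   unfolding W_def by (simp add: nn_integral_cmult)
  also have "... \<le> (\<integral>\<^sup>+x. ennreal ((cmod (h x))\<^sup>2 / J x) * ennreal (K / R ^ d) \<partial>M)"
   using push[OF R] by (intro nn_integral_mono mult_left_mono) (auto simp: W_def norm_minus_commute)
  also have "... = I * ennreal (K / R ^ d)" unfolding I_def by (simp add: nn_integral_multc)
  also have "(\<integral>\<^sup>+p. ennreal ((cmod (h (snd p)))\<^sup>2 / J (snd p)) * ennreal (J (fst p) * W (fst p) (snd p)) \<partial>(M \<Otimes>\<^sub>M M))
    = (\<integral>\<^sup>+y. \<integral>\<^sup>+x. ennreal ((cmod (h y))\<^sup>2 / J y) * ennreal (J x * W x y) \<partial>M \<partial>M)"
   unfolding W_def by (subst MM.nn_integral_snd[symmetric]) auto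
  also have "... = (\<integral>\<^sup>+y. ennreal ((cmod (h y))\<^sup>2 / J y) * (\<integral>\<^sup>+x. ennreal (J x * W x y) \<partial>M) \<partial>M)"
   unfolding W_def by (simp add: nn_integral_cmult)
  also have "... \<le> (\<integral>\<^sup>+x. ennreal ((cmod (h x))\<^sup>2 / J x) * ennreal (K / R ^ d) \<partial>M)"
   using push[OF R] by (intro nn_integral_mono mult_left_mono) (auto simp: W_def)
  also have "... = I * ennreal (K / R ^ d)" unfolding I_def by (simp add: nn_integral_multc)
  also have "ennreal (c * R ^ d / 2) * (I * ennreal (K / R ^ d) + I * ennreal (K / R ^ d))
    = (ennreal (c * R ^ d / 2) * (ennreal (K / R ^ d) * 2)) * I" by (simp add: algebra_simps mult_2)
  also have "ennreal (c * R ^ d / 2) * (ennreal (K / R ^ d) * 2) = ennreal (c * K)"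
  proof -
   have "ennreal (c * R ^ d / 2) * (ennreal (K / R ^ d) * ennreal 2) = ennreal ((c * R ^ d / 2) * ((K / R ^ d) * 2))"
    using c K R by (simp only: ennreal_mult[symmetric] mult_nonneg_nonneg divide_nonneg_nonneg zero_le_power less_imp_le zero_le_numeral)
   then show ?thesis using R by simp
  qed
  finally show ?thesis by (simp add: g_def add_mono mult_left_mono)
 qed
 \<comment> \<open>The bound in \<open>main\<close> is free of \<open>R\<close>, so Fatou's lemma
   along R = 1, 2, 3, ... removes the Gaussian.\<close>
 have lim: "(\<lambda>n. ennreal ((cmod (G z))\<^sup>2 * exp (- (norm z)\<^sup>2 / (2 * (real (Suc n))\<^sup>2)))) \<longlonglongrightarrow> ennreal ((cmod (G z))\<^sup>2)" for z
 proof (rule tendsto_ennrealI)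
  have "(\<lambda>n. (cmod (G z))\<^sup>2 * exp (- (norm z)\<^sup>2 / 2 * (inverse (real (Suc n)))\<^sup>2)) \<longlonglongrightarrow> (cmod (G z))\<^sup>2 * exp (- (norm z)\<^sup>2 / 2 * 0\<^sup>2)"
   by (intro tendsto_intros LIMSEQ_inverse_real_of_nat)
  then show "(\<lambda>n. (cmod (G z))\<^sup>2 * exp (- (norm z)\<^sup>2 / (2 * (real (Suc n))\<^sup>2))) \<longlonglongrightarrow> (cmod (G z))\<^sup>2"
   by (simp add: field_simps)
 qed
 have "(LEB z. ennreal ((cmod (G z))\<^sup>2))
   = (LEB z. liminf (\<lambda>n. ennreal ((cmod (G z))\<^sup>2 * exp (- (norm z)\<^sup>2 / (2 * (real (Suc n))\<^sup>2)))))"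
  by (intro nn_integral_cong lim_imp_Liminf[OF _ lim, symmetric]) simp
 also have "... \<le> liminf (\<lambda>n. LEB z. ennreal ((cmod (G z))\<^sup>2 * exp (- (norm z)\<^sup>2 / (2 * (real (Suc n))\<^sup>2))))"
  by (rule nn_integral_liminf) measurable
 also have "... \<le> ennreal (c * K) * I" using main by (intro Liminf_le) (auto simp: eventually_sequentially simp del: of_nat_Suc)
 finally show ?thesis unfolding G_def I_def .
qed

section \<open>The circle measure\<close>

lemma space_circle_measure [simp]: "space \<sigma> = sphere 0 1" by (simp add: circle_measure_def space_restrict_space)

lemma sets_circle_measure [measurable_cong]:
 "sets \<sigma> = sets (restrict_space borel (sphere 0 1))" by (simp add: circle_measure_def)

lemma finite_measure_circle: "finite_measure \<sigma>" by (rule finite_measureI) (simp add: emeasure_circle_measure)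

lemma measurable_circle_measureI [measurable (raw)]:
 "f \<in> borel_measurable borel \<Longrightarrow> f \<in> borel_measurable \<sigma>"
 by (subst measurable_cong_sets[OF sets_circle_measure refl]) (rule measurable_restrict_space1)

lemma measurable_circle_coords [measurable]:
 "(\<lambda>om. om) \<in> borel_measurable \<sigma>"
 "fst \<in> borel_measurable \<sigma>"
 "snd \<in> borel_measurable \<sigma>" by (auto intro!: measurable_circle_measureI borel_measurable_continuous_onI continuous_intros)

lemma nn_integral_circle:
 assumes f: "f \<in> borel_measurable \<sigma>"
 shows "(ARC om. f om) = (\<integral>\<^sup>+t\<in>{0..<2 * pi}. f (cos t, sin t) \<partial>lborel)"
proof -
 have "(ARC om. f om) = (\<integral>\<^sup>+t. f (cos t, sin t) \<partial>restrict_space lborel {0..<2 * pi})" unfolding circle_measure_def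
  by (subst nn_integral_distr[OF measurable_circle_param]) (use f in \<open>simp_all add: measurable_cong_sets[OF sets_circle_measure refl]\<close>)
 also have "... = (\<integral>\<^sup>+t\<in>{0..<2 * pi}. f (cos t, sin t) \<partial>lborel)" by (subst nn_integral_restrict_space) auto
 finally show ?thesis .
qed

lemma nn_integral_periodic_shift:
 fixes f :: "real \<Rightarrow> ennreal"
 assumes [measurable]: "f \<in> borel_measurable borel" and per: "\<And>t. f (t + 2 * pi) = f t"
  and s: "0 \<le> s" "s \<le> 2 * pi"
 shows "(\<integral>\<^sup>+t\<in>{0..<2 * pi}. f (t + s) \<partial>lborel) = (\<integral>\<^sup>+t\<in>{0..<2 * pi}. f t \<partial>lborel)"
proof -
 have "(LEB t. f t * indicator {s..<s + 2 * pi} t)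
   = (LEB t. f (s + 1 * t) * indicator {s..<s + 2 * pi} (s + 1 * t))" by (subst nn_integral_real_affine[where c = 1 and t = s]) auto
 also have "... = (\<integral>\<^sup>+t\<in>{0..<2 * pi}. f (t + s) \<partial>lborel)"
  by (intro nn_integral_cong) (auto simp: indicator_def add.commute)
 finally have 1: "(\<integral>\<^sup>+t\<in>{0..<2 * pi}. f (t + s) \<partial>lborel) = (LEB t. f t * indicator {s..<s + 2 * pi} t)" ..
 have "(LEB t. f t * indicator {2 * pi..<s + 2 * pi} t)
   = (LEB t. f (2 * pi + 1 * t) * indicator {2 * pi..<s + 2 * pi} (2 * pi + 1 * t))"
  by (subst nn_integral_real_affine[where c = 1 and t = "2 * pi"]) auto
 also have "... = (LEB t. f t * indicator {0..<s} t)" by (intro nn_integral_cong) (auto simp: indicator_def add.commute per)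
 finally have 2: "(LEB t. f t * indicator {2 * pi..<s + 2 * pi} t) = (LEB t. f t * indicator {0..<s} t)" .
 have "(LEB t. f t * indicator {s..<s + 2 * pi} t)
  = (LEB t. f t * indicator {s..<2 * pi} t + f t * indicator {2 * pi..<s + 2 * pi} t)"
  using s by (intro nn_integral_cong) (auto simp: indicator_def)
 also have "... = (LEB t. f t * indicator {s..<2 * pi} t) + (LEB t. f t * indicator {0..<s} t)" by (subst nn_integral_add) (auto simp: 2)
 also have "... = (LEB t. f t * indicator {s..<2 * pi} t + f t * indicator {0..<s} t)" by (subst nn_integral_add) auto
 also have "... = (\<integral>\<^sup>+t\<in>{0..<2 * pi}. f t \<partial>lborel)" using s by (intro nn_integral_cong) (auto simp: indicator_def)
 finally show ?thesis using 1 by simp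
qed

lemma nn_integral_periodic_reflect:
 fixes f :: "real \<Rightarrow> ennreal"
 assumes [measurable]: "f \<in> borel_measurable borel" and per: "\<And>t. f (t + 2 * pi) = f t"
 shows "(\<integral>\<^sup>+t\<in>{0..<2 * pi}. f (- t) \<partial>lborel) = (\<integral>\<^sup>+t\<in>{0..<2 * pi}. f t \<partial>lborel)"
proof -
 have "(\<integral>\<^sup>+t\<in>{0..<2 * pi}. f t \<partial>lborel)
   = (LEB t. f (2 * pi + (-1) * t) * indicator {0..<2 * pi} (2 * pi + (-1) * t))"
  by (subst nn_integral_real_affine[where c = "-1" and t = "2 * pi"]) auto
 also have "... = (\<integral>\<^sup>+t\<in>{0..<2 * pi}. f (- t) \<partial>lborel)"
 proof (rule nn_integral_cong_AE)
  \<comment> \<open>The reflection turns the half-open period around, so its two end points are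
    discarded as a null set.\<close>
  have "AE t in lborel. t \<noteq> 0 \<and> t \<noteq> 2 * pi"
   using AE_lborel_singleton[of 0] AE_lborel_singleton[of "2 * pi"] by eventually_elim simp
  then show "AE t in lborel. f (2 * pi + (-1) * t) * indicator {0..<2 * pi} (2 * pi + (-1) * t)
    = f (- t) * indicator {0..<2 * pi} t"
  proof eventually_elim
   case (elim t)
   then show ?case using per[of "- t"] by (auto simp: indicator_def add.commute)
  qed
 qed
 finally show ?thesis ..
qed

text \<open>In the angle, exchanging the coordinates is t -> pi/2 - t: a reflection of the period
  and a shift by a quarter turn. Every statement about one axis is transferred to the other by this
  symmetry.\<close>

lemma nn_integral_circle_swap:
 assumes f[measurable]: "f \<in> borel_measurable borel"
 shows "(ARC om. f (snd om, fst om)) = (ARC om. f om)"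
proof -
 have f'[measurable]: "f \<in> borel_measurable (borel \<Otimes>\<^sub>M borel)" by (simp add: borel_prod)
 have m: "(\<lambda>t::real. f (cos t, sin t)) \<in> borel_measurable borel" by measurable
 have "(ARC om. f (snd om, fst om)) = (\<integral>\<^sup>+t\<in>{0..<2 * pi}. f (sin t, cos t) \<partial>lborel)"
  by (subst nn_integral_circle) (auto intro!: measurable_circle_measureI)
 also have "... = (\<integral>\<^sup>+t\<in>{0..<2 * pi}. f (sin (- t), cos (- t)) \<partial>lborel)"
  by (rule nn_integral_periodic_reflect[symmetric]) auto
 also have "... = (\<integral>\<^sup>+t\<in>{0..<2 * pi}. (\<lambda>t. f (cos t, sin t)) (t + pi / 2) \<partial>lborel)"
  by (intro nn_integral_cong) (simp add: cos_add sin_add)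
 also have "... = (\<integral>\<^sup>+t\<in>{0..<2 * pi}. f (cos t, sin t) \<partial>lborel)" by (rule nn_integral_periodic_shift[OF m]) auto
 also have "... = (ARC om. f om)" by (subst nn_integral_circle) (auto intro!: measurable_circle_measureI)
 finally show ?thesis .
qed

lemma measurable_circle_swap [measurable]: "(\<lambda>om. (snd om, fst om)) \<in> \<sigma> \<rightarrow>\<^sub>M \<sigma>"
proof -
 have "(\<lambda>om. (snd om, fst om)) \<in> \<sigma> \<rightarrow>\<^sub>M restrict_space borel (sphere (0 :: real \<times> real) 1)"
  by (rule measurable_restrict_space2) (auto simp: norm_Pair add.commute intro!: measurable_circle_measureI borel_measurable_continuous_onI continuous_intros)
 then show ?thesis by (simp add: measurable_cong_sets[OF refl sets_circle_measure])
qed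

lemma distr_circle_swap: "distr \<sigma> \<sigma> (\<lambda>om. (snd om, fst om)) = \<sigma>"
proof (rule measure_eqI)
 fix A assume "A \<in> sets (distr \<sigma> \<sigma> (\<lambda>om. (snd om, fst om)))"
 then have A: "A \<in> sets \<sigma>" by simp
 then have "A \<in> sets borel" by (auto simp: sets_circle_measure sets_restrict_space)
 then have "(ARC om. indicator A (snd om, fst om)) = (ARC om. indicator A om :: ennreal)" by (intro nn_integral_circle_swap) simp
 then show "emeasure (distr \<sigma> \<sigma> (\<lambda>om. (snd om, fst om))) A = emeasure \<sigma> A"
  using A by (simp flip: nn_integral_indicator add: nn_integral_distr)
qed simp

section \<open>Push-forwards of arc length under projections and sums\<close>

text \<open>The cosine is monotone on each half of the period. Each half contributes at most one
  copy of Lebesgue measure, hence the factor 2.\<close>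

lemma nn_integral_sin_cos:
 fixes k :: "real \<Rightarrow> ennreal"
 assumes [measurable]: "k \<in> borel_measurable borel"
 shows "(\<integral>\<^sup>+t\<in>{0..<2 * pi}. ennreal \<bar>sin t\<bar> * k (cos t) \<partial>lborel) \<le> 2 * (LEB x. k x)"
proof -
 have "(LEB x. k (- x) * indicator {- cos 0..- cos pi} x)
   = (LEB t. k (- (- cos t)) * ennreal (sin t) * indicator {0..pi} t)" by (rule nn_integral_substitution_aux)
   (auto intro!: derivative_eq_intros continuous_intros sin_ge_zero)
 moreover have "(LEB x. k (- x) * indicator {- cos 0..- cos pi} x) \<le> (LEB x. k (- x))" by (intro nn_integral_mono) (auto simp: indicator_def)
 moreover have "(LEB x. k (- x)) = (LEB x. k x)" by (subst nn_integral_real_affine[where c = "-1" and t = 0 and f = k]) auto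
 ultimately have 1: "(LEB t. k (cos t) * ennreal (sin t) * indicator {0..pi} t) \<le> (LEB x. k x)" by simp
 have sn: "sin x \<le> 0" if "pi \<le> x" "x \<le> 2 * pi" for x :: real
 proof (cases "x = 2 * pi")
  case True
  then show ?thesis by simp
 next
  case False
  then show ?thesis using that sin_le_zero[of x] by simp
 qed
 have "(LEB x. k x * indicator {cos pi..cos (2 * pi)} x)
   = (LEB t. k (cos t) * ennreal (- sin t) * indicator {pi..2 * pi} t)" by (rule nn_integral_substitution_aux)
   (auto intro!: derivative_eq_intros continuous_intros simp: sn)
 moreover have "(LEB x. k x * indicator {cos pi..cos (2 * pi)} x) \<le> (LEB x. k x)" by (intro nn_integral_mono) (auto simp: indicator_def)
 ultimately have 2: "(LEB t. k (cos t) * ennreal (- sin t) * indicator {pi..2 * pi} t) \<le> (LEB x. k x)" by simp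
 have "(\<integral>\<^sup>+t\<in>{0..<2 * pi}. ennreal \<bar>sin t\<bar> * k (cos t) \<partial>lborel) \<le>
  (LEB t. k (cos t) * ennreal (sin t) * indicator {0..pi} t + k (cos t) * ennreal (- sin t) * indicator {pi..2 * pi} t)"
 proof (rule nn_integral_mono)
  fix t :: real
  show "ennreal \<bar>sin t\<bar> * k (cos t) * indicator {0..<2 * pi} t \<le>
   k (cos t) * ennreal (sin t) * indicator {0..pi} t + k (cos t) * ennreal (- sin t) * indicator {pi..2 * pi} t"
   using sin_ge_zero[of t] sin_le_zero[of t] by (cases "t < pi") (auto simp: indicator_def mult.commute abs_if)
 qed
 also have "... = (LEB t. k (cos t) * ennreal (sin t) * indicator {0..pi} t)
   + (LEB t. k (cos t) * ennreal (- sin t) * indicator {pi..2 * pi} t)" by (rule nn_integral_add) auto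
 also have "... \<le> 2 * (LEB x. k x)" using add_mono[OF 1 2] by (simp only: mult_2[of "integral\<^sup>N lborel k"])
 finally show ?thesis .
qed

lemma circle_push_fst:
 fixes k :: "real \<Rightarrow> ennreal"
 assumes [measurable]: "k \<in> borel_measurable borel"
 shows "(ARC om. ennreal \<bar>snd om\<bar> * k (fst om)) \<le> 2 * (LEB x. k x)"
 using nn_integral_sin_cos[OF assms] by (subst nn_integral_circle) auto

lemma circle_push_snd:
 fixes k :: "real \<Rightarrow> ennreal"
 assumes [measurable]: "k \<in> borel_measurable borel"
 shows "(ARC om. ennreal \<bar>fst om\<bar> * k (snd om)) \<le> 2 * (LEB x. k x)"
proof -
 have m: "(\<lambda>om::real \<times> real. ennreal \<bar>fst om\<bar> * k (snd om)) \<in> borel_measurable borel"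
  unfolding borel_prod[symmetric] by measurable
 show ?thesis using circle_push_fst[OF assms] nn_integral_circle_swap[OF m] by simp
qed

text \<open>Halving the angle, sin u = 2 sin (u/2) cos (u/2) with sin (u/2) at least (u/2) cos (u/2)
  by the mean value theorem, and cos (u/2)^2 is at least 1/2.\<close>

lemma abs_sin_ge_half:
 fixes u :: real
 assumes "\<bar>u\<bar> \<le> pi / 2"
 shows "\<bar>u\<bar> / 2 \<le> \<bar>sin u\<bar>"
proof -
 have *: "u / 2 \<le> sin u" if u: "0 < u" "u \<le> pi / 2" for u :: real
 proof -
  obtain z where z: "0 < z" "z < u / 2" "sin (u / 2) - sin 0 = (u / 2 - 0) * cos z" using MVT2[of 0 "u / 2" sin cos] u by auto
  have c0: "cos (pi / 4) \<le> cos (u / 2)" using u by (intro cos_monotone_0_pi_le) auto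
  then have c: "sqrt 2 / 2 \<le> cos (u / 2)" by (simp add: cos_45)
  have "cos (u / 2) \<le> cos z" using z u by (intro cos_monotone_0_pi_le) auto
  then have "u / 2 * cos (u / 2) \<le> sin (u / 2)" using z u by (auto intro!: mult_left_mono)
  then have "u / 2 * cos (u / 2) * cos (u / 2) \<le> sin (u / 2) * cos (u / 2)"
   by (rule mult_right_mono) (use u in \<open>auto intro!: cos_ge_zero\<close>)
  moreover have "1 / 2 \<le> cos (u / 2) * cos (u / 2)" using mult_mono[OF c c] c by (simp add: order_trans[OF _ c])
  then have "u / 2 * (1 / 2) \<le> u / 2 * (cos (u / 2) * cos (u / 2))" using u by (intro mult_left_mono) auto
  ultimately show ?thesis using sin_double[of "u / 2"] by simp
 qed
 show ?thesis using *[of "\<bar>u\<bar>"] assms by (cases "u = 0"; cases "u > 0") auto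
qed

text \<open>Near the window the zeros of the sine are \<open>t0 + k * pi\<close> with k from -2 to
  2. Since the sine is at least half the distance to the nearest zero, the set lies in five
  intervals of length \<open>4 * ta\<close>. This is the source of the constant 20 that recurs
  below.\<close>

lemma emeasure_sin_small:
 fixes t0 ta :: real
 assumes t0: "0 \<le> t0" "t0 < 2 * pi" and ta: "ta \<ge> 0"
 shows "emeasure lborel {t \<in> {0..<2 * pi}. \<bar>sin (t - t0)\<bar> \<le> ta} \<le> ennreal (20 * ta)"
proof -
 let ?K = "{-2..2::int}"
 let ?A = "\<lambda>k::int. {t0 + of_int k * pi - 2 * ta..t0 + of_int k * pi + 2 * ta}"
 have sub: "{t \<in> {0..<2 * pi}. \<bar>sin (t - t0)\<bar> \<le> ta} \<subseteq> (\<Union>k\<in>?K. ?A k)"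
 proof
  fix t assume t: "t \<in> {t \<in> {0..<2 * pi}. \<bar>sin (t - t0)\<bar> \<le> ta}"
  define k where "k = round ((t - t0) / pi)"
  have "\<bar>of_int k - (t - t0) / pi\<bar> \<le> 1 / 2" unfolding k_def by (rule of_int_round_abs_le)
  then have "\<bar>of_int k - (t - t0) / pi\<bar> * pi \<le> 1 / 2 * pi" by (rule mult_right_mono) auto
  then have d: "\<bar>(t - t0) - of_int k * pi\<bar> \<le> pi / 2" by (auto simp: abs_if field_simps split: if_splits)
  have "\<bar>sin (t - t0 - of_int k * pi)\<bar> = \<bar>sin (t - t0)\<bar>"
   by (simp add: sin_diff cos_int_times_real sin_int_times_real abs_mult mult.commute[of _ pi])
  then have d2: "\<bar>(t - t0) - of_int k * pi\<bar> \<le> 2 * ta" using abs_sin_ge_half[OF d] t by auto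
  have "(t - t0) / pi < 2" "(t - t0) / pi > -2" using t t0 by (auto simp: field_simps)
  then have "k \<le> 2" "k \<ge> -2" unfolding k_def by (simp_all add: round_def)
  then show "t \<in> (\<Union>k\<in>?K. ?A k)" using d2 by (intro UN_I[of k]) (auto simp: abs_le_iff)
 qed
 have "emeasure lborel {t \<in> {0..<2 * pi}. \<bar>sin (t - t0)\<bar> \<le> ta} \<le> emeasure lborel (\<Union>k\<in>?K. ?A k)"
  by (rule emeasure_mono[OF sub]) auto
 also have "... \<le> (\<Sum>k\<in>?K. emeasure lborel (?A k))" by (rule emeasure_subadditive_finite) auto
 also have "... = (\<Sum>k\<in>?K. ennreal (4 * ta))" using ta by (intro sum.cong) auto
 also have "... = ennreal (20 * ta)" using ta by (simp only: sum_ennreal mult_nonneg_nonneg zero_le_numeral) simp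
 finally show ?thesis .
qed

text \<open>The determinant of two vectors. For unit vectors it is the sine of the angle between
  them, and its absolute value is the Jacobian of addition on pairs of points of the circle. With
  \<open>(0, 1)\<close> as first argument it is minus the first coordinate of the second, so bounds
  for it also cover the projection to the second axis.\<close>

definition cross :: "real \<times> real \<Rightarrow> real \<times> real \<Rightarrow> real" where
 "cross u v = fst u * snd v - snd u * fst v"

lemma borel_measurable_cross [measurable]: "cross u \<in> borel_measurable borel"
 unfolding cross_def by (intro borel_measurable_continuous_onI continuous_intros)

lemma circle_polar:
 assumes "om \<in> sphere (0 :: real \<times> real) 1"
 obtains t where "0 \<le> t" "t < 2 * pi" "om = (cos t, sin t)"
proof -
 have "(fst om)\<^sup>2 + (snd om)\<^sup>2 = 1" using assms by (cases om) (simp add: norm_Pair)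
 from sincos_total_2pi[OF this] that show thesis by (metis prod.collapse)
qed

lemma emeasure_cross_small:
 assumes om: "om \<in> sphere (0 :: real \<times> real) 1" and ta: "ta \<ge> 0"
 shows "(ARC om'. indicator {om'. \<bar>cross om om'\<bar> \<le> ta} om') \<le> ennreal (20 * ta)"
proof -
 obtain t0 where t0: "0 \<le> t0" "t0 < 2 * pi" "om = (cos t0, sin t0)" using circle_polar[OF om] .
 have m: "{om'. \<bar>cross om om'\<bar> \<le> ta} \<in> sets borel" by measurable
 have "(ARC om'. indicator {om'. \<bar>cross om om'\<bar> \<le> ta} om')
  = (\<integral>\<^sup>+t\<in>{0..<2 * pi}. indicator {om'. \<bar>cross om om'\<bar> \<le> ta} (cos t, sin t) \<partial>lborel)"
  using m by (intro nn_integral_circle) auto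
 also have "... = (LEB t. indicator {t \<in> {0..<2 * pi}. \<bar>sin (t - t0)\<bar> \<le> ta} t)" by (intro nn_integral_cong)
   (auto simp: indicator_def cross_def t0 sin_diff algebra_simps)
 also have "... \<le> ennreal (20 * ta)" using emeasure_sin_small[OF t0(1,2) ta] by (simp add: nn_integral_indicator)
 finally show ?thesis .
qed

text \<open>For large \<open>c\<close> the mass sits within about c^(-1/2) of the angle 0, because 1
  - cos u is at least u^2/8. A shift by \<open>pi\<close> moves this peak from the ends of the
  period to its middle, where one Gaussian on the line dominates it.\<close>

lemma circle_gaussian_bounds:
 fixes c :: real
 assumes c: "c \<ge> 0"
 shows "(\<integral>\<^sup>+t\<in>{0..<2 * pi}. ennreal (exp (- (c * (1 - cos t)))) \<partial>lborel) \<le> ennreal (2 * pi)"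
  and "c > 0 \<Longrightarrow> (\<integral>\<^sup>+t\<in>{0..<2 * pi}. ennreal (exp (- (c * (1 - cos t)))) \<partial>lborel) \<le> ennreal (2 * sqrt (2 * pi) / sqrt c)"
proof -
 have "(\<integral>\<^sup>+t\<in>{0..<2 * pi}. ennreal (exp (- (c * (1 - cos t)))) \<partial>lborel) \<le> (\<integral>\<^sup>+t\<in>{0..<2 * pi}. 1 \<partial>lborel)"
  using c by (intro nn_integral_mono) (auto simp: indicator_def)
 then show "(\<integral>\<^sup>+t\<in>{0..<2 * pi}. ennreal (exp (- (c * (1 - cos t)))) \<partial>lborel) \<le> ennreal (2 * pi)" by simp
 assume c: "c > 0"
 have "(\<integral>\<^sup>+t\<in>{0..<2 * pi}. ennreal (exp (- (c * (1 - cos t)))) \<partial>lborel)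
  = (\<integral>\<^sup>+t\<in>{0..<2 * pi}. ennreal (exp (- (c * (1 - cos (t + pi))))) \<partial>lborel)"
  by (rule nn_integral_periodic_shift[symmetric]) auto
 also have "... \<le> (LEB t. ennreal (exp (- ((sqrt c / 2)\<^sup>2 * (t - pi)\<^sup>2 / 2))))"
 proof (rule nn_integral_mono)
  fix t :: real
  have "(sqrt c / 2)\<^sup>2 * (t - pi)\<^sup>2 / 2 \<le> c * (1 - cos (t + pi))" if t: "t \<in> {0..<2 * pi}"
  proof -
   have "\<bar>(t - pi) / 2\<bar> \<le> pi / 2"
   proof -
    have "\<bar>t - pi\<bar> \<le> pi" using t by auto
    then show ?thesis by simp
   qed
   from abs_sin_ge_half[OF this] have "(\<bar>(t - pi) / 2\<bar> / 2)\<^sup>2 \<le> \<bar>sin ((t - pi) / 2)\<bar>\<^sup>2"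
    by (intro power_mono) auto
   moreover have "cos (t - pi) = 1 - 2 * (sin ((t - pi) / 2))\<^sup>2"
   proof -
    have "cos (t - pi) = cos (2 * ((t - pi) / 2))" by (rule arg_cong) simp
    then show ?thesis by (simp only: cos_double_sin)
   qed
   ultimately have "(t - pi)\<^sup>2 / 8 \<le> 1 - cos (t - pi)" by (simp add: power_divide)
   then have "c * ((t - pi)\<^sup>2 / 8) \<le> c * (1 - cos (t - pi))" using c by (intro mult_left_mono) auto
   then show ?thesis using c by (simp add: power_divide cos_add cos_diff)
  qed
  then show "ennreal (exp (- (c * (1 - cos (t + pi))))) * indicator {0..<2 * pi} t
    \<le> ennreal (exp (- ((sqrt c / 2)\<^sup>2 * (t - pi)\<^sup>2 / 2)))" by (auto simp: indicator_def intro!: ennreal_leI)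
 qed
 also have "... = ennreal (sqrt (2 * pi) / (sqrt c / 2))" using c by (intro gaussian_nn_integral) auto
 finally show "(\<integral>\<^sup>+t\<in>{0..<2 * pi}. ennreal (exp (- (c * (1 - cos t)))) \<partial>lborel) \<le> ennreal (2 * sqrt (2 * pi) / sqrt c)"
  by (simp add: mult.commute)
qed

text \<open>Half of the exponent absorbs the linear factor: with x = R|s| this is x + 1 \<le> 2
  exp(x^2/4).\<close>

lemma polar_gaussian_aux:
 fixes R s :: real
 assumes R: "R > 0"
 shows "(\<bar>s\<bar> + 1 / R) * exp (- (R\<^sup>2 * s\<^sup>2 / 2)) \<le> 2 / R * exp (- (R\<^sup>2 * s\<^sup>2 / 4))"
proof -
 define x where "x = R * \<bar>s\<bar>"
 have x: "x \<ge> 0" "R\<^sup>2 * s\<^sup>2 = x\<^sup>2" using R by (auto simp: x_def power_mult_distrib)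
 have "0 \<le> (1 - x / 2)\<^sup>2" by simp
 then have "x \<le> 1 + x\<^sup>2 / 4" by (simp add: power2_eq_square algebra_simps)
 also have "... \<le> exp (x\<^sup>2 / 4)" using exp_ge_add_one_self[of "x\<^sup>2 / 4"] by simp
 finally have "x + 1 \<le> 2 * exp (x\<^sup>2 / 4)" using exp_ge_add_one_self[of "x\<^sup>2 / 4"] zero_le_power2[of x] by linarith
 then have "(x + 1) * exp (- (x\<^sup>2 / 2)) \<le> 2 * exp (x\<^sup>2 / 4) * exp (- (x\<^sup>2 / 2))" by (intro mult_right_mono) auto
 also have "... = 2 * exp (- (x\<^sup>2 / 4))" by (simp add: exp_add[symmetric])
 finally have "(x + 1) * exp (- (x\<^sup>2 / 2)) / R \<le> 2 * exp (- (x\<^sup>2 / 4)) / R" using R by (intro divide_right_mono) auto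
 moreover have "(\<bar>s\<bar> + 1 / R) = (x + 1) / R" using R by (simp add: x_def field_simps)
 ultimately show ?thesis unfolding x(2) by simp
qed

lemma polar_gaussian:
 fixes R rh :: real and p :: "real \<times> real"
 assumes R: "R > 0"
 shows "ennreal \<bar>rh\<bar> * (\<integral>\<^sup>+t\<in>{0..<2 * pi}. ennreal (exp (- (R\<^sup>2 * (norm (rh *\<^sub>R (cos t, sin t) - p))\<^sup>2 / 2))) \<partial>lborel)
  \<le> ennreal (8 * pi / R * exp (- (R\<^sup>2 * (\<bar>rh\<bar> - norm p)\<^sup>2 / 4)))"
proof -
 define g where "g rh t = ennreal (exp (- (R\<^sup>2 * (norm (rh *\<^sub>R (cos t, sin t) - p))\<^sup>2 / 2)))" for rh t :: real
 have [measurable]: "g rh \<in> borel_measurable borel" for rh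
  unfolding g_def by (rule measurable_compose[OF _ measurable_ennreal], intro borel_measurable_continuous_onI continuous_intros) auto
 define P where "P = norm p"
 obtain \<psi> where \<psi>: "0 \<le> \<psi>" "\<psi> < 2 * pi" "p = P *\<^sub>R (cos \<psi>, sin \<psi>)"
 proof (cases "p = 0")
  case True
  then show thesis using that[of 0] by (simp add: P_def zero_prod_def)
 next
  case False
  then have "p /\<^sub>R P \<in> sphere 0 1" by (simp add: P_def)
  then obtain t where "0 \<le> t" "t < 2 * pi" "p /\<^sub>R P = (cos t, sin t)" by (rule circle_polar)
  moreover from this have "p = P *\<^sub>R (cos t, sin t)" using False by (metis P_def divideR_right norm_eq_zero)
  ultimately show thesis using that by blast
 qed
 have P0: "P \<ge> 0" by (simp add: P_def)
 have pos: "ennreal r * (\<integral>\<^sup>+t\<in>{0..<2 * pi}. g r t \<partial>lborel) \<le> ennreal (8 * pi / R * exp (- (R\<^sup>2 * (r - P)\<^sup>2 / 4)))"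
  if r: "r \<ge> 0" for r
 proof -
  define c where "c = R\<^sup>2 * (r * P)"
  have c0: "c \<ge> 0" using r P0 by (simp add: c_def)
  have dist: "(norm (r *\<^sub>R (cos t, sin t) - p))\<^sup>2 = (r - P)\<^sup>2 + 2 * (r * P) * (1 - cos (t - \<psi>))" for t
  proof -
   have "(norm (r *\<^sub>R (cos t, sin t) - p))\<^sup>2 = (r * cos t - P * cos \<psi>)\<^sup>2 + (r * sin t - P * sin \<psi>)\<^sup>2"
    unfolding \<psi>(3) by (simp add: norm_Pair)
   also have "... = r\<^sup>2 * ((cos t)\<^sup>2 + (sin t)\<^sup>2) + P\<^sup>2 * ((cos \<psi>)\<^sup>2 + (sin \<psi>)\<^sup>2) - 2 * (r * P) * cos (t - \<psi>)"
    unfolding cos_diff by algebra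
   also have "... = (r - P)\<^sup>2 + 2 * (r * P) * (1 - cos (t - \<psi>))"
    by (simp only: sin_cos_squared_add2) (simp add: power2_eq_square algebra_simps)
   finally show ?thesis .
  qed
  have "(\<integral>\<^sup>+t\<in>{0..<2 * pi}. g r t \<partial>lborel) = (\<integral>\<^sup>+t\<in>{0..<2 * pi}. g r (t + \<psi>) \<partial>lborel)"
   using \<psi> by (intro nn_integral_periodic_shift[symmetric]) (auto simp: g_def)
  also have "... = (LEB t. ennreal (exp (- (R\<^sup>2 * (r - P)\<^sup>2 / 2))) * (ennreal (exp (- (c * (1 - cos t)))) * indicator {0..<2 * pi} t))"
  proof -
   have "exp (- (R\<^sup>2 * ((r - P)\<^sup>2 + 2 * (r * P) * (1 - cos t)) / 2))
     = exp (- (R\<^sup>2 * (r - P)\<^sup>2 / 2)) * exp (- (c * (1 - cos t)))" for t by (simp add: exp_add[symmetric] c_def field_simps)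
   then show ?thesis unfolding g_def dist by (intro nn_integral_cong) (simp add: ennreal_mult mult.assoc)
  qed
  also have "... = ennreal (exp (- (R\<^sup>2 * (r - P)\<^sup>2 / 2))) * (\<integral>\<^sup>+t\<in>{0..<2 * pi}. ennreal (exp (- (c * (1 - cos t)))) \<partial>lborel)"
   by (rule nn_integral_cmult) auto
  finally have eq: "(\<integral>\<^sup>+t\<in>{0..<2 * pi}. g r t \<partial>lborel) = ennreal (exp (- (R\<^sup>2 * (r - P)\<^sup>2 / 2))) *
    (\<integral>\<^sup>+t\<in>{0..<2 * pi}. ennreal (exp (- (c * (1 - cos t)))) \<partial>lborel)" .
  \<comment> \<open>If r is at least 2P, then r \<le> 2|r - P| and the trivial angular bound
    suffices. Otherwise the angular Gaussian with parameter \<open>c\<close> has integral of order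
    c^(-1/2), and r / sqrt c is at most sqrt 2 / R.\<close>
  have "ennreal r * (\<integral>\<^sup>+t\<in>{0..<2 * pi}. ennreal (exp (- (c * (1 - cos t)))) \<partial>lborel) \<le> ennreal (4 * pi * (\<bar>r - P\<bar> + 1 / R))"
  proof (cases "r \<ge> 2 * P")
   case True
   have "ennreal r * (\<integral>\<^sup>+t\<in>{0..<2 * pi}. ennreal (exp (- (c * (1 - cos t)))) \<partial>lborel) \<le> ennreal r * ennreal (2 * pi)"
    by (intro mult_left_mono circle_gaussian_bounds c0) auto
   also have "... = ennreal (r * (2 * pi))" using r by (simp add: ennreal_mult)
   also have "... \<le> ennreal (4 * pi * (\<bar>r - P\<bar> + 1 / R))"
   proof (rule ennreal_leI)
    have "r \<le> 2 * (\<bar>r - P\<bar> + 1 / R)"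

    proof -
     have "0 \<le> 1 / R" using R by simp
     moreover have "r \<le> 2 * \<bar>r - P\<bar>" using True r P0 by (auto simp: abs_if)
     ultimately show ?thesis unfolding distrib_left by linarith
    qed
    then have "(2 * pi) * r \<le> (2 * pi) * (2 * (\<bar>r - P\<bar> + 1 / R))" by (intro mult_left_mono) auto
    then show "r * (2 * pi) \<le> 4 * pi * (\<bar>r - P\<bar> + 1 / R)" by (simp add: algebra_simps)
   qed
   finally show ?thesis .
  next
   case False
   show ?thesis
   proof (cases "r = 0")
    case False': False
    have Pp: "P > 0" and rp: "r > 0" using False r False' by auto
    then have cp: "c > 0" using R by (simp add: c_def)
    have "ennreal r * (\<integral>\<^sup>+t\<in>{0..<2 * pi}. ennreal (exp (- (c * (1 - cos t)))) \<partial>lborel) \<le> ennreal r * ennreal (2 * sqrt (2 * pi) / sqrt c)"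
     by (intro mult_left_mono circle_gaussian_bounds c0 cp) auto
    also have "... = ennreal (r * (2 * sqrt (2 * pi) / sqrt c))" using r c0 by (intro ennreal_mult[symmetric]) auto
    also have "... \<le> ennreal (4 * pi * (\<bar>r - P\<bar> + 1 / R))"
    proof (rule ennreal_leI)
     have "r * r \<le> 2 * (r * P)" using False rp by simp
     then have "sqrt (r * r) \<le> sqrt (2 * (r * P))" by (rule real_sqrt_le_mono)
     then have "r \<le> sqrt 2 * sqrt (r * P)" using rp by (simp add: real_sqrt_mult)
     moreover have "sqrt c = R * sqrt (r * P)" using R by (simp add: c_def real_sqrt_mult)
     ultimately have "r / sqrt c \<le> sqrt 2 / R" using R rp Pp by (simp add: field_simps)
     then have "2 * sqrt (2 * pi) * (r / sqrt c) \<le> 2 * sqrt (2 * pi) * (sqrt 2 / R)" by (intro mult_left_mono) auto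
     also have "... = 4 * sqrt pi / R" by (simp add: real_sqrt_mult)
     also have "... \<le> 4 * pi / R"
     proof -
      have "sqrt pi * 1 \<le> sqrt pi * sqrt pi" using pi_gt3 by (intro mult_left_mono) auto
      then show ?thesis using R by (intro divide_right_mono) auto
     qed
     also have "... \<le> 4 * pi * (\<bar>r - P\<bar> + 1 / R)" by (simp add: algebra_simps)
     finally show "r * (2 * sqrt (2 * pi) / sqrt c) \<le> 4 * pi * (\<bar>r - P\<bar> + 1 / R)" by (simp add: mult_ac)
    qed
    finally show ?thesis .
   qed simp
  qed
  then have "ennreal r * (\<integral>\<^sup>+t\<in>{0..<2 * pi}. g r t \<partial>lborel)
   \<le> ennreal (exp (- (R\<^sup>2 * (r - P)\<^sup>2 / 2))) * ennreal (4 * pi * (\<bar>r - P\<bar> + 1 / R))"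
   unfolding eq by (subst mult.left_commute) (auto intro!: mult_left_mono)
  also have "... = ennreal (4 * pi * ((\<bar>r - P\<bar> + 1 / R) * exp (- (R\<^sup>2 * (r - P)\<^sup>2 / 2))))"
   using R by (subst ennreal_mult[symmetric]) (auto simp: mult_ac)
  also have "... \<le> ennreal (4 * pi * (2 / R * exp (- (R\<^sup>2 * (r - P)\<^sup>2 / 4))))"
   using polar_gaussian_aux[OF R, of "r - P"] by (intro ennreal_leI mult_left_mono) auto
  finally show ?thesis by (simp add: mult.assoc)
 qed
 show ?thesis
 proof (cases "rh \<ge> 0")
  case True
  then show ?thesis using pos[of rh] by (simp add: g_def P_def)
 next
  case False
  have "(\<integral>\<^sup>+t\<in>{0..<2 * pi}. g rh t \<partial>lborel) = (\<integral>\<^sup>+t\<in>{0..<2 * pi}. g rh (t + pi) \<partial>lborel)"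
   by (intro nn_integral_periodic_shift[symmetric]) (auto simp: g_def)
  also have "... = (\<integral>\<^sup>+t\<in>{0..<2 * pi}. g \<bar>rh\<bar> t \<partial>lborel)" using False by (simp add: g_def)
  finally show ?thesis using pos[of "\<bar>rh\<bar>"] by (simp add: g_def P_def)
 qed
qed

text \<open>Points at the angles s and s + t add up to 2 cos(t/2) times the point at angle s + t/2,
  and the Jacobian |sin t| factors as |sin(t/2)| times |2 cos(t/2)|. The second factor is the polar
  Jacobian consumed by \<open>polar_gaussian\<close> in the integral over s; the first turns the
  integral over t into one over cos(t/2) with respect to Lebesgue measure, in which a
  one-dimensional Gaussian remains.\<close>

lemma circle_circle_push:
 fixes R :: real and p :: "real \<times> real"
 assumes R: "R > 0"
 shows "(ARC om. ARC om'. ennreal (\<bar>cross om om'\<bar> * exp (- (R\<^sup>2 * (norm (om + om' - p))\<^sup>2 / 2))))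
  \<le> ennreal (128 * pi * sqrt pi / R ^ 2)"
proof -
 define w where "w t = (cos t, sin t)" for t :: real
 define g where "g v = ennreal (exp (- (R\<^sup>2 * (norm (v - p))\<^sup>2 / 2)))" for v
 define I where "I = {0..<2 * pi}"
 have wm: "continuous_on UNIV w" unfolding w_def by (intro continuous_intros)
 have gm[measurable]: "g \<in> borel_measurable borel" unfolding g_def by measurable
 have [measurable]: "I \<in> sets borel" by (simp add: I_def)
 have wM[measurable]: "w \<in> borel_measurable borel" using wm by (rule borel_measurable_continuous_onI)
 have cr: "cross (w s) (w t) = sin (t - s)" for s t by (simp add: w_def cross_def sin_diff algebra_simps)
 have per: "w (t + 2 * pi) = w t" for t by (simp add: w_def)
 let ?L = "(ARC om. ARC om'. ennreal (\<bar>cross om om'\<bar> * exp (- (R\<^sup>2 * (norm (om + om' - p))\<^sup>2 / 2))))"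
 let ?f = "\<lambda>om om'. ennreal \<bar>cross om om'\<bar> * g (om + om')"
 interpret C: finite_measure \<sigma> by (rule finite_measure_circle)
 have fm: "(\<lambda>z. ?f (fst z) (snd z)) \<in> borel_measurable (\<sigma> \<Otimes>\<^sub>M \<sigma>)"
  unfolding cross_def by measurable
 have fm1: "?f om \<in> borel_measurable \<sigma>" for om by (intro measurable_circle_measureI) measurable
 have "?L = (ARC om. ARC om'. ?f om om')" by (simp add: g_def ennreal_mult)
 also have "... = (\<integral>\<^sup>+s\<in>I. (ARC om'. ?f (w s) om') \<partial>lborel)" unfolding I_def w_def
  by (rule nn_integral_circle) (use C.borel_measurable_nn_integral_fst[OF fm] in simp)
 also have "... = (\<integral>\<^sup>+s\<in>I. (\<integral>\<^sup>+t\<in>I. ennreal \<bar>sin t\<bar> * g (w s + w (t + s)) \<partial>lborel) \<partial>lborel)"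
 proof (rule nn_integral_cong)
  fix s :: real
  have "(ARC om'. ?f (w s) om') = (\<integral>\<^sup>+t\<in>I. ?f (w s) (w t) \<partial>lborel)"
   unfolding I_def w_def[of t for t] using fm1 by (rule nn_integral_circle)
  also have "... = (\<integral>\<^sup>+t\<in>I. ?f (w s) (w (t + s)) \<partial>lborel)" if "s \<in> I"
   unfolding I_def using that by (intro nn_integral_periodic_shift[symmetric]) (auto simp: per I_def)
  also have "... = (\<integral>\<^sup>+t\<in>I. ennreal \<bar>sin t\<bar> * g (w s + w (t + s)) \<partial>lborel)" by (simp add: cr)
  finally show "(ARC om'. ?f (w s) om') * indicator I s =
   (\<integral>\<^sup>+t\<in>I. ennreal \<bar>sin t\<bar> * g (w s + w (t + s)) \<partial>lborel) * indicator I s" by (auto simp: indicator_def)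
 qed
 also have "... = (LEB s. LEB t. ennreal \<bar>sin t\<bar> * g (w s + w (t + s)) * indicator I t * indicator I s)"
  by (intro nn_integral_cong) (simp add: nn_integral_multc)
 also have "... = (LEB t. LEB s. ennreal \<bar>sin t\<bar> * g (w s + w (t + s)) * indicator I t * indicator I s)"
  by (rule lborel_pair.Fubini') measurable
 also have "... = (LEB t. ennreal \<bar>sin t\<bar> * indicator I t * (\<integral>\<^sup>+s\<in>I. g (w s + w (t + s)) \<partial>lborel))"
  by (intro nn_integral_cong, subst nn_integral_cmult[symmetric]) (auto intro!: nn_integral_cong simp: mult_ac)
 also have "... \<le> (LEB t. ennreal (\<bar>sin (t / 2)\<bar> * (8 * pi / R * exp (- (R\<^sup>2 * (\<bar>2 * cos (t / 2)\<bar> - norm p)\<^sup>2 / 4)))) * indicator I t)"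
 proof (rule nn_integral_mono)
  fix t :: real
  have ww: "w s + w (t + s) = (2 * cos (t / 2)) *\<^sub>R w (s + t / 2)" for s
  proof -
   have c: "2 * (cos (t / 2) * cos (t / 2)) = 1 + cos t" and "sin t = 2 * sin (t / 2) * cos (t / 2)"
    using cos_double_cos[of "t / 2"] sin_double[of "t / 2"] by (auto simp: power2_eq_square)
   then show ?thesis by (simp add: w_def cos_add sin_add c algebra_simps)
  qed
  have "ennreal \<bar>sin t\<bar> * (\<integral>\<^sup>+s\<in>I. g (w s + w (t + s)) \<partial>lborel)
   \<le> ennreal (\<bar>sin (t / 2)\<bar> * (8 * pi / R * exp (- (R\<^sup>2 * (\<bar>2 * cos (t / 2)\<bar> - norm p)\<^sup>2 / 4))))" if t: "t \<in> I"
  proof -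
   have "(\<integral>\<^sup>+s\<in>I. g (w s + w (t + s)) \<partial>lborel) = (\<integral>\<^sup>+s\<in>I. g ((2 * cos (t / 2)) *\<^sub>R w (s + t / 2)) \<partial>lborel)"
    by (simp add: ww)
   also have "... = (\<integral>\<^sup>+s\<in>I. g ((2 * cos (t / 2)) *\<^sub>R w s) \<partial>lborel)"
    unfolding I_def using t by (intro nn_integral_periodic_shift) (auto simp: per I_def)
   finally have shift: "(\<integral>\<^sup>+s\<in>I. g (w s + w (t + s)) \<partial>lborel) = (\<integral>\<^sup>+s\<in>I. g ((2 * cos (t / 2)) *\<^sub>R w s) \<partial>lborel)" .
   have "ennreal \<bar>sin t\<bar> * (\<integral>\<^sup>+s\<in>I. g (w s + w (t + s)) \<partial>lborel)
    = ennreal \<bar>sin (t / 2)\<bar> * (ennreal \<bar>2 * cos (t / 2)\<bar> * (\<integral>\<^sup>+s\<in>I. g ((2 * cos (t / 2)) *\<^sub>R w s) \<partial>lborel))"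
   proof -
    have "\<bar>sin t\<bar> = \<bar>sin (t / 2)\<bar> * \<bar>2 * cos (t / 2)\<bar>" using sin_double[of "t / 2"] by (simp add: abs_mult)
    then have "ennreal \<bar>sin t\<bar> = ennreal \<bar>sin (t / 2)\<bar> * ennreal \<bar>2 * cos (t / 2)\<bar>"
     by (simp only: ennreal_mult abs_ge_zero)
    then show ?thesis  unfolding shift by (simp only: mult.assoc)
   qed
   also have "... \<le> ennreal \<bar>sin (t / 2)\<bar> * ennreal (8 * pi / R * exp (- (R\<^sup>2 * (\<bar>2 * cos (t / 2)\<bar> - norm p)\<^sup>2 / 4)))"
    unfolding I_def g_def w_def by (intro mult_left_mono polar_gaussian R) auto
   also have "... = ennreal (\<bar>sin (t / 2)\<bar> * (8 * pi / R * exp (- (R\<^sup>2 * (\<bar>2 * cos (t / 2)\<bar> - norm p)\<^sup>2 / 4))))"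
    using R by (subst ennreal_mult) auto
   finally show ?thesis .
  qed
  then show "ennreal \<bar>sin t\<bar> * indicator I t * (\<integral>\<^sup>+s\<in>I. g (w s + w (t + s)) \<partial>lborel)
   \<le> ennreal (\<bar>sin (t / 2)\<bar> * (8 * pi / R * exp (- (R\<^sup>2 * (\<bar>2 * cos (t / 2)\<bar> - norm p)\<^sup>2 / 4)))) * indicator I t"
   by (auto simp: indicator_def)
 qed
 also have "... = 2 * (LEB u. ennreal (\<bar>sin u\<bar> * (8 * pi / R * exp (- (R\<^sup>2 * (\<bar>2 * cos u\<bar> - norm p)\<^sup>2 / 4)))) * indicator I (2 * u))"
  by (subst nn_integral_real_affine[where c = 2 and t = 0]) auto
 also have "... \<le> 2 * (\<integral>\<^sup>+u\<in>I. ennreal \<bar>sin u\<bar> * ennreal (8 * pi / R * exp (- (R\<^sup>2 * (\<bar>2 * cos u\<bar> - norm p)\<^sup>2 / 4))) \<partial>lborel)"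
 proof -
  have "ennreal (\<bar>sin u\<bar> * (8 * pi / R * exp (- (R\<^sup>2 * (\<bar>2 * cos u\<bar> - norm p)\<^sup>2 / 4))))
   = ennreal \<bar>sin u\<bar> * ennreal (8 * pi / R * exp (- (R\<^sup>2 * (\<bar>2 * cos u\<bar> - norm p)\<^sup>2 / 4)))" for u
   using R by (intro ennreal_mult) auto
  then show ?thesis by (intro mult_left_mono nn_integral_mono) (auto simp: indicator_def I_def)
 qed
 also have "... \<le> 2 * (2 * (LEB x. ennreal (8 * pi / R * exp (- (R\<^sup>2 * (\<bar>2 * x\<bar> - norm p)\<^sup>2 / 4)))))" unfolding I_def
  by (intro mult_left_mono nn_integral_sin_cos[where k = "\<lambda>x. ennreal (8 * pi / R * exp (- (R\<^sup>2 * (\<bar>2 * x\<bar> - norm p)\<^sup>2 / 4)))"]) auto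
 also have "(LEB x. ennreal (8 * pi / R * exp (- (R\<^sup>2 * (\<bar>2 * x\<bar> - norm p)\<^sup>2 / 4))))
   \<le> (LEB x. ennreal (8 * pi / R) * (ennreal (exp (- ((sqrt 2 * R)\<^sup>2 * (x - norm p / 2)\<^sup>2 / 2))) +
     ennreal (exp (- ((sqrt 2 * R)\<^sup>2 * (x - (- norm p / 2))\<^sup>2 / 2)))))"
 proof (rule nn_integral_mono)
  fix x :: real
  have e: "R\<^sup>2 * (\<bar>2 * x\<bar> - norm p)\<^sup>2 / 4 = (sqrt 2 * R)\<^sup>2 * (x - norm p / 2)\<^sup>2 / 2 \<or>
    R\<^sup>2 * (\<bar>2 * x\<bar> - norm p)\<^sup>2 / 4 = (sqrt 2 * R)\<^sup>2 * (x - (- norm p / 2))\<^sup>2 / 2"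
   by (cases "x \<ge> 0") (auto simp: abs_if power_mult_distrib power2_eq_square field_simps)
  have "exp (- (R\<^sup>2 * (\<bar>2 * x\<bar> - norm p)\<^sup>2 / 4)) \<le> exp (- ((sqrt 2 * R)\<^sup>2 * (x - norm p / 2)\<^sup>2 / 2)) +
     exp (- ((sqrt 2 * R)\<^sup>2 * (x - (- norm p / 2))\<^sup>2 / 2))"
   using e by (elim disjE; simp only: le_add_same_cancel1 le_add_same_cancel2 exp_ge_zero)
  then have "8 * pi / R * exp (- (R\<^sup>2 * (\<bar>2 * x\<bar> - norm p)\<^sup>2 / 4)) \<le> 8 * pi / R * (exp (- ((sqrt 2 * R)\<^sup>2 * (x - norm p / 2)\<^sup>2 / 2)) +
     exp (- ((sqrt 2 * R)\<^sup>2 * (x - (- norm p / 2))\<^sup>2 / 2)))" using R by (intro mult_left_mono) auto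
  then show "ennreal (8 * pi / R * exp (- (R\<^sup>2 * (\<bar>2 * x\<bar> - norm p)\<^sup>2 / 4))) \<le>
    ennreal (8 * pi / R) * (ennreal (exp (- ((sqrt 2 * R)\<^sup>2 * (x - norm p / 2)\<^sup>2 / 2))) +
     ennreal (exp (- ((sqrt 2 * R)\<^sup>2 * (x - (- norm p / 2))\<^sup>2 / 2))))"
   using R by (subst ennreal_plus[symmetric], simp, simp, subst ennreal_mult[symmetric]) (auto intro!: ennreal_leI)
 qed
 also have "... = ennreal (8 * pi / R) * (ennreal (sqrt (2 * pi) / (sqrt 2 * R)) + ennreal (sqrt (2 * pi) / (sqrt 2 * R)))"
  using R by (subst nn_integral_cmult, simp, subst nn_integral_add, simp, simp, subst (1 2) gaussian_nn_integral) auto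
 also have "... = ennreal (8 * pi / R * (2 * sqrt pi / R))"
  using R by (subst ennreal_plus[symmetric], simp, simp, subst ennreal_mult[symmetric]) (auto simp: real_sqrt_mult)
 also have "2 * (2 * ennreal (8 * pi / R * (2 * sqrt pi / R))) = ennreal (2 * (2 * (8 * pi / R * (2 * sqrt pi / R))))"
  using R by (subst (1 2) ennreal_mult) auto
 also have "... \<le> ennreal (128 * pi * sqrt pi / R ^ 2)" using R by (intro ennreal_leI) (simp add: power2_eq_square field_simps)
 finally show ?thesis by (simp add: mult_left_mono)
qed

section \<open>Extensions of bounded functions with small mass\<close>

text \<open>A replacement for Minkowski's inequality that is valid for every positive exponent. Each
  \<open>g m / ka ^ m\<close> is at most the 1/s-th power of the sum on the right, and the weights
  \<open>ka ^ m\<close> sum. The price ka^(-m s) has to be paid by decay of the pieces.\<close>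

lemma powr_suminf_le:
 fixes g :: "nat \<Rightarrow> real" and x s ka :: real
 assumes g: "\<And>m. g m \<ge> 0" and ka: "0 < ka" "ka < 1" and s: "s > 0" and x: "x \<ge> 0"
  and le: "ennreal x \<le> (\<Sum>m. ennreal (g m))"
 shows "ennreal (x powr s) \<le> ennreal ((1 / (1 - ka)) powr s) * (\<Sum>m. ennreal ((g m / ka ^ m) powr s))"
proof (cases "(\<Sum>m. ennreal ((g m / ka ^ m) powr s)) = \<top>")
 case True
 have "(1 / (1 - ka)) powr s > 0" using ka by simp
 then have "ennreal ((1 / (1 - ka)) powr s) \<noteq> 0" by (simp only: ennreal_eq_0_iff not_le)
 then show ?thesis by (simp only: True ennreal_mult_top if_False top_greatest)
next
 case False
 define t where "t = enn2real (\<Sum>m. ennreal ((g m / ka ^ m) powr s))"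
 have "ennreal t = (\<Sum>m. ennreal ((g m / ka ^ m) powr s))" unfolding t_def by (rule ennreal_enn2real[OF False[unfolded less_top]])
 then have t: "t \<ge> 0" "(\<Sum>m. ennreal ((g m / ka ^ m) powr s)) = ennreal t" by (simp_all only: t_def enn2real_nonneg)
 have gm: "g m \<le> ka ^ m * t powr (1 / s)" for m
 proof -
  have "ennreal ((g m / ka ^ m) powr s) \<le> ennreal t"
   using sum_le_suminf[OF summableI, of "{m}" "\<lambda>m. ennreal ((g m / ka ^ m) powr s)"] t by simp
  then have "((g m / ka ^ m) powr s) powr (1 / s) \<le> t powr (1 / s)" using t s by (intro powr_mono2) auto
  then show ?thesis using s g[of m] ka by (simp add: powr_powr field_simps)
 qed
 have "ennreal x \<le> (\<Sum>m. ennreal (ka ^ m * t powr (1 / s)))" by (rule order_trans[OF le]) (intro suminf_le ennreal_leI gm summableI)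
 also have "... = ennreal (\<Sum>m. ka ^ m * t powr (1 / s))"
  using ka by (intro suminf_ennreal2) (auto intro!: summable_mult2 summable_geometric)
 also have "(\<Sum>m. ka ^ m * t powr (1 / s)) = 1 / (1 - ka) * t powr (1 / s)"
  using ka by (subst suminf_mult2[symmetric]) (auto simp: suminf_geometric intro!: summable_geometric)
 finally have "x \<le> 1 / (1 - ka) * t powr (1 / s)" using ka by simp
 then have "x powr s \<le> (1 / (1 - ka) * t powr (1 / s)) powr s" using x s by (intro powr_mono2) auto
 also have "... = (1 / (1 - ka)) powr s * t" using ka t s by (subst powr_mult) (auto simp: powr_powr)
 finally show ?thesis unfolding t(2) using ka t by (subst ennreal_mult[symmetric]) (auto intro!: ennreal_leI)
qed

lemma norm_integral_countable_le:
 fixes u :: "'a \<Rightarrow> complex"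
 assumes u: "integrable M u" and B: "\<And>m::nat. B m \<in> sets M" "disjoint_family B"
  and AE: "AE om in M. u om = 0 \<or> om \<in> (\<Union>m. B m)"
 shows "ennreal (norm (\<integral>om. u om \<partial>M)) \<le> (\<Sum>m. ennreal (norm (\<integral>om. indicator (B m) om *\<^sub>R u om \<partial>M)))"
proof (cases "(\<Sum>m. ennreal (norm (\<integral>om. indicator (B m) om *\<^sub>R u om \<partial>M))) = \<top>")
 case False
 let ?a = "\<lambda>m. \<integral>om. indicator (B m) om *\<^sub>R u om \<partial>M"
 have summ: "summable (\<lambda>m. norm (?a m))" by (rule summable_suminf_not_top) (use False in auto)
 have [measurable]: "u \<in> borel_measurable M" using u by auto
 note B(1)[measurable]
 have "(\<integral>om. u om \<partial>M) = (\<integral>om. indicator (\<Union>m. B m) om *\<^sub>R u om \<partial>M)"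
  by (rule integral_cong_AE) (use AE in \<open>auto elim!: eventually_mono simp: indicator_def\<close>)
 also have "... = (\<Sum>m. ?a m)"
 proof -
  have "set_integrable M (\<Union>m. B m) u" unfolding set_integrable_def using u by (intro integrable_mult_indicator) auto
  then show ?thesis using lebesgue_integral_countable_add[of B M u] B by (auto simp: set_lebesgue_integral_def disjoint_family_on_def)
 qed
 finally have "norm (\<integral>om. u om \<partial>M) \<le> (\<Sum>m. norm (?a m))" using summable_norm[OF summ] by simp
 then show ?thesis using summ by (subst suminf_ennreal2) (auto intro: ennreal_leI)
qed simp

text \<open>Piece \<open>m\<close> of \<open>h\<close> lives where \<open>J\<close> is about \<open>a / 2 ^ m\<close>; its extension is estimated in \<open>L\<^sup>2\<close> by \<open>plancherel_schur\<close> and in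
  \<open>L\<^sup>\<infinity>\<close> by \<open>small\<close>.\<close>

theorem extension_Lp_bound:
 fixes M :: "'a measure" and ph :: "'a \<Rightarrow> 'v::euclidean_space" and h :: "'a \<Rightarrow> complex"
  and J :: "'a \<Rightarrow> real" and c K N a s :: real and d :: nat
 assumes M: "finite_measure M"
  and [measurable]: "ph \<in> borel_measurable M" "h \<in> borel_measurable M" "J \<in> borel_measurable M"
  and J: "\<And>om. J om \<ge> 0"
  and h: "\<And>om. cmod (h om) \<le> 1"
  and c: "c \<ge> 0" and K: "K \<ge> 0" and N: "N \<ge> 0" and a: "a > 0" and s: "s > 2"
  and gauss: "\<And>R. R > 0 \<Longrightarrow> integrable lborel (\<lambda>z::'v. exp (- (norm z)\<^sup>2 / (2 * R\<^sup>2)))"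
   "\<And>R t. R > 0 \<Longrightarrow> (\<integral>z. exp (\<i> * of_real (z \<bullet> t)) * of_real (exp (- (norm z)\<^sup>2 / (2 * R\<^sup>2))) \<partial>lborel)
     = complex_of_real (c * R ^ d * exp (- (R\<^sup>2 * (norm (t::'v))\<^sup>2 / 2)))"
  and push: "\<And>R p. R > 0 \<Longrightarrow>
   (\<integral>\<^sup>+om. ennreal (J om * exp (- (R\<^sup>2 * (norm (ph om - p))\<^sup>2 / 2))) \<partial>M) \<le> ennreal (K / R ^ d)"
  and small: "\<And>ta. ta > 0 \<Longrightarrow> (\<integral>\<^sup>+om. ennreal (cmod (h om)) * indicator {om. J om \<le> ta} om \<partial>M) \<le> ennreal (N * ta)"
  and tot: "(\<integral>\<^sup>+om. ennreal (cmod (h om)) \<partial>M) \<le> ennreal (N * a)"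
 shows "(LEB z. ennreal (cmod (\<integral>om. exp (\<i> * of_real (z \<bullet> ph om)) * h om \<partial>M) powr s))
   \<le> ennreal ((1 / (1 - 2 powr (-(s - 2) / (2 * s)))) powr s / (1 - 2 powr (-(s - 2) / 2)) * (2 powr (s - 1) * c * K)
      * (N powr (s - 1) * a powr (s - 2)))"
proof -
 interpret M: finite_measure M by fact
 define G where "G z = (\<integral>om. exp (\<i> * of_real (z \<bullet> ph om)) * h om \<partial>M)" for z
 \<comment> \<open>Piece 0 has no upper bound on \<open>J\<close>: it takes all \<open>J\<close>
   above \<open>a\<close>, where the total mass \<open>N * a\<close> plays the part of
   \<open>small\<close>.\<close>
 define B where "B m = {om \<in> space M. a / 2 ^ m < J om \<and> (m = 0 \<or> J om \<le> 2 * a / 2 ^ m)}" for m :: nat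
 have Bm[measurable]: "B m \<in> sets M" for m unfolding B_def by measurable
 define h' where "h' m om = indicator (B m) om *\<^sub>R h om" for m om
 have [measurable]: "h' m \<in> borel_measurable M" for m unfolding h'_def by measurable
 define G' where "G' m z = (\<integral>om. exp (\<i> * of_real (z \<bullet> ph om)) * h' m om \<partial>M)" for m z
 have [measurable]: "G \<in> borel_measurable borel" "\<And>m. G' m \<in> borel_measurable borel" unfolding G_def G'_def by measurable
 have intG: "integrable M (\<lambda>om. exp (\<i> * of_real (z \<bullet> ph om)) * h om)" for z
  by (rule M.integrable_const_bound[where B = 1]) (auto simp: norm_mult h)
 have h'1: "cmod (h' m om) \<le> 1" for m om using h[of om] by (auto simp: h'_def indicator_def)
 have intG': "integrable M (\<lambda>om. exp (\<i> * of_real (z \<bullet> ph om)) * h' m om)" for z m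
  by (rule M.integrable_const_bound[where B = 1]) (auto simp: norm_mult h'1)
 have disj: "disjoint_family B"
 proof -
  have "B m \<inter> B n = {}" if "m < n" for m n
  proof -
   have "(2::real) * 2 ^ m \<le> 2 ^ n" using that by (metis Suc_leI one_le_numeral power_Suc power_increasing)
   then have "a * (2 * 2 ^ m) \<le> a * 2 ^ n" using a by (intro mult_left_mono) auto
   then have "2 * a / 2 ^ n \<le> a / 2 ^ m" by (simp add: field_simps)
   then show ?thesis using that unfolding B_def by force
  qed
  then show ?thesis unfolding disjoint_family_on_def by (metis inf_commute linorder_neqE_nat)
 qed
 \<comment> \<open>Letting \<open>ta\<close> tend to 0 in \<open>small\<close> shows that
   \<open>h\<close> vanishes almost everywhere on the zero set of \<open>J\<close>, so the shells
   miss nothing.\<close>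
 have AEpos: "AE om in M. h om = 0 \<or> J om > 0"
 proof -
  have "(\<integral>\<^sup>+om. ennreal (cmod (h om)) * indicator {om. J om \<le> 0} om \<partial>M) \<le> 0"
  proof (rule ennreal_le_epsilon)
   fix e :: real assume e: "e > 0"
   have "(\<integral>\<^sup>+om. ennreal (cmod (h om)) * indicator {om. J om \<le> 0} om \<partial>M)
    \<le> (\<integral>\<^sup>+om. ennreal (cmod (h om)) * indicator {om. J om \<le> e / (N + 1)} om \<partial>M)"
   proof -
    have "0 \<le> e / (N + 1)" using e N by simp
    then have "J om \<le> e / (N + 1)" if "J om \<le> 0" for om using that by linarith
    then show ?thesis by (intro nn_integral_mono) (auto simp: indicator_def)
   qed
   also have "... \<le> ennreal (N * (e / (N + 1)))" using e N by (intro small) auto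
   also have "... \<le> ennreal e" using e N by (intro ennreal_leI) (simp add: field_simps)
   finally show "(\<integral>\<^sup>+om. ennreal (cmod (h om)) * indicator {om. J om \<le> 0} om \<partial>M) \<le> 0 + ennreal e" by simp
  qed
  then have "AE om in M. ennreal (cmod (h om)) * indicator {om. J om \<le> 0} om = 0" by (subst nn_integral_0_iff_AE[symmetric]) auto
  then show ?thesis by eventually_elim (auto simp: indicator_def split: if_splits)
 qed
 have cover: "J om > 0 \<Longrightarrow> om \<in> space M \<Longrightarrow> om \<in> (\<Union>m. B m)" for om
 proof -
  assume "J om > 0" "om \<in> space M"
  obtain n where "a / J om < 2 ^ n" using real_arch_pow[of 2 "a / J om"] by auto
  then have ex: "\<exists>n. a / 2 ^ n < J om" using \<open>J om > 0\<close> by (auto simp: field_simps)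
  define m where "m = (LEAST n. a / 2 ^ n < J om)"
  have m: "a / 2 ^ m < J om" unfolding m_def using ex by (rule LeastI_ex)
  have "J om \<le> 2 * a / 2 ^ m" if m0: "m \<noteq> 0"
  proof -
   obtain k where k: "m = Suc k" using m0 not0_implies_Suc by blast
   have "\<not> a / 2 ^ k < J om" using not_less_Least[of k "\<lambda>n. a / 2 ^ n < J om"] k unfolding m_def by auto
   then have "J om \<le> a / 2 ^ k" by simp
   also have "a / 2 ^ k = 2 * a / 2 ^ m" unfolding k by simp
   finally show ?thesis .
  qed
  then show "om \<in> (\<Union>m. B m)" using m \<open>om \<in> space M\<close> by (auto simp: B_def)
 qed
 have Gle: "ennreal (cmod (G z)) \<le> (\<Sum>m. ennreal (cmod (G' m z)))" for z
 proof -
  have "ennreal (norm (G z)) \<le> (\<Sum>m. ennreal (norm (\<integral>om. indicator (B m) om *\<^sub>R (exp (\<i> * of_real (z \<bullet> ph om)) * h om) \<partial>M)))"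
   unfolding G_def
  proof (rule norm_integral_countable_le[OF intG Bm disj])
   show "AE om in M. exp (\<i> * of_real (z \<bullet> ph om)) * h om = 0 \<or> om \<in> (\<Union>m. B m)"
    using AEpos AE_space by eventually_elim (use cover in auto)
  qed
  then show ?thesis by (simp add: G'_def h'_def mult_ac)
 qed
 have h'L1: "(\<integral>\<^sup>+om. ennreal (cmod (h' m om)) \<partial>M) \<le> ennreal (2 * N * a / 2 ^ m)" for m
 proof (cases m)
  case 0
  have "(\<integral>\<^sup>+om. ennreal (cmod (h' m om)) \<partial>M) \<le> (\<integral>\<^sup>+om. ennreal (cmod (h om)) \<partial>M)"
   by (intro nn_integral_mono) (auto simp: h'_def indicator_def)
  also have "... \<le> ennreal (N * a)" by (rule tot)
  also have "... \<le> ennreal (2 * N * a / 2 ^ m)" using 0 N a by (intro ennreal_leI) simp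
  finally show ?thesis .
 next
  case (Suc k)
  have "(\<integral>\<^sup>+om. ennreal (cmod (h' m om)) \<partial>M)
   \<le> (\<integral>\<^sup>+om. ennreal (cmod (h om)) * indicator {om. J om \<le> 2 * a / 2 ^ m} om \<partial>M)"
   using Suc by (intro nn_integral_mono) (auto simp: h'_def indicator_def B_def)
  also have "... \<le> ennreal (N * (2 * a / 2 ^ m))" using a by (intro small) auto
  finally show ?thesis by (simp add: mult_ac)
 qed
 \<comment> \<open>The mass \<open>2 * N * a / 2 ^ m\<close> and the lower bound
   \<open>a / 2 ^ m\<close> for \<open>J\<close> cancel: the energy is the same on all shells, and
   all decay comes from the sup bound.\<close>
 have h'L2: "(\<integral>\<^sup>+om. ennreal ((cmod (h' m om))\<^sup>2 / J om) \<partial>M) \<le> ennreal (2 * N)" for m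
 proof -
  have "(\<integral>\<^sup>+om. ennreal ((cmod (h' m om))\<^sup>2 / J om) \<partial>M) \<le> (\<integral>\<^sup>+om. ennreal (2 ^ m / a) * ennreal (cmod (h' m om)) \<partial>M)"
  proof (rule nn_integral_mono)
   fix om
   have "(cmod (h' m om))\<^sup>2 / J om \<le> 2 ^ m / a * cmod (h' m om)"
   proof (cases "om \<in> B m")
    case True
    then have "a / 2 ^ m < J om" by (simp add: B_def)
    moreover have "0 < a / 2 ^ m" using a by simp
    ultimately have "1 / J om \<le> 1 / (a / 2 ^ m)" by (intro divide_left_mono mult_pos_pos) linarith+
    then have "(cmod (h' m om) * cmod (h' m om)) * (1 / J om) \<le> (cmod (h' m om) * 1) * (2 ^ m / a)"
     using h'1[of m om] J[of om] by (intro mult_mono mult_left_mono) auto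
    then show ?thesis by (simp add: power2_eq_square mult_ac)
   qed (simp add: h'_def)
   then show "ennreal ((cmod (h' m om))\<^sup>2 / J om) \<le> ennreal (2 ^ m / a) * ennreal (cmod (h' m om))"
    using a by (subst ennreal_mult[symmetric]) (auto intro!: ennreal_leI)
  qed
  also have "... = ennreal (2 ^ m / a) * (\<integral>\<^sup>+om. ennreal (cmod (h' m om)) \<partial>M)" by (rule nn_integral_cmult) auto
  also have "... \<le> ennreal (2 ^ m / a) * ennreal (2 * N * a / 2 ^ m)" by (intro mult_left_mono h'L1) auto
  also have "... = ennreal (2 * N)" using a N by (subst ennreal_mult[symmetric]) auto
  finally show ?thesis .
 qed
 have G'sup: "cmod (G' m z) \<le> 2 * N * a / 2 ^ m" for m z
 proof -
  have "ennreal (cmod (G' m z)) \<le> (\<integral>\<^sup>+om. norm (exp (\<i> * of_real (z \<bullet> ph om)) * h' m om) \<partial>M)"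
   unfolding G'_def by (rule integral_norm_bound_ennreal[OF intG'])
  also have "... \<le> ennreal (2 * N * a / 2 ^ m)" using h'L1[of m] by (simp add: norm_mult)
  finally show ?thesis using N a by (subst (asm) ennreal_le_iff) auto
 qed
 have G'L2: "(LEB z. ennreal ((cmod (G' m z))\<^sup>2)) \<le> ennreal (2 * c * K * N)" for m
 proof -
  have "(LEB z. ennreal ((cmod (G' m z))\<^sup>2)) \<le> ennreal (c * K) * (\<integral>\<^sup>+om. ennreal ((cmod (h' m om))\<^sup>2 / J om) \<partial>M)"
   unfolding G'_def
  proof (rule plancherel_schur[where B = 1 and d = d])
   fix om assume "h' m om \<noteq> 0"
   then have "om \<in> B m" by (auto simp: h'_def indicator_def split: if_splits)
   then have "a / 2 ^ m < J om" by (simp add: B_def)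
   then show "J om > 0" using a by (intro less_trans[of 0 "a / 2 ^ m" "J om"]) auto
  qed (use M J h'1 c K gauss push in auto)
  also have "... \<le> ennreal (c * K) * ennreal (2 * N)" by (intro mult_left_mono h'L2) auto
  also have "... = ennreal (2 * c * K * N)" using c K N by (subst ennreal_mult[symmetric]) (auto simp: mult_ac)
  finally show ?thesis .
 qed
 \<comment> \<open>The L^s integral of piece m decays like 2^(-m (s - 2)). Half of that, ka^s = mu,
   pays for the weights in \<open>powr_suminf_le\<close>; the other half, \<open>mu\<close>, remains
   for the geometric series.\<close>
 define ka where "ka = 2 powr (-(s - 2) / (2 * s))"
 have ka: "0 < ka" "ka < 1" using s by (auto simp: ka_def powr_less_one divide_neg_pos)
 define mu where "mu = 2 powr (-(s - 2) / 2)"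
 have mu: "0 < mu" "mu < 1" using s by (auto simp: mu_def powr_less_one)
 define D where "D = 2 powr (s - 1) * c * K * (N powr (s - 1) * a powr (s - 2))"
 have D0: "D \<ge> 0" using c K by (simp add: D_def)
 have G'Ls: "(LEB z. ennreal ((cmod (G' m z) / ka ^ m) powr s)) \<le> ennreal (D * mu ^ m)" for m
 proof (cases "N = 0")
  case True
  then have "G' m z = 0" for z using G'sup[of m z] by simp
  then show ?thesis by simp
 next
  case False
  then have N: "N > 0" using N by simp
  define q where "q = (2 * N * a / 2 ^ m) powr (s - 2) / (ka ^ m) powr s"
  have q0: "q \<ge> 0" by (simp add: q_def)
  have "(LEB z. ennreal ((cmod (G' m z) / ka ^ m) powr s)) \<le> (LEB z. ennreal q * ennreal ((cmod (G' m z))\<^sup>2))"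
  proof (rule nn_integral_mono)
   fix z
   have "(cmod (G' m z) / ka ^ m) powr s = cmod (G' m z) powr (s - 2) * (cmod (G' m z))\<^sup>2 / (ka ^ m) powr s"
   proof (cases "G' m z = 0")
    case False
    then have "cmod (G' m z) powr s = cmod (G' m z) powr (s - 2) * (cmod (G' m z))\<^sup>2"
     using powr_add[of "cmod (G' m z)" "s - 2" 2] by (simp add: powr_numeral)
    then show ?thesis using ka by (simp add: powr_divide)
   qed (use s in simp)
   also have "... \<le> (2 * N * a / 2 ^ m) powr (s - 2) * (cmod (G' m z))\<^sup>2 / (ka ^ m) powr s"
    using s ka by (intro divide_right_mono mult_right_mono powr_mono2 G'sup) auto
   finally have "(cmod (G' m z) / ka ^ m) powr s \<le> q * (cmod (G' m z))\<^sup>2" by (simp add: q_def)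
   then show "ennreal ((cmod (G' m z) / ka ^ m) powr s) \<le> ennreal q * ennreal ((cmod (G' m z))\<^sup>2)"
    using q0 by (subst ennreal_mult[symmetric]) (auto intro!: ennreal_leI)
  qed
  also have "... = ennreal q * (LEB z. ennreal ((cmod (G' m z))\<^sup>2))" by (rule nn_integral_cmult) auto
  also have "... \<le> ennreal q * ennreal (2 * c * K * N)" by (intro mult_left_mono G'L2) auto
  also have "... = ennreal (q * (2 * c * K * N))" using q0 c K N by (subst ennreal_mult[symmetric]) auto
  also have "q * (2 * c * K * N) = D * mu ^ m"
  proof -
   have e1: "(2 * N * a / 2 ^ m) powr (s - 2) = 2 powr (s - 2) * N powr (s - 2) * a powr (s - 2) / (2 ^ m) powr (s - 2)"
    using N a by (simp add: powr_mult powr_divide)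
   have e2: "(2 ^ m) powr (s - 2) = (2::real) powr (real m * (s - 2))" by (simp add: powr_powr[symmetric] powr_realpow)
   have e3: "(ka ^ m) powr s = 2 powr (- (real m * (s - 2) / 2))"
   proof -
    have "ka ^ m = ka powr real m" using ka by (simp add: powr_realpow)
    then show ?thesis
     unfolding ka_def by (simp only: powr_powr, intro arg_cong[where f = "\<lambda>x. 2 powr x"]) (use s in \<open>simp add: field_simps\<close>)
   qed
   have e4: "mu ^ m = 2 powr (- (real m * (s - 2) / 2))"
   proof -
    have "mu ^ m = mu powr real m" using mu by (simp add: powr_realpow)
    then show ?thesis unfolding mu_def by (simp only: powr_powr, intro arg_cong[where f = "\<lambda>x. 2 powr x"]) (simp add: field_simps)
   qed
   have e5: "1 / (2::real) powr (real m * (s - 2)) / 2 powr (- (real m * (s - 2) / 2)) = 2 powr (- (real m * (s - 2) / 2))"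
   proof -
    define b where "b = real m * (s - 2) / 2"
    have "(2::real) powr (real m * (s - 2)) = 2 powr b * 2 powr b" by (simp add: powr_add[symmetric] b_def)
    then show ?thesis unfolding b_def[symmetric] by (simp add: powr_minus divide_inverse)
   qed
   have e6: "2 powr (s - 1) = 2 * 2 powr (s - 2)" "N powr (s - 1) = N * N powr (s - 2)"
    using N powr_add[of 2 1 "s - 2"] powr_add[of N 1 "s - 2"] by auto
   have "q * (2 * c * K * N) = D * (1 / (2::real) powr (real m * (s - 2)) / 2 powr (- (real m * (s - 2) / 2)))"
   proof -
    have "P * Q * A / X / Y * (2 * c * K * N) = 2 * P * c * K * (N * Q * A) * (1 / X / Y)" for P Q A X Y :: real
     by (simp add: divide_inverse mult_ac)
    then show ?thesis unfolding q_def D_def e1 e2 e3 e6 .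
   qed
   then show ?thesis unfolding e5 e4 .
  qed
  finally show ?thesis .
 qed
 have "(LEB z. ennreal (cmod (G z) powr s))
  \<le> (LEB z. ennreal ((1 / (1 - ka)) powr s) * (\<Sum>m. ennreal ((cmod (G' m z) / ka ^ m) powr s)))"
  using s ka by (intro nn_integral_mono powr_suminf_le Gle) auto
 also have "... = ennreal ((1 / (1 - ka)) powr s) * (\<Sum>m. LEB z. ennreal ((cmod (G' m z) / ka ^ m) powr s))"
  by (subst nn_integral_cmult, simp, subst nn_integral_suminf) auto
 also have "... \<le> ennreal ((1 / (1 - ka)) powr s) * (\<Sum>m. ennreal (D * mu ^ m))" by (intro mult_left_mono suminf_le G'Ls summableI) auto
 also have "(\<Sum>m. ennreal (D * mu ^ m)) = ennreal (\<Sum>m. D * mu ^ m)"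
  using D0 mu by (intro suminf_ennreal2) (auto intro!: summable_mult summable_geometric)
 also have "(\<Sum>m. D * mu ^ m) = D / (1 - mu)" using mu by (subst suminf_mult) (auto simp: suminf_geometric intro!: summable_geometric)
 also have "ennreal ((1 / (1 - ka)) powr s) * ennreal (D / (1 - mu)) = ennreal ((1 / (1 - ka)) powr s * (D / (1 - mu)))"
  using D0 mu by (subst ennreal_mult) auto
 finally show ?thesis unfolding G_def D_def ka_def mu_def by (simp add: mult_ac)
qed

section \<open>Line and plane bounds for bounded functions of small mass\<close>

text \<open>Normalised data, modelled on the indicator of a set of measure \<open>a\<close>. The
  limit \<open>2 * pi\<close>, the total length, allows a surplus positive power of \<open>a\<close>
  to be replaced by a constant.\<close>

definition circle_bound :: "(real \<times> real \<Rightarrow> complex) \<Rightarrow> real \<Rightarrow> bool" where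
 "circle_bound F a \<longleftrightarrow> F \<in> borel_measurable \<sigma> \<and> (\<forall>om. cmod (F om) \<le> 1) \<and>
  0 < a \<and> a \<le> 2 * pi \<and> (ARC om. ennreal (cmod (F om))) \<le> ennreal a"

lemma borel_measurable_extension_op [measurable]:
 assumes [measurable]: "F \<in> borel_measurable \<sigma>"
 shows "Ext F \<in> borel_measurable borel"
proof -
 interpret C: finite_measure \<sigma> by (rule finite_measure_circle)
 show ?thesis unfolding extension_op_def by measurable
qed

lemma borel_measurable_extension_op_Pair [measurable]:
 assumes [measurable]: "F \<in> borel_measurable \<sigma>"
 shows "(\<lambda>y. Ext F (x, y)) \<in> borel_measurable borel"
  "(\<lambda>x. Ext F (x, y)) \<in> borel_measurable borel" by (rule measurable_compose[OF _ borel_measurable_extension_op[OF assms]],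
   simp add: borel_prod[symmetric])+

lemma extension_op_slice_snd:
 "Ext F (x, y) = 1 / (2 * of_real pi) *
  (\<integral>om. exp (\<i> * of_real (y \<bullet> snd om)) * (exp (\<i> * of_real (x * fst om)) * F om) \<partial>\<sigma>)"
 unfolding extension_op_def by (simp add: inner_prod_def exp_add[symmetric] ring_distribs mult_ac add_ac flip: mult.assoc[of "exp _" "exp _"])

lemma extension_op_swap:
 assumes [measurable]: "F \<in> borel_measurable \<sigma>"
 shows "Ext (\<lambda>om. F (snd om, fst om)) z = Ext F (snd z, fst z)"
proof -
 have "(\<integral>om. exp (\<i> * of_real ((snd z, fst z) \<bullet> om)) * F om \<partial>distr \<sigma> \<sigma> (\<lambda>om. (snd om, fst om)))
   = (\<integral>om. exp (\<i> * of_real (z \<bullet> om)) * F (snd om, fst om) \<partial>\<sigma>)"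
  by (subst integral_distr) (auto simp: inner_prod_def add.commute)
 then show ?thesis unfolding extension_op_def distr_circle_swap by simp
qed

lemma circle_L1_swap:
 assumes "F \<in> borel_measurable \<sigma>"
 shows "(ARC om. ennreal (cmod (F (snd om, fst om)))) = (ARC om. ennreal (cmod (F om)))"
 using nn_integral_distr[OF measurable_circle_swap, of "\<lambda>om. ennreal (cmod (F om))"] assms by (simp add: distr_circle_swap)

lemma circle_bound_swap: "circle_bound F a \<Longrightarrow> circle_bound (\<lambda>om. F (snd om, fst om)) a"
 using measurable_compose[OF measurable_circle_swap] by (auto simp: circle_bound_def circle_L1_swap)

lemma norm_extension_le:
 "cmod (1 / (2 * of_real pi) * w) \<le> cmod w"
proof -
 have "cmod (1 / (2 * of_real pi) * w) = cmod w / (2 * pi)" by (simp add: norm_mult norm_divide)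
 also have "... \<le> cmod w" using pi_gt3 mult_left_mono[of 1 "2 * pi" "cmod w"] by (simp add: divide_le_eq)
 finally show ?thesis .
qed

lemma circle_small_fst:
 assumes F: "\<And>om. cmod (F om) \<le> 1" and ta: "ta > 0"
 shows "(ARC om. ennreal (cmod (F om)) * indicator {om. \<bar>fst om\<bar> \<le> ta} om) \<le> ennreal (20 * ta)"
proof -
 have "(ARC om. ennreal (cmod (F om)) * indicator {om. \<bar>fst om\<bar> \<le> ta} om)
  \<le> (ARC om. indicator {om. \<bar>cross (0, 1) om\<bar> \<le> ta} om)" using F by (intro nn_integral_mono) (auto simp: indicator_def cross_def)
 also have "... \<le> ennreal (20 * ta)" using ta by (intro emeasure_cross_small) (auto simp: norm_Pair)
 finally show ?thesis .
qed

lemma circle_push_gaussian: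
 fixes R p :: real
 assumes R: "R > 0"
 shows "(ARC om. ennreal (\<bar>fst om\<bar> * exp (- (R\<^sup>2 * (norm (snd om - p))\<^sup>2 / 2)))) \<le> ennreal (2 * sqrt (2 * pi) / R ^ 1)"
proof -
 let ?k = "\<lambda>x. ennreal (exp (- (R\<^sup>2 * (x - p)\<^sup>2 / 2)))"
 have e: "2 * (LEB x. ?k x) = ennreal (2 * sqrt (2 * pi) / R ^ 1)"
  using R by (subst gaussian_nn_integral) (auto simp: ennreal_mult' simp flip: times_divide_eq_right)
 have k: "?k \<in> borel_measurable borel" by measurable
 show ?thesis using circle_push_snd[OF k] unfolding e by (simp add: ennreal_mult')
qed

text \<open>On a vertical line the phase is carried by \<open>snd om\<close>, with Jacobian
  \<open>fst om\<close>; the rest of the exponential is a unimodular factor of the density, so the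
  bound is uniform in \<open>x\<close>. The power \<open>p - 2\<close> is that of a cap of width
  \<open>a\<close>: amplitude \<open>a\<close> over the length 1/a^2.\<close>

lemma extension_slice_bound:
 assumes p: "p > 2"
 obtains C where "C \<ge> 0"
  "\<And>F a x. circle_bound F a \<Longrightarrow>
   (LEB y. ennreal (cmod (Ext F (x, y)) powr p)) \<le> ennreal (C * a powr (p - 2))"
proof -
 define C0 where "C0 = (1 / (1 - 2 powr (-(p - 2) / (2 * p)))) powr p / (1 - 2 powr (-(p - 2) / 2)) *
  (2 powr (p - 1) * sqrt (2 * pi) * (2 * sqrt (2 * pi)))"
 define C where "C = C0 * 20 powr (p - 1)"
 have "2 powr (-(p - 2) / 2) < 1" using p by (auto simp: powr_less_one)
 then have C0: "C0 \<ge> 0" unfolding C0_def by (intro mult_nonneg_nonneg divide_nonneg_nonneg) auto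
 have fst_fixed: "(LEB y. ennreal (cmod (Ext F (x, y)) powr p)) \<le> ennreal (C * a powr (p - 2))" if cb: "circle_bound F a" for F a x
 proof -
  have [measurable]: "F \<in> borel_measurable \<sigma>" and F: "\<And>om. cmod (F om) \<le> 1"
   and a: "0 < a" "(ARC om. ennreal (cmod (F om))) \<le> ennreal a" using cb by (auto simp: circle_bound_def)
  let ?h = "\<lambda>om. exp (\<i> * of_real (x * fst om)) * F om"
  have hn: "cmod (?h om) = cmod (F om)" for om by (simp add: norm_mult)
  have "(LEB y. ennreal (cmod (\<integral>om. exp (\<i> * of_real (y \<bullet> snd om)) * ?h om \<partial>\<sigma>) powr p))
   \<le> ennreal (C0 * (20 powr (p - 1) * a powr (p - 2)))" unfolding C0_def
  proof (rule extension_Lp_bound[where d = 1 and J = "\<lambda>om. \<bar>fst om\<bar>" and N = 20])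
   show "(ARC om. ennreal (cmod (?h om)) * indicator {om. \<bar>fst om\<bar> \<le> ta} om) \<le> ennreal (20 * ta)"
    if "ta > 0" for ta unfolding hn using F that by (rule circle_small_fst)
   show "(ARC om. ennreal (cmod (?h om))) \<le> ennreal (20 * a)" unfolding hn using a by (auto intro!: order_trans[OF a(2)] ennreal_leI)
  qed (use p a F circle_push_gaussian gaussian_ft_real gaussian_integrable finite_measure_circle hn in auto)
  moreover have "(LEB y. ennreal (cmod (Ext F (x, y)) powr p))
   \<le> (LEB y. ennreal (cmod (\<integral>om. exp (\<i> * of_real (y \<bullet> snd om)) * ?h om \<partial>\<sigma>) powr p))"
   unfolding extension_op_slice_snd using p by (intro nn_integral_mono ennreal_leI powr_mono2 norm_extension_le) auto
  ultimately show ?thesis by (simp add: C_def mult.assoc)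
 qed
 show thesis
 proof (rule that[of C])
  show "C \<ge> 0" using C0 by (simp add: C_def)
 qed (rule fst_fixed)
qed

text \<open>The square of the extension is an integral over pairs, treated with the exponent s =
  p/2. Integrating one point over the set of small Jacobian leaves the mass \<open>a\<close> of the
  other, so \<open>N = 20 * a\<close> and the powers add up to (s - 1) + (s - 2) = p - 3. This is
  the Knapp value: amplitude \<open>a\<close> on a box of area 1/a^3.\<close>

lemma extension_global_bound:
 assumes p: "p > 4"
 obtains C where "C \<ge> 0"
  "\<And>F a. circle_bound F a \<Longrightarrow>
   (LEB z. ennreal (cmod (Ext F z) powr p)) \<le> ennreal (C * a powr (p - 3))"
proof -
 define s where "s = p / 2"
 have s: "s > 2" using p by (simp add: s_def)
 define C0 where "C0 = (1 / (1 - 2 powr (-(s - 2) / (2 * s)))) powr s / (1 - 2 powr (-(s - 2) / 2)) *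
  (2 powr (s - 1) * (2 * pi) * (128 * pi * sqrt pi))"
 define C where "C = C0 * 20 powr (s - 1)"
 have "2 powr (-(s - 2) / 2) < 1" using s by (auto simp: powr_less_one)
 then have C0: "C0 \<ge> 0" unfolding C0_def by (intro mult_nonneg_nonneg divide_nonneg_nonneg) auto
 show thesis
 proof (rule that[of C])
  show "C \<ge> 0" using C0 by (simp add: C_def)
 next
  fix F a assume "circle_bound F a"
  then have [measurable]: "F \<in> borel_measurable \<sigma>" and F: "\<And>om. cmod (F om) \<le> 1"
   and a: "0 < a" "(ARC om. ennreal (cmod (F om))) \<le> ennreal a" by (auto simp: circle_bound_def)
  interpret C: finite_measure \<sigma> by (rule finite_measure_circle)
  interpret CC: pair_sigma_finite \<sigma> \<sigma> ..
  interpret P: finite_measure "\<sigma> \<Otimes>\<^sub>M \<sigma>" by (intro finite_measure_pair_measure finite_measure_circle)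
  let ?P = "\<sigma> \<Otimes>\<^sub>M \<sigma>"
  let ?h = "\<lambda>p. F (fst p) * F (snd p)"
  let ?J = "\<lambda>p. \<bar>cross (fst p) (snd p)\<bar>"
  have cm[measurable]: "(\<lambda>p. cross (fst p) (snd p)) \<in> borel_measurable ?P" unfolding cross_def by measurable
  have hn: "cmod (?h p) = cmod (F (fst p)) * cmod (F (snd p))" for p by (simp add: norm_mult)
  have small: "(\<integral>\<^sup>+p. ennreal (cmod (?h p)) * indicator {p. ?J p \<le> ta} p \<partial>?P) \<le> ennreal (20 * a * ta)" if "ta > 0" for ta
  proof -
   have "(\<integral>\<^sup>+p. ennreal (cmod (?h p)) * indicator {p. ?J p \<le> ta} p \<partial>?P)
    = (\<integral>\<^sup>+p. ennreal (cmod (?h p)) * (if ?J p \<le> ta then 1 else 0) \<partial>?P)"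
    by (intro nn_integral_cong) (auto simp: indicator_def)
   also have "... = (ARC om. ARC om'. ennreal (cmod (?h (om, om'))) * (if ?J (om, om') \<le> ta then 1 else 0))"
    by (rule C.nn_integral_fst[symmetric]) measurable
   also have "... \<le> (ARC om. ennreal (cmod (F om)) * ennreal (20 * ta))"
   proof (rule nn_integral_mono)
    fix om assume w: "om \<in> space \<sigma>"
    have m: "{om'. \<bar>cross om om'\<bar> \<le> ta} \<in> sets borel" by measurable
    have "(ARC om'. ennreal (cmod (?h (om, om'))) * (if ?J (om, om') \<le> ta then 1 else 0))
     \<le> (ARC om'. ennreal (cmod (F om)) * indicator {om'. \<bar>cross om om'\<bar> \<le> ta} om')"
     using F by (intro nn_integral_mono) (auto simp: indicator_def norm_mult mult_left_le intro!: ennreal_leI)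
    also have "... = ennreal (cmod (F om)) * (ARC om'. indicator {om'. \<bar>cross om om'\<bar> \<le> ta} om')"
     using m by (intro nn_integral_cmult) auto
    also have "... \<le> ennreal (cmod (F om)) * ennreal (20 * ta)" using w that by (intro mult_left_mono emeasure_cross_small) auto
    finally show "(ARC om'. ennreal (cmod (?h (om, om'))) * (if ?J (om, om') \<le> ta then 1 else 0))
     \<le> ennreal (cmod (F om)) * ennreal (20 * ta)" .
   qed
   also have "... = (ARC om. ennreal (cmod (F om))) * ennreal (20 * ta)" by (rule nn_integral_multc) auto
   also have "... \<le> ennreal a * ennreal (20 * ta)" by (intro mult_right_mono a) auto
   also have "... = ennreal (20 * a * ta)" using a that by (subst ennreal_mult[symmetric]) (auto simp: mult_ac)
   finally show ?thesis .
  qed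
  have tot: "(\<integral>\<^sup>+p. ennreal (cmod (?h p)) \<partial>?P) \<le> ennreal (20 * a * a)"
  proof -
   have "(\<integral>\<^sup>+p. ennreal (cmod (?h p)) \<partial>?P) = (ARC om. ARC om'. ennreal (cmod (?h (om, om'))))"
    by (rule C.nn_integral_fst[symmetric]) measurable
   also have "... = (ARC om. ennreal (cmod (F om))) * (ARC om. ennreal (cmod (F om)))"
    by (simp add: norm_mult ennreal_mult nn_integral_cmult nn_integral_multc)
   also have "... \<le> ennreal a * ennreal a" by (intro mult_mono a) auto
   also have "... = ennreal (a * a)" using a by (subst ennreal_mult) auto
   also have "... \<le> ennreal (20 * a * a)" using a by (intro ennreal_leI) auto
   finally show ?thesis .
  qed
  have push: "(\<integral>\<^sup>+p. ennreal (?J p * exp (- (R\<^sup>2 * (norm ((fst p + snd p) - v))\<^sup>2 / 2))) \<partial>?P) \<le> ennreal (128 * pi * sqrt pi / R ^ 2)"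
   if R: "R > 0" for R v
  proof -
   have "(\<integral>\<^sup>+p. ennreal (?J p * exp (- (R\<^sup>2 * (norm ((fst p + snd p) - v))\<^sup>2 / 2))) \<partial>?P)
    = (ARC om. ARC om'. ennreal (?J (om, om') * exp (- (R\<^sup>2 * (norm ((fst (om, om') + snd (om, om')) - v))\<^sup>2 / 2))))"
    by (rule C.nn_integral_fst[symmetric]) measurable
   also have "... \<le> ennreal (128 * pi * sqrt pi / R ^ 2)" using circle_circle_push[OF R, of v] by simp
   finally show ?thesis .
  qed
  have "(LEB z. ennreal (cmod (\<integral>p. exp (\<i> * of_real (z \<bullet> (fst p + snd p))) * ?h p \<partial>?P) powr s))
   \<le> ennreal (C0 * ((20 * a) powr (s - 1) * a powr (s - 2)))" unfolding C0_def
  proof (rule extension_Lp_bound[where d = 2 and J = ?J and N = "20 * a"])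
   show "cmod (?h p) \<le> 1" for p unfolding hn using mult_mono[OF F F, of "fst p" "snd p"] by (simp add: mult.commute)
  qed (use s a small tot push gaussian_ft_prod P.finite_measure_axioms in auto)
  also have "C0 * ((20 * a) powr (s - 1) * a powr (s - 2)) = C * a powr (p - 3)"
  proof -
   have "p - 3 = (s - 1) + (s - 2)" by (simp add: s_def)
   then have "a powr (p - 3) = a powr (s - 1) * a powr (s - 2)" by (simp only: powr_add)
   then show ?thesis using a by (simp add: C_def powr_mult)
  qed
  finally have "(LEB z. ennreal (cmod (\<integral>p. exp (\<i> * of_real (z \<bullet> (fst p + snd p))) * ?h p \<partial>?P) powr s))
   \<le> ennreal (C * a powr (p - 3))" .
  moreover have "(LEB z. ennreal (cmod (Ext F z) powr p))
   \<le> (LEB z. ennreal (cmod (\<integral>p. exp (\<i> * of_real (z \<bullet> (fst p + snd p))) * ?h p \<partial>?P) powr s))"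
  proof (intro nn_integral_mono ennreal_leI)
   fix z :: "real \<times> real"
   let ?u = "\<lambda>om. exp (\<i> * of_real (z \<bullet> om)) * F om"
   have i: "integrable \<sigma> ?u" by (rule C.integrable_const_bound[where B = 1]) (auto simp: norm_mult F)
   have hb: "cmod (?h p) \<le> 1" for p unfolding hn using mult_mono[OF F F, of "fst p" "snd p"] by (simp add: mult.commute)
   have i2: "integrable ?P (\<lambda>p. exp (\<i> * of_real (z \<bullet> (fst p + snd p))) * ?h p)"
    by (rule P.integrable_const_bound[where B = 1]) (use hb in \<open>auto simp: norm_mult\<close>)
   have "(\<integral>p. exp (\<i> * of_real (z \<bullet> (fst p + snd p))) * ?h p \<partial>?P) = (\<integral>om. \<integral>om'. ?u om * ?u om' \<partial>\<sigma> \<partial>\<sigma>)"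
    by (subst CC.integral_fst'[OF i2, symmetric]) (simp add: inner_add_right exp_add ring_distribs mult_ac)
   also have "... = (\<integral>om. ?u om \<partial>\<sigma>) * (\<integral>om. ?u om \<partial>\<sigma>)" by simp
   finally have e: "cmod (\<integral>p. exp (\<i> * of_real (z \<bullet> (fst p + snd p))) * ?h p \<partial>?P) = (cmod (\<integral>om. ?u om \<partial>\<sigma>))\<^sup>2"
    by (simp add: norm_mult power2_eq_square)
   have "cmod (Ext F z) powr p \<le> cmod (\<integral>om. ?u om \<partial>\<sigma>) powr p"
    unfolding extension_op_def using p by (intro powr_mono2 norm_extension_le) auto
   also have "... = ((cmod (\<integral>om. ?u om \<partial>\<sigma>))\<^sup>2) powr s"
    by (subst powr_numeral[symmetric]) (simp_all only: powr_powr s_def norm_ge_zero, simp)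
   finally show "cmod (Ext F z) powr p \<le> cmod (\<integral>p. exp (\<i> * of_real (z \<bullet> (fst p + snd p))) * ?h p \<partial>?P) powr s"
    unfolding e .
  qed
  ultimately show "(LEB z. ennreal (cmod (Ext F z) powr p)) \<le> ennreal (C * a powr (p - 3))" by (rule order_trans[rotated])
 qed
qed

section \<open>Weighted estimates\<close>

lemma nn_integral_powr_0_1:
 fixes e :: real
 assumes e: "e > -1"
 shows "(LEB x. ennreal (x powr e) * indicator {0..1} x) = ennreal (1 / (e + 1))"
proof -
 have "((\<lambda>x. if x \<in> {0..1} then x powr e else 0) has_integral (1 powr (e + 1) / (e + 1))) UNIV"
  using has_integral_powr_from_0[OF e, of 1] by (subst has_integral_restrict_UNIV) auto
 then have "integral\<^sup>N lborel (\<lambda>x. ennreal (if x \<in> {0..1} then x powr e else 0)) = ennreal (1 powr (e + 1) / (e + 1))"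
  by (intro nn_integral_has_integral_lborel) auto
 moreover have "(\<lambda>x. ennreal (if x \<in> {0..1} then x powr e else 0)) = (\<lambda>x. ennreal (x powr e) * indicator {0..1} x)"
  by (auto simp: indicator_def)
 ultimately show ?thesis by simp
qed

lemma nn_integral_powr_to_inf:
 fixes e t :: real
 assumes e: "e > 1" and t: "t > 0"
 shows "(LEB x. ennreal (x powr (- e)) * indicator {t..} x) = ennreal (t powr (1 - e) / (e - 1))"
proof -
 have "((\<lambda>x. if x \<in> {t..} then x powr (- e) else 0) has_integral (- (t powr (- e + 1)) / (- e + 1))) UNIV"
  using has_integral_powr_to_inf[of "- e" t] e t by (subst has_integral_restrict_UNIV) auto
 then have "integral\<^sup>N lborel (\<lambda>x. ennreal (if x \<in> {t..} then x powr (- e) else 0)) = ennreal (- (t powr (- e + 1)) / (- e + 1))"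
  by (intro nn_integral_has_integral_lborel) auto
 moreover have "(\<lambda>x. ennreal (if x \<in> {t..} then x powr (- e) else 0)) = (\<lambda>x. ennreal (x powr (- e)) * indicator {t..} x)"
  by (auto simp: indicator_def)
 moreover have "- (t powr (- e + 1)) / (- e + 1) = t powr (1 - e) / (e - 1)" using e by (simp add: field_simps)
 ultimately show ?thesis by simp
qed

lemma nn_integral_even_le:
 fixes g :: "real \<Rightarrow> ennreal"
 assumes [measurable]: "g \<in> borel_measurable borel"
 shows "(LEB x. g \<bar>x\<bar>) \<le> 2 * (LEB x. g x * indicator {0..} x)"
proof -
 have "(LEB x. g \<bar>x\<bar>) \<le> (LEB x. g x * indicator {0..} x + g (- x) * indicator {0..} (- x))"
  by (intro nn_integral_mono) (auto simp: indicator_def abs_if)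
 also have "... = (LEB x. g x * indicator {0..} x) + (LEB x. g (- x) * indicator {0..} (- x))" by (rule nn_integral_add) auto
 also have "(LEB x. g (- x) * indicator {0..} (- x)) = (LEB x. g x * indicator {0..} x)"
  using nn_integral_real_affine[of "\<lambda>x. g x * indicator {0..} x" "-1" 0] by simp
 finally show ?thesis by (simp only: mult_2[of "(LEB x. g x * indicator {0..} x)"])
qed

lemma nn_integral_abs_powr_small:
 fixes ga :: real
 assumes "ga < 1"
 shows "(LEB x. ennreal (\<bar>x\<bar> powr (- ga)) * indicator {x. \<bar>x\<bar> \<le> 1} x) \<le> ennreal (2 / (1 - ga))"
proof -
 have "(LEB x. ennreal (\<bar>x\<bar> powr (- ga)) * indicator {x. \<bar>x\<bar> \<le> 1} x)
  = (LEB x. (\<lambda>x. ennreal (x powr (- ga)) * indicator {..1} x) \<bar>x\<bar>)" by (intro nn_integral_cong) (auto simp: indicator_def)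
 also have "... \<le> 2 * (LEB x. ennreal (x powr (- ga)) * indicator {..1} x * indicator {0..} x)" by (rule nn_integral_even_le) auto
 also have "(LEB x. ennreal (x powr (- ga)) * indicator {..1} x * indicator {0..} x)
  = (LEB x. ennreal (x powr (- ga)) * indicator {0..1} x)" by (intro nn_integral_cong) (auto simp: indicator_def)
 also have "... = ennreal (1 / (1 - ga))" using assms by (subst nn_integral_powr_0_1) auto
 also have "2 * ennreal (1 / (1 - ga)) = ennreal (2 / (1 - ga))" using assms ennreal_mult'[of 2 "1 / (1 - ga)"] by simp
 finally show ?thesis .
qed

lemma nn_integral_abs_powr_large:
 fixes mu t :: real
 assumes mu: "mu > 1" and t: "t > 0"
 shows "(LEB x. ennreal (\<bar>x\<bar> powr (- mu)) * indicator {x. t \<le> \<bar>x\<bar>} x) \<le> ennreal (2 / (mu - 1) * t powr (1 - mu))"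
proof -
 have "(LEB x. ennreal (\<bar>x\<bar> powr (- mu)) * indicator {x. t \<le> \<bar>x\<bar>} x)
  = (LEB x. (\<lambda>x. ennreal (x powr (- mu)) * indicator {t..} x) \<bar>x\<bar>)" by (intro nn_integral_cong) (auto simp: indicator_def)
 also have "... \<le> 2 * (LEB x. ennreal (x powr (- mu)) * indicator {t..} x * indicator {0..} x)" by (rule nn_integral_even_le) auto
 also have "(LEB x. ennreal (x powr (- mu)) * indicator {t..} x * indicator {0..} x)
  = (LEB x. ennreal (x powr (- mu)) * indicator {t..} x)" using t by (intro nn_integral_cong) (auto simp: indicator_def)
 also have "... = ennreal (t powr (1 - mu) / (mu - 1))" by (rule nn_integral_powr_to_inf[OF mu t])
 also have "2 * ennreal (t powr (1 - mu) / (mu - 1)) = ennreal (2 / (mu - 1) * t powr (1 - mu))"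
  using mu ennreal_mult'[of 2 "t powr (1 - mu) / (mu - 1)"] by simp
 finally show ?thesis .
qed

text \<open>Hoelder's inequality in pointwise form. The two terms balance at t = Y^(-1/p): below
  this height the first dominates, above it the second.\<close>

lemma powr_split_le:
 fixes q p Y t :: real
 assumes "0 < q" "q \<le> p" "Y > 0" "t \<ge> 0"
 shows "t powr q \<le> Y powr (- (q / p)) + Y powr (1 - q / p) * t powr p"
proof (cases "t \<le> Y powr (- (1 / p))")
 case True
 then have "t powr q \<le> (Y powr (- (1 / p))) powr q" using assms by (intro powr_mono2) auto
 also have "... = Y powr (- (q / p))" by (simp add: powr_powr)
 finally show ?thesis using assms by (simp add: add_increasing2)
next
 case False
 then have t: "t > 0" using assms powr_ge_zero[of Y "- (1 / p)"] by linarith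
 have "t powr (q - p) \<le> (Y powr (- (1 / p))) powr (q - p)" using assms False by (intro powr_mono2') auto
 also have "... = Y powr (1 - q / p)"
  unfolding powr_powr by (rule arg_cong[where f = "\<lambda>e. Y powr e"]) (use assms in \<open>simp add: field_simps\<close>)
 finally have "t powr (q - p) * t powr p \<le> Y powr (1 - q / p) * t powr p" by (rule mult_right_mono) simp
 then have "t powr q \<le> Y powr (1 - q / p) * t powr p" by (simp add: powr_add[symmetric])
 then show ?thesis by (simp add: add_increasing)
qed

text \<open>Interpolation of the power \<open>q\<close> between \<open>p\<close> and
  \<open>s\<close>, again pointwise: the comparison of t^(s - q) with X^(-ka) decides which term is
  used.\<close>

lemma powr_interpolate_le:
 fixes q p s ka X t :: real
 assumes "0 < p" "p \<le> q" "q < s" "ka \<ge> 0" "X \<ge> 1" "0 \<le> t" "t \<le> 1"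
 shows "X powr (- ka) * t powr q \<le> t powr s + X powr (- (ka * (s - p) / (s - q))) * t powr p"
proof (cases "t = 0")
 case False
 then have t: "t > 0" using assms by simp
 show ?thesis
 proof (cases "X powr (- ka) \<le> t powr (s - q)")
  case True
  then have "X powr (- ka) * t powr q \<le> t powr (s - q) * t powr q" by (rule mult_right_mono) simp
  also have "... = t powr s" by (simp add: powr_add[symmetric])
  finally show ?thesis by (simp add: add_increasing2)
 next
  case F: False
  then have "(t powr (s - q)) powr ((q - p) / (s - q)) \<le> (X powr (- ka)) powr ((q - p) / (s - q))" using assms by (intro powr_mono2) auto
  then have "t powr (q - p) \<le> X powr (- ka * ((q - p) / (s - q)))" using assms by (simp add: powr_powr)
  then have "X powr (- ka) * (t powr (q - p) * t powr p) \<le> X powr (- ka) * (X powr (- ka * ((q - p) / (s - q))) * t powr p)"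
   by (intro mult_left_mono mult_right_mono) auto
  also have "... = X powr (- ka + - ka * ((q - p) / (s - q))) * t powr p" by (simp only: powr_add mult.assoc)
  also have "- ka + - ka * ((q - p) / (s - q)) = - (ka * (s - p) / (s - q))" using assms by (simp add: field_simps)
  also have "t powr (q - p) * t powr p = t powr q" by (simp add: powr_add[symmetric])
  finally show ?thesis by (simp add: add_increasing)
 qed
qed (use assms in simp)

lemma powr_mono_base_neg:
 fixes x y e :: real
 assumes "0 < x" "x \<le> y" "e \<ge> 0"
 shows "y powr (- e) \<le> x powr (- e)" using assms by (intro powr_mono2') auto

lemma powr_le_one_neg:
 fixes x e :: real
 assumes "1 \<le> x" "e \<ge> 0"
 shows "x powr (- e) \<le> 1" using powr_mono_base_neg[of 1 x e] assms by simp

text \<open>The right side can be integrated along a line, the weight because \<open>mu > 1\<close>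
  and the power of the extension because \<open>p > 2\<close>. For q \<le> 2 the exponent
  \<open>p\<close> is taken close enough to 2 that \<open>mu = de + q / p\<close> inherits its lower
  bound from de > 1 - q/2.\<close>

lemma slice_exponents:
 fixes q de :: real
 assumes q: "q > 0" and de: "0 \<le> de" "de < 1" and c: "de > 1 - q / 2"
 obtains p mu where "p > 2" "mu > 1"
  "\<And>Y t. 1 \<le> Y \<Longrightarrow> 0 \<le> t \<Longrightarrow> t \<le> 1 \<Longrightarrow> Y powr (- de) * t powr q \<le> Y powr (- mu) + t powr p"
proof (cases "q > 2")
 case True
 show thesis
 proof (rule that[of q 2])
  fix Y t :: real assume "1 \<le> Y" "0 \<le> t" "t \<le> 1"
  then have "Y powr (- de) * t powr q \<le> 1 * t powr q" using de by (intro mult_right_mono powr_le_one_neg) auto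
  then show "Y powr (- de) * t powr q \<le> Y powr (- 2) + t powr q" using powr_ge_zero[of Y "-2"] by linarith
 qed (use True in auto)
next
 case False
 define e where "e = min ((de + q / 2 - 1) / 2) (q / 4)"
 have e: "e > 0" "e \<le> (de + q / 2 - 1) / 2" "e \<le> q / 4" using c q unfolding e_def by (auto simp: min_def)
 define p where "p = q / (q / 2 - e)"
 have d: "q / 2 - e > 0" using e q by simp
 have p2: "p > 2" using d e q by (simp add: p_def field_simps)
 have qp: "q / p = q / 2 - e" using q d by (simp add: p_def)
 show thesis
 proof (rule that[of p "de + q / p"])
  show "de + q / p > 1" unfolding qp using e c by (simp add: field_simps)
  fix Y t :: real assume Y: "1 \<le> Y" "0 \<le> t" "t \<le> 1"
  have "Y powr (- de) * t powr q \<le> Y powr (- de) * (Y powr (- (q / p)) + Y powr (1 - q / p) * t powr p)"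
   using Y q p2 False by (intro mult_left_mono powr_split_le) auto
  also have "... = Y powr (- (de + q / p)) + Y powr (1 - q / p - de) * t powr p"
   by (simp add: ring_distribs powr_add[symmetric] mult.assoc[symmetric])
  also have "Y powr (1 - q / p - de) \<le> 1" using powr_le_one_neg[of Y "- (1 - q / p - de)"] Y e c unfolding qp by (simp add: field_simps)
  finally show "Y powr (- de) * t powr q \<le> Y powr (- (de + q / p)) + t powr p" by (simp add: mult_right_mono)
 qed (use p2 in auto)
qed

text \<open>\<open>X\<close> and \<open>Y\<close> stand for rescaled coordinates and
  \<open>t\<close> for the normalised extension. The three clauses serve the strip X \<le> 1, the
  region 1 \<le> X \<le> Y and the region Y \<le> X. All terms on the right can be integrated: t^s
  in the plane as s > 4, t^p on lines as p > 2, t^2 on boxes, and the pure weights by the conditions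
  on \<open>mu\<close> and \<open>nu\<close>; \<open>ka > 1\<close> gives convergence in the
  variable that is then left over.\<close>

definition plane_data where
 "plane_data ga de q p s mu nu ka \<longleftrightarrow> p > 2 \<and> s > 4 \<and> mu > 1 \<and> nu > 1 \<and> ka > 1 \<and> ga + mu > 2 \<and> de + nu > 2 \<and>
  (\<forall>Y t::real. 1 \<le> Y \<longrightarrow> 0 \<le> t \<longrightarrow> t \<le> 1 \<longrightarrow> Y powr (- de) * t powr q \<le> Y powr (- mu) + t powr p) \<and>
  (\<forall>X Y t. 1 \<le> X \<longrightarrow> X \<le> Y \<longrightarrow> 0 \<le> t \<longrightarrow> t \<le> 1 \<longrightarrow>
   X powr (- ga) * Y powr (- de) * t powr q \<le> t powr s + X powr (- ka) * t powr p + X powr (- ga) * Y powr (- mu)) \<and>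
  (\<forall>X Y t. 1 \<le> X \<longrightarrow> 0 < Y \<longrightarrow> Y \<le> X \<longrightarrow> 0 \<le> t \<longrightarrow> t \<le> 1 \<longrightarrow>
   X powr (- ga) * Y powr (- de) * t powr q \<le> t powr s +
    (if Y \<le> 1 then Y powr (- de) else Y powr (- ka)) * t\<^sup>2 + Y powr (- de) * X powr (- nu))"

lemma plane_exponents:
 fixes q ga de :: real
 assumes q: "q > 0" and ga: "0 \<le> ga" "ga < 1" and de: "0 \<le> de" "de < 1" and c: "ga + de > 2 - q / 2"
 obtains p s mu nu ka where "plane_data ga de q p s mu nu ka"
proof (cases "q > 2")
 case True
 define K where "K = ga + de"
 have K0: "K \<ge> 0" using ga de by (simp add: K_def)
 obtain p s ka where e: "p > 2" "p \<le> q" "s > 4" "ka > 1"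
  and I: "\<And>X t. 1 \<le> X \<Longrightarrow> 0 \<le> t \<Longrightarrow> t \<le> 1 \<Longrightarrow> X powr (- K) * t powr q \<le> t powr s + X powr (- ka) * t powr p"
 proof (cases "q > 4")
  case q4: True
  show thesis
  proof (rule that[of q q 2])
   fix X t :: real assume "1 \<le> X" "0 \<le> t" "t \<le> 1"
   then have "X powr (- K) * t powr q \<le> 1 * t powr q" using K0 by (intro mult_right_mono powr_le_one_neg) auto
   then show "X powr (- K) * t powr q \<le> t powr q + X powr (- 2) * t powr q" by (simp add: add_increasing2)
  qed (use q4 in auto)
 next
  case q4: False
  \<comment> \<open>With K = ga + de the interpolated weight exponent is 2K/(4 + e - q). It exceeds
    1 exactly when e < 2K - 4 + q, which the hypothesis makes positive.\<close>
  define e where "e = min ((2 * K - 4 + q) / 2) (q - 2)"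
  have "e > 0" "e \<le> (2 * K - 4 + q) / 2" and e3: "e \<le> q - 2" using True c unfolding e_def K_def by (auto simp: min_def)
  then have e: "e > 0" "2 * e \<le> 2 * K - 4 + q" "e \<le> q - 2" by auto
  show thesis
  proof (rule that[of "2 + e" "4 + e" "K * (4 + e - (2 + e)) / (4 + e - q)"])
   have "4 + e - q > 0" using q4 e by simp
   then show "K * (4 + e - (2 + e)) / (4 + e - q) > 1" using e by (simp add: field_simps)
   fix X t :: real assume "1 \<le> X" "0 \<le> t" "t \<le> 1"
   then show "X powr (- K) * t powr q \<le> t powr (4 + e) + X powr (- (K * (4 + e - (2 + e)) / (4 + e - q))) * t powr (2 + e)"
    using e q4 K0 by (intro powr_interpolate_le) auto
  qed (use e in auto)
 qed
 show thesis
 proof (rule that[of p s 3 3 ka], unfold plane_data_def, intro conjI allI impI)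
  fix Y t :: real assume A: "1 \<le> Y" "0 \<le> t" "t \<le> 1"
  then have "Y powr (- de) * t powr q \<le> 1 * t powr q" using de by (intro mult_right_mono powr_le_one_neg) auto
  also have "1 * t powr q \<le> t powr p" using A e by (cases "t = 0") (auto intro!: powr_mono')
  finally show "Y powr (- de) * t powr q \<le> Y powr (- 3) + t powr p" using powr_ge_zero[of Y "-3"] by linarith
 next
  fix X Y t :: real assume A: "1 \<le> X" "X \<le> Y" "0 \<le> t" "t \<le> 1"
  have "X powr (- ga) * Y powr (- de) * t powr q \<le> X powr (- ga) * X powr (- de) * t powr q"
   using A de by (intro mult_right_mono mult_left_mono powr_mono_base_neg) auto
  also have "X powr (- ga) * X powr (- de) = X powr (- K)" by (simp add: K_def powr_add[symmetric])
  also have "X powr (- K) * t powr q \<le> t powr s + X powr (- ka) * t powr p" using A by (intro I) auto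
  finally show "X powr (- ga) * Y powr (- de) * t powr q \<le> t powr s + X powr (- ka) * t powr p + X powr (- ga) * Y powr (- 3)"
   by (simp add: add_increasing2)
 next
  fix X Y t :: real assume A: "1 \<le> X" "0 < Y" "Y \<le> X" "0 \<le> t" "t \<le> 1"
  have t2: "t powr p \<le> t\<^sup>2" "t powr q \<le> t\<^sup>2"
  proof -
   show "t powr p \<le> t\<^sup>2"  using powr_mono'[of 2 p t] A e True by (cases "t = 0") (auto simp: powr_numeral)
   show "t powr q \<le> t\<^sup>2"  using powr_mono'[of 2 q t] A e True by (cases "t = 0") (auto simp: powr_numeral)
  qed
  have "X powr (- ga) * Y powr (- de) * t powr q \<le> t powr s + (if Y \<le> 1 then Y powr (- de) else Y powr (- ka)) * t\<^sup>2"
  proof (cases "Y \<le> 1")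
   case True
   have "X powr (- ga) * Y powr (- de) * t powr q \<le> 1 * Y powr (- de) * t\<^sup>2" using A ga t2 by (intro mult_mono powr_le_one_neg) auto
   then show ?thesis using True by (simp add: add_increasing)
  next
   case False
   have "X powr (- ga) * Y powr (- de) * t powr q \<le> Y powr (- ga) * Y powr (- de) * t powr q"
    using A ga by (intro mult_right_mono powr_mono_base_neg) auto
   also have "Y powr (- ga) * Y powr (- de) = Y powr (- K)" by (simp add: K_def powr_add[symmetric])
   also have "Y powr (- K) * t powr q \<le> t powr s + Y powr (- ka) * t powr p" using A False by (intro I) auto
   also have "... \<le> t powr s + Y powr (- ka) * t\<^sup>2" using t2 by (intro add_left_mono mult_left_mono) auto
   finally show ?thesis using False by simp
  qed
  then show "X powr (- ga) * Y powr (- de) * t powr q \<le> t powr s +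
    (if Y \<le> 1 then Y powr (- de) else Y powr (- ka)) * t\<^sup>2 + Y powr (- de) * X powr (- 3)" by (simp add: add_increasing2)
 qed (use e ga de in auto)
next
 case False
 \<comment> \<open>For q \<le> 2 the splitting inequality is applied in the larger variable: against
   t^p when this is \<open>Y\<close> and against t^2 when it is \<open>X\<close>. The weights left
   over have exponents \<open>mu\<close> and \<open>nu\<close>, and \<open>e\<close> is small enough
   to keep \<open>ga + mu\<close> above 2.\<close>
 define e where "e = min ((ga + de + q / 2 - 2) / 2) (q / 4)"
 have "e > 0" "e \<le> (ga + de + q / 2 - 2) / 2" and e3: "e \<le> q / 4" using c q unfolding e_def by (auto simp: min_def)
 then have e: "e > 0" "2 * e \<le> ga + de + q / 2 - 2" "e \<le> q / 4" by auto
 define p where "p = q / (q / 2 - e)"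
 have d: "q / 2 - e > 0" using e q by simp
 have p2: "p > 2" using d e q by (simp add: p_def field_simps)
 have qp: "q / p = q / 2 - e" using q d by (simp add: p_def)
 define mu where "mu = de + q / p"
 define nu where "nu = ga + q / 2"
 define ka where "ka = ga + mu - 1"
 have mu: "mu > 1" "ga + mu > 2" using e ga by (auto simp: mu_def qp)
 have nu: "nu > 1" "de + nu > 2" using c de by (auto simp: nu_def)
 have Ysplit: "Y powr (- de) * t powr q \<le> Y powr (- mu) + Y powr (1 - mu) * t powr p" if "1 \<le> Y" "0 \<le> t" "t \<le> 1" for Y t
 proof -
  have "Y powr (- de) * t powr q \<le> Y powr (- de) * (Y powr (- (q / p)) + Y powr (1 - q / p) * t powr p)"
   using that q p2 False by (intro mult_left_mono powr_split_le) auto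
  also have "... = Y powr (- de + - (q / p)) + Y powr (- de + (1 - q / p)) * t powr p" by (simp only: ring_distribs powr_add mult.assoc)
  finally show ?thesis by (simp add: mu_def algebra_simps)
 qed
 show thesis
 proof (rule that[of p 5 mu nu ka], unfold plane_data_def, intro conjI allI impI)
  fix Y t :: real assume Y: "1 \<le> Y" "0 \<le> t" "t \<le> 1"
  have "Y powr (1 - mu) \<le> 1" using powr_le_one_neg[of Y "mu - 1"] Y mu by simp
  then have "Y powr (1 - mu) * t powr p \<le> 1 * t powr p" by (intro mult_right_mono) auto
  then show "Y powr (- de) * t powr q \<le> Y powr (- mu) + t powr p" using Ysplit[OF Y] by linarith
 next
  fix X Y t :: real assume A: "1 \<le> X" "X \<le> Y" "0 \<le> t" "t \<le> 1"
  have "X powr (- ga) * (Y powr (- de) * t powr q) \<le> X powr (- ga) * (Y powr (- mu) + Y powr (1 - mu) * t powr p)"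
   using A by (intro mult_left_mono Ysplit) auto
  also have "... \<le> X powr (- ga) * (Y powr (- mu) + X powr (1 - mu) * t powr p)" using powr_mono_base_neg[of X Y "mu - 1"] A mu
   by (intro mult_left_mono add_left_mono mult_right_mono) auto
  also have "... = X powr (- ga) * Y powr (- mu) + X powr (- ga + (1 - mu)) * t powr p" by (simp only: ring_distribs powr_add mult.assoc)
  also have "- ga + (1 - mu) = - ka" by (simp add: ka_def)
  finally show "X powr (- ga) * Y powr (- de) * t powr q \<le> t powr 5 + X powr (- ka) * t powr p + X powr (- ga) * Y powr (- mu)"
   unfolding mult.assoc using powr_ge_zero[of t 5] by linarith
 next
  fix X Y t :: real assume A: "1 \<le> X" "0 < Y" "Y \<le> X" "0 \<le> t" "t \<le> 1"
  have "X powr (- ga) * t powr q \<le> X powr (- ga) * (X powr (- (q / 2)) + X powr (1 - q / 2) * t powr 2)"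
   using A q False by (intro mult_left_mono powr_split_le) auto
  also have "... = X powr (- ga + - (q / 2)) + X powr (- ga + (1 - q / 2)) * t powr 2" by (simp only: ring_distribs powr_add mult.assoc)
  finally have X: "X powr (- ga) * t powr q \<le> X powr (- nu) + X powr (1 - nu) * t\<^sup>2"
   using A by (simp add: nu_def algebra_simps powr_numeral)
  have Z: "Y powr (- de) * X powr (1 - nu) \<le> (if Y \<le> 1 then Y powr (- de) else Y powr (- ka))"
  proof (cases "Y \<le> 1")
   case True
   have "X powr (1 - nu) \<le> 1" using powr_le_one_neg[of X "nu - 1"] A nu by simp
   then show ?thesis using True by (simp add: mult_left_le)
  next
   case False
   have "Y powr (- de) * X powr (1 - nu) \<le> Y powr (- de) * Y powr (1 - nu)"
    using powr_mono_base_neg[of Y X "nu - 1"] A nu by (intro mult_left_mono) auto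
   also have "... = Y powr (- (de + nu - 1))" by (simp add: powr_add[symmetric] algebra_simps)
   also have "... \<le> Y powr (- ka)" using False e by (intro powr_mono) (auto simp: ka_def mu_def nu_def qp)
   finally show ?thesis using False by simp
  qed
  have "X powr (- ga) * Y powr (- de) * t powr q = Y powr (- de) * (X powr (- ga) * t powr q)" by simp
  also have "... \<le> Y powr (- de) * (X powr (- nu) + X powr (1 - nu) * t\<^sup>2)" using X by (intro mult_left_mono) auto
  also have "... = Y powr (- de) * X powr (- nu) + (Y powr (- de) * X powr (1 - nu)) * t\<^sup>2" by (simp add: algebra_simps)
  also have "... \<le> Y powr (- de) * X powr (- nu) + (if Y \<le> 1 then Y powr (- de) else Y powr (- ka)) * t\<^sup>2"
   by (intro add_left_mono mult_right_mono Z) auto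
  finally show "X powr (- ga) * Y powr (- de) * t powr q \<le> t powr 5 +
    (if Y \<le> 1 then Y powr (- de) else Y powr (- ka)) * t\<^sup>2 + Y powr (- de) * X powr (- nu)" using powr_ge_zero[of t 5] by linarith
 qed (use p2 mu nu in \<open>auto simp: ka_def\<close>)
qed

section \<open>Weighted integration in rescaled coordinates\<close>

lemma borel_measurable_plane_coords [measurable]:
 "(\<lambda>z::real \<times> real. fst z) \<in> borel_measurable borel"
 "(\<lambda>z::real \<times> real. snd z) \<in> borel_measurable borel" by (auto intro!: borel_measurable_continuous_onI continuous_intros)

lemma nn_integral_plane:
 fixes f :: "real \<times> real \<Rightarrow> ennreal"
 assumes f: "f \<in> borel_measurable borel"
 shows "(LEB z. f z) = (LEB x. LEB y. f (x, y))"
  and "(LEB z. f z) = (LEB y. LEB x. f (x, y))" using f lborel.nn_integral_fst[of f lborel] lborel_pair.nn_integral_snd[of f]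
 by (simp_all add: lborel_prod)

lemma nn_integral_plane_slice_le:
 fixes f :: "real \<Rightarrow> ennreal" and K :: "real \<times> real \<Rightarrow> ennreal"
 assumes [measurable]: "f \<in> borel_measurable borel" "K \<in> borel_measurable borel"
  and K: "\<And>x. (LEB y. K (x, y)) \<le> B"
 shows "(LEB z. f (fst z) * K z) \<le> (LEB x. f x) * B"
proof -
 have [measurable]: "K \<in> borel_measurable (borel \<Otimes>\<^sub>M borel)" by (simp add: borel_prod)
 have "(LEB z. f (fst z) * K z) = (LEB x. LEB y. f (fst (x, y)) * K (x, y))" by (rule nn_integral_plane(1)) (simp add: borel_prod[symmetric])
 also have "... = (LEB x. f x * (LEB y. K (x, y)))" by (simp add: nn_integral_cmult)
 also have "... \<le> (LEB x. f x * B)" by (intro nn_integral_mono mult_left_mono K) auto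
 also have "... = (LEB x. f x) * B" by (rule nn_integral_multc) auto
 finally show ?thesis .
qed

lemma ennreal_term_le_suminf:
 fixes f :: "nat \<Rightarrow> ennreal"
 shows "f k \<le> (\<Sum>k. f k)" using sum_le_suminf[OF summableI, of "{k}" f] by simp

lemma two_powr_minus_nat: "2 powr (- real k) = (1/2 :: real) ^ k"
proof -
 have "(2::real) powr (- real k) = inverse (2 ^ k)" by (subst powr_minus, subst powr_realpow) simp_all
 then show ?thesis by (simp only: power_one_over inverse_eq_divide)
qed

lemma dyadic_dominate:
 fixes Y de ka :: real
 assumes Y: "Y \<ge> 0" and de: "de \<ge> 0" and ka: "ka \<ge> 0"
 shows "Y \<le> 1 \<Longrightarrow> ennreal (Y powr (- de)) \<le> (\<Sum>k. ennreal (2 powr ((real k + 1) * de)) * indicator {..(1/2) ^ k} Y)"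
  and "1 \<le> Y \<Longrightarrow> ennreal (Y powr (- ka)) \<le> (\<Sum>k. ennreal (2 powr (- (real k * ka))) * indicator {..2 ^ Suc k} Y)"
proof -
 assume Y1: "Y \<le> 1"
 show "ennreal (Y powr (- de)) \<le> (\<Sum>k. ennreal (2 powr ((real k + 1) * de)) * indicator {..(1/2) ^ k} Y)"
 proof (cases "Y = 0")
  case False
  then have Y0: "Y > 0" using Y by simp
  obtain n where "(1/2) ^ n < Y" using real_arch_pow_inv[OF Y0, of "1/2"] by auto
  then have ex: "\<exists>n. (1/2) ^ n < Y" ..
  define m where "m = (LEAST n. (1/2) ^ n < Y)"
  have m: "(1/2) ^ m < Y" unfolding m_def using ex by (rule LeastI_ex)
  then have "m \<noteq> 0" using Y1 by (intro notI) simp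
  then obtain k where k: "m = Suc k" using not0_implies_Suc by blast
  have "Y \<le> (1/2) ^ k" using not_less_Least[of k "\<lambda>n. (1/2) ^ n < Y"] k unfolding m_def[symmetric] by auto
  have "Y powr (- de) \<le> ((1/2) ^ m) powr (- de)" using m de by (intro powr_mono_base_neg) auto
  also have "((1/2::real) ^ m) = 2 powr (- real m)" by (rule two_powr_minus_nat[symmetric])
  also have "(2 powr (- real m)) powr (- de) = 2 powr ((real k + 1) * de)"
   unfolding powr_powr k by (rule arg_cong[where f = "\<lambda>e. 2 powr e"]) (simp add: algebra_simps)
  finally have "ennreal (Y powr (- de)) \<le> ennreal (2 powr ((real k + 1) * de)) * indicator {..(1/2) ^ k} Y"
   using \<open>Y \<le> (1/2) ^ k\<close> by (simp add: ennreal_leI)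
  also have "... \<le> (\<Sum>k. ennreal (2 powr ((real k + 1) * de)) * indicator {..(1/2) ^ k} Y)" by (rule ennreal_term_le_suminf)
  finally show ?thesis .
 qed simp
next
 assume Y1: "1 \<le> Y"
 obtain n where "Y < 2 ^ n" using real_arch_pow[of 2 Y] by auto
 then have ex: "\<exists>n. Y < 2 ^ n" ..
 define m where "m = (LEAST n. Y < 2 ^ n)"
 have m: "Y < 2 ^ m" unfolding m_def using ex by (rule LeastI_ex)
 then have "m \<noteq> 0" using Y1 by (intro notI) simp
 then obtain k where k: "m = Suc k" using not0_implies_Suc by blast
 have "2 ^ k \<le> Y" using not_less_Least[of k "\<lambda>n. Y < 2 ^ n"] k unfolding m_def[symmetric] by auto
 then have "Y powr (- ka) \<le> (2 ^ k) powr (- ka)" using ka by (intro powr_mono_base_neg) auto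
 also have "(2::real) ^ k = 2 powr real k" by (simp add: powr_realpow)
 also have "(2 powr real k) powr (- ka) = 2 powr (- (real k * ka))" by (simp add: powr_powr)
 finally have "ennreal (Y powr (- ka)) \<le> ennreal (2 powr (- (real k * ka))) * indicator {..2 ^ Suc k} Y" using m k by (simp add: ennreal_leI)
 also have "... \<le> (\<Sum>k. ennreal (2 powr (- (real k * ka))) * indicator {..2 ^ Suc k} Y)" by (rule ennreal_term_le_suminf)
 finally show "ennreal (Y powr (- ka)) \<le> (\<Sum>k. ennreal (2 powr (- (real k * ka))) * indicator {..2 ^ Suc k} Y)" .
qed

text \<open>The weight is dominated by a sum of multiples of indicators of dyadic strips around the
  first axis. Mass \<open>B * R\<close> in the strip of half-width \<open>R\<close> gives geometric
  series of ratio 2^(de - 1) near the axis and 2^(1 - ka) far from it.\<close>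

lemma dyadic_weight_bound:
 fixes g :: "real \<times> real \<Rightarrow> ennreal" and B de ka :: real
 assumes [measurable]: "g \<in> borel_measurable borel" and B: "B \<ge> 0"
  and de: "0 \<le> de" "de < 1" and ka: "ka > 1"
  and g: "\<And>R. R > 0 \<Longrightarrow> (LEB z. g z * indicator {..R} \<bar>snd z\<bar>) \<le> ennreal (B * R)"
 shows "(LEB z. ennreal (if \<bar>snd z\<bar> \<le> 1 then \<bar>snd z\<bar> powr (- de) else \<bar>snd z\<bar> powr (- ka)) * g z)
  \<le> ennreal ((2 powr de / (1 - 2 powr (de - 1)) + 2 / (1 - 2 powr (1 - ka))) * B)"
proof -
 let ?b = "\<lambda>k. ennreal (2 powr ((real k + 1) * de))" and ?c = "\<lambda>k. ennreal (2 powr (- (real k * ka)))"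
 let ?u = "\<lambda>k z. ?b k * (g z * indicator {..(1/2) ^ k} \<bar>snd z\<bar>)"
 let ?v = "\<lambda>k z. ?c k * (g z * indicator {..2 ^ Suc k} \<bar>snd z\<bar>)"
 have [measurable]: "(\<lambda>z::real \<times> real. indicator {..r} \<bar>snd z\<bar> :: ennreal) \<in> borel_measurable borel" for r
  unfolding borel_prod[symmetric] by measurable
 have "(LEB z. ennreal (if \<bar>snd z\<bar> \<le> 1 then \<bar>snd z\<bar> powr (- de) else \<bar>snd z\<bar> powr (- ka)) * g z)
  \<le> (LEB z. (\<Sum>k. ?u k z) + (\<Sum>k. ?v k z))"
 proof (rule nn_integral_mono)
  fix z :: "real \<times> real"
  let ?Y = "\<bar>snd z\<bar>"
  have "ennreal (if ?Y \<le> 1 then ?Y powr (- de) else ?Y powr (- ka)) \<le>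
    (\<Sum>k. ?b k * indicator {..(1/2) ^ k} ?Y) + (\<Sum>k. ?c k * indicator {..2 ^ Suc k} ?Y)"
   using dyadic_dominate[of ?Y de ka] de ka by (auto intro: add_increasing add_increasing2)
  then have "ennreal (if ?Y \<le> 1 then ?Y powr (- de) else ?Y powr (- ka)) * g z \<le>
    ((\<Sum>k. ?b k * indicator {..(1/2) ^ k} ?Y) + (\<Sum>k. ?c k * indicator {..2 ^ Suc k} ?Y)) * g z" by (rule mult_right_mono) simp
  also have "... = (\<Sum>k. ?u k z) + (\<Sum>k. ?v k z)" by (simp only: distrib_right ennreal_suminf_multc[symmetric]) (simp only: mult_ac)
  finally show "ennreal (if ?Y \<le> 1 then ?Y powr (- de) else ?Y powr (- ka)) * g z \<le> (\<Sum>k. ?u k z) + (\<Sum>k. ?v k z)" .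
 qed
 also have "... = (\<Sum>k. LEB z. ?u k z) + (\<Sum>k. LEB z. ?v k z)" by (simp add: nn_integral_add nn_integral_suminf)
 also have "... \<le> (\<Sum>k. ennreal (2 powr de * B * (2 powr (de - 1)) ^ k)) + (\<Sum>k. ennreal (2 * B * (2 powr (1 - ka)) ^ k))"
 proof (intro add_mono suminf_le summableI)
  fix k
  have "(LEB z. ?u k z) = ?b k * (LEB z. g z * indicator {..(1/2) ^ k} \<bar>snd z\<bar>)" by (rule nn_integral_cmult) auto
  also have "... \<le> ?b k * ennreal (B * (1/2) ^ k)" by (intro mult_left_mono g) auto
  also have "... = ennreal (2 powr ((real k + 1) * de) * (B * (1/2) ^ k))" using B by (subst ennreal_mult) auto
  also have "2 powr ((real k + 1) * de) * (B * (1/2) ^ k) = 2 powr de * B * (2 powr (de - 1)) ^ k"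
  proof -
   have "(2 powr (de - 1)) ^ k = 2 powr ((de - 1) * real k)" by (simp add: powr_powr[symmetric] powr_realpow)
   also have "(de - 1) * real k = ((real k + 1) * de - de) + - real k" by (simp add: algebra_simps)
   also have "2 powr ... = 2 powr ((real k + 1) * de) / 2 powr de * (1/2) ^ k"
    unfolding powr_add[of 2 "(real k + 1) * de - de"] powr_diff two_powr_minus_nat ..
   finally have e: "(2 powr (de - 1)) ^ k = 2 powr ((real k + 1) * de) / 2 powr de * (1/2) ^ k" .
   have "2 powr de * B * (u / 2 powr de * v) = u * (B * v)" for u v :: real by simp
   then show ?thesis unfolding e by (rule sym)
  qed
  finally show "(LEB z. ?u k z) \<le> ennreal (2 powr de * B * (2 powr (de - 1)) ^ k)" .
  have "(LEB z. ?v k z) = ?c k * (LEB z. g z * indicator {..2 ^ Suc k} \<bar>snd z\<bar>)" by (rule nn_integral_cmult) auto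
  also have "... \<le> ?c k * ennreal (B * 2 ^ Suc k)" by (intro mult_left_mono g) auto
  also have "... = ennreal (2 powr (- (real k * ka)) * (B * 2 ^ Suc k))" using B by (subst ennreal_mult) auto
  also have "2 powr (- (real k * ka)) * (B * 2 ^ Suc k) = 2 * B * (2 powr (1 - ka)) ^ k"
  proof -
   have "(2 powr (1 - ka)) ^ k = 2 powr ((1 - ka) * real k)" by (simp add: powr_powr[symmetric] powr_realpow)
   also have "(1 - ka) * real k = - (real k * ka) + real k" by (simp add: algebra_simps)
   also have "2 powr ... = 2 powr (- (real k * ka)) * 2 ^ k" unfolding powr_add by (simp add: powr_realpow)
   finally show ?thesis by simp
  qed
  finally show "(LEB z. ?v k z) \<le> ennreal (2 * B * (2 powr (1 - ka)) ^ k)" .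
 qed
 also have "(\<Sum>k. ennreal (2 powr de * B * (2 powr (de - 1)) ^ k)) = ennreal (2 powr de * B * (1 / (1 - 2 powr (de - 1))))"
 proof -
  have l: "(2::real) powr (de - 1) < 1" using de by (auto simp: powr_less_one)
  show ?thesis using l B by (subst suminf_ennreal2) (auto intro!: summable_mult summable_geometric simp: suminf_mult suminf_geometric)
 qed
 also have "(\<Sum>k. ennreal (2 * B * (2 powr (1 - ka)) ^ k)) = ennreal (2 * B * (1 / (1 - 2 powr (1 - ka))))"
 proof -
  have l: "(2::real) powr (1 - ka) < 1" using ka by (auto simp: powr_less_one)
  show ?thesis using l B by (subst suminf_ennreal2) (auto intro!: summable_mult summable_geometric simp: suminf_mult suminf_geometric)
 qed
 also have "ennreal (2 powr de * B * (1 / (1 - 2 powr (de - 1)))) + ennreal (2 * B * (1 / (1 - 2 powr (1 - ka))))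
  = ennreal ((2 powr de / (1 - 2 powr (de - 1)) + 2 / (1 - 2 powr (1 - ka))) * B)"
 proof -
  have "(2::real) powr (de - 1) < 1" "(2::real) powr (1 - ka) < 1" using de ka by (auto simp: powr_less_one)
  then show ?thesis using B by (subst ennreal_plus[symmetric]) (auto simp: algebra_simps)
 qed
 finally show ?thesis .
qed

text \<open>One summand for each majorant in the proof of \<open>weighted_core\<close>, in the same
  order.\<close>

definition core_const :: "real \<Rightarrow> real \<Rightarrow> real \<Rightarrow> real \<Rightarrow> real \<Rightarrow> real \<Rightarrow> ennreal" where
 "core_const ga de mu nu ka B = ennreal (2 / (1 - ga)) * ennreal (2 / (1 - de) + 2 / (mu - 1) + B) + ennreal B + ennreal (2 / (ka - 1)) * ennreal B
   + ennreal (2 / (mu - 1) * (2 / (ga + mu - 2)))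
   + ennreal ((2 powr de / (1 - 2 powr (de - 1)) + 2 / (1 - 2 powr (1 - ka))) * B)
   + ennreal (2 / (nu - 1) * (2 / (1 - de) + 2 / (de + nu - 2)))"

text \<open>\<open>H\<close> is a normalised extension in coordinates in which the Knapp box of a
  cap of width \<open>a\<close> around a point of the second axis is a unit box. The plane is
  divided according to how |x| and |y| compare with 1 and with each other. On each part a clause of
  \<open>plane_data\<close> trades H^q for powers that \<open>h1\<close>, \<open>h2\<close> or
  \<open>h3\<close> integrate and for weights that are integrable on their own.\<close>

lemma weighted_core:
 fixes H :: "real \<times> real \<Rightarrow> real" and a B q p s mu nu ka ga de :: real
 assumes Hm[measurable]: "H \<in> borel_measurable borel" and H: "\<And>z. 0 \<le> H z" "\<And>z. H z \<le> 1"
  and B: "B \<ge> 0" and a: "a > 0"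
  and h1: "\<And>x. (LEB y. ennreal (H (x, y) powr p)) \<le> ennreal B"
  and h2: "(LEB z. ennreal (H z powr s)) \<le> ennreal B"
  and h3: "\<And>R. R > 0 \<Longrightarrow> (LEB z. ennreal ((H z)\<^sup>2) * indicator {z. \<bar>fst z\<bar> \<le> R / a \<and> \<bar>snd z\<bar> \<le> R} z) \<le> ennreal (B * R)"
  and ga: "0 \<le> ga" "ga < 1" and de: "0 \<le> de" "de < 1"
  and pd: "plane_data ga de q p s mu nu ka"
  and q: "q > 0"
 shows "(LEB z. ennreal (\<bar>fst z\<bar> powr (- ga) * \<bar>snd z\<bar> powr (- de) * H z powr q) * indicator {z. a * \<bar>fst z\<bar> \<le> \<bar>snd z\<bar>} z)
  \<le> core_const ga de mu nu ka B"
proof -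
 have e: "mu > 1" "nu > 1" "ka > 1" "ga + mu > 2" "de + nu > 2"
  and P1: "\<And>Y t. 1 \<le> Y \<Longrightarrow> 0 \<le> t \<Longrightarrow> t \<le> 1 \<Longrightarrow> Y powr (- de) * t powr q \<le> Y powr (- mu) + t powr p"
  and P2: "\<And>X Y t. 1 \<le> X \<Longrightarrow> X \<le> Y \<Longrightarrow> 0 \<le> t \<Longrightarrow> t \<le> 1 \<Longrightarrow>
   X powr (- ga) * Y powr (- de) * t powr q \<le> t powr s + X powr (- ka) * t powr p + X powr (- ga) * Y powr (- mu)"
  and P3: "\<And>X Y t. 1 \<le> X \<Longrightarrow> 0 < Y \<Longrightarrow> Y \<le> X \<Longrightarrow> 0 \<le> t \<Longrightarrow> t \<le> 1 \<Longrightarrow>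
   X powr (- ga) * Y powr (- de) * t powr q \<le> t powr s +
    (if Y \<le> 1 then Y powr (- de) else Y powr (- ka)) * t\<^sup>2 + Y powr (- de) * X powr (- nu)"
  using pd by (auto simp: plane_data_def)

 have Hm'[measurable]: "H \<in> borel_measurable (borel \<Otimes>\<^sub>M borel)" by (simp add: borel_prod)
 \<comment> \<open>\<open>i1\<close> and \<open>j1\<close> belong to the strip |x| \<le> 1,
   \<open>i3\<close> and \<open>t4\<close> to 1 < |x| \<le> |y|, \<open>j5\<close>,
   \<open>g5\<close> and \<open>t6\<close> to |y| < |x|.\<close>
 define i1 :: "real \<Rightarrow> real" where "i1 x = \<bar>x\<bar> powr (- ga) * (if \<bar>x\<bar> \<le> 1 then 1 else 0)" for x
 define j1 :: "real \<Rightarrow> real" where "j1 y = (if \<bar>y\<bar> \<le> 1 then \<bar>y\<bar> powr (- de) else 0) + (if 1 \<le> \<bar>y\<bar> then \<bar>y\<bar> powr (- mu) else 0)" for y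
 define i3 :: "real \<Rightarrow> real" where "i3 x = (if 1 \<le> \<bar>x\<bar> then \<bar>x\<bar> powr (- ka) else 0)" for x
 define t4 :: "real \<times> real \<Rightarrow> real" where "t4 z = (if 1 \<le> \<bar>fst z\<bar> \<and> \<bar>fst z\<bar> \<le> \<bar>snd z\<bar> then \<bar>fst z\<bar> powr (- ga) * \<bar>snd z\<bar> powr (- mu) else 0)" for z
 define j5 :: "real \<Rightarrow> real" where "j5 y = (if \<bar>y\<bar> \<le> 1 then \<bar>y\<bar> powr (- de) else \<bar>y\<bar> powr (- ka))" for y
 define g5 :: "real \<times> real \<Rightarrow> ennreal" where "g5 z = ennreal ((H z)\<^sup>2) * indicator {z. a * \<bar>fst z\<bar> \<le> \<bar>snd z\<bar>} z" for z
 define t6 :: "real \<times> real \<Rightarrow> real" where "t6 z = (if 1 \<le> \<bar>fst z\<bar> \<and> \<bar>snd z\<bar> \<le> \<bar>fst z\<bar> then \<bar>snd z\<bar> powr (- de) * \<bar>fst z\<bar> powr (- nu) else 0)" for z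
 have nn: "i1 x \<ge> 0" "j1 x \<ge> 0" "i3 x \<ge> 0" "t4 z \<ge> 0" "j5 x \<ge> 0" "t6 z \<ge> 0" for x z
  by (auto simp: i1_def j1_def i3_def t4_def j5_def t6_def)
 have [measurable]: "i1 \<in> borel_measurable borel" "j1 \<in> borel_measurable borel" "i3 \<in> borel_measurable borel"
  "j5 \<in> borel_measurable borel" unfolding i1_def j1_def i3_def j5_def by measurable
 have [measurable]: "t4 \<in> borel_measurable borel" "t6 \<in> borel_measurable borel" unfolding t4_def t6_def by measurable
 have Dm[measurable]: "{z::real \<times> real. a * \<bar>fst z\<bar> \<le> \<bar>snd z\<bar>} \<in> sets borel" by measurable
 have [measurable]: "g5 \<in> borel_measurable borel" unfolding g5_def by measurable
 have "(LEB z. ennreal (\<bar>fst z\<bar> powr (- ga) * \<bar>snd z\<bar> powr (- de) * H z powr q) * indicator {z. a * \<bar>fst z\<bar> \<le> \<bar>snd z\<bar>} z)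
  \<le> (LEB z. ennreal (i1 (fst z)) * (ennreal (j1 (snd z)) + ennreal (H z powr p)) + ennreal (H z powr s)
     + ennreal (i3 (fst z)) * ennreal (H z powr p) + ennreal (t4 z) + ennreal (j5 (snd z)) * g5 z + ennreal (t6 z))"
 proof (rule nn_integral_mono)
  fix z :: "real \<times> real"
  define X Y t where "X = \<bar>fst z\<bar>" and "Y = \<bar>snd z\<bar>" and "t = H z"
  have t: "0 \<le> t" "t \<le> 1" using H by (auto simp: t_def)
  show "ennreal (\<bar>fst z\<bar> powr (- ga) * \<bar>snd z\<bar> powr (- de) * H z powr q) * indicator {z. a * \<bar>fst z\<bar> \<le> \<bar>snd z\<bar>} z
   \<le> ennreal (i1 (fst z)) * (ennreal (j1 (snd z)) + ennreal (H z powr p)) + ennreal (H z powr s)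
     + ennreal (i3 (fst z)) * ennreal (H z powr p) + ennreal (t4 z) + ennreal (j5 (snd z)) * g5 z + ennreal (t6 z)"
  proof (cases "a * \<bar>fst z\<bar> \<le> \<bar>snd z\<bar>")
   case True
   have real: "X powr (- ga) * Y powr (- de) * t powr q \<le> i1 (fst z) * (j1 (snd z) + t powr p) + t powr s
    + i3 (fst z) * t powr p + t4 z + j5 (snd z) * t\<^sup>2 + t6 z"
   proof -
    consider "X \<le> 1" | "1 < X" "X \<le> Y" | "1 < X" "Y < X" by linarith
    then show ?thesis
    proof cases
     case 1
     have "Y powr (- de) * t powr q \<le> j1 (snd z) + t powr p"
     proof (cases "Y \<le> 1")
      case True
      then have "Y powr (- de) * t powr q \<le> Y powr (- de) * 1" using t q powr_mono2[of q t 1] by (intro mult_left_mono) auto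
      also have "... \<le> j1 (snd z)" using True by (simp add: j1_def Y_def)
      finally show ?thesis by (simp add: add_increasing2)
     next
      case False
      then show ?thesis using P1[of Y t] t by (simp add: j1_def Y_def)
     qed
     then have "X powr (- ga) * (Y powr (- de) * t powr q) \<le> X powr (- ga) * (j1 (snd z) + t powr p)" by (intro mult_left_mono) auto
     also have "X powr (- ga) = i1 (fst z)" using 1 by (simp add: i1_def X_def)
     finally have "X powr (- ga) * Y powr (- de) * t powr q \<le> i1 (fst z) * (j1 (snd z) + t powr p)"
      using 1 by (simp add: i1_def X_def mult.assoc)
     then show ?thesis using nn by (intro add_increasing2) auto
    next
     case 2
     have "X powr (- ga) * Y powr (- de) * t powr q \<le> t powr s + X powr (- ka) * t powr p + X powr (- ga) * Y powr (- mu)"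
      using 2 t by (intro P2) auto
     also have "... = t powr s + i3 (fst z) * t powr p + t4 z" using 2 by (simp add: i3_def t4_def X_def Y_def)
     finally have "X powr (- ga) * Y powr (- de) * t powr q \<le> t powr s + i3 (fst z) * t powr p + t4 z" .
     moreover have "0 \<le> i1 (fst z) * (j1 (snd z) + t powr p)" "0 \<le> j5 (snd z) * t\<^sup>2" "0 \<le> t6 z"
      using nn by (auto intro!: mult_nonneg_nonneg add_nonneg_nonneg)
     ultimately show ?thesis by linarith
    next
     case 3
     have "0 < a * X" using a 3 by (intro mult_pos_pos) auto
     then have Y0: "0 < Y" using True unfolding X_def Y_def by linarith
     have "X powr (- ga) * Y powr (- de) * t powr q \<le> t powr s +
       (if Y \<le> 1 then Y powr (- de) else Y powr (- ka)) * t\<^sup>2 + Y powr (- de) * X powr (- nu)" using 3 t Y0 by (intro P3) auto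
     also have "... = t powr s + j5 (snd z) * t\<^sup>2 + t6 z" using 3 by (simp add: j5_def t6_def X_def Y_def)
     finally have "X powr (- ga) * Y powr (- de) * t powr q \<le> t powr s + j5 (snd z) * t\<^sup>2 + t6 z" .
     moreover have "0 \<le> i1 (fst z) * (j1 (snd z) + t powr p)" "0 \<le> i3 (fst z) * t powr p" "0 \<le> t4 z"
      using nn by (auto intro!: mult_nonneg_nonneg add_nonneg_nonneg)
     ultimately show ?thesis by linarith
    qed
   qed
   have "ennreal (X powr (- ga) * Y powr (- de) * t powr q) \<le> ennreal (i1 (fst z) * (j1 (snd z) + t powr p) + t powr s
    + i3 (fst z) * t powr p + t4 z + j5 (snd z) * t\<^sup>2 + t6 z)" by (rule ennreal_leI[OF real])
   also have "... = ennreal (i1 (fst z)) * (ennreal (j1 (snd z)) + ennreal (t powr p)) + ennreal (t powr s)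
     + ennreal (i3 (fst z)) * ennreal (t powr p) + ennreal (t4 z) + ennreal (j5 (snd z)) * ennreal (t\<^sup>2) + ennreal (t6 z)"
    using nn by (simp add: ennreal_plus ennreal_mult add_nonneg_nonneg mult_nonneg_nonneg del: ennreal_plus_if)
   finally show ?thesis using True by (simp add: X_def Y_def t_def g5_def)
  qed simp
 qed
 also have "... = (LEB z. ennreal (i1 (fst z)) * (ennreal (j1 (snd z)) + ennreal (H z powr p))) + (LEB z. ennreal (H z powr s))
   + (LEB z. ennreal (i3 (fst z)) * ennreal (H z powr p)) + (LEB z. ennreal (t4 z))
   + (LEB z. ennreal (j5 (snd z)) * g5 z) + (LEB z. ennreal (t6 z))" by (simp add: nn_integral_add)
 also have "... \<le> core_const ga de mu nu ka B" unfolding core_const_def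
 proof (intro add_mono)
  have j1int: "(LEB y. ennreal (j1 y)) \<le> ennreal (2 / (1 - de) + 2 / (mu - 1))"
  proof -
   have "(LEB y. ennreal (j1 y)) = (LEB y. ennreal (\<bar>y\<bar> powr (- de)) * indicator {y. \<bar>y\<bar> \<le> 1} y +
     ennreal (\<bar>y\<bar> powr (- mu)) * indicator {y. 1 \<le> \<bar>y\<bar>} y)" by (intro nn_integral_cong) (auto simp: j1_def indicator_def)
   also have "... = (LEB y. ennreal (\<bar>y\<bar> powr (- de)) * indicator {y. \<bar>y\<bar> \<le> 1} y) +
     (LEB y. ennreal (\<bar>y\<bar> powr (- mu)) * indicator {y. 1 \<le> \<bar>y\<bar>} y)" by (rule nn_integral_add) auto
   also have "... \<le> ennreal (2 / (1 - de)) + ennreal (2 / (mu - 1) * 1 powr (1 - mu))"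
    using de e by (intro add_mono nn_integral_abs_powr_small nn_integral_abs_powr_large) auto
   also have "... = ennreal (2 / (1 - de) + 2 / (mu - 1))" using de e by (subst ennreal_plus) auto
   finally show ?thesis .
  qed
  have i1int: "(LEB x. ennreal (i1 x)) \<le> ennreal (2 / (1 - ga))"
  proof -
   have "(LEB x. ennreal (i1 x)) = (LEB x. ennreal (\<bar>x\<bar> powr (- ga)) * indicator {x. \<bar>x\<bar> \<le> 1} x)"
    by (intro nn_integral_cong) (auto simp: i1_def indicator_def)
   then show ?thesis using nn_integral_abs_powr_small[OF ga(2)] by simp
  qed
  have "(LEB z. ennreal (i1 (fst z)) * (ennreal (j1 (snd z)) + ennreal (H z powr p)))
   \<le> (LEB x. ennreal (i1 x)) * ennreal (2 / (1 - de) + 2 / (mu - 1) + B)"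
  proof (rule nn_integral_plane_slice_le)
   fix x :: real
   have "(LEB y. (ennreal (j1 (snd (x, y))) + ennreal (H (x, y) powr p)))
    = (LEB y. ennreal (j1 y)) + (LEB y. ennreal (H (x, y) powr p))" by (subst nn_integral_add) auto
   also have "... \<le> ennreal (2 / (1 - de) + 2 / (mu - 1)) + ennreal B" by (intro add_mono j1int h1)
   also have "... = ennreal (2 / (1 - de) + 2 / (mu - 1) + B)" using de e B by (subst ennreal_plus[symmetric]) auto
   finally show "(LEB y. (ennreal (j1 (snd (x, y))) + ennreal (H (x, y) powr p))) \<le> ennreal (2 / (1 - de) + 2 / (mu - 1) + B)" .
  qed measurable
  also have "... \<le> ennreal (2 / (1 - ga)) * ennreal (2 / (1 - de) + 2 / (mu - 1) + B)" by (intro mult_right_mono i1int) auto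
  finally show "(LEB z. ennreal (i1 (fst z)) * (ennreal (j1 (snd z)) + ennreal (H z powr p)))
   \<le> ennreal (2 / (1 - ga)) * ennreal (2 / (1 - de) + 2 / (mu - 1) + B)" .
  show "(LEB z. ennreal (H z powr s)) \<le> ennreal B" by (rule h2)
  have "(LEB x. ennreal (i3 x)) = (LEB x. ennreal (\<bar>x\<bar> powr (- ka)) * indicator {x. 1 \<le> \<bar>x\<bar>} x)"
   by (intro nn_integral_cong) (auto simp: i3_def indicator_def)
  also have "... \<le> ennreal (2 / (ka - 1) * 1 powr (1 - ka))" using e by (intro nn_integral_abs_powr_large) auto
  finally have i3int: "(LEB x. ennreal (i3 x)) \<le> ennreal (2 / (ka - 1))" by simp
  have "(LEB z. ennreal (i3 (fst z)) * ennreal (H z powr p)) \<le> (LEB x. ennreal (i3 x)) * ennreal B"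
   by (rule nn_integral_plane_slice_le) (use h1 in auto)
  also have "... \<le> ennreal (2 / (ka - 1)) * ennreal B" by (intro mult_right_mono i3int) auto
  finally show "(LEB z. ennreal (i3 (fst z)) * ennreal (H z powr p)) \<le> ennreal (2 / (ka - 1)) * ennreal B" .
  have "(LEB z. ennreal (t4 z)) = (LEB x. LEB y. ennreal (t4 (x, y)))" by (rule nn_integral_plane(1)) measurable
  also have "... \<le> (LEB x. ennreal (2 / (mu - 1)) * (ennreal (\<bar>x\<bar> powr (- (ga + mu - 1))) * indicator {x. 1 \<le> \<bar>x\<bar>} x))"
  proof (rule nn_integral_mono)
   fix x :: real
   show "(LEB y. ennreal (t4 (x, y))) \<le> ennreal (2 / (mu - 1)) * (ennreal (\<bar>x\<bar> powr (- (ga + mu - 1))) * indicator {x. 1 \<le> \<bar>x\<bar>} x)"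
   proof (cases "1 \<le> \<bar>x\<bar>")
    case True
    have "(LEB y. ennreal (t4 (x, y))) = (LEB y. ennreal (\<bar>x\<bar> powr (- ga)) * (ennreal (\<bar>y\<bar> powr (- mu)) * indicator {y. \<bar>x\<bar> \<le> \<bar>y\<bar>} y))"
     using True by (intro nn_integral_cong) (auto simp: t4_def indicator_def ennreal_mult)
    also have "... = ennreal (\<bar>x\<bar> powr (- ga)) * (LEB y. ennreal (\<bar>y\<bar> powr (- mu)) * indicator {y. \<bar>x\<bar> \<le> \<bar>y\<bar>} y)"
     by (rule nn_integral_cmult) auto
    also have "... \<le> ennreal (\<bar>x\<bar> powr (- ga)) * ennreal (2 / (mu - 1) * \<bar>x\<bar> powr (1 - mu))"
     using True e by (intro mult_left_mono nn_integral_abs_powr_large) auto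
    also have "... = ennreal (2 / (mu - 1) * (\<bar>x\<bar> powr (- ga) * \<bar>x\<bar> powr (1 - mu)))"
     using e by (subst ennreal_mult[symmetric]) (auto simp: mult_ac)
    also have "\<bar>x\<bar> powr (- ga) * \<bar>x\<bar> powr (1 - mu) = \<bar>x\<bar> powr (- (ga + mu - 1))"
     by (simp add: powr_add[symmetric] algebra_simps)
    also have "ennreal (2 / (mu - 1) * \<bar>x\<bar> powr (- (ga + mu - 1))) = ennreal (2 / (mu - 1)) * ennreal (\<bar>x\<bar> powr (- (ga + mu - 1)))"
     using e by (intro ennreal_mult) auto
    finally show ?thesis using True by simp
   qed (simp add: t4_def)
  qed
  also have "... = ennreal (2 / (mu - 1)) * (LEB x. ennreal (\<bar>x\<bar> powr (- (ga + mu - 1))) * indicator {x. 1 \<le> \<bar>x\<bar>} x)"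
   by (rule nn_integral_cmult) auto
  also have "... \<le> ennreal (2 / (mu - 1)) * ennreal (2 / ((ga + mu - 1) - 1) * 1 powr (1 - (ga + mu - 1)))"
   using e by (intro mult_left_mono nn_integral_abs_powr_large) auto
  also have "... = ennreal (2 / (mu - 1) * (2 / (ga + mu - 2)))" using e by (subst ennreal_mult[symmetric]) auto
  finally show "(LEB z. ennreal (t4 z)) \<le> ennreal (2 / (mu - 1) * (2 / (ga + mu - 2)))" .
  show "(LEB z. ennreal (j5 (snd z)) * g5 z) \<le> ennreal ((2 powr de / (1 - 2 powr (de - 1)) + 2 / (1 - 2 powr (1 - ka))) * B)" unfolding j5_def
  proof (rule dyadic_weight_bound)
   fix R :: real assume R: "R > 0"
   \<comment> \<open>In the sector a|x| \<le> |y| the strip |y| \<le> R lies in the box of sides R/a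
     and R, the shape for which \<open>h3\<close> is stated.\<close>
   have "(LEB z. g5 z * indicator {..R} \<bar>snd z\<bar>) \<le>
    (LEB z. ennreal ((H z)\<^sup>2) * indicator {z. \<bar>fst z\<bar> \<le> R / a \<and> \<bar>snd z\<bar> \<le> R} z)"
    using a by (intro nn_integral_mono) (auto simp: g5_def indicator_def field_simps)
   also have "... \<le> ennreal (B * R)" by (rule h3[OF R])
   finally show "(LEB z. g5 z * indicator {..R} \<bar>snd z\<bar>) \<le> ennreal (B * R)" .
  qed (use B de e in auto)
  have "(LEB z. ennreal (t6 z)) = (LEB y. LEB x. ennreal (t6 (x, y)))" by (rule nn_integral_plane(2)) measurable
  also have "... \<le> (LEB y. ennreal (2 / (nu - 1)) * (ennreal (\<bar>y\<bar> powr (- de)) * indicator {y. \<bar>y\<bar> \<le> 1} y +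
    ennreal (\<bar>y\<bar> powr (- (de + nu - 1))) * indicator {y. 1 \<le> \<bar>y\<bar>} y))"
  proof (rule nn_integral_mono)
   fix y :: real
   define m where "m = max 1 \<bar>y\<bar>"
   have m: "m > 0" by (simp add: m_def)
   have "(LEB x. ennreal (t6 (x, y))) = (LEB x. ennreal (\<bar>y\<bar> powr (- de)) * (ennreal (\<bar>x\<bar> powr (- nu)) * indicator {x. m \<le> \<bar>x\<bar>} x))"
    by (intro nn_integral_cong) (auto simp: t6_def indicator_def ennreal_mult m_def)
   also have "... = ennreal (\<bar>y\<bar> powr (- de)) * (LEB x. ennreal (\<bar>x\<bar> powr (- nu)) * indicator {x. m \<le> \<bar>x\<bar>} x)"
    by (rule nn_integral_cmult) auto
   also have "... \<le> ennreal (\<bar>y\<bar> powr (- de)) * ennreal (2 / (nu - 1) * m powr (1 - nu))"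
    using m e by (intro mult_left_mono nn_integral_abs_powr_large) auto
   also have "... = ennreal (2 / (nu - 1)) * ennreal (\<bar>y\<bar> powr (- de) * m powr (1 - nu))"
    using e by (subst (1 2) ennreal_mult[symmetric]) (auto simp: mult_ac)
   also have "... \<le> ennreal (2 / (nu - 1)) * (ennreal (\<bar>y\<bar> powr (- de)) * indicator {y. \<bar>y\<bar> \<le> 1} y +
    ennreal (\<bar>y\<bar> powr (- (de + nu - 1))) * indicator {y. 1 \<le> \<bar>y\<bar>} y)"
   proof (intro mult_left_mono)
    show "ennreal (\<bar>y\<bar> powr (- de) * m powr (1 - nu)) \<le> ennreal (\<bar>y\<bar> powr (- de)) * indicator {y. \<bar>y\<bar> \<le> 1} y +
    ennreal (\<bar>y\<bar> powr (- (de + nu - 1))) * indicator {y. 1 \<le> \<bar>y\<bar>} y"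
    proof (cases "\<bar>y\<bar> \<le> 1")
     case True
     then show ?thesis by (simp add: m_def max_def indicator_def)
    next
     case False
     then have "m = \<bar>y\<bar>" by (simp add: m_def)
     then have "\<bar>y\<bar> powr (- de) * m powr (1 - nu) = \<bar>y\<bar> powr (- (de + nu - 1))"
      by (simp add: powr_add[symmetric] algebra_simps)
     then show ?thesis using False by (simp add: indicator_def)
    qed
   qed simp
   finally show "(LEB x. ennreal (t6 (x, y))) \<le> ennreal (2 / (nu - 1)) * (ennreal (\<bar>y\<bar> powr (- de)) * indicator {y. \<bar>y\<bar> \<le> 1} y +
    ennreal (\<bar>y\<bar> powr (- (de + nu - 1))) * indicator {y. 1 \<le> \<bar>y\<bar>} y)" .
  qed
  also have "... = ennreal (2 / (nu - 1)) * ((LEB y. ennreal (\<bar>y\<bar> powr (- de)) * indicator {y. \<bar>y\<bar> \<le> 1} y) +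
    (LEB y. ennreal (\<bar>y\<bar> powr (- (de + nu - 1))) * indicator {y. 1 \<le> \<bar>y\<bar>} y))"
   by (subst nn_integral_cmult, measurable, subst nn_integral_add) auto
  also have "... \<le> ennreal (2 / (nu - 1)) * (ennreal (2 / (1 - de)) + ennreal (2 / ((de + nu - 1) - 1) * 1 powr (1 - (de + nu - 1))))"
   using e de by (intro mult_left_mono add_mono nn_integral_abs_powr_large nn_integral_abs_powr_small) auto
  also have "... = ennreal (2 / (nu - 1) * (2 / (1 - de) + 2 / (de + nu - 2)))"
   using e de by (subst ennreal_plus[symmetric], simp, simp, subst ennreal_mult[symmetric]) (auto intro!: add_nonneg_nonneg)
  finally show "(LEB z. ennreal (t6 z)) \<le> ennreal (2 / (nu - 1) * (2 / (1 - de) + 2 / (de + nu - 2)))" .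
 qed
 finally show ?thesis .
qed

lemma ennreal_mult3:
 "0 \<le> a \<Longrightarrow> 0 \<le> b \<Longrightarrow> 0 \<le> c \<Longrightarrow> ennreal a * (ennreal b * ennreal c) = ennreal (a * (b * c))"
 by (simp add: ennreal_mult)

lemma nn_integral_plane_swap:
 fixes f :: "real \<times> real \<Rightarrow> ennreal"
 assumes [measurable]: "f \<in> borel_measurable borel"
 shows "(LEB z. f (snd z, fst z)) = (LEB z. f z)"
proof -
 have [measurable]: "f \<in> borel_measurable (borel \<Otimes>\<^sub>M borel)" by (simp add: borel_prod)
 have "(\<lambda>z. f (snd z, fst z)) \<in> borel_measurable borel" unfolding borel_prod[symmetric] by measurable
 from nn_integral_plane(1)[OF this] nn_integral_plane(2)[OF assms] show ?thesis by simp
qed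

lemma nn_integral_plane_scale:
 fixes f :: "real \<times> real \<Rightarrow> ennreal" and a b :: real
 assumes f[measurable]: "f \<in> borel_measurable borel" and ab: "a > 0" "b > 0"
 shows "(LEB z. f z) = ennreal (a * b) * (LEB z. f (a * fst z, b * snd z))"
proof -
 have [measurable]: "f \<in> borel_measurable (borel \<Otimes>\<^sub>M borel)" by (simp add: borel_prod)
 have "(LEB z. f z) = (LEB x. LEB y. f (x, y))" by (rule nn_integral_plane(1)[OF f])
 also have "... = (LEB x. ennreal b * (LEB y. f (x, b * y)))"
 proof (intro nn_integral_cong)
  fix x
  show "(LEB y. f (x, y)) = ennreal b * (LEB y. f (x, b * y))" using nn_integral_real_affine[of "\<lambda>y. f (x, y)" b 0] ab by simp
 qed
 also have "... = ennreal b * (LEB x. LEB y. f (x, b * y))" by (rule nn_integral_cmult) measurable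
 also have "(LEB x. LEB y. f (x, b * y)) = ennreal a * (LEB x. LEB y. f (a * x, b * y))"
  using nn_integral_real_affine[of "\<lambda>x. (LEB y. f (x, b * y))" a 0] ab by simp
 also have "(LEB x. LEB y. f (a * x, b * y)) = (LEB z. f (a * fst z, b * snd z))"
  by (subst nn_integral_plane(1)) (simp_all add: borel_prod[symmetric])
 finally show ?thesis using ab by (simp add: ennreal_mult mult_ac)
qed

lemma AE_plane_nonzero: "AE z in (lborel :: (real \<times> real) measure). fst z \<noteq> 0 \<and> snd z \<noteq> 0"
proof -
 have m: "(\<lambda>z::real \<times> real. indicator {0} (fst z) :: ennreal) \<in> borel_measurable borel"
  unfolding borel_prod[symmetric] by measurable
 have "(\<integral>\<^sup>+z. indicator {0} (fst z) \<partial>(lborel :: (real \<times> real) measure)) = (LEB x. \<integral>\<^sup>+y. indicator {0::real} x \<partial>(lborel :: real measure))"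
  using nn_integral_plane(1)[OF m] by simp
 also have "... = (LEB x. indicator {0::real} x * \<infinity>)" by simp
 also have "... = 0" by (subst nn_integral_multc) auto
 finally have 1: "(\<integral>\<^sup>+z. indicator {0} (fst z) \<partial>(lborel :: (real \<times> real) measure)) = 0" .
 then have 2: "(\<integral>\<^sup>+z. indicator {0} (snd z) \<partial>(lborel :: (real \<times> real) measure)) = 0"
  using nn_integral_plane_swap[OF m] by simp
 have m': "(\<lambda>z::real \<times> real. indicator {0} (snd z) :: ennreal) \<in> borel_measurable borel"
  unfolding borel_prod[symmetric] by measurable
 have "AE z in (lborel :: (real \<times> real) measure). indicator {0} (fst z) = (0::ennreal)" using 1 m by (subst (asm) nn_integral_0_iff_AE) auto
 moreover have "AE z in (lborel :: (real \<times> real) measure). indicator {0} (snd z) = (0::ennreal)"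
  using 2 m' by (subst (asm) nn_integral_0_iff_AE) auto
 ultimately show ?thesis by eventually_elim (auto simp: indicator_def split: if_splits)
qed

section \<open>Energy on lines and boxes\<close>

text \<open>On the support of \<open>F\<close> the Jacobian of the projection is at least 1/2, so
  the Plancherel estimate applies with no shells, and even at the exponent 2.\<close>

lemma extension_slice_L2_snd:
 assumes [measurable]: "F \<in> borel_measurable \<sigma>" and F: "\<And>om. cmod (F om) \<le> 1"
  and supp: "\<And>om. F om \<noteq> 0 \<Longrightarrow> 1 / 2 \<le> \<bar>fst om\<bar>"
  and a: "(ARC om. ennreal (cmod (F om))) \<le> ennreal a" "a \<ge> 0"
 shows "(LEB y. ennreal ((cmod (Ext F (x, y)))\<^sup>2)) \<le> ennreal (8 * pi * a)"
proof -
 let ?h = "\<lambda>om. exp (\<i> * of_real (x * fst om)) * F om"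
 have hn: "cmod (?h om) = cmod (F om)" for om by (simp add: norm_mult)
 have "(LEB y. ennreal ((cmod (Ext F (x, y)))\<^sup>2))
  \<le> (LEB y. ennreal ((cmod (\<integral>om. exp (\<i> * of_real (y \<bullet> snd om)) * ?h om \<partial>\<sigma>))\<^sup>2))"
  unfolding extension_op_slice_snd by (intro nn_integral_mono ennreal_leI power_mono norm_extension_le) auto
 also have "... \<le> ennreal (sqrt (2 * pi) * (2 * sqrt (2 * pi))) * (ARC om. ennreal ((cmod (?h om))\<^sup>2 / \<bar>fst om\<bar>))"
 proof (rule plancherel_schur[where d = 1 and B = 1])
  fix om assume "?h om \<noteq> 0"
  then show "0 < \<bar>fst om\<bar>" using supp[of om] by auto
 qed (use F circle_push_gaussian gaussian_ft_real gaussian_integrable finite_measure_circle hn in auto)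
 also have "... \<le> ennreal (4 * pi) * (ARC om. ennreal 2 * ennreal (cmod (F om)))"
 proof (intro mult_mono nn_integral_mono)
  fix om
  have "(cmod (F om))\<^sup>2 / \<bar>fst om\<bar> \<le> 2 * cmod (F om)"
  proof (cases "F om = 0")
   case False
   then have f: "1 \<le> 2 * \<bar>fst om\<bar>" using supp[of om] by simp
   have "cmod (F om) * cmod (F om) \<le> cmod (F om) * 1" using F by (intro mult_left_mono) auto
   also have "... \<le> cmod (F om) * (2 * \<bar>fst om\<bar>)" using f by (intro mult_left_mono) auto
   finally show ?thesis using f by (simp add: power2_eq_square field_simps)
  qed simp
  then show "ennreal ((cmod (?h om))\<^sup>2 / \<bar>fst om\<bar>) \<le> ennreal 2 * ennreal (cmod (F om))"
   unfolding hn by (subst ennreal_mult[symmetric]) (auto intro!: ennreal_leI)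
 qed auto
 also have "... = ennreal (4 * pi) * (ennreal 2 * (ARC om. ennreal (cmod (F om))))" by (subst nn_integral_cmult) auto
 also have "... \<le> ennreal (4 * pi) * (ennreal 2 * ennreal a)" by (intro mult_left_mono a) auto
 also have "... = ennreal (8 * pi * a)" using a by (subst ennreal_mult3) auto
 finally show ?thesis .
qed

lemma extension_slice_L2_fst:
 assumes [measurable]: "F \<in> borel_measurable \<sigma>" and F: "\<And>om. cmod (F om) \<le> 1"
  and supp: "\<And>om. F om \<noteq> 0 \<Longrightarrow> 1 / 2 \<le> \<bar>snd om\<bar>"
  and a: "(ARC om. ennreal (cmod (F om))) \<le> ennreal a" "a \<ge> 0"
 shows "(LEB x. ennreal ((cmod (Ext F (x, y)))\<^sup>2)) \<le> ennreal (8 * pi * a)"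
proof -
 have "(LEB x. ennreal ((cmod (Ext (\<lambda>om. F (snd om, fst om)) (y, x)))\<^sup>2)) \<le> ennreal (8 * pi * a)"
  using measurable_compose[OF measurable_circle_swap assms(1)] F supp a by (intro extension_slice_L2_snd) (auto simp: circle_L1_swap)
 then show ?thesis by (simp add: extension_op_swap)
qed

lemma integrable_extension:
 assumes [measurable]: "F \<in> borel_measurable \<sigma>" and F: "\<And>om. cmod (F om) \<le> B"
 shows "integrable \<sigma> (\<lambda>om. exp (\<i> * of_real (z \<bullet> om)) * F om)"
proof -
 interpret C: finite_measure \<sigma> by (rule finite_measure_circle)
 show ?thesis by (rule C.integrable_const_bound[where B = B]) (auto simp: norm_mult F)
qed

lemma nn_integral_abs_le_interval: "R \<ge> 0 \<Longrightarrow> (LEB x. indicator {x. \<bar>x\<bar> \<le> R} x) = ennreal (2 * R)"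
proof -
 assume "R \<ge> 0"
 have "{x. \<bar>x\<bar> \<le> R} = {-R..R}" by (auto simp: abs_le_iff)
 then show ?thesis using \<open>R \<ge> 0\<close> by simp
qed

text \<open>Every point of the circle has a coordinate of size at least 1/2. Splitting
  \<open>F\<close> accordingly, each half has energy of order \<open>a\<close> on all lines of one
  direction, and these lines are parametrised by an interval of length \<open>2 * R\<close>.\<close>

lemma extension_box_bound:
 assumes "circle_bound F a" and R: "R > 0"
 shows "(LEB z. ennreal ((cmod (Ext F z))\<^sup>2) * indicator {z. \<bar>fst z\<bar> \<le> R \<and> \<bar>snd z\<bar> \<le> R} z)
  \<le> ennreal (64 * pi * R * a)"
proof -
 have Fm[measurable]: "F \<in> borel_measurable \<sigma>" and F: "\<And>om. cmod (F om) \<le> 1"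
  and a: "0 < a" "(ARC om. ennreal (cmod (F om))) \<le> ennreal a" using assms by (auto simp: circle_bound_def)
 define F1 where "F1 om = (if 1 / 2 \<le> \<bar>fst om\<bar> then F om else 0)" for om
 define F2 where "F2 om = (if \<bar>fst om\<bar> < 1 / 2 \<and> 1 / 2 \<le> \<bar>snd om\<bar> then F om else 0)" for om
 have m[measurable]: "F1 \<in> borel_measurable \<sigma>" "F2 \<in> borel_measurable \<sigma>" unfolding F1_def F2_def by measurable
 have b: "cmod (F1 om) \<le> cmod (F om)" "cmod (F2 om) \<le> cmod (F om)" for om by (auto simp: F1_def F2_def)
 have b1: "cmod (F1 om) \<le> 1" "cmod (F2 om) \<le> 1" for om using b F order_trans by blast+
 have a1: "(ARC om. ennreal (cmod (F1 om))) \<le> ennreal a" "(ARC om. ennreal (cmod (F2 om))) \<le> ennreal a"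
  by (rule order_trans[OF nn_integral_mono a(2)], rule ennreal_leI, rule b)+
 have dec: "Ext F z = Ext F1 z + Ext F2 z" for z
 proof -
  have "F om = F1 om + F2 om" if "om \<in> space \<sigma>" for om
  proof (cases "1 / 2 \<le> \<bar>fst om\<bar>")
   case False
   have n1: "(fst om)\<^sup>2 + (snd om)\<^sup>2 = 1" using that by (cases om) (simp add: norm_Pair)
   have "1 / 2 \<le> \<bar>snd om\<bar>"
   proof (rule ccontr)
    assume "\<not> 1 / 2 \<le> \<bar>snd om\<bar>"
    then have "\<bar>snd om\<bar>\<^sup>2 \<le> (1/2)\<^sup>2" "\<bar>fst om\<bar>\<^sup>2 \<le> (1/2)\<^sup>2" using False by (intro power_mono; simp)+
    then show False using n1 by (simp add: power2_eq_square)
   qed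
   then show ?thesis using False by (simp add: F1_def F2_def)
  qed (auto simp: F1_def F2_def)
  then have "(\<integral>om. exp (\<i> * of_real (z \<bullet> om)) * F om \<partial>\<sigma>)
   = (\<integral>om. exp (\<i> * of_real (z \<bullet> om)) * F1 om + exp (\<i> * of_real (z \<bullet> om)) * F2 om \<partial>\<sigma>)"
   by (intro Bochner_Integration.integral_cong) (auto simp: ring_distribs)
  also have "... = (\<integral>om. exp (\<i> * of_real (z \<bullet> om)) * F1 om \<partial>\<sigma>) + (\<integral>om. exp (\<i> * of_real (z \<bullet> om)) * F2 om \<partial>\<sigma>)"
   by (intro Bochner_Integration.integral_add integrable_extension[where B = 1] m b1)
  finally show ?thesis unfolding extension_op_def by (simp add: ring_distribs)
 qed
 let ?e1 = "\<lambda>z. ennreal ((cmod (Ext F1 z))\<^sup>2)" and ?e2 = "\<lambda>z. ennreal ((cmod (Ext F2 z))\<^sup>2)"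
 let ?I = "indicator {x. \<bar>x\<bar> \<le> R} :: real \<Rightarrow> ennreal"
 have [measurable]: "(\<lambda>z::real \<times> real. ?I (fst z)) \<in> borel_measurable borel" "(\<lambda>z::real \<times> real. ?I (snd z)) \<in> borel_measurable borel"
  unfolding borel_prod[symmetric] by measurable
 have "(LEB z. ennreal ((cmod (Ext F z))\<^sup>2) * indicator {z. \<bar>fst z\<bar> \<le> R \<and> \<bar>snd z\<bar> \<le> R} z)
  \<le> (LEB z. ennreal 2 * (?I (fst z) * ?e1 z) + ennreal 2 * (?I (snd z) * ?e2 z))"
 proof (rule nn_integral_mono)
  fix z :: "real \<times> real"
  have "(cmod (Ext F z))\<^sup>2 \<le> (cmod (Ext F1 z) + cmod (Ext F2 z))\<^sup>2"
   unfolding dec by (intro power_mono norm_triangle_ineq) auto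
  also have "... \<le> 2 * (cmod (Ext F1 z))\<^sup>2 + 2 * (cmod (Ext F2 z))\<^sup>2"
   using zero_le_power2[of "cmod (Ext F1 z) - cmod (Ext F2 z)"] by (simp add: power2_eq_square algebra_simps)
  finally have "ennreal ((cmod (Ext F z))\<^sup>2) \<le> ennreal (2 * (cmod (Ext F1 z))\<^sup>2 + 2 * (cmod (Ext F2 z))\<^sup>2)"
   by (rule ennreal_leI)
  also have "... = ennreal 2 * ?e1 z + ennreal 2 * ?e2 z" by (simp add: ennreal_plus ennreal_mult)
  finally show "ennreal ((cmod (Ext F z))\<^sup>2) * indicator {z. \<bar>fst z\<bar> \<le> R \<and> \<bar>snd z\<bar> \<le> R} z
   \<le> ennreal 2 * (?I (fst z) * ?e1 z) + ennreal 2 * (?I (snd z) * ?e2 z)" by (auto simp: indicator_def)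
 qed
 also have "... = ennreal 2 * (LEB z. ?I (fst z) * ?e1 z) + ennreal 2 * (LEB z. ?I (snd z) * ?e2 z)"
  by (simp add: nn_integral_add nn_integral_cmult)
 also have "... \<le> ennreal 2 * (ennreal (2 * R) * ennreal (8 * pi * a)) + ennreal 2 * (ennreal (2 * R) * ennreal (8 * pi * a))"
 proof (intro add_mono mult_left_mono)
  have "(LEB z. ?I (fst z) * ?e1 z) \<le> (LEB x. ?I x) * ennreal (8 * pi * a)"
  proof (rule nn_integral_plane_slice_le)
   show "(LEB y. ?e1 (x, y)) \<le> ennreal (8 * pi * a)" for x
    using a by (intro extension_slice_L2_snd m b1 a1) (auto simp: F1_def split: if_splits)
  qed measurable
  then show "(LEB z. ?I (fst z) * ?e1 z) \<le> ennreal (2 * R) * ennreal (8 * pi * a)" using R by (subst (asm) nn_integral_abs_le_interval) auto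
  have e2s[measurable]: "(\<lambda>z. ?e2 (snd z, fst z)) \<in> borel_measurable borel"
   by (rule measurable_compose[of "\<lambda>z. (snd z, fst z)" borel borel])
    (auto intro!: borel_measurable_continuous_onI continuous_intros)
  have "(LEB z. ?I (snd z) * ?e2 z) = (LEB z. ?I (fst z) * ?e2 (snd z, fst z))"
   using nn_integral_plane_swap[of "\<lambda>z. ?I (snd z) * ?e2 z"] by simp
  also have "... \<le> (LEB x. ?I x) * ennreal (8 * pi * a)"
  proof (rule nn_integral_plane_slice_le)
   show "(LEB y. ?e2 (snd (x, y), fst (x, y))) \<le> ennreal (8 * pi * a)" for x unfolding fst_conv snd_conv
    using a by (intro extension_slice_L2_fst m b1 a1) (auto simp: F2_def split: if_splits)
  qed measurable
  finally show "(LEB z. ?I (snd z) * ?e2 z) \<le> ennreal (2 * R) * ennreal (8 * pi * a)" using R by (subst (asm) nn_integral_abs_le_interval) auto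
 qed auto
 also have "... = ennreal (64 * pi * R * a)"
 proof -
  have "ennreal 2 * (ennreal (2 * R) * ennreal (8 * pi * a)) = ennreal (2 * (2 * R * (8 * pi * a)))" using R a by (intro ennreal_mult3) auto
  then show ?thesis using R a by (simp only:) (subst ennreal_plus[symmetric], auto simp: mult_ac)
 qed
 finally show ?thesis .
qed

lemma extension_op_le:
 assumes "circle_bound F a"
 shows "cmod (Ext F z) \<le> a"
proof -
 have Fm[measurable]: "F \<in> borel_measurable \<sigma>" and F: "\<And>om. cmod (F om) \<le> 1"
  and a: "0 < a" "(ARC om. ennreal (cmod (F om))) \<le> ennreal a" using assms by (auto simp: circle_bound_def)
 let ?u = "\<lambda>om. exp (\<i> * of_real (z \<bullet> om)) * F om"
 have "ennreal (cmod (Ext F z)) \<le> ennreal (cmod (\<integral>om. ?u om \<partial>\<sigma>))"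
  unfolding extension_op_def by (intro ennreal_leI norm_extension_le)
 also have "... \<le> (ARC om. norm (?u om))" by (rule integral_norm_bound_ennreal[OF integrable_extension[OF Fm F]])
 also have "... \<le> ennreal a" using a by (simp add: norm_mult)
 finally show ?thesis using a by (subst (asm) ennreal_le_iff) auto
qed

lemma profile_bounds:
 fixes p s :: real
 assumes p: "p > 2" and s: "s > 4"
 obtains B where "B \<ge> 0"
  "\<And>F a. circle_bound F a \<Longrightarrow>
   (\<forall>x. (LEB y. ennreal (cmod (Ext F (x, y)) powr p)) \<le> ennreal (B * a powr (p - 2))) \<and>
   (LEB z. ennreal (cmod (Ext F z) powr s)) \<le> ennreal (B * a powr (s - 3)) \<and>
   (\<forall>R>0. (LEB z. ennreal ((cmod (Ext F z))\<^sup>2) * indicator {z. \<bar>fst z\<bar> \<le> R \<and> \<bar>snd z\<bar> \<le> R} z) \<le> ennreal (B * (R * a)))"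
proof -
 obtain C1 where C1: "C1 \<ge> 0" "\<And>F a x. circle_bound F a \<Longrightarrow> (LEB y. ennreal (cmod (Ext F (x, y)) powr p)) \<le> ennreal (C1 * a powr (p - 2))"
  by (rule extension_slice_bound[OF p]) (rule that)
 obtain C2 where C2: "C2 \<ge> 0" "\<And>F a. circle_bound F a \<Longrightarrow> (LEB z. ennreal (cmod (Ext F z) powr s)) \<le> ennreal (C2 * a powr (s - 3))"
  by (rule extension_global_bound[OF s]) (rule that)
 define B where "B = C1 + C2 + 64 * pi"
 have B: "C1 \<le> B" "C2 \<le> B" "64 * pi \<le> B" "B \<ge> 0" using C1(1) C2(1) by (auto simp: B_def)
 show thesis
 proof (rule that[OF B(4)], intro conjI allI impI)
  fix F a assume F: "circle_bound F a"
  then have a: "a > 0" by (auto simp: circle_bound_def)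
  show "(LEB y. ennreal (cmod (Ext F (x, y)) powr p)) \<le> ennreal (B * a powr (p - 2))" for x
   by (rule order_trans[OF C1(2)[OF F]]) (use B in \<open>auto intro!: ennreal_leI mult_right_mono\<close>)
  show "(LEB z. ennreal (cmod (Ext F z) powr s)) \<le> ennreal (B * a powr (s - 3))"
   by (rule order_trans[OF C2(2)[OF F]]) (use B in \<open>auto intro!: ennreal_leI mult_right_mono\<close>)
  fix R :: real assume R: "R > 0"
  show "(LEB z. ennreal ((cmod (Ext F z))\<^sup>2) * indicator {z. \<bar>fst z\<bar> \<le> R \<and> \<bar>snd z\<bar> \<le> R} z) \<le> ennreal (B * (R * a))"
   using mult_right_mono[OF B(3), of "R * a"] R a
   by (intro order_trans[OF extension_box_bound[OF F R]] ennreal_leI) (simp add: mult_ac)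
 qed
qed

text \<open>The parabolic substitution (X, Y) = (a x, a^2 y) and division by \<open>a\<close> turn
  the extension into a function bounded by 1 that satisfies the line and plane bounds with constants
  free of \<open>a\<close>. The power is read off from the scaling: \<open>q\<close> from the
  amplitude, -3 from the area, \<open>ga + 2 * de\<close> from the homogeneous weight. In the sector
  considered the dominant Knapp boxes are long in y; the other sector follows by exchanging the
  axes.\<close>

lemma half_plane_bound:
 fixes q ga de :: real
 assumes q: "q > 0" and ga: "0 \<le> ga" "ga < 1" and de: "0 \<le> de" "de < 1" and c: "ga + de > 2 - q / 2"
 obtains C where "C \<ge> 0"
  "\<And>F a. circle_bound F a \<Longrightarrow>
   (LEB z. ennreal (\<bar>fst z\<bar> powr (- ga) * \<bar>snd z\<bar> powr (- de) * cmod (Ext F z) powr q) * indicator {z. \<bar>fst z\<bar> \<le> \<bar>snd z\<bar>} z)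
    \<le> ennreal (C * a powr (q - 3 + ga + 2 * de))"
proof -
 obtain p s mu nu ka where pd: "plane_data ga de q p s mu nu ka"
  by (rule plane_exponents[OF assms]) (rule that)
 have e: "p > 2" "s > 4" using pd by (auto simp: plane_data_def)
 obtain B where B: "B \<ge> 0" and PB: "\<And>F a. circle_bound F a \<Longrightarrow>
   (\<forall>x. (LEB y. ennreal (cmod (Ext F (x, y)) powr p)) \<le> ennreal (B * a powr (p - 2))) \<and>
   (LEB z. ennreal (cmod (Ext F z) powr s)) \<le> ennreal (B * a powr (s - 3)) \<and>
   (\<forall>R>0. (LEB z. ennreal ((cmod (Ext F z))\<^sup>2) * indicator {z. \<bar>fst z\<bar> \<le> R \<and> \<bar>snd z\<bar> \<le> R} z) \<le> ennreal (B * (R * a)))"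
  by (rule profile_bounds[OF e(1,2)]) (rule that)
 define D where "D = core_const ga de mu nu ka B"
 have "D < \<top>" unfolding D_def core_const_def by (simp add: ennreal_mult_less_top less_top[symmetric] ennreal_mult_eq_top_iff)
 define C where "C = enn2real D"
 have C: "C \<ge> 0" "D = ennreal C" using \<open>D < \<top>\<close> by (auto simp: C_def)
 show thesis
 proof (rule that[of C])
  fix F a assume F: "circle_bound F a"
  define H where "H z = cmod (Ext F z)" for z
  have a: "a > 0" using F by (simp add: circle_bound_def)
  have Fm[measurable]: "F \<in> borel_measurable \<sigma>" using F by (simp add: circle_bound_def)
  have Hm[measurable]: "H \<in> borel_measurable borel" unfolding H_def by measurable
  have H: "0 \<le> H z" "H z \<le> a" for z using extension_op_le[OF F] by (auto simp: H_def)
  from PB[OF F] have h1: "\<And>x. (LEB y. ennreal (H (x, y) powr p)) \<le> ennreal (B * a powr (p - 2))"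
   and h2: "(LEB z. ennreal (H z powr s)) \<le> ennreal (B * a powr (s - 3))"
   and h3: "\<And>R. R > 0 \<Longrightarrow> (LEB z. ennreal ((H z)\<^sup>2) * indicator {z. \<bar>fst z\<bar> \<le> R \<and> \<bar>snd z\<bar> \<le> R} z) \<le> ennreal (B * (R * a))"
   by (auto simp: H_def)
  have a2: "a\<^sup>2 > 0" using a by simp
  have aa: "a * a\<^sup>2 = a powr 3" using a by (simp add: powr_numeral power2_eq_square power3_eq_cube)
  define K where "K z = H (fst z / a, snd z / a\<^sup>2) / a" for z
  have Km[measurable]: "K \<in> borel_measurable borel"
  proof -
   have "(\<lambda>z::real \<times> real. (fst z / a, snd z / a\<^sup>2)) \<in> borel_measurable borel"
    using a by (intro borel_measurable_continuous_onI continuous_intros) auto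
   from measurable_compose[OF this Hm] show ?thesis unfolding K_def by simp
  qed
  have K: "0 \<le> K z" "K z \<le> 1" for z using H a by (auto simp: K_def)
  have Ks: "K (a * x, a\<^sup>2 * y) = H (x, y) / a" for x y using a by (simp add: K_def)
  have Hdiv: "(H z / a) powr e = a powr (- e) * H z powr e" for z e using a H(1)[of z] by (subst powr_divide) (auto simp: powr_minus divide_simps)
  have scale: "(LEB z. f z) = ennreal (a powr 3) * (LEB z. f (a * fst z, a\<^sup>2 * snd z))"
   if "f \<in> borel_measurable borel" for f using nn_integral_plane_scale[OF that a a2] unfolding aa .
  have k1: "(LEB y. ennreal (K (x, y) powr p)) \<le> ennreal B" for x
  proof -
   have m: "(\<lambda>y. ennreal (H (x / a, y) powr p)) \<in> borel_measurable borel"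
   proof -
    have "(\<lambda>y::real. (x / a, y)) \<in> borel_measurable borel" by (intro borel_measurable_continuous_onI continuous_intros)
    from measurable_compose[OF this Hm] show ?thesis by simp
   qed
   have m': "(\<lambda>y. ennreal (K (x, y) powr p)) \<in> borel_measurable borel"
   proof -
    have "(\<lambda>y::real. (x, y)) \<in> borel_measurable borel" by (intro borel_measurable_continuous_onI continuous_intros)
    from measurable_compose[OF this Km] show ?thesis by simp
   qed
   have "(LEB y. ennreal (K (x, y) powr p)) = ennreal (a\<^sup>2) * (LEB y. ennreal (K (x, a\<^sup>2 * y) powr p))"
    using nn_integral_real_affine[OF m', of "a\<^sup>2" 0] a by simp
   also have "(LEB y. ennreal (K (x, a\<^sup>2 * y) powr p)) = (LEB y. ennreal (a powr (- p)) * ennreal (H (x / a, y) powr p))"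
    using a by (intro nn_integral_cong) (simp add: K_def Hdiv ennreal_mult)
   also have "... = ennreal (a powr (- p)) * (LEB y. ennreal (H (x / a, y) powr p))" by (rule nn_integral_cmult) (use m in simp)
   also have "ennreal (a\<^sup>2) * ... \<le> ennreal (a\<^sup>2) * (ennreal (a powr (- p)) * ennreal (B * a powr (p - 2)))"
    by (intro mult_left_mono h1) auto
   also have "... = ennreal (B * (a\<^sup>2 * (a powr (- p) * a powr (p - 2))))" using a B by (subst ennreal_mult3) (auto simp: mult_ac)
   also have "a\<^sup>2 * (a powr (- p) * a powr (p - 2)) = 1"
   proof -
    have "a powr (- p) * a powr (p - 2) = a powr (- 2)" by (simp add: powr_add[symmetric])
    then show ?thesis using a by (simp add: powr_minus)
   qed
   finally show ?thesis by simp
  qed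
  have k2: "(LEB z. ennreal (K z powr s)) \<le> ennreal B"
  proof -
   have "(LEB z. ennreal (K z powr s)) = ennreal (a powr 3) * (LEB z. ennreal (K (a * fst z, a\<^sup>2 * snd z) powr s))" by (rule scale) auto
   also have "(LEB z. ennreal (K (a * fst z, a\<^sup>2 * snd z) powr s)) = (LEB z. ennreal (a powr (- s)) * ennreal (H z powr s))"
    unfolding Ks by (intro nn_integral_cong) (simp add: Hdiv ennreal_mult)
   also have "... = ennreal (a powr (- s)) * (LEB z. ennreal (H z powr s))" by (rule nn_integral_cmult) auto
   also have "ennreal (a powr 3) * ... \<le> ennreal (a powr 3) * (ennreal (a powr (- s)) * ennreal (B * a powr (s - 3)))"
    by (intro mult_left_mono h2) auto
   also have "... = ennreal (B * (a powr 3 * (a powr (- s) * a powr (s - 3))))" using a B by (subst ennreal_mult3) (auto simp: mult_ac)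
   also have "a powr 3 * (a powr (- s) * a powr (s - 3)) = 1" using a by (simp only: powr_add[symmetric]) simp
   finally show ?thesis by simp
  qed
  have k3: "(LEB z. ennreal ((K z)\<^sup>2) * indicator {z. \<bar>fst z\<bar> \<le> R / a \<and> \<bar>snd z\<bar> \<le> R} z) \<le> ennreal (B * R)" if R: "R > 0" for R
  proof -
   have [measurable]: "{z::real \<times> real. \<bar>fst z\<bar> \<le> u \<and> \<bar>snd z\<bar> \<le> v} \<in> sets borel" for u v by measurable
   have "(LEB z. ennreal ((K z)\<^sup>2) * indicator {z. \<bar>fst z\<bar> \<le> R / a \<and> \<bar>snd z\<bar> \<le> R} z)
    = ennreal (a powr 3) * (LEB z. ennreal ((K (a * fst z, a\<^sup>2 * snd z))\<^sup>2) * indicator {z. \<bar>fst z\<bar> \<le> R / a \<and> \<bar>snd z\<bar> \<le> R} (a * fst z, a\<^sup>2 * snd z))"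
    by (rule scale) auto
   also have "(LEB z. ennreal ((K (a * fst z, a\<^sup>2 * snd z))\<^sup>2) * indicator {z. \<bar>fst z\<bar> \<le> R / a \<and> \<bar>snd z\<bar> \<le> R} (a * fst z, a\<^sup>2 * snd z))
    = (LEB z. ennreal (a powr (- 2)) * (ennreal ((H z)\<^sup>2) * indicator {z. \<bar>fst z\<bar> \<le> R / a\<^sup>2 \<and> \<bar>snd z\<bar> \<le> R / a\<^sup>2} z))"
   proof (intro nn_integral_cong)
    fix z :: "real \<times> real"
    have i: "(\<bar>a * fst z\<bar> \<le> R / a \<and> \<bar>a\<^sup>2 * snd z\<bar> \<le> R) \<longleftrightarrow> (\<bar>fst z\<bar> \<le> R / a\<^sup>2 \<and> \<bar>snd z\<bar> \<le> R / a\<^sup>2)"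
     using a by (simp add: abs_mult field_simps power2_eq_square)
    have "(H z / a)\<^sup>2 = a powr (- 2) * (H z)\<^sup>2" using a by (simp add: power_divide powr_minus divide_simps)
    then show "ennreal ((K (a * fst z, a\<^sup>2 * snd z))\<^sup>2) * indicator {z. \<bar>fst z\<bar> \<le> R / a \<and> \<bar>snd z\<bar> \<le> R} (a * fst z, a\<^sup>2 * snd z)
     = ennreal (a powr (- 2)) * (ennreal ((H z)\<^sup>2) * indicator {z. \<bar>fst z\<bar> \<le> R / a\<^sup>2 \<and> \<bar>snd z\<bar> \<le> R / a\<^sup>2} z)"
     unfolding Ks using i by (simp add: indicator_def ennreal_mult)
   qed
   also have "... = ennreal (a powr (- 2)) * (LEB z. ennreal ((H z)\<^sup>2) * indicator {z. \<bar>fst z\<bar> \<le> R / a\<^sup>2 \<and> \<bar>snd z\<bar> \<le> R / a\<^sup>2} z)"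
    by (rule nn_integral_cmult) auto
   also have "ennreal (a powr 3) * ... \<le> ennreal (a powr 3) * (ennreal (a powr (- 2)) * ennreal (B * (R / a\<^sup>2 * a)))"
    using R a by (intro mult_left_mono h3) auto
   also have "... = ennreal (a powr 3 * (a powr (- 2) * (B * (R / a\<^sup>2 * a))))" using a B R by (intro ennreal_mult3) auto
   also have "a powr 3 * (a powr (- 2) * (B * (R / a\<^sup>2 * a))) = B * R"
    using a by (simp add: powr_minus powr_numeral field_simps power2_eq_square power3_eq_cube)
   finally show ?thesis .
  qed
  have main: "(LEB z. ennreal (\<bar>fst z\<bar> powr (- ga) * \<bar>snd z\<bar> powr (- de) * K z powr q) * indicator {z. a * \<bar>fst z\<bar> \<le> \<bar>snd z\<bar>} z) \<le> ennreal C"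
   unfolding C(2)[symmetric] D_def by (rule weighted_core[OF Km K B a k1 k2 k3 ga de pd q])
  let ?T = "(LEB z. ennreal (\<bar>fst z\<bar> powr (- ga) * \<bar>snd z\<bar> powr (- de) * H z powr q) * indicator {z. \<bar>fst z\<bar> \<le> \<bar>snd z\<bar>} z)"
  let ?x = "- ga - 2 * de - q"
  have Dm[measurable]: "{z::real \<times> real. c * \<bar>fst z\<bar> \<le> \<bar>snd z\<bar>} \<in> sets borel" for c by measurable
  have Dm1[measurable]: "{z::real \<times> real. \<bar>fst z\<bar> \<le> \<bar>snd z\<bar>} \<in> sets borel" by measurable
  have "(LEB z. ennreal (\<bar>fst z\<bar> powr (- ga) * \<bar>snd z\<bar> powr (- de) * K z powr q) * indicator {z. a * \<bar>fst z\<bar> \<le> \<bar>snd z\<bar>} z)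
   = ennreal (a powr 3) * (LEB z. (\<lambda>z. ennreal (\<bar>fst z\<bar> powr (- ga) * \<bar>snd z\<bar> powr (- de) * K z powr q) * indicator {z. a * \<bar>fst z\<bar> \<le> \<bar>snd z\<bar>} z) (a * fst z, a\<^sup>2 * snd z))"
   by (rule scale) auto
  also have "(LEB z. (\<lambda>z. ennreal (\<bar>fst z\<bar> powr (- ga) * \<bar>snd z\<bar> powr (- de) * K z powr q) * indicator {z. a * \<bar>fst z\<bar> \<le> \<bar>snd z\<bar>} z) (a * fst z, a\<^sup>2 * snd z))
   = (LEB z. ennreal (a powr ?x) * (ennreal (\<bar>fst z\<bar> powr (- ga) * \<bar>snd z\<bar> powr (- de) * H z powr q) * indicator {z. \<bar>fst z\<bar> \<le> \<bar>snd z\<bar>} z))"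
  proof (intro nn_integral_cong)
   fix z :: "real \<times> real"
   have i: "(a * \<bar>a * fst z\<bar> \<le> \<bar>a\<^sup>2 * snd z\<bar>) \<longleftrightarrow> (\<bar>fst z\<bar> \<le> \<bar>snd z\<bar>)"
    using a by (simp add: abs_mult power2_eq_square)
   have 1: "\<bar>a * fst z\<bar> powr (- ga) = a powr (- ga) * \<bar>fst z\<bar> powr (- ga)" using a by (simp add: abs_mult powr_mult)
   have 2: "\<bar>a\<^sup>2 * snd z\<bar> powr (- de) = a powr (- 2 * de) * \<bar>snd z\<bar> powr (- de)"
   proof -
    have "(a\<^sup>2) powr (- de) = (a powr 2) powr (- de)" using a by (simp add: powr_numeral)
    also have "... = a powr (- 2 * de)" by (simp add: powr_powr)
    finally show ?thesis using a by (simp add: abs_mult powr_mult)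
   qed
   have 3: "(H z / a) powr q = a powr (- q) * H z powr q" by (rule Hdiv)
   have 4: "a powr ?x = a powr (- ga) * (a powr (- 2 * de) * a powr (- q))" by (simp add: powr_add[symmetric] algebra_simps)
   have "\<bar>a * fst z\<bar> powr (- ga) * \<bar>a\<^sup>2 * snd z\<bar> powr (- de) * (H z / a) powr q
    = a powr ?x * (\<bar>fst z\<bar> powr (- ga) * \<bar>snd z\<bar> powr (- de) * H z powr q)" unfolding 1 2 3 4 by (simp only: mult_ac)
   then show "(\<lambda>z. ennreal (\<bar>fst z\<bar> powr (- ga) * \<bar>snd z\<bar> powr (- de) * K z powr q) * indicator {z. a * \<bar>fst z\<bar> \<le> \<bar>snd z\<bar>} z) (a * fst z, a\<^sup>2 * snd z)
    = ennreal (a powr ?x) * (ennreal (\<bar>fst z\<bar> powr (- ga) * \<bar>snd z\<bar> powr (- de) * H z powr q) * indicator {z. \<bar>fst z\<bar> \<le> \<bar>snd z\<bar>} z)"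
    using i by (simp add: Ks ennreal_mult' indicator_def)
  qed
  also have "... = ennreal (a powr ?x) * ?T" by (rule nn_integral_cmult) auto
  finally have "ennreal (a powr 3) * (ennreal (a powr ?x) * ?T) \<le> ennreal C" using main by simp
  then have "ennreal (a powr (- 3 - ?x)) * (ennreal (a powr 3) * (ennreal (a powr ?x) * ?T)) \<le> ennreal (a powr (- 3 - ?x)) * ennreal C"
   by (rule mult_left_mono) simp
  also have "ennreal (a powr (- 3 - ?x)) * (ennreal (a powr 3) * (ennreal (a powr ?x) * ?T)) = ennreal (a powr (- 3 - ?x) * (a powr 3 * a powr ?x)) * ?T"
   by (simp add: ennreal_mult mult.assoc)
  also have "a powr (- 3 - ?x) * (a powr 3 * a powr ?x) = 1" using a by (simp only: powr_add[symmetric]) simp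
  also have "ennreal (a powr (- 3 - ?x)) * ennreal C = ennreal (C * a powr (q - 3 + ga + 2 * de))"
   using C by (subst ennreal_mult[symmetric]) (auto simp: algebra_simps)
  finally show "(LEB z. ennreal (\<bar>fst z\<bar> powr (- ga) * \<bar>snd z\<bar> powr (- de) * cmod (Ext F z) powr q) * indicator {z. \<bar>fst z\<bar> \<le> \<bar>snd z\<bar>} z)
   \<le> ennreal (C * a powr (q - 3 + ga + 2 * de))" by (simp add: H_def)
 qed (rule C)
qed

section \<open>Weighted bounds for normalised data\<close>

definition plane_weight :: "real \<Rightarrow> real \<Rightarrow> real \<times> real \<Rightarrow> real" where
 "plane_weight al be z = (1 + \<bar>fst z\<bar>) powr (- al) * (1 + \<bar>snd z\<bar>) powr (- be)"

lemma borel_measurable_plane_weight [measurable]: "plane_weight al be \<in> borel_measurable borel"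
 unfolding plane_weight_def by measurable

lemma plane_weight_bounds: "0 \<le> plane_weight al be z" "0 \<le> al \<Longrightarrow> 0 \<le> be \<Longrightarrow> plane_weight al be z \<le> 1"
proof -
 assume "0 \<le> al" "0 \<le> be"
 then have "plane_weight al be z \<le> 1 * 1" unfolding plane_weight_def by (intro mult_mono powr_le_one_neg) auto
 then show "plane_weight al be z \<le> 1" by simp
qed (simp add: plane_weight_def)

lemma plane_weight_antimono:
 "al' \<le> al \<Longrightarrow> be' \<le> be \<Longrightarrow> plane_weight al be z \<le> plane_weight al' be' z"
 unfolding plane_weight_def by (intro mult_mono powr_mono) auto

lemma plane_weight_powr:
 "plane_weight al be z powr q = (1 + \<bar>fst z\<bar>) powr (- (al * q)) * (1 + \<bar>snd z\<bar>) powr (- (be * q))"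
 unfolding plane_weight_def by (subst powr_mult) (auto simp: powr_powr)

text \<open>The parameters \<open>A\<close> and \<open>B\<close> are separated because the endpoint
  argument uses the estimate at two exponents on either side of \<open>q\<close> with the same
  \<open>A\<close> and \<open>B\<close>; the norm bound a^(A - B/q) is then the one that
  interpolation predicts in between.\<close>

definition restricted_bound :: "(real \<times> real \<Rightarrow> real) \<Rightarrow> real \<Rightarrow> real \<Rightarrow> real \<Rightarrow> bool" where
 "restricted_bound w q A B \<longleftrightarrow> (\<exists>C\<ge>0. \<forall>F a. circle_bound F a \<longrightarrow>
  (LEB z. ennreal ((w z * cmod (Ext F z)) powr q)) \<le> ennreal (C * a powr (q * A - B)))"

lemma powr_add_le:
 fixes a e d T :: real
 assumes "0 < a" "a \<le> T" "d \<ge> 0"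
 shows "a powr (e + d) \<le> T powr d * a powr e" using assms by (simp add: powr_add powr_mono2 mult_right_mono mult.commute)

text \<open>Since \<open>al * q\<close> and \<open>be * q\<close> are below 1, the weight may be
  replaced by the homogeneous one, which is locally integrable. The two sectors give the powers with
  \<open>ga + 2 * de\<close> and \<open>de + 2 * ga\<close>; the smaller is kept and the surplus of
  the other bounded through a \<le> 2 pi.\<close>

lemma restricted_bound_plane:
 assumes al: "0 \<le> al" "al * q < 1" and be: "0 \<le> be" "be * q < 1" and q: "q > 0"
  and c: "al + be > 2 / q - 1 / 2"
 shows "restricted_bound (plane_weight al be) q (1 + al + be + min al be) 3"
proof -
 define ga de where "ga = al * q" and "de = be * q"
 have ga: "0 \<le> ga" "ga < 1" and de: "0 \<le> de" "de < 1" using al be q by (auto simp: ga_def de_def)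
 have "(al + be) * q > (2 / q - 1 / 2) * q" using c q by (intro mult_strict_right_mono) auto
 then have c1: "ga + de > 2 - q / 2" using q by (simp add: ga_def de_def algebra_simps)
 then have c2: "de + ga > 2 - q / 2" by simp
 obtain C1 where C1: "C1 \<ge> 0" and B1: "\<And>F a. circle_bound F a \<Longrightarrow>
   (LEB z. ennreal (\<bar>fst z\<bar> powr (- ga) * \<bar>snd z\<bar> powr (- de) * cmod (Ext F z) powr q) * indicator {z. \<bar>fst z\<bar> \<le> \<bar>snd z\<bar>} z)
    \<le> ennreal (C1 * a powr (q - 3 + ga + 2 * de))" by (rule half_plane_bound[OF q ga de c1]) (rule that)
 obtain C2 where C2: "C2 \<ge> 0" and B2: "\<And>F a. circle_bound F a \<Longrightarrow>
   (LEB z. ennreal (\<bar>fst z\<bar> powr (- de) * \<bar>snd z\<bar> powr (- ga) * cmod (Ext F z) powr q) * indicator {z. \<bar>fst z\<bar> \<le> \<bar>snd z\<bar>} z)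
    \<le> ennreal (C2 * a powr (q - 3 + de + 2 * ga))" by (rule half_plane_bound[OF q de ga c2]) (rule that)
 define m where "m = min ga de"
 have m: "m \<le> ga" "m \<le> de" by (auto simp: m_def)
 have mm: "m = q * min al be" using q by (auto simp: m_def ga_def de_def min_def)
 define e where "e = q - 3 + ga + de + m"
 have e: "e = q * (1 + al + be + min al be) - 3" unfolding e_def mm ga_def de_def by (simp add: algebra_simps)
 define C where "C = C1 * (2 * pi) powr (de - m) + C2 * (2 * pi) powr (ga - m)"
 have C: "C \<ge> 0" using C1 C2 by (simp add: C_def)
 show ?thesis unfolding restricted_bound_def
 proof (intro exI[of _ C] conjI C allI impI)
  fix F a assume F: "circle_bound F a"
  then have Fm[measurable]: "F \<in> borel_measurable \<sigma>" and a: "0 < a" "a \<le> 2 * pi" by (auto simp: circle_bound_def)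
  let ?e = "\<lambda>z. cmod (Ext F z)"
  let ?f = "\<lambda>z. ennreal (\<bar>fst z\<bar> powr (- ga) * \<bar>snd z\<bar> powr (- de) * ?e z powr q)"
  let ?f1 = "\<lambda>z. ?f z * indicator {z. \<bar>fst z\<bar> \<le> \<bar>snd z\<bar>} z" and ?f2 = "\<lambda>z. ?f z * indicator {z. \<bar>snd z\<bar> \<le> \<bar>fst z\<bar>} z"
  have [measurable]: "{z::real \<times> real. \<bar>fst z\<bar> \<le> \<bar>snd z\<bar>} \<in> sets borel" "{z::real \<times> real. \<bar>snd z\<bar> \<le> \<bar>fst z\<bar>} \<in> sets borel"
   by measurable
  have f1: "(LEB z. ?f1 z) \<le> ennreal (C1 * (2 * pi) powr (de - m) * a powr e)"
  proof -
   have "(LEB z. ?f1 z) \<le> ennreal (C1 * a powr (q - 3 + ga + 2 * de))" by (rule B1[OF F])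
   also have "q - 3 + ga + 2 * de = e + (de - m)" by (simp add: e_def)
   also have "ennreal (C1 * a powr (e + (de - m))) \<le> ennreal (C1 * ((2 * pi) powr (de - m) * a powr e))"
    using a m C1 by (intro ennreal_leI mult_left_mono powr_add_le) auto
   finally show ?thesis by (simp add: mult.assoc)
  qed
  have f2: "(LEB z. ?f2 z) \<le> ennreal (C2 * (2 * pi) powr (ga - m) * a powr e)"
  proof -
   have "(LEB z. ?f2 z) = (LEB z. ?f2 (snd z, fst z))" by (rule nn_integral_plane_swap[symmetric]) auto
   also have "... = (LEB z. ennreal (\<bar>fst z\<bar> powr (- de) * \<bar>snd z\<bar> powr (- ga) * ?e (snd z, fst z) powr q) * indicator {z. \<bar>fst z\<bar> \<le> \<bar>snd z\<bar>} z)"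
    by (intro nn_integral_cong) (auto simp: indicator_def mult_ac)
   also have "... \<le> ennreal (C2 * a powr (q - 3 + de + 2 * ga))"
    using B2[OF circle_bound_swap[OF F]] by (simp add: extension_op_swap)
   also have "q - 3 + de + 2 * ga = e + (ga - m)" by (simp add: e_def)
   also have "ennreal (C2 * a powr (e + (ga - m))) \<le> ennreal (C2 * ((2 * pi) powr (ga - m) * a powr e))"
    using a m C2 by (intro ennreal_leI mult_left_mono powr_add_le) auto
   finally show ?thesis by (simp add: mult.assoc)
  qed
  have "(LEB z. ennreal ((plane_weight al be z * ?e z) powr q)) \<le> (LEB z. ?f1 z + ?f2 z)"
  proof (rule nn_integral_mono_AE)
   \<comment> \<open>On the axes the homogeneous weight takes the value 0, since
     \<open>0 powr x = 0\<close>, and does not dominate; hence the exceptional null set.\<close>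
   show "AE z in lborel. ennreal ((plane_weight al be z * ?e z) powr q) \<le> ?f1 z + ?f2 z" using AE_plane_nonzero
   proof eventually_elim
    case (elim z)
    have "(plane_weight al be z * ?e z) powr q = (1 + \<bar>fst z\<bar>) powr (- ga) * (1 + \<bar>snd z\<bar>) powr (- de) * ?e z powr q"
     using plane_weight_bounds(1) by (simp add: powr_mult plane_weight_powr ga_def de_def)
    also have "... \<le> \<bar>fst z\<bar> powr (- ga) * \<bar>snd z\<bar> powr (- de) * ?e z powr q"
     using elim ga de by (intro mult_right_mono mult_mono powr_mono_base_neg) auto
    finally have "ennreal ((plane_weight al be z * ?e z) powr q) \<le> ?f z" by (rule ennreal_leI)
    also have "... \<le> ?f1 z + ?f2 z" by (cases "\<bar>fst z\<bar> \<le> \<bar>snd z\<bar>") (auto simp: indicator_def)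
    finally show ?case .
   qed
  qed
  also have "... = (LEB z. ?f1 z) + (LEB z. ?f2 z)" by (rule nn_integral_add) auto
  also have "... \<le> ennreal (C1 * (2 * pi) powr (de - m) * a powr e) + ennreal (C2 * (2 * pi) powr (ga - m) * a powr e)"
   by (intro add_mono f1 f2)
  also have "... = ennreal (C * a powr e)" using C1 C2 by (subst ennreal_plus[symmetric]) (auto simp: C_def algebra_simps)
  finally show "(LEB z. ennreal ((plane_weight al be z * ?e z) powr q)) \<le> ennreal (C * a powr (q * (1 + al + be + min al be) - 3))"
   unfolding e .
 qed
qed

lemma nn_integral_weight_line:
 fixes ga :: real
 assumes "ga > 1"
 shows "(LEB x. ennreal ((1 + \<bar>x\<bar>) powr (- ga))) \<le> ennreal (2 + 2 / (ga - 1))"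
proof -
 have "(LEB x. ennreal ((1 + \<bar>x\<bar>) powr (- ga))) \<le>
  (LEB x. indicator {x::real. \<bar>x\<bar> \<le> 1} x + ennreal (\<bar>x\<bar> powr (- ga)) * indicator {x. 1 \<le> \<bar>x\<bar>} x)"
 proof (rule nn_integral_mono)
  fix x :: real
  show "ennreal ((1 + \<bar>x\<bar>) powr (- ga)) \<le> indicator {x::real. \<bar>x\<bar> \<le> 1} x + ennreal (\<bar>x\<bar> powr (- ga)) * indicator {x. 1 \<le> \<bar>x\<bar>} x"
  proof (cases "\<bar>x\<bar> \<le> 1")
   case True
   have "ennreal ((1 + \<bar>x\<bar>) powr (- ga)) \<le> ennreal 1" using assms by (intro ennreal_leI powr_le_one_neg) auto
   then show ?thesis using True by (simp add: add_increasing2)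
  next
   case False
   then have "ennreal ((1 + \<bar>x\<bar>) powr (- ga)) \<le> ennreal (\<bar>x\<bar> powr (- ga))"
    using assms by (intro ennreal_leI powr_mono_base_neg) auto
   then show ?thesis using False by simp
  qed
 qed
 also have "... = (LEB x. indicator {x::real. \<bar>x\<bar> \<le> 1} x) + (LEB x. ennreal (\<bar>x\<bar> powr (- ga)) * indicator {x. 1 \<le> \<bar>x\<bar>} x)"
  
  by (rule nn_integral_add) auto
 also have "... \<le> ennreal (2 * 1) + ennreal (2 / (ga - 1) * 1 powr (1 - ga))"
  by (intro add_mono nn_integral_abs_powr_large assms eq_refl[OF nn_integral_abs_le_interval]) auto
 also have "... = ennreal (2 + 2 / (ga - 1))" using assms by (subst ennreal_plus[symmetric]) auto
 finally show ?thesis .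
qed

text \<open>For al q > 1 the weight in x is integrable by itself, so a bound for each vertical line,
  uniform in x, is enough. Only the long side of the Knapp box then matters, which replaces
  \<open>B = 3\<close> by \<open>B = 2\<close>.\<close>

lemma profile_line_bound:
 assumes q: "q > 0" and al: "al * q > 1" and be: "0 \<le> be" "be * q < 1" "be * q > 1 - q / 2"
 shows "restricted_bound (plane_weight al be) q (1 + 2 * be) 2"
proof -
 define ga de where "ga = al * q" and "de = be * q"
 have ga: "ga > 1" and de: "0 \<le> de" "de < 1" "de > 1 - q / 2" using al be q by (auto simp: ga_def de_def)
 obtain p mu where p: "p > 2" and mu: "mu > 1"
  and P: "\<And>Y t. 1 \<le> Y \<Longrightarrow> 0 \<le> t \<Longrightarrow> t \<le> 1 \<Longrightarrow> Y powr (- de) * t powr q \<le> Y powr (- mu) + t powr p"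
  by (rule slice_exponents[OF q de]) (rule that)
 \<comment> \<open>\<open>profile_bounds\<close> asks for an exponent above 4; the value 5 is
   arbitrary.\<close>
 have s5: "(5::real) > 4" by simp
 obtain B where B: "B \<ge> 0" and PB: "\<And>F a. circle_bound F a \<Longrightarrow>
   (\<forall>x. (LEB y. ennreal (cmod (Ext F (x, y)) powr p)) \<le> ennreal (B * a powr (p - 2))) \<and>
   (LEB z. ennreal (cmod (Ext F z) powr 5)) \<le> ennreal (B * a powr (5 - 3)) \<and>
   (\<forall>R>0. (LEB z. ennreal ((cmod (Ext F z))\<^sup>2) * indicator {z. \<bar>fst z\<bar> \<le> R \<and> \<bar>snd z\<bar> \<le> R} z) \<le> ennreal (B * (R * a)))"
  by (rule profile_bounds[OF p s5]) (rule that)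
 define D where "D = 2 / (1 - de) + 2 / (mu - 1) + B"
 have D: "D \<ge> 0" using de mu B by (simp add: D_def)
 define C where "C = (2 + 2 / (ga - 1)) * D"
 have C: "C \<ge> 0" using D ga by (simp add: C_def)
 show ?thesis unfolding restricted_bound_def
 proof (intro exI[of _ C] conjI C allI impI)
  fix F a assume F: "circle_bound F a"
  define H where "H z = cmod (Ext F z)" for z
  have a: "a > 0" using F by (simp add: circle_bound_def)
  have Fm[measurable]: "F \<in> borel_measurable \<sigma>" using F by (simp add: circle_bound_def)
  have Hm[measurable]: "H \<in> borel_measurable borel" unfolding H_def by measurable
  have H: "0 \<le> H z" "H z \<le> a" for z using extension_op_le[OF F] by (auto simp: H_def)
  from PB[OF F] have h1: "(LEB y. ennreal (H (x, y) powr p)) \<le> ennreal (B * a powr (p - 2))" for x by (auto simp: H_def)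
  define j :: "real \<Rightarrow> ennreal" where "j y = ennreal (\<bar>y\<bar> powr (- de)) * indicator {y. \<bar>y\<bar> \<le> 1} y + ennreal (\<bar>y\<bar> powr (- mu)) * indicator {y. 1 \<le> \<bar>y\<bar>} y" for y
  have jm[measurable]: "j \<in> borel_measurable borel" unfolding j_def by measurable
  have jint: "(LEB y. j y) \<le> ennreal (2 / (1 - de) + 2 / (mu - 1))"
  proof -
   have "(LEB y. j y) = (LEB y. ennreal (\<bar>y\<bar> powr (- de)) * indicator {y. \<bar>y\<bar> \<le> 1} y) +
     (LEB y. ennreal (\<bar>y\<bar> powr (- mu)) * indicator {y. 1 \<le> \<bar>y\<bar>} y)" unfolding j_def by (rule nn_integral_add) auto
   also have "... \<le> ennreal (2 / (1 - de)) + ennreal (2 / (mu - 1) * 1 powr (1 - mu))"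
    using de mu by (intro add_mono nn_integral_abs_powr_small nn_integral_abs_powr_large) auto
   also have "... = ennreal (2 / (1 - de) + 2 / (mu - 1))" using de mu by (subst ennreal_plus) auto
   finally show ?thesis .
  qed
  let ?K = "\<lambda>z. ennreal (((1 + \<bar>snd z\<bar>) powr (- be) * H z) powr q)"
  \<comment> \<open>Along a line only y is rescaled, by a^2. The power \<open>2 * de + q\<close>
    collects the weight and the amplitude; the length element will contribute -2.\<close>
  let ?x = "2 * de + q"
  have slice: "(LEB y. ?K (x, y)) \<le> ennreal (D * a powr (?x - 2))" for x
  proof -
   have m: "(\<lambda>y. ennreal (H (x, y) powr p)) \<in> borel_measurable borel"
   proof -
    have "(\<lambda>y::real. (x, y)) \<in> borel_measurable borel" by (intro borel_measurable_continuous_onI continuous_intros)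
    from measurable_compose[OF this Hm] show ?thesis by simp
   qed
   have "(LEB y. ?K (x, y)) \<le> (LEB y. ennreal (a powr ?x) * (j (a\<^sup>2 * y) + ennreal (a powr (- p)) * ennreal (H (x, y) powr p)))"
   proof (rule nn_integral_mono_AE)
    show "AE y in lborel. ?K (x, y) \<le> ennreal (a powr ?x) * (j (a\<^sup>2 * y) + ennreal (a powr (- p)) * ennreal (H (x, y) powr p))"
     using AE_lborel_singleton[of "0::real"]
    proof eventually_elim
     case (elim y)
     define Y t where "Y = a\<^sup>2 * \<bar>y\<bar>" and "t = H (x, y) / a"
     have Y: "Y > 0" using a elim by (simp add: Y_def)
     have t: "0 \<le> t" "t \<le> 1" using H a by (auto simp: t_def)
     have tp: "t powr e = a powr (- e) * H (x, y) powr e" for e using a H by (simp add: t_def powr_divide powr_minus divide_simps)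
     have "ennreal (Y powr (- de) * t powr q) \<le> j (a\<^sup>2 * y) + ennreal (t powr p)"
     proof (cases "Y \<le> 1")
      case True
      have "Y powr (- de) * t powr q \<le> Y powr (- de) * 1" using t q powr_mono2[of q t 1] by (intro mult_left_mono) auto
      then have "ennreal (Y powr (- de) * t powr q) \<le> ennreal (Y powr (- de))" by (intro ennreal_leI) simp
      also have "... \<le> j (a\<^sup>2 * y)" using True a by (simp add: j_def Y_def abs_mult indicator_def)
      finally show ?thesis by (simp add: add_increasing2)
     next
      case False
      have "ennreal (Y powr (- de) * t powr q) \<le> ennreal (Y powr (- mu) + t powr p)" using False t by (intro ennreal_leI P) auto
      also have "... = ennreal (Y powr (- mu)) + ennreal (t powr p)" by simp
      also have "... \<le> j (a\<^sup>2 * y) + ennreal (t powr p)"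
       using False a by (intro add_right_mono) (simp add: j_def Y_def abs_mult indicator_def)
      finally show ?thesis .
     qed
     then have "ennreal (a powr ?x) * ennreal (Y powr (- de) * t powr q) \<le> ennreal (a powr ?x) * (j (a\<^sup>2 * y) + ennreal (t powr p))"
      by (rule mult_left_mono) simp
     moreover have "?K (x, y) \<le> ennreal (a powr ?x) * ennreal (Y powr (- de) * t powr q)"
     proof -
      have "((1 + \<bar>y\<bar>) powr (- be) * H (x, y)) powr q = (1 + \<bar>y\<bar>) powr (- de) * H (x, y) powr q"
       using H by (simp add: powr_mult powr_powr de_def)
      also have "... \<le> \<bar>y\<bar> powr (- de) * H (x, y) powr q" using elim de by (intro mult_right_mono powr_mono_base_neg) auto
      also have "... = a powr ?x * (Y powr (- de) * t powr q)"
      proof -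
       have 1: "Y powr (- de) = a powr (- 2 * de) * \<bar>y\<bar> powr (- de)"
       proof -
        have "(a\<^sup>2) powr (- de) = (a powr 2) powr (- de)" using a by (simp add: powr_numeral)
        also have "... = a powr (- 2 * de)" by (simp add: powr_powr)
        finally show ?thesis using a by (simp add: Y_def powr_mult)
       qed
       have "a powr ?x * (a powr (- 2 * de) * a powr (- q)) = 1" using a by (simp only: powr_add[symmetric]) simp
       then have "a powr ?x * ((a powr (- 2 * de) * u) * (a powr (- q) * v)) = u * v" for u v
        by (metis (no_types, lifting) mult.assoc mult.commute mult.left_neutral)
       then show ?thesis unfolding 1 tp by simp
      qed
      finally show ?thesis by (subst ennreal_mult[symmetric]) (auto intro!: ennreal_leI)
     qed
     moreover have "ennreal (t powr p) = ennreal (a powr (- p)) * ennreal (H (x, y) powr p)" unfolding tp by (simp add: ennreal_mult)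
     ultimately show ?case by simp
    qed
   qed
   also have "... = ennreal (a powr ?x) * ((LEB y. j (a\<^sup>2 * y)) + ennreal (a powr (- p)) * (LEB y. ennreal (H (x, y) powr p)))"
    using m by (simp add: nn_integral_cmult nn_integral_add)
   also have "... \<le> ennreal (a powr ?x) * (ennreal (a powr (- 2)) * ennreal (2 / (1 - de) + 2 / (mu - 1)) + ennreal (a powr (- p)) * ennreal (B * a powr (p - 2)))"
   proof (intro mult_left_mono add_mono h1)
    have "(LEB y. j y) = ennreal (a\<^sup>2) * (LEB y. j (a\<^sup>2 * y))" using nn_integral_real_affine[OF jm, of "a\<^sup>2" 0] a by simp
    then have "ennreal (a powr (- 2)) * (LEB y. j y) = ennreal (a powr (- 2) * a\<^sup>2) * (LEB y. j (a\<^sup>2 * y))"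
     by (simp add: ennreal_mult mult.assoc)
    also have "a powr (- 2) * a\<^sup>2 = 1" using a by (simp add: powr_minus)
    finally have "(LEB y. j (a\<^sup>2 * y)) = ennreal (a powr (- 2)) * (LEB y. j y)" by simp
    also have "... \<le> ennreal (a powr (- 2)) * ennreal (2 / (1 - de) + 2 / (mu - 1))" by (intro mult_left_mono jint) auto
    finally show "(LEB y. j (a\<^sup>2 * y)) \<le> ennreal (a powr (- 2)) * ennreal (2 / (1 - de) + 2 / (mu - 1))" .
   qed auto
   also have "... = ennreal (a powr ?x * (a powr (- 2) * (2 / (1 - de) + 2 / (mu - 1)) + a powr (- p) * (B * a powr (p - 2))))"
   proof -
    have "ennreal t * (ennreal u * ennreal v + ennreal w * ennreal y) = ennreal (t * (u * v + w * y))"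
     if "0 \<le> t" "0 \<le> u" "0 \<le> v" "0 \<le> w" "0 \<le> y" for t u v w y :: real using that by (simp add: ennreal_mult ennreal_plus)
    note * = this
    show ?thesis by (rule *) (use B de mu in auto)
   qed
   also have "a powr ?x * (a powr (- 2) * (2 / (1 - de) + 2 / (mu - 1)) + a powr (- p) * (B * a powr (p - 2))) = D * a powr (?x - 2)"
   proof -
    have 1: "a powr (- p) * a powr (p - 2) = a powr (- 2)" by (simp add: powr_add[symmetric])
    have 2: "a powr (?x - 2) = a powr ?x * a powr (- 2)" by (simp add: powr_add[symmetric])
    have "a powr ?x * (a powr (- 2) * u + a powr (- p) * (B * a powr (p - 2))) = a powr ?x * (a powr (- 2) * u + B * (a powr (- p) * a powr (p - 2)))" for u
     by (simp add: mult_ac)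
    then show ?thesis unfolding 1 2 D_def by (simp add: algebra_simps)
   qed
   finally show ?thesis .
  qed
  have "(LEB z. ennreal ((plane_weight al be z * H z) powr q)) = (LEB z. ennreal ((1 + \<bar>fst z\<bar>) powr (- ga)) * ?K z)"
  proof (intro nn_integral_cong)
   fix z :: "real \<times> real"
   have "(plane_weight al be z * H z) powr q = (1 + \<bar>fst z\<bar>) powr (- ga) * ((1 + \<bar>snd z\<bar>) powr (- be) * H z) powr q"
    using H plane_weight_bounds(1) by (simp add: powr_mult plane_weight_powr powr_powr ga_def)
   then show "ennreal ((plane_weight al be z * H z) powr q) = ennreal ((1 + \<bar>fst z\<bar>) powr (- ga)) * ?K z"
    by (simp add: ennreal_mult)
  qed
  also have "... \<le> (LEB x. ennreal ((1 + \<bar>x\<bar>) powr (- ga))) * ennreal (D * a powr (?x - 2))"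
   by (rule nn_integral_plane_slice_le) (use slice in auto)
  also have "... \<le> ennreal (2 + 2 / (ga - 1)) * ennreal (D * a powr (?x - 2))" by (intro mult_right_mono nn_integral_weight_line ga) auto
  also have "... = ennreal (C * a powr (?x - 2))" using D ga by (subst ennreal_mult[symmetric]) (auto simp: C_def)
  also have "?x - 2 = q * (1 + 2 * be) - 2" by (simp add: de_def algebra_simps)
  finally show "(LEB z. ennreal ((plane_weight al be z * cmod (Ext F z)) powr q)) \<le> ennreal (C * a powr (q * (1 + 2 * be) - 2))"
   unfolding H_def .
 qed
qed

lemma restricted_bound_swap:
 assumes "restricted_bound (plane_weight al be) q A B"
 shows "restricted_bound (plane_weight be al) q A B"
proof -
 obtain C where C: "C \<ge> 0" "\<And>F a. circle_bound F a \<Longrightarrow>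
  (LEB z. ennreal ((plane_weight al be z * cmod (Ext F z)) powr q)) \<le> ennreal (C * a powr (q * A - B))"
  using assms unfolding restricted_bound_def by auto
 show ?thesis unfolding restricted_bound_def
 proof (intro exI[of _ C] conjI C(1) allI impI)
  fix F a assume F: "circle_bound F a"
  then have [measurable]: "F \<in> borel_measurable \<sigma>" by (auto simp: circle_bound_def)
  have "(LEB z. ennreal ((plane_weight be al z * cmod (Ext F z)) powr q))
   = (LEB z. ennreal ((plane_weight be al (snd z, fst z) * cmod (Ext F (snd z, fst z))) powr q))"
   by (rule nn_integral_plane_swap[of "\<lambda>z. ennreal ((plane_weight be al z * cmod (Ext F z)) powr q)", symmetric]) auto
  also have "... = (LEB z. ennreal ((plane_weight al be z * cmod (Ext (\<lambda>om. F (snd om, fst om)) z)) powr q))"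
   by (simp add: plane_weight_def mult.commute extension_op_swap)
  also have "... \<le> ennreal (C * a powr (q * A - B))" by (rule C(2)[OF circle_bound_swap[OF F]])
  finally show "(LEB z. ennreal ((plane_weight be al z * cmod (Ext F z)) powr q)) \<le> ennreal (C * a powr (q * A - B))" .
 qed
qed

lemma restricted_bound_line:
 assumes q: "q > 0" and "0 \<le> al" "0 \<le> be" "max al be * q > 1" "min al be * q < 1" "min al be * q > 1 - q / 2"
 shows "restricted_bound (plane_weight al be) q (1 + 2 * min al be) 2"
proof (cases "be \<le> al")
 case True
 then show ?thesis using profile_line_bound[OF q, of al be] assms by simp
next
 case False
 then show ?thesis using restricted_bound_swap[OF profile_line_bound[OF q, of be al]] assms by simp
qed

section \<open>Rearrangement and summation of levels\<close>

text \<open>\<open>L j\<close> is the decreasing rearrangement of \<open>f\<close> at \<open>T / 2 ^ j\<close>.\<close>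

lemma rearrangement_levels:
 fixes f :: "'a \<Rightarrow> real" and T r :: real
 assumes M: "finite_measure M" and [measurable]: "f \<in> borel_measurable M" and f: "\<And>om. f om \<ge> 0"
  and T: "T > 0" "measure M (space M) \<le> T" and r: "r > 0"
 obtains L :: "nat \<Rightarrow> real" where "L 0 = 0" "\<And>j. L j \<le> L (Suc j)"
  "\<And>j. measure M {om \<in> space M. L j < f om} \<le> T / 2 ^ j"
  "AE om in M. f om = 0 \<or> (\<exists>j. L j < f om \<and> f om \<le> L (Suc j))"
  "\<And>n. ennreal (\<Sum>j\<le>n. T / 2 ^ j * L j powr r) \<le> 2 * (\<integral>\<^sup>+om. ennreal (f om powr r) \<partial>M)"
proof -
 interpret M: finite_measure M by fact
 define m where "m t = measure M {om \<in> space M. t < f om}" for t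
 have m_mono: "m t \<le> m u" if "u \<le> t" for t u unfolding m_def using that by (intro M.finite_measure_mono) auto
 define S where "S j = {t. 0 \<le> t \<and> m t \<le> T / 2 ^ j}" for j :: nat
 define L where "L j = Inf (S j)" for j
 have bdd: "bdd_below (S j)" for j by (rule bdd_belowI[of _ 0]) (simp add: S_def)
 have m0: "(\<lambda>n. m (real n)) \<longlonglongrightarrow> 0"
 proof -
  have "(\<lambda>n. measure M {om \<in> space M. real n < f om}) \<longlonglongrightarrow> measure M (\<Inter>n. {om \<in> space M. real n < f om})"
   by (rule M.finite_Lim_measure_decseq) (auto simp: decseq_def)
  also have "(\<Inter>n. {om \<in> space M. real n < f om}) = {}"
  proof -
   have False if "\<And>n. real n < f om" for om using reals_Archimedean2[of "f om"] that by (meson less_asym)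
   then show ?thesis by auto
  qed
  finally show ?thesis by (simp add: m_def)
 qed
 have ne: "S j \<noteq> {}" for j
 proof -
  have "T / 2 ^ j > 0" using T by simp
  then have "\<forall>\<^sub>F n in sequentially. m (real n) < T / 2 ^ j" by (rule order_tendstoD(2)[OF m0])
  then obtain n where "m (real n) < T / 2 ^ j" by (auto simp: eventually_sequentially)
  then have "real n \<in> S j" by (simp add: S_def)
  then show ?thesis by auto
 qed
 have L_nonneg: "L j \<ge> 0" for j unfolding L_def using ne by (intro cInf_greatest) (auto simp: S_def)
 have "0 \<in> S 0" using T by (simp add: S_def m_def) (rule order_trans[OF M.bounded_measure])
 then have "L 0 \<le> 0" unfolding L_def by (intro cInf_lower bdd)
 then have L0: "L 0 = 0" using L_nonneg[of 0] by simp
 have "T / 2 ^ Suc j \<le> T / 2 ^ j" for j using T by (simp add: field_simps)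
 then have sub: "S (Suc j) \<subseteq> S j" for j unfolding S_def by (auto intro: order_trans)
 have Lmono: "L j \<le> L (Suc j)" for j unfolding L_def by (rule cInf_superset_mono[OF ne bdd sub])
 \<comment> \<open>Right continuity of the distribution function: the infimum that defines
   \<open>L j\<close> is attained.\<close>
 have mL: "m (L j) \<le> T / 2 ^ j" for j
 proof -
  have "(\<lambda>n. measure M {om \<in> space M. L j + 1 / real (Suc n) < f om}) \<longlonglongrightarrow> measure M (\<Union>n. {om \<in> space M. L j + 1 / real (Suc n) < f om})"
  proof (rule M.finite_Lim_measure_incseq)
   show "incseq (\<lambda>n. {om \<in> space M. L j + 1 / real (Suc n) < f om})"
   proof (rule incseq_SucI, safe)
    fix n om assume "L j + 1 / real (Suc n) < f om"
    moreover have "1 / real (Suc (Suc n)) \<le> 1 / real (Suc n)" by (intro divide_left_mono) auto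
    ultimately show "L j + 1 / real (Suc (Suc n)) < f om" by linarith
   qed
  qed auto
  moreover have "(\<Union>n. {om \<in> space M. L j + 1 / real (Suc n) < f om}) = {om \<in> space M. L j < f om}"
  proof (intro equalityI subsetI)
   fix om assume "om \<in> {om \<in> space M. L j < f om}"
   then have "om \<in> space M" "0 < f om - L j" by auto
   then obtain n where "inverse (real (Suc n)) < f om - L j" using reals_Archimedean by blast
   then have "L j + 1 / real (Suc n) < f om" by (simp add: inverse_eq_divide)
   then show "om \<in> (\<Union>n. {om \<in> space M. L j + 1 / real (Suc n) < f om})" using \<open>om \<in> space M\<close> by blast
  next
   fix om assume "om \<in> (\<Union>n. {om \<in> space M. L j + 1 / real (Suc n) < f om})"
   then obtain n where w: "om \<in> space M" "L j + 1 / real (Suc n) < f om" by auto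
   have "0 < 1 / real (Suc n)" by simp
   then have "L j < f om" using w(2) by linarith
   then show "om \<in> {om \<in> space M. L j < f om}" using w(1) by simp
  qed
  ultimately have "(\<lambda>n. m (L j + 1 / real (Suc n))) \<longlonglongrightarrow> m (L j)" by (simp add: m_def)
  moreover have "m (L j + 1 / real (Suc n)) \<le> T / 2 ^ j" for n
  proof -
   have "Inf (S j) < L j + 1 / real (Suc n)" by (simp add: L_def)
   then obtain t where "t \<in> S j" "t < L j + 1 / real (Suc n)" using cInf_lessD[OF ne] by blast
   then show ?thesis using m_mono[of t "L j + 1 / real (Suc n)"] by (auto simp: S_def)
  qed
  ultimately show ?thesis by (intro LIMSEQ_le_const2) auto
 qed
 have AEcov: "AE om in M. f om = 0 \<or> (\<exists>j. L j < f om \<and> f om \<le> L (Suc j))"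
 proof -
  let ?N = "{om \<in> space M. \<forall>j. L j < f om}"
  have Nm: "?N \<in> sets M" by measurable
  have "measure M ?N \<le> T * (1/2) ^ j" for j
  proof -
   have "measure M ?N \<le> m (L j)" unfolding m_def by (intro M.finite_measure_mono) auto
   also have "... \<le> T / 2 ^ j" by (rule mL)
   finally show ?thesis by (simp add: power_divide)
  qed
  moreover have "(\<lambda>j. T * (1/2) ^ j) \<longlonglongrightarrow> T * 0" by (intro tendsto_intros LIMSEQ_realpow_zero) auto
  ultimately have "measure M ?N \<le> T * 0" by (intro LIMSEQ_le_const) auto
  then have "emeasure M ?N = 0" by (simp add: M.emeasure_eq_measure measure_le_0_iff)
  then have "AE om in M. om \<notin> ?N" using Nm by (intro AE_not_in) (auto simp: null_sets_def)
  then show ?thesis using AE_space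
  proof eventually_elim
   case (elim om)
   show ?case
   proof (cases "f om = 0")
    case False
    then have fp: "f om > 0" using f[of om] by simp
    have ex: "\<exists>j. f om \<le> L j" using elim by (auto simp: not_less)
    define k where "k = (LEAST j. f om \<le> L j)"
    have k: "f om \<le> L k" unfolding k_def using ex by (rule LeastI_ex)
    then have "k \<noteq> 0" using fp L0 by (intro notI) simp
    then obtain i where i: "k = Suc i" using not0_implies_Suc by blast
    have "\<not> f om \<le> L i" using not_less_Least[of i "\<lambda>j. f om \<le> L j"] i unfolding k_def[symmetric] by auto
    then show ?thesis using k i by (auto simp: not_le)
   qed simp
  qed
 qed
 define m' where "m' j = measure M {om \<in> space M. L j \<le> f om}" for j
 \<comment> \<open>The counterpart from the left: values slightly below a positive
   \<open>L j\<close> are nonnegative and outside \<open>S j\<close>, so the super-level sets still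
   have mass above \<open>T / 2 ^ j\<close>, and in the limit {L j \<le> f} keeps it.\<close>
 have m'_ge: "T / 2 ^ j \<le> m' j" if Lp: "L j > 0" for j
 proof -
  let ?u = "\<lambda>n. L j - L j / real (Suc n)"
  have "(\<lambda>n. measure M {om \<in> space M. ?u n < f om}) \<longlonglongrightarrow> measure M (\<Inter>n. {om \<in> space M. ?u n < f om})"
  proof (rule M.finite_Lim_measure_decseq)
   show "decseq (\<lambda>n. {om \<in> space M. ?u n < f om})"
   proof (rule decseq_SucI, safe)
    fix n om assume "?u (Suc n) < f om"
    moreover have "L j / real (Suc (Suc n)) \<le> L j / real (Suc n)" using Lp by (intro divide_left_mono) auto
    ultimately show "?u n < f om" by linarith
   qed
  qed auto
  moreover have "(\<Inter>n. {om \<in> space M. ?u n < f om}) = {om \<in> space M. L j \<le> f om}"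
  proof (intro equalityI subsetI)
   fix om assume w: "om \<in> (\<Inter>n. {om \<in> space M. ?u n < f om})"
   then have w: "om \<in> space M" "\<And>n. ?u n < f om" by auto
   have "(\<lambda>n. L j - L j * inverse (real (Suc n))) \<longlonglongrightarrow> L j - L j * 0"
    by (intro tendsto_intros LIMSEQ_inverse_real_of_nat)
   then have "L j - L j * 0 \<le> f om" by (rule LIMSEQ_le_const2) (use w in \<open>auto simp: divide_inverse intro!: less_imp_le\<close>)
   then show "om \<in> {om \<in> space M. L j \<le> f om}" using w by simp
  next
   fix om assume w: "om \<in> {om \<in> space M. L j \<le> f om}"
   have "?u n < f om" for n
   proof -
    have "0 < L j / real (Suc n)" using Lp by simp
    then show ?thesis using w by simp
   qed
   then show "om \<in> (\<Inter>n. {om \<in> space M. ?u n < f om})" using w by auto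
  qed
  ultimately have "(\<lambda>n. m (?u n)) \<longlonglongrightarrow> m' j" by (simp add: m_def m'_def)
  moreover have "T / 2 ^ j \<le> m (?u n)" for n
  proof (rule ccontr)
   assume "\<not> T / 2 ^ j \<le> m (?u n)"
   moreover have "0 \<le> ?u n" using Lp by (simp add: field_simps)
   ultimately have "?u n \<in> S j" by (simp add: S_def)
   then have "L j \<le> ?u n" unfolding L_def by (intro cInf_lower bdd)
   moreover have "0 < L j / real (Suc n)" using Lp by simp
   ultimately show False by simp
  qed
  ultimately show ?thesis by (intro LIMSEQ_le_const) auto
 qed
 define d where "d j = L (Suc j) powr r - L j powr r" for j
 have d0: "d j \<ge> 0" for j unfolding d_def using L_nonneg Lmono r by (simp add: powr_mono2)
 \<comment> \<open>Summation by parts replaces the levels by their increments. The geometric masses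
   sum to twice their first term, which is the factor 2 of the claim.\<close>
 have abel: "(\<Sum>j\<le>n. T / 2 ^ j * L j powr r) + T / 2 ^ n * L n powr r = 2 * (\<Sum>j<n. T / 2 ^ Suc j * d j)" for n
 proof (induction n)
  case 0 then show ?case by (simp add: L0)
 next
  case (Suc n)
  have "(\<Sum>j\<le>Suc n. T / 2 ^ j * L j powr r) + T / 2 ^ Suc n * L (Suc n) powr r
   = ((\<Sum>j\<le>n. T / 2 ^ j * L j powr r) + T / 2 ^ n * L n powr r) + 2 * (T / 2 ^ Suc n * d n)" by (simp add: d_def field_simps)
  also have "... = 2 * (\<Sum>j<Suc n. T / 2 ^ Suc j * d j)" unfolding Suc.IH by (simp only: sum.lessThan_Suc distrib_left)
  finally show ?case .
 qed
 \<comment> \<open>The increments belonging to levels below \<open>v\<close> telescope to at most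
   v^r. Applied with v = f om this is the layer-cake formula restricted to the levels
   \<open>L j\<close>.\<close>
 have tele: "(\<Sum>j<n. d j * indicator {L (Suc j)..} v) \<le> v powr r" if v: "v \<ge> 0" for n v
 proof -
  have 1: "(\<Sum>j<n. d j * indicator {L (Suc j)..} v) \<le> L n powr r" for n
  proof -
  have "(\<Sum>j<n. d j * indicator {L (Suc j)..} v) \<le> (\<Sum>j<n. d j)" using d0 by (intro sum_mono) (auto simp: indicator_def)
  also have "(\<Sum>j<n. d j) = L n powr r" by (induction n) (auto simp: d_def L0)
  finally show ?thesis .
  qed
  show ?thesis
  proof (induction n)
   case (Suc n)
   show ?case
   proof (cases "L (Suc n) \<le> v")
    case True
    then show ?thesis using 1[of "Suc n"] powr_mono2[of r "L (Suc n)" v] L_nonneg r by auto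
   next
    case False
    then show ?thesis using Suc by simp
   qed
  qed simp
 qed
 show thesis
 proof (rule that[OF L0 Lmono])
  show "measure M {om \<in> space M. L j < f om} \<le> T / 2 ^ j" for j using mL[of j] by (simp add: m_def)
  show "AE om in M. f om = 0 \<or> (\<exists>j. L j < f om \<and> f om \<le> L (Suc j))" by (rule AEcov)
  fix n
  have "0 \<le> T / 2 ^ n * L n powr r" using T by simp
  then have "(\<Sum>j\<le>n. T / 2 ^ j * L j powr r) \<le> 2 * (\<Sum>j<n. T / 2 ^ Suc j * d j)" using abel[of n] by linarith
  also have "(\<Sum>j<n. T / 2 ^ Suc j * d j) \<le> (\<Sum>j<n. d j * m' (Suc j))"
  proof (rule sum_mono)
   fix j
   show "T / 2 ^ Suc j * d j \<le> d j * m' (Suc j)"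
   proof (cases "L (Suc j) > 0")
    case True
    then show ?thesis using mult_left_mono[OF m'_ge[OF True] d0[of j]] by (simp add: mult.commute)
   next
    case False
    then have "L (Suc j) = 0" "L j = 0" using L_nonneg[of j] L_nonneg[of "Suc j"] Lmono[of j] by auto
    then show ?thesis by (simp add: d_def)
   qed
  qed
  finally have "ennreal (\<Sum>j\<le>n. T / 2 ^ j * L j powr r) \<le> ennreal (2 * (\<Sum>j<n. d j * m' (Suc j)))" by (intro ennreal_leI) simp
  also have "... = 2 * ennreal (\<Sum>j<n. d j * m' (Suc j))" by (subst ennreal_mult') auto
  also have "ennreal (\<Sum>j<n. d j * m' (Suc j)) = (\<Sum>j<n. ennreal (d j * m' (Suc j)))" using d0 by (subst sum_ennreal) (auto simp: m'_def)
  also have "... = (\<Sum>j<n. \<integral>\<^sup>+om. ennreal (d j) * indicator {om \<in> space M. L (Suc j) \<le> f om} om \<partial>M)"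
  proof (rule sum.cong[OF refl])
   fix j
   have "(\<integral>\<^sup>+om. ennreal (d j) * indicator {om \<in> space M. L (Suc j) \<le> f om} om \<partial>M)
    = ennreal (d j) * emeasure M {om \<in> space M. L (Suc j) \<le> f om}" by (rule nn_integral_cmult_indicator) measurable
   then show "ennreal (d j * m' (Suc j)) = (\<integral>\<^sup>+om. ennreal (d j) * indicator {om \<in> space M. L (Suc j) \<le> f om} om \<partial>M)"
    using d0[of j] by (simp add: M.emeasure_eq_measure m'_def ennreal_mult)
  qed
  also have "... = (\<integral>\<^sup>+om. (\<Sum>j<n. ennreal (d j) * indicator {om \<in> space M. L (Suc j) \<le> f om} om) \<partial>M)"
   by (rule nn_integral_sum[symmetric]) measurable
  also have "... \<le> (\<integral>\<^sup>+om. ennreal (f om powr r) \<partial>M)"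
  proof (rule nn_integral_mono)
   fix om assume "om \<in> space M"
   then have "(\<Sum>j<n. ennreal (d j) * indicator {om \<in> space M. L (Suc j) \<le> f om} om) = (\<Sum>j<n. ennreal (d j * indicator {L (Suc j)..} (f om)))"
    by (intro sum.cong) (auto simp: indicator_def)
   also have "... = ennreal (\<Sum>j<n. d j * indicator {L (Suc j)..} (f om))" using d0 by (subst sum_ennreal) auto
   also have "... \<le> ennreal (f om powr r)" by (intro ennreal_leI tele f)
   finally show "(\<Sum>j<n. ennreal (d j) * indicator {om \<in> space M. L (Suc j) \<le> f om} om) \<le> ennreal (f om powr r)" .
  qed
  finally show "ennreal (\<Sum>j\<le>n. T / 2 ^ j * L j powr r) \<le> 2 * (\<integral>\<^sup>+om. ennreal (f om powr r) \<partial>M)"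
   by (simp add: mult_left_mono)
 qed
qed

section \<open>Interpolation for a sum of pieces\<close>

lemma suminf_ennreal_commute:
 fixes h :: "nat \<Rightarrow> nat \<Rightarrow> ennreal"
 shows "(\<Sum>n. \<Sum>j. h n j) = (\<Sum>j. \<Sum>n. h n j)"
proof -
 have "(\<Sum>n. \<Sum>j. h n j) = (\<integral>\<^sup>+n. (\<Sum>j. h n j) \<partial>count_space UNIV)" by (simp add: nn_integral_count_space_nat)
 also have "... = (\<Sum>j. \<integral>\<^sup>+n. h n j \<partial>count_space UNIV)" by (rule nn_integral_suminf) simp
 finally show ?thesis by (simp add: nn_integral_count_space_nat)
qed

lemma suminf_two_sided_geometric:
 fixes rh :: real
 assumes rh: "rh > 0"
 shows "(\<Sum>j. ennreal (2 powr (- rh * \<bar>real j - real n\<bar>))) \<le> ennreal (2 / (1 - 2 powr (- rh)))"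
proof -
 define ka where "ka = 2 powr (- rh)"
 have ka: "0 < ka" "ka < 1" using rh by (auto simp: ka_def powr_less_one)
 have pw: "2 powr (- rh * real k) = ka ^ k" for k
 proof -
  have "ka ^ k = ka powr real k" using ka by (simp add: powr_realpow)
  then show ?thesis by (simp only: ka_def powr_powr)
 qed
 have geo: "(\<Sum>j. ennreal (ka ^ j)) = ennreal (1 / (1 - ka))"
  using ka by (subst suminf_ennreal2) (auto simp: suminf_geometric intro!: summable_geometric)
 have "(\<Sum>j. ennreal (2 powr (- rh * \<bar>real j - real n\<bar>)))
  = (\<Sum>j. ennreal (2 powr (- rh * \<bar>real (j + n) - real n\<bar>))) + (\<Sum>j<n. ennreal (2 powr (- rh * \<bar>real j - real n\<bar>)))"
  by (rule suminf_offset) (rule summableI)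
 also have "(\<Sum>j. ennreal (2 powr (- rh * \<bar>real (j + n) - real n\<bar>))) = (\<Sum>j. ennreal (ka ^ j))" by (simp add: pw[symmetric])
 also have "(\<Sum>j<n. ennreal (2 powr (- rh * \<bar>real j - real n\<bar>))) = (\<Sum>j<n. ennreal (ka ^ (n - j)))"
 proof (intro sum.cong refl)
  fix j assume "j \<in> {..<n}"
  then have "\<bar>real j - real n\<bar> = real (n - j)" by (simp add: of_nat_diff)
  then show "ennreal (2 powr (- rh * \<bar>real j - real n\<bar>)) = ennreal (ka ^ (n - j))" by (simp only: pw)
 qed
 also have "... = (\<Sum>j\<in>{1..n}. ennreal (ka ^ j))" by (rule sum.reindex_bij_witness[of _ "\<lambda>j. n - j" "\<lambda>j. n - j"]) auto
 also have "(\<Sum>j. ennreal (ka ^ j)) + (\<Sum>j\<in>{1..n}. ennreal (ka ^ j)) \<le> (\<Sum>j. ennreal (ka ^ j)) + (\<Sum>j. ennreal (ka ^ j))"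
  by (intro add_left_mono sum_le_suminf) auto
 finally have "(\<Sum>j. ennreal (2 powr (- rh * \<bar>real j - real n\<bar>))) \<le> ennreal (1 / (1 - ka)) + ennreal (1 / (1 - ka))"
  by (simp only: geo)
 also have "... = ennreal (2 / (1 - ka))" using ka by (subst ennreal_plus[symmetric]) auto
 finally show ?thesis unfolding ka_def .
qed

text \<open>The two-sided form of \<open>powr_suminf_le\<close>. Half of the rate \<open>ep\<close>
  makes the series over j converge, the other half stays on the right so that the result can be
  summed over n as well.\<close>

lemma powr_suminf_two_sided_le:
 fixes c :: "nat \<Rightarrow> real" and q ep x :: real
 assumes c: "\<And>j. c j \<ge> 0" and q: "q > 0" and ep: "ep > 0" and x: "x \<ge> 0"
  and le: "ennreal x \<le> (\<Sum>j. ennreal (c j * 2 powr (- ep * \<bar>real j - real n\<bar>)))"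
 shows "ennreal (x powr q) \<le> ennreal ((2 / (1 - 2 powr (- (ep / 2)))) powr q) *
  (\<Sum>j. ennreal (c j powr q * 2 powr (- (ep * q / 2) * \<bar>real j - real n\<bar>)))"
proof -
 let ?X = "\<Sum>j. ennreal (c j powr q * 2 powr (- (ep * q / 2) * \<bar>real j - real n\<bar>))"
 let ?G = "2 / (1 - 2 powr (- (ep / 2)))"
 have G: "?G > 0" using ep by (simp add: powr_less_one)
 show ?thesis
 proof (cases "?X = \<top>")
  case True
  have "ennreal (?G powr q) \<noteq> 0" using G by (simp only: ennreal_eq_0_iff not_le powr_gt_zero)
  then show ?thesis unfolding True by (simp only: ennreal_mult_top if_False top_greatest)
 next
  case False
  define t where "t = enn2real ?X"
  have t: "t \<ge> 0" "?X = ennreal t" unfolding t_def by (rule enn2real_nonneg, rule ennreal_enn2real[OF False[unfolded less_top], symmetric])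
  have cj: "c j * 2 powr (- (ep / 2) * \<bar>real j - real n\<bar>) \<le> t powr (1 / q)" for j
  proof -
   let ?y = "c j * 2 powr (- (ep / 2) * \<bar>real j - real n\<bar>)"
   have "?y powr q = c j powr q * 2 powr (- (ep * q / 2) * \<bar>real j - real n\<bar>)" using c by (simp add: powr_mult powr_powr mult_ac)
   then have "ennreal (?y powr q) \<le> ennreal t"
    using ennreal_term_le_suminf[of "\<lambda>j. ennreal (c j powr q * 2 powr (- (ep * q / 2) * \<bar>real j - real n\<bar>))" j]
    unfolding t(2) by simp
   then have "?y powr q \<le> t" using t(1) by simp
   then have "(?y powr q) powr (1 / q) \<le> t powr (1 / q)" using q by (intro powr_mono2) auto
   then show ?thesis using q c by (simp add: powr_powr)
  qed
  have "(\<Sum>j. ennreal (c j * 2 powr (- ep * \<bar>real j - real n\<bar>))) \<le> (\<Sum>j. ennreal (t powr (1 / q)) * ennreal (2 powr (- (ep / 2) * \<bar>real j - real n\<bar>)))"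
  proof (intro suminf_le summableI)
   fix j
   let ?u = "2 powr (- (ep / 2) * \<bar>real j - real n\<bar>)"
   have "2 powr (- ep * \<bar>real j - real n\<bar>) = ?u * ?u" by (simp add: powr_add[symmetric])
   then have "c j * 2 powr (- ep * \<bar>real j - real n\<bar>) = (c j * ?u) * ?u" by simp
   also have "... \<le> t powr (1 / q) * ?u" by (intro mult_right_mono cj) auto
   finally show "ennreal (c j * 2 powr (- ep * \<bar>real j - real n\<bar>)) \<le> ennreal (t powr (1 / q)) * ennreal ?u"
    by (subst ennreal_mult[symmetric]) (auto intro!: ennreal_leI)
  qed
  also have "... = ennreal (t powr (1 / q)) * (\<Sum>j. ennreal (2 powr (- (ep / 2) * \<bar>real j - real n\<bar>)))"
   by (rule ennreal_suminf_cmult)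
  also have "... \<le> ennreal (t powr (1 / q)) * ennreal ?G" using ep by (intro mult_left_mono suminf_two_sided_geometric) auto
  also have "... = ennreal (t powr (1 / q) * ?G)" using G by (intro ennreal_mult[symmetric]) auto
  finally have "ennreal x \<le> ennreal (t powr (1 / q) * ?G)" using le by (rule order_trans[rotated])
  moreover have "0 \<le> t powr (1 / q) * ?G" using G by (intro mult_nonneg_nonneg) auto
  ultimately have "x \<le> t powr (1 / q) * ?G" by (simp only: ennreal_le_iff)
  then have "x powr q \<le> (t powr (1 / q) * ?G) powr q" using x q by (intro powr_mono2) auto
  also have "... = (t powr (1 / q)) powr q * ?G powr q" by (rule powr_mult)
  also have "(t powr (1 / q)) powr q = t" using t q by (simp add: powr_powr)
  finally have "ennreal (x powr q) \<le> ennreal (t * ?G powr q)" by (rule ennreal_leI)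
  also have "... = ennreal (?G powr q) * ?X" unfolding t(2) using t by (subst ennreal_mult) (auto simp: mult.commute)
  finally show ?thesis .
 qed
qed

lemma chebyshev_powr:
 fixes g :: "'a \<Rightarrow> real"
 assumes [measurable]: "g \<in> borel_measurable M" and s: "s > 0" and p: "p > 0"
  and g: "(\<integral>\<^sup>+om. ennreal (g om powr p) \<partial>M) \<le> ennreal I" and I: "I \<ge> 0"
 shows "emeasure M {om \<in> space M. s \<le> g om} \<le> ennreal (s powr (- p) * I)"
proof -
 have "emeasure M {om \<in> space M. s \<le> g om} = (\<integral>\<^sup>+om. indicator {om \<in> space M. s \<le> g om} om \<partial>M)" by simp
 also have "... \<le> (\<integral>\<^sup>+om. ennreal (s powr (- p)) * ennreal (g om powr p) \<partial>M)"
 proof (rule nn_integral_mono)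
  fix om
  show "indicator {om \<in> space M. s \<le> g om} om \<le> ennreal (s powr (- p)) * ennreal (g om powr p)"
  proof (cases "s \<le> g om")
   case True
   have "s powr (- p) * s powr p \<le> s powr (- p) * g om powr p" using True s p by (intro mult_left_mono powr_mono2) auto
   moreover have "s powr (- p) * s powr p = 1" using s by (simp add: powr_minus)
   ultimately have "ennreal 1 \<le> ennreal (s powr (- p) * g om powr p)" by (intro ennreal_leI) simp
   then show ?thesis using True by (simp add: ennreal_mult indicator_def)
  qed simp
 qed
 also have "... = ennreal (s powr (- p)) * (\<integral>\<^sup>+om. ennreal (g om powr p) \<partial>M)" by (rule nn_integral_cmult) auto
 also have "... \<le> ennreal (s powr (- p)) * ennreal I" by (intro mult_left_mono g) auto
 also have "... = ennreal (s powr (- p) * I)" using I by (intro ennreal_mult[symmetric]) auto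
 finally show ?thesis .
qed

text \<open>\<open>g j\<close> behaves like the height \<open>c j * 2 powr (- j * b / q)\<close> on a set of measure \<open>2 powr (j * b)\<close>.\<close>

definition marcinkiewicz_data where
 "marcinkiewicz_data M q0 q q1 b K et D g c f S \<longleftrightarrow>
  (\<forall>j. g j \<in> borel_measurable M) \<and> f \<in> borel_measurable M \<and>
  (\<forall>j om. 0 \<le> g j om) \<and> (\<forall>j. 0 \<le> c j) \<and> (\<forall>om. 0 \<le> f om) \<and> 0 \<le> S \<and>
  (\<forall>j. (\<integral>\<^sup>+om. ennreal (g j om powr q0) \<partial>M) \<le> ennreal (K * c j powr q0 * 2 powr (real j * b * (1 - q0 / q)))) \<and>
  (\<forall>j. (\<integral>\<^sup>+om. ennreal (g j om powr q1) \<partial>M) \<le> ennreal (K * c j powr q1 * 2 powr (real j * b * (1 - q1 / q)))) \<and>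
  (\<forall>j om. g j om \<le> D * c j * 2 powr (- et * real j)) \<and>
  (\<forall>om. ennreal (f om) \<le> (\<Sum>j. ennreal (g j om))) \<and>
  (\<Sum>j. ennreal (c j powr q)) \<le> ennreal S"

text \<open>Real interpolation for a sum of pieces. Level n has height 2^(-n b/q) times an average
  \<open>tt n\<close> of the \<open>c j\<close> around n. Where \<open>f\<close> exceeds it, some
  \<open>g j\<close> exceeds its share of the average. Chebyshev's inequality, at \<open>q0\<close>
  for j \<le> n and at \<open>q1\<close> for j > n, bounds the measure of that set by 2^(n b) with
  decay in |j - n|. In the sum of height^q times measure the powers 2^(n b) cancel, and the l^q norm
  of \<open>c\<close> remains.\<close>

lemma marcinkiewicz_sum:
 fixes M :: "'a measure" and q0 q q1 b K et D :: real
 assumes q: "0 < q0" "q0 < q" "q < q1" and b: "b > 0" and K: "K \<ge> 0" and et: "et > 0" and D: "D \<ge> 1"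
 obtains K' where "K' \<ge> 0"
  "\<And>g c f S. marcinkiewicz_data M q0 q q1 b K et D g c f S \<Longrightarrow> (\<integral>\<^sup>+om. ennreal (f om powr q) \<partial>M) \<le> ennreal (K' * S)"
proof -
 define r0 r1 where "r0 = b * (1 - q0 / q)" and "r1 = b * (q1 / q - 1)"
 have r: "r0 > 0" "r1 > 0" using q b by (auto simp: r0_def r1_def)
 \<comment> \<open>The shares 2^(-ep |j - n|) may cost at most half of the Chebyshev rates
   \<open>r0\<close> and \<open>r1\<close>; ep \<le> et is used where level 0 is shown to lie above
   \<open>f\<close>.\<close>
 define ep where "ep = min et (min (r0 / (2 * q0)) (r1 / (2 * q1)))"
 have ep: "ep > 0" "ep \<le> et" "ep \<le> r0 / (2 * q0)" "ep \<le> r1 / (2 * q1)" using et r q by (auto simp: ep_def min_def)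
 have ep0: "ep * q0 \<le> r0 / 2" and ep1: "ep * q1 \<le> r1 / 2" using ep q by (auto simp: field_simps)
 define rh where "rh = min (r0 / 2) (r1 / 2)"
 have rh: "rh > 0" "rh \<le> r0 / 2" "rh \<le> r1 / 2" using r by (auto simp: rh_def)
 define Cr where "Cr = 2 / (1 - 2 powr (- rh))"
 have Cr: "Cr \<ge> 0" using rh by (simp add: Cr_def powr_less_one less_imp_le)
 define Ce where "Ce = (2 / (1 - 2 powr (- (ep / 2)))) powr q"
 define Cs where "Cs = 2 / (1 - 2 powr (- (ep * q / 2)))"
 have Cs: "Cs \<ge> 0" using ep q by (simp add: Cs_def powr_less_one less_imp_le)
 have Ce: "Ce \<ge> 0" by (simp add: Ce_def)
 define K' where "K' = D powr q * (K * 2 powr b * Cr) * (Ce * Cs)"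
 have K': "K' \<ge> 0" using K Cr Ce Cs by (simp add: K'_def)
 show thesis
 proof (rule that[OF K'])
  fix g :: "nat \<Rightarrow> 'a \<Rightarrow> real" and c :: "nat \<Rightarrow> real" and f :: "'a \<Rightarrow> real" and S :: real
  assume data: "marcinkiewicz_data M q0 q q1 b K et D g c f S"
  have gm[measurable]: "g j \<in> borel_measurable M" and fm[measurable]: "f \<in> borel_measurable M"
   and g: "0 \<le> g j om" and c: "0 \<le> c j" and f: "0 \<le> f om" and S: "0 \<le> S"
   and h0: "(\<integral>\<^sup>+om. ennreal (g j om powr q0) \<partial>M) \<le> ennreal (K * c j powr q0 * 2 powr (real j * b * (1 - q0 / q)))"
   and h1: "(\<integral>\<^sup>+om. ennreal (g j om powr q1) \<partial>M) \<le> ennreal (K * c j powr q1 * 2 powr (real j * b * (1 - q1 / q)))"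
   and sup: "g j om \<le> D * c j * 2 powr (- et * real j)"
   and le: "ennreal (f om) \<le> (\<Sum>j. ennreal (g j om))"
   and sumc: "(\<Sum>j. ennreal (c j powr q)) \<le> ennreal S" for j om
   using data by (auto simp: marcinkiewicz_data_def)
  define dl where "dl n j = \<bar>real j - real n\<bar>" for n j :: nat
  define v where "v n j = c j * 2 powr (- ep * dl n j)" for n j
  have v0: "v n j \<ge> 0" for n j using c by (simp add: v_def)
  have cS: "c j \<le> S powr (1 / q)" for j
  proof -
   have "ennreal (c j powr q) \<le> ennreal S" using ennreal_term_le_suminf[of "\<lambda>j. ennreal (c j powr q)" j] sumc by (rule order_trans)
   then have "c j powr q \<le> S" using S by simp
   then have "(c j powr q) powr (1 / q) \<le> S powr (1 / q)" using q by (intro powr_mono2) auto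
   then show ?thesis using q c by (simp add: powr_powr)
  qed
  define Cb where "Cb = S powr (1 / q) * (2 / (1 - 2 powr (- ep)))"
  have Cb: "Cb \<ge> 0" using ep by (simp add: Cb_def powr_less_one less_imp_le)
  have sumv: "(\<Sum>j. ennreal (v n j)) \<le> ennreal Cb" for n
  proof -
   have "(\<Sum>j. ennreal (v n j)) \<le> (\<Sum>j. ennreal (S powr (1 / q)) * ennreal (2 powr (- ep * dl n j)))"
    unfolding v_def by (intro suminf_le summableI, subst ennreal_mult[symmetric]) (auto intro!: ennreal_leI mult_right_mono cS)
   also have "... = ennreal (S powr (1 / q)) * (\<Sum>j. ennreal (2 powr (- ep * dl n j)))" by (rule ennreal_suminf_cmult)
   also have "... \<le> ennreal (S powr (1 / q)) * ennreal (2 / (1 - 2 powr (- ep)))"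
    unfolding dl_def using ep by (intro mult_left_mono suminf_two_sided_geometric) auto
   also have "... = ennreal Cb" unfolding Cb_def using ep by (intro ennreal_mult[symmetric]) (auto simp: powr_less_one less_imp_le)
   finally show ?thesis .
  qed
  define tt where "tt n = enn2real (\<Sum>j. ennreal (v n j))" for n
  have tt: "tt n \<ge> 0" "ennreal (tt n) = (\<Sum>j. ennreal (v n j))" for n
  proof -
   have "(\<Sum>j. ennreal (v n j)) < \<top>" using sumv[of n] by (rule le_less_trans) simp
   then show "tt n \<ge> 0" "ennreal (tt n) = (\<Sum>j. ennreal (v n j))" unfolding tt_def by (auto intro: ennreal_enn2real)
  qed
  have ttle: "tt n \<le> Cb" for n using sumv[of n] Cb unfolding tt(2)[symmetric] by simp
  define hn where "hn n = D * 2 powr (- (real n * b / q))" for n :: nat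
  have hn: "hn n > 0" for n using D by (simp add: hn_def)
  define ta where "ta n = hn n * tt n" for n
  have ta0: "ta n \<ge> 0" for n using hn[of n] tt(1)[of n] by (simp add: ta_def)
  have meas: "emeasure M {om \<in> space M. ta n < f om} \<le> ennreal (K * 2 powr (real n * b) * Cr)" for n
  proof -
   define A where "A j = {om \<in> space M. hn n * v n j < g j om}" for j
   have [measurable]: "A j \<in> sets M" for j unfolding A_def by measurable
   have sub: "{om \<in> space M. ta n < f om} \<subseteq> (\<Union>j. A j)"
   proof
    fix om assume w: "om \<in> {om \<in> space M. ta n < f om}"
    show "om \<in> (\<Union>j. A j)"
    proof (rule ccontr)
     assume "om \<notin> (\<Union>j. A j)"
     then have ge: "g j om \<le> hn n * v n j" for j using w by (auto simp: A_def not_less)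
     have "ennreal (f om) \<le> (\<Sum>j. ennreal (hn n) * ennreal (v n j))"
      using hn[of n] v0 by (intro order_trans[OF le] suminf_le summableI, subst ennreal_mult[symmetric]) (auto intro!: ennreal_leI ge)
     also have "... = ennreal (hn n) * ennreal (tt n)" unfolding tt(2) by (rule ennreal_suminf_cmult)
     also have "... = ennreal (ta n)" using hn[of n] tt(1)[of n] by (simp add: ta_def ennreal_mult)
     finally have "f om \<le> ta n" using ta0[of n] by simp
     then show False using w by simp
    qed
   qed
   have Aj: "emeasure M (A j) \<le> ennreal (K * 2 powr (real n * b)) * ennreal (2 powr (- rh * dl n j))" for j
   proof (cases "c j = 0")
    case True
    then have "g j om \<le> 0" for om using sup[of j om] by simp
    then have "A j = {}" using True by (auto simp: A_def v_def not_less)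
    then show ?thesis by simp
   next
    case False
    then have cp: "c j > 0" using c[of j] by simp
    define s where "s = 2 powr (- (real n * b / q)) * (c j * 2 powr (- ep * dl n j))"
    have s: "s > 0" using cp by (simp add: s_def)
    have ss: "s \<le> hn n * v n j" using D cp mult_right_mono[of 1 D s] s by (simp add: s_def hn_def v_def mult.assoc)
    have dn: "dl n j \<ge> 0" by (simp add: dl_def)
    have key: "emeasure M (A j) \<le> ennreal (s powr (- p) * (K * c j powr p * 2 powr (real j * b * (1 - p / q))))"
     if p: "p > 0" and hp: "(\<integral>\<^sup>+om. ennreal (g j om powr p) \<partial>M) \<le> ennreal (K * c j powr p * 2 powr (real j * b * (1 - p / q)))" for p
    proof -
     have "emeasure M (A j) \<le> emeasure M {om \<in> space M. s \<le> g j om}" using ss by (intro emeasure_mono) (auto simp: A_def)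
     also have "... \<le> ennreal (s powr (- p) * (K * c j powr p * 2 powr (real j * b * (1 - p / q))))"
      using s p hp K by (intro chebyshev_powr) auto
     finally show ?thesis .
    qed
    have eq: "s powr (- p) * (K * c j powr p * 2 powr (real j * b * (1 - p / q)))
     = K * 2 powr (real n * b * p / q + ep * p * dl n j + real j * b * (1 - p / q))" for p
    proof -
     have "s powr (- p) = 2 powr (real n * b * p / q) * (c j powr (- p) * 2 powr (ep * p * dl n j))"
      unfolding s_def using cp by (simp add: powr_mult powr_powr mult_ac)
     moreover have "c j powr (- p) * c j powr p = 1" using cp by (simp add: powr_minus)
     ultimately have "s powr (- p) * (K * c j powr p * 2 powr (real j * b * (1 - p / q)))
      = K * (2 powr (real n * b * p / q) * 2 powr (ep * p * dl n j) * 2 powr (real j * b * (1 - p / q)))" by (simp add: mult_ac)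
     then show ?thesis by (simp only: powr_add)
    qed
    have fin: "emeasure M (A j) \<le> ennreal (K * 2 powr (real n * b)) * ennreal (2 powr (- rh * dl n j))"
     if p: "p > 0" and hp: "(\<integral>\<^sup>+om. ennreal (g j om powr p) \<partial>M) \<le> ennreal (K * c j powr p * 2 powr (real j * b * (1 - p / q)))"
      and ex: "real n * b * p / q + ep * p * dl n j + real j * b * (1 - p / q) \<le> real n * b + - rh * dl n j" for p
    proof -
     have "emeasure M (A j) \<le> ennreal (K * 2 powr (real n * b * p / q + ep * p * dl n j + real j * b * (1 - p / q)))"
      using key[OF p hp] unfolding eq .
     also have "... \<le> ennreal (K * 2 powr (real n * b + - rh * dl n j))" using K ex by (intro ennreal_leI mult_left_mono powr_mono) auto
     also have "... = ennreal (K * 2 powr (real n * b)) * ennreal (2 powr (- rh * dl n j))"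
      using K by (subst ennreal_mult[symmetric]) (simp_all only: powr_add mult.assoc mult_nonneg_nonneg powr_ge_zero)
     finally show ?thesis .
    qed
    show ?thesis
    proof (cases "j \<le> n")
     case True
     then have d: "dl n j = real n - real j" by (simp add: dl_def)
     have "real n * b * q0 / q + ep * q0 * dl n j + real j * b * (1 - q0 / q) = real n * b - r0 * dl n j + ep * q0 * dl n j"
      using q unfolding d r0_def by (simp add: field_simps)
     also have "... \<le> real n * b + - rh * dl n j"
     proof -
      have "(ep * q0 + rh) * dl n j \<le> r0 * dl n j" using ep0 rh dn by (intro mult_right_mono) auto
      then show ?thesis by (simp add: algebra_simps)
     qed
     finally show ?thesis by (intro fin[OF q(1) h0])
    next
     case False
     then have d: "dl n j = real j - real n" by (simp add: dl_def)
     have q1: "q1 > 0" using q by simp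
     have "real n * b * q1 / q + ep * q1 * dl n j + real j * b * (1 - q1 / q) = real n * b - r1 * dl n j + ep * q1 * dl n j"
      using q unfolding d r1_def by (simp add: field_simps)
     also have "... \<le> real n * b + - rh * dl n j"
     proof -
      have "(ep * q1 + rh) * dl n j \<le> r1 * dl n j" using ep1 rh dn by (intro mult_right_mono) auto
      then show ?thesis by (simp add: algebra_simps)
     qed
     finally show ?thesis by (intro fin[OF q1 h1])
    qed
   qed
   have "emeasure M {om \<in> space M. ta n < f om} \<le> emeasure M (\<Union>j. A j)" by (rule emeasure_mono[OF sub]) auto
   also have "... \<le> (\<Sum>j. emeasure M (A j))" by (rule emeasure_subadditive_countably) auto
   also have "... \<le> (\<Sum>j. ennreal (K * 2 powr (real n * b)) * ennreal (2 powr (- rh * dl n j)))" by (intro suminf_le summableI Aj)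
   also have "... = ennreal (K * 2 powr (real n * b)) * (\<Sum>j. ennreal (2 powr (- rh * dl n j)))" by (rule ennreal_suminf_cmult)
   also have "... \<le> ennreal (K * 2 powr (real n * b)) * ennreal Cr"
    unfolding dl_def Cr_def using rh by (intro mult_left_mono suminf_two_sided_geometric) auto
   also have "... = ennreal (K * 2 powr (real n * b) * Cr)" using K Cr by (intro ennreal_mult[symmetric]) auto
   finally show ?thesis .
  qed
  have talim: "ta \<longlonglongrightarrow> 0"
  proof (rule tendsto_sandwich[of "\<lambda>_. 0" _ _ "\<lambda>n. (D * Cb) * (2 powr (- (b / q))) ^ n"])
   have "ta n \<le> (D * Cb) * (2 powr (- (b / q))) ^ n" for n
   proof -
    have "(2 powr (- (b / q))) ^ n = 2 powr (- (real n * b / q))" by (simp add: powr_realpow[symmetric] powr_powr mult.commute)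
    moreover have "ta n \<le> hn n * Cb" unfolding ta_def using hn[of n] ttle by (intro mult_left_mono) auto
    ultimately show ?thesis by (simp add: hn_def mult_ac)
   qed
   then show "\<forall>\<^sub>F n in sequentially. ta n \<le> (D * Cb) * (2 powr (- (b / q))) ^ n" by simp
   have "(\<lambda>n. (2 powr (- (b / q))) ^ n) \<longlonglongrightarrow> 0" using b q by (intro LIMSEQ_realpow_zero) (auto simp: powr_less_one)
   then show "(\<lambda>n. (D * Cb) * (2 powr (- (b / q))) ^ n) \<longlonglongrightarrow> 0" by (rule tendsto_mult_right_zero)
  qed (use ta0 in auto)
  \<comment> \<open>The sup bounds of the pieces put all of \<open>f\<close> below level 0, so no
    levels of negative index are needed.\<close>
  have fle: "f om \<le> ta 0" for om
  proof -
   have "ennreal (f om) \<le> (\<Sum>j. ennreal D * ennreal (v 0 j))"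
   proof (intro order_trans[OF le] suminf_le summableI)
    fix j
    have "2 powr (- et * real j) \<le> (2::real) powr (- ep * dl 0 j)" using ep by (intro powr_mono) (auto simp: dl_def intro!: mult_right_mono)
    then have "D * c j * 2 powr (- et * real j) \<le> D * v 0 j" using D c unfolding v_def by (simp add: mult.assoc mult_left_mono)
    then have "ennreal (g j om) \<le> ennreal (D * v 0 j)" using sup[of j om] by (intro ennreal_leI) simp
    then show "ennreal (g j om) \<le> ennreal D * ennreal (v 0 j)" using D v0 by (simp add: ennreal_mult)
   qed
   also have "... = ennreal D * ennreal (tt 0)" unfolding tt(2) by (rule ennreal_suminf_cmult)
   also have "... = ennreal (ta 0)" using D tt(1) by (simp add: ta_def hn_def ennreal_mult)
   finally show ?thesis using ta0 by simp
  qed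
  have pt: "ennreal (f om powr q) \<le> (\<Sum>n. ennreal (ta n powr q) * indicator {om \<in> space M. ta (Suc n) < f om} om)" if w: "om \<in> space M" for om
  proof (cases "f om = 0")
   case False
   then have fp: "f om > 0" using f[of om] by simp
   then have "\<forall>\<^sub>F n in sequentially. ta n < f om" using talim by (intro order_tendstoD) auto
   then have ex: "\<exists>n. ta n < f om" by (auto simp: eventually_sequentially)
   define k where "k = (LEAST n. ta n < f om)"
   have k: "ta k < f om" unfolding k_def using ex by (rule LeastI_ex)
   then have "k \<noteq> 0" using fle[of om] by (intro notI) simp
   then obtain i where i: "k = Suc i" using not0_implies_Suc by blast
   have "\<not> ta i < f om" using not_less_Least[of i "\<lambda>n. ta n < f om"] i unfolding k_def[symmetric] by auto
   then have "ennreal (f om powr q) \<le> ennreal (ta i powr q)" using q fp by (intro ennreal_leI powr_mono2) auto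
   also have "... = ennreal (ta i powr q) * indicator {om \<in> space M. ta (Suc i) < f om} om" using k i w by simp
   also have "... \<le> (\<Sum>n. ennreal (ta n powr q) * indicator {om \<in> space M. ta (Suc n) < f om} om)" by (rule ennreal_term_le_suminf)
   finally show ?thesis .
  qed (use q in simp)
  let ?X = "\<lambda>n. \<Sum>j. ennreal (c j powr q * 2 powr (- (ep * q / 2) * \<bar>real j - real n\<bar>))"
  have "(\<integral>\<^sup>+om. ennreal (f om powr q) \<partial>M) \<le> (\<integral>\<^sup>+om. (\<Sum>n. ennreal (ta n powr q) * indicator {om \<in> space M. ta (Suc n) < f om} om) \<partial>M)"
   by (intro nn_integral_mono pt)
  also have "... = (\<Sum>n. \<integral>\<^sup>+om. ennreal (ta n powr q) * indicator {om \<in> space M. ta (Suc n) < f om} om \<partial>M)"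
   by (rule nn_integral_suminf) measurable
  also have "... = (\<Sum>n. ennreal (ta n powr q) * emeasure M {om \<in> space M. ta (Suc n) < f om})"
   by (intro suminf_cong nn_integral_cmult_indicator) measurable
  also have "... \<le> (\<Sum>n. ennreal (D powr q * (K * 2 powr b * Cr) * Ce) * ?X n)"
  proof (intro suminf_le summableI)
   fix n
   have "ennreal (tt n powr q) \<le> ennreal Ce * ?X n"
    unfolding Ce_def using c q ep tt[of n] by (intro powr_suminf_two_sided_le) (auto simp: v_def dl_def)
   then have A: "ennreal (D powr q * (K * 2 powr b * Cr)) * ennreal (tt n powr q) \<le> ennreal (D powr q * (K * 2 powr b * Cr)) * (ennreal Ce * ?X n)"
    by (rule mult_left_mono) simp
   have "ennreal (ta n powr q) * emeasure M {om \<in> space M. ta (Suc n) < f om} \<le> ennreal (ta n powr q) * ennreal (K * 2 powr (real (Suc n) * b) * Cr)"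
    by (intro mult_left_mono meas) auto
   also have "... = ennreal (ta n powr q * (K * 2 powr (real (Suc n) * b) * Cr))" using K Cr by (intro ennreal_mult[symmetric]) auto
   also have "ta n powr q * (K * 2 powr (real (Suc n) * b) * Cr) = D powr q * (K * 2 powr b * Cr) * tt n powr q"
   proof -
    have 1: "ta n powr q = D powr q * 2 powr (- (real n * b)) * tt n powr q"
     using D tt(1)[of n] q by (simp add: ta_def hn_def powr_mult powr_powr)
    have 2: "2 powr (real (Suc n) * b) = 2 powr (real n * b) * 2 powr b" by (simp add: powr_add[symmetric] algebra_simps)
    have 3: "2 powr (- (real n * b)) * 2 powr (real n * b) = (1::real)" by (simp add: powr_add[symmetric])
    have "ta n powr q * (K * 2 powr (real (Suc n) * b) * Cr) = (2 powr (- (real n * b)) * 2 powr (real n * b)) * (D powr q * (K * 2 powr b * Cr) * tt n powr q)"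
     unfolding 1 2 by (simp only: mult_ac)
    then show ?thesis unfolding 3 by simp
   qed
   also have "ennreal (D powr q * (K * 2 powr b * Cr) * tt n powr q) = ennreal (D powr q * (K * 2 powr b * Cr)) * ennreal (tt n powr q)"
    using K Cr by (intro ennreal_mult) auto
   also have "... \<le> ennreal (D powr q * (K * 2 powr b * Cr)) * (ennreal Ce * ?X n)" by (rule A)
   also have "... = ennreal (D powr q * (K * 2 powr b * Cr) * Ce) * ?X n"
    using K Cr Ce by (simp only: ennreal_mult mult.assoc[symmetric] mult_nonneg_nonneg powr_ge_zero)
   finally show "ennreal (ta n powr q) * emeasure M {om \<in> space M. ta (Suc n) < f om} \<le> ennreal (D powr q * (K * 2 powr b * Cr) * Ce) * ?X n" .
  qed
  also have "... = ennreal (D powr q * (K * 2 powr b * Cr) * Ce) * (\<Sum>n. ?X n)" by (rule ennreal_suminf_cmult)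
  also have "(\<Sum>n. ?X n) \<le> ennreal (S * Cs)"
  proof -
   have "(\<Sum>n. ?X n) = (\<Sum>j. \<Sum>n. ennreal (c j powr q * 2 powr (- (ep * q / 2) * \<bar>real j - real n\<bar>)))"
    by (rule suminf_ennreal_commute)
   also have "... = (\<Sum>j. ennreal (c j powr q) * (\<Sum>n. ennreal (2 powr (- (ep * q / 2) * \<bar>real n - real j\<bar>))))"
    by (simp add: ennreal_mult abs_minus_commute)
   also have "... \<le> (\<Sum>j. ennreal (c j powr q) * ennreal Cs)"
    unfolding Cs_def using ep q by (intro suminf_le summableI mult_left_mono suminf_two_sided_geometric) auto
   also have "... = (\<Sum>j. ennreal (c j powr q)) * ennreal Cs" by simp
   also have "... \<le> ennreal S * ennreal Cs" by (intro mult_right_mono sumc) auto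
   also have "... = ennreal (S * Cs)" using S Cs by (intro ennreal_mult[symmetric]) auto
   finally show ?thesis .
  qed
  also have "ennreal (D powr q * (K * 2 powr b * Cr) * Ce) * ennreal (S * Cs) = ennreal (K' * S)"
   using K Cr Ce Cs S by (subst ennreal_mult[symmetric]) (auto simp: K'_def mult_ac)
  finally show "(\<integral>\<^sup>+om. ennreal (f om powr q) \<partial>M) \<le> ennreal (K' * S)" by (simp add: mult_left_mono)
 qed
qed

section \<open>From normalised data to all of L^r\<close>

lemma extension_op_scale: "Ext (\<lambda>om. c * F om) z = c * Ext F z"
proof -
 have "(\<integral>om. exp (\<i> * of_real (z \<bullet> om)) * (c * F om) \<partial>\<sigma>)
   = (\<integral>om. c * (exp (\<i> * of_real (z \<bullet> om)) * F om) \<partial>\<sigma>)"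
  by (intro Bochner_Integration.integral_cong) (simp_all add: mult_ac)
 then show ?thesis by (simp add: extension_op_def)
qed

lemma circle_measure_total: "measure \<sigma> (sphere 0 1) = 2 * pi" by (simp add: measure_def emeasure_circle_measure)

text \<open>Pointwise |F| \<le> t + t^(1 - r) |F|^r: where |F| exceeds \<open>t\<close>, the power r
  - 1 \<ge> 0 is harmless. With \<open>t\<close> the bound for the norm, both terms integrate to
  multiples of \<open>t\<close>, the first because the circle has finite length.\<close>

lemma circle_Lp_L1:
 fixes F :: "real \<times> real \<Rightarrow> complex"
 assumes [measurable]: "F \<in> borel_measurable \<sigma>" and r: "r \<ge> 1" and t: "t > 0"
  and J: "(ARC om. ennreal (cmod (F om) powr r)) \<le> ennreal (t powr r)"
 shows "(ARC om. ennreal (cmod (F om))) \<le> ennreal ((2 * pi + 1) * t)"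
proof -
 have "(ARC om. ennreal (cmod (F om))) \<le>
  (ARC om. ennreal t + ennreal (t powr (1 - r)) * ennreal (cmod (F om) powr r))"
 proof (rule nn_integral_mono)
  fix om
  have "cmod (F om) \<le> t + t powr (1 - r) * cmod (F om) powr r"
  proof (cases "cmod (F om) \<le> t")
   case True
   then show ?thesis by (simp add: add_increasing2)
  next
   case False
   then have F: "cmod (F om) > t" by simp
   have "cmod (F om) powr (1 - r) \<le> t powr (1 - r)" using F t r by (intro powr_mono2') auto
   then have "cmod (F om) powr (1 - r) * cmod (F om) powr r \<le> t powr (1 - r) * cmod (F om) powr r" by (rule mult_right_mono) simp
   moreover have "cmod (F om) powr (1 - r) * cmod (F om) powr r = cmod (F om)" using F t by (simp add: powr_add[symmetric])
   ultimately show ?thesis using t by linarith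
  qed
  then have "ennreal (cmod (F om)) \<le> ennreal (t + t powr (1 - r) * cmod (F om) powr r)" by (rule ennreal_leI)
  then show "ennreal (cmod (F om)) \<le> ennreal t + ennreal (t powr (1 - r)) * ennreal (cmod (F om) powr r)" using t by (simp add: ennreal_mult)
 qed
 also have "... = ennreal t * emeasure \<sigma> (space \<sigma>) + ennreal (t powr (1 - r)) * (ARC om. ennreal (cmod (F om) powr r))"
  by (simp add: nn_integral_add nn_integral_cmult)
 also have "... \<le> ennreal t * ennreal (2 * pi) + ennreal (t powr (1 - r)) * ennreal (t powr r)"
  by (intro add_mono mult_left_mono J) (simp_all add: emeasure_circle_measure)
 also have "... = ennreal ((2 * pi + 1) * t)"
 proof -
  have "t powr (1 - r) * t powr r = t" using t by (simp add: powr_add[symmetric])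
  then have "ennreal (t powr (1 - r)) * ennreal (t powr r) = ennreal t" by (simp add: ennreal_mult[symmetric])
  moreover have "ennreal t * ennreal (2 * pi) = ennreal (t * (2 * pi))" using t by (intro ennreal_mult[symmetric]) auto
  moreover have "ennreal (t * (2 * pi)) + ennreal t = ennreal (t * (2 * pi) + t)" using t by (intro ennreal_plus[symmetric]) auto
  ultimately show ?thesis by (simp add: algebra_simps)
 qed
 finally show ?thesis .
qed

text \<open>\<open>G j\<close> is the part of \<open>F\<close> with values between
  \<open>L j\<close> and \<open>L (Suc j)\<close>. Its support has measure at most
  \<open>2 * pi / 2 ^ j\<close>, so after division by the upper level it is normalised data. The
  summation bound refers to the lower level; the shift of the index costs a factor 2 later. A
  vanishing upper level is singled out because it cannot be divided by.\<close>

lemma extension_levels: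
 fixes F :: "real \<times> real \<Rightarrow> complex"
 assumes Fm[measurable]: "F \<in> borel_measurable \<sigma>" and r: "r \<ge> 1" and J0: "J \<ge> 0"
  and J: "(ARC om. ennreal (cmod (F om) powr r)) \<le> ennreal J"
 obtains L :: "nat \<Rightarrow> real" and G :: "nat \<Rightarrow> real \<times> real \<Rightarrow> complex" where
  "\<And>j. L j \<ge> 0" "\<And>j. G j \<in> borel_measurable \<sigma>"
  "\<And>j. L (Suc j) = 0 \<Longrightarrow> G j = (\<lambda>_. 0)"
  "\<And>j. L (Suc j) > 0 \<Longrightarrow> circle_bound (\<lambda>om. G j om / of_real (L (Suc j))) (2 * pi / 2 ^ j)"
  "\<And>z. ennreal (cmod (Ext F z)) \<le> (\<Sum>j. ennreal (cmod (Ext (G j) z)))"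
  "\<And>n. (\<Sum>j\<le>n. 2 * pi / 2 ^ j * L j powr r) \<le> 2 * J"
proof -
 interpret C: finite_measure \<sigma> by (rule finite_measure_circle)
 let ?f = "\<lambda>om. cmod (F om)"
 have fm: "?f \<in> borel_measurable \<sigma>" by measurable
 obtain L :: "nat \<Rightarrow> real" where L0: "L 0 = 0" and Lmono: "\<And>j. L j \<le> L (Suc j)"
  and mL: "\<And>j. measure \<sigma> {om \<in> space \<sigma>. L j < ?f om} \<le> 2 * pi / 2 ^ j"
  and AEc: "AE om in \<sigma>. ?f om = 0 \<or> (\<exists>j. L j < ?f om \<and> ?f om \<le> L (Suc j))"
  and sumL: "\<And>n. ennreal (\<Sum>j\<le>n. 2 * pi / 2 ^ j * L j powr r) \<le> 2 * (ARC om. ennreal (?f om powr r))"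
 proof (rule rearrangement_levels[OF finite_measure_circle fm])
  show "0 < 2 * pi" "measure \<sigma> (space \<sigma>) \<le> 2 * pi" "0 < r" using r by (auto simp: circle_measure_total)
  show "0 \<le> cmod (F om)" for om by simp
 qed (rule that)
 have Lm: "mono L" by (rule mono_iff_le_Suc[THEN iffD2]) (use Lmono in auto)
 have Ln: "L j \<ge> 0" for j using monoD[OF Lm, of 0 j] L0 by simp
 define B where "B j = {om \<in> space \<sigma>. L j < ?f om \<and> ?f om \<le> L (Suc j)}" for j
 have Sm: "{om \<in> space \<sigma>. L j < ?f om} \<in> sets \<sigma>" for j by measurable
 have Bm[measurable]: "B j \<in> sets \<sigma>" for j unfolding B_def by measurable
 define G where "G j om = indicator (B j) om *\<^sub>R F om" for j om
 have Gm[measurable]: "G j \<in> borel_measurable \<sigma>" for j unfolding G_def by measurable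
 have intF: "integrable \<sigma> F"
 proof (rule integrableI_bounded)
  define t where "t = (J + 1) powr (1 / r)"
  have t: "t > 0" "t powr r = J + 1" using J0 r by (auto simp: t_def powr_powr)
  have "(ARC om. ennreal (norm (F om))) \<le> ennreal ((2 * pi + 1) * t)"
   by (rule circle_Lp_L1[OF Fm r t(1)]) (use J t in \<open>auto intro: order_trans[OF _ ennreal_leI]\<close>)
  then show "(ARC om. ennreal (norm (F om))) < \<infinity>" by (rule le_less_trans) simp
 qed measurable
 show thesis
 proof (rule that[of L G, OF Ln Gm])
  fix j assume z: "L (Suc j) = 0"
  have "om \<notin> B j" for om using z Ln[of j] by (auto simp: B_def)
  then show "G j = (\<lambda>_. 0)" by (auto simp: G_def fun_eq_iff)
 next
  fix j assume p: "L (Suc j) > 0"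
  have b: "cmod (G j om / of_real (L (Suc j))) \<le> indicator (B j) om" for om
   using p by (auto simp: G_def B_def indicator_def norm_divide divide_le_eq)
  show "circle_bound (\<lambda>om. G j om / of_real (L (Suc j))) (2 * pi / 2 ^ j)" unfolding circle_bound_def
  proof (intro conjI allI)
   show "cmod (G j om / of_real (L (Suc j))) \<le> 1" for om by (rule order_trans[OF b]) (auto simp: indicator_def)
   show "0 < 2 * pi / 2 ^ j" by simp
   have "1 \<le> (2::real) ^ j" by simp
   then show "2 * pi / 2 ^ j \<le> 2 * pi" using mult_left_mono[of 1 "2 ^ j" "2 * pi"] by (simp add: divide_le_eq)
   have "(ARC om. ennreal (cmod (G j om / of_real (L (Suc j))))) \<le> (ARC om. indicator (B j) om)"
    by (intro nn_integral_mono) (use ennreal_leI[OF b] in \<open>simp only: ennreal_indicator\<close>)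
   also have "... = emeasure \<sigma> (B j)" by simp
   also have "... = ennreal (measure \<sigma> (B j))" by (rule C.emeasure_eq_measure)
   also have "... \<le> ennreal (measure \<sigma> {om \<in> space \<sigma>. L j < ?f om})"
    by (intro ennreal_leI C.finite_measure_mono[OF _ Sm]) (auto simp: B_def)
   also have "... \<le> ennreal (2 * pi / 2 ^ j)" by (intro ennreal_leI mL)
   finally show "(ARC om. ennreal (cmod (G j om / of_real (L (Suc j))))) \<le> ennreal (2 * pi / 2 ^ j)" .
  qed measurable
 next
  fix z
  let ?u = "\<lambda>om. exp (\<i> * of_real (z \<bullet> om)) * F om"
  have iu: "integrable \<sigma> ?u" by (rule Bochner_Integration.integrable_bound[OF intF]) (auto simp: norm_mult)
  have disj: "disjoint_family B"
  proof -
   have "B m \<inter> B n = {}" if "m < n" for m n using monoD[OF Lm, of "Suc m" n] that by (auto simp: B_def)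
   then show ?thesis unfolding disjoint_family_on_def by (metis inf_commute linorder_neqE_nat)
  qed
  have "ennreal (norm (\<integral>om. ?u om \<partial>\<sigma>)) \<le> (\<Sum>m. ennreal (norm (\<integral>om. indicator (B m) om *\<^sub>R ?u om \<partial>\<sigma>)))"
  proof (rule norm_integral_countable_le[OF iu Bm disj])
   show "AE om in \<sigma>. ?u om = 0 \<or> om \<in> (\<Union>m. B m)" using AEc AE_space by eventually_elim (auto simp: B_def)
  qed
  also have "(\<lambda>m. \<integral>om. indicator (B m) om *\<^sub>R ?u om \<partial>\<sigma>) = (\<lambda>m. \<integral>om. exp (\<i> * of_real (z \<bullet> om)) * G m om \<partial>\<sigma>)"
   by (simp add: G_def)
  finally have *: "ennreal (norm (\<integral>om. ?u om \<partial>\<sigma>)) \<le> (\<Sum>m. ennreal (norm (\<integral>om. exp (\<i> * of_real (z \<bullet> om)) * G m om \<partial>\<sigma>)))"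
   by meson
  have e: "ennreal (cmod (Ext H z)) = ennreal (1 / (2 * pi)) * ennreal (norm (\<integral>om. exp (\<i> * of_real (z \<bullet> om)) * H om \<partial>\<sigma>))" for H
   unfolding extension_op_def by (subst ennreal_mult[symmetric]) (auto simp: norm_mult norm_divide)
  show "ennreal (cmod (Ext F z)) \<le> (\<Sum>j. ennreal (cmod (Ext (G j) z)))"
   unfolding e ennreal_suminf_cmult by (intro mult_left_mono *) auto
 next
  fix n
  have "ennreal (\<Sum>j\<le>n. 2 * pi / 2 ^ j * L j powr r) \<le> 2 * ennreal J" by (rule order_trans[OF sumL]) (intro mult_left_mono J, simp)
  also have "2 * ennreal J = ennreal (2 * J)" using J0 by (simp add: ennreal_mult)
  finally show "(\<Sum>j\<le>n. 2 * pi / 2 ^ j * L j powr r) \<le> 2 * J" using J0 by (subst (asm) ennreal_le_iff) auto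
 qed
qed

lemma restricted_level_bound:
 assumes w[measurable]: "w \<in> borel_measurable borel" and w0: "\<And>z. w z \<ge> 0" and q: "q > 0" and C: "C \<ge> 0"
  and R: "\<And>F a. circle_bound F a \<Longrightarrow> (LEB z. ennreal ((w z * cmod (Ext F z)) powr q)) \<le> ennreal (C * a powr (q * A - B))"
  and L: "L \<ge> 0" and Z: "L = 0 \<Longrightarrow> G = (\<lambda>_. 0)" and G: "L > 0 \<Longrightarrow> circle_bound (\<lambda>om. G om / of_real L) a"
 shows "(LEB z. ennreal ((w z * cmod (Ext G z)) powr q)) \<le> ennreal (C * L powr q * a powr (q * A - B))"
proof (cases "L = 0")
 case True
 then have "Ext G z = 0" for z using Z by (simp add: extension_op_def)
 then show ?thesis using q by simp
next
 case False
 then have Lp: "L > 0" using L by simp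
 let ?H = "\<lambda>om. G om / of_real L"
 have Hm[measurable]: "?H \<in> borel_measurable \<sigma>" using G[OF Lp] by (simp add: circle_bound_def)
 have "Ext G z = of_real L * Ext ?H z" for z using extension_op_scale[of "of_real L" ?H z] Lp by simp
 then have "(LEB z. ennreal ((w z * cmod (Ext G z)) powr q))
  = (LEB z. ennreal (L powr q) * ennreal ((w z * cmod (Ext ?H z)) powr q))"
  using Lp w0 by (intro nn_integral_cong, subst ennreal_mult[symmetric]) (auto simp: norm_mult powr_mult mult_ac)
 also have "... = ennreal (L powr q) * (LEB z. ennreal ((w z * cmod (Ext ?H z)) powr q))" by (rule nn_integral_cmult) auto
 also have "... \<le> ennreal (L powr q) * ennreal (C * a powr (q * A - B))" by (intro mult_left_mono R G Lp) auto
 also have "... = ennreal (C * L powr q * a powr (q * A - B))" using C by (subst ennreal_mult[symmetric]) (auto simp: mult_ac)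
 finally show ?thesis .
qed

text \<open>\<open>J\<close> is a bound for the r-th power of the norm of \<open>F\<close>, so
  homogeneity dictates the power q/r on the right. All quantities are finite reals, which keeps
  infinite norms out of the analysis.\<close>

definition strong_bound :: "(real \<times> real \<Rightarrow> real) \<Rightarrow> real \<Rightarrow> real \<Rightarrow> bool" where
 "strong_bound w q r \<longleftrightarrow> (\<exists>K\<ge>0. \<forall>F J. F \<in> borel_measurable \<sigma> \<longrightarrow> J \<ge> 0 \<longrightarrow>
  (ARC om. ennreal (cmod (F om) powr r)) \<le> ennreal J \<longrightarrow>
  (LEB z. ennreal ((w z * cmod (Ext F z)) powr q)) \<le> ennreal (K * J powr (q / r)))"

lemma dyadic_arc_powr: "(2 * pi / 2 ^ j) powr x = (2 * pi) powr x * 2 powr (- (real j * x))"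
proof -
 have "2 * pi / 2 ^ j = 2 * pi * 2 powr (- real j)" by (simp only: two_powr_minus_nat) (simp add: power_divide)
 then show ?thesis by (simp add: powr_mult powr_powr)
qed

text \<open>Piece j has the height \<open>L (Suc j)\<close>, at most a multiple of (J / a_j)^(1/r)
  with a_j = 2 pi / 2^j, and its extension has weighted norm at most a multiple of this height times
  a_j^(A - B/q). The gap \<open>ep\<close> between the two exponents gives decay 2^(-ep j), half of
  which is spent on summing in L^q.\<close>

lemma restricted_strict:
 assumes w[measurable]: "w \<in> borel_measurable borel" and w0: "\<And>z. w z \<ge> 0" and q: "q > 0" and r: "r \<ge> 1"
  and R: "restricted_bound w q A B" and ex: "1 / r < A - B / q"
 shows "strong_bound w q r"
proof -
 obtain C where C: "C \<ge> 0" and RC: "\<And>F a. circle_bound F a \<Longrightarrow> (LEB z. ennreal ((w z * cmod (Ext F z)) powr q)) \<le> ennreal (C * a powr (q * A - B))"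
  using R unfolding restricted_bound_def by auto
 define ep where "ep = A - B / q - 1 / r"
 have ep: "ep > 0" using ex by (simp add: ep_def)
 define ka where "ka = 2 powr (- (ep / 2))"
 have ka: "0 < ka" "ka < 1" using ep by (auto simp: ka_def powr_less_one)
 define mu where "mu = 2 powr (- (ep * q / 2))"
 have mu: "0 < mu" "mu < 1" using ep q by (auto simp: mu_def powr_less_one)
 define E where "E = C * 4 powr (q / r) * (2 * pi) powr (ep * q)"
 have E: "E \<ge> 0" using C by (simp add: E_def)
 define K where "K = (1 / (1 - ka)) powr q * (E / (1 - mu))"
 have K: "K \<ge> 0" using E mu by (simp add: K_def)
 show ?thesis unfolding strong_bound_def
 proof (intro exI[of _ K] conjI allI impI K)
  fix F J assume Fm[measurable]: "F \<in> borel_measurable \<sigma>" and J0: "J \<ge> 0"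
   and J: "(ARC om. ennreal (cmod (F om) powr r)) \<le> ennreal J"
  obtain L G where Ln: "\<And>j. L j \<ge> 0" and Gm[measurable]: "\<And>j. G j \<in> borel_measurable \<sigma>"
   and Gz: "\<And>j. L (Suc j) = 0 \<Longrightarrow> G j = (\<lambda>_. 0)"
   and Gb: "\<And>j. L (Suc j) > 0 \<Longrightarrow> circle_bound (\<lambda>om. G j om / of_real (L (Suc j))) (2 * pi / 2 ^ j)"
   and le: "\<And>z. ennreal (cmod (Ext F z)) \<le> (\<Sum>j. ennreal (cmod (Ext (G j) z)))"
   and sumL: "\<And>n. (\<Sum>j\<le>n. 2 * pi / 2 ^ j * L j powr r) \<le> 2 * J" by (rule extension_levels[OF Fm r J0 J]) (rule that)
  define a where "a j = 2 * pi / 2 ^ j" for j :: nat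
  have a: "a j > 0" for j by (simp add: a_def)
  have apw: "a j powr x = (2 * pi) powr x * 2 powr (- (real j * x))" for j x unfolding a_def by (rule dyadic_arc_powr)
  have Lle: "L (Suc j) powr q \<le> 4 powr (q / r) * J powr (q / r) * a j powr (- (q / r))" for j
  proof -
   have "a (Suc j) * L (Suc j) powr r \<le> (\<Sum>i\<le>Suc j. a i * L i powr r)"
    using a Ln by (intro member_le_sum) (auto intro!: mult_nonneg_nonneg simp: less_imp_le)
   also have "... \<le> 2 * J" using sumL[of "Suc j"] by (simp only: a_def)
   \<comment> \<open>The factor 4 is 2 from the rearrangement bound times 2 from a_j = 2
     a_(j+1).\<close>
   finally have "a j * L (Suc j) powr r \<le> 4 * J" by (simp add: a_def field_simps)
   then have "L (Suc j) powr r \<le> 4 * J / a j" using a[of j] by (simp add: field_simps)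
   then have "(L (Suc j) powr r) powr (q / r) \<le> (4 * J / a j) powr (q / r)" using q r by (intro powr_mono2) auto
   also have "(L (Suc j) powr r) powr (q / r) = L (Suc j) powr q" using r by (simp add: powr_powr)
   also have "(4 * J / a j) powr (q / r) = 4 powr (q / r) * J powr (q / r) * a j powr (- (q / r))"
    using a[of j] J0 by (subst powr_divide) (auto simp: powr_mult powr_minus divide_inverse)
   finally show ?thesis .
  qed
  have piece: "(LEB z. ennreal ((w z * cmod (Ext (G j) z) / ka ^ j) powr q)) \<le> ennreal (E * J powr (q / r) * mu ^ j)" for j
  proof -
   have kj: "(ka ^ j) powr q = 2 powr (- (real j * ep * q / 2))"
   proof -
    have "ka ^ j = ka powr real j" using ka by (simp add: powr_realpow)
    then show ?thesis unfolding ka_def by (simp add: powr_powr mult_ac)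
   qed
   have mj: "mu ^ j = 2 powr (- (real j * ep * q / 2))"
   proof -
    have "mu ^ j = mu powr real j" using mu by (simp add: powr_realpow)
    then show ?thesis unfolding mu_def by (simp add: powr_powr mult_ac)
   qed
   let ?k = "1 / (ka ^ j) powr q"
   have "(LEB z. ennreal ((w z * cmod (Ext (G j) z) / ka ^ j) powr q))
    = (LEB z. ennreal ?k * ennreal ((w z * cmod (Ext (G j) z)) powr q))"
    using w0 ka by (intro nn_integral_cong, subst ennreal_mult[symmetric], simp, simp, subst powr_divide) auto
   also have "... = ennreal ?k * (LEB z. ennreal ((w z * cmod (Ext (G j) z)) powr q))" by (rule nn_integral_cmult) auto
   also have "... \<le> ennreal ?k * ennreal (C * L (Suc j) powr q * a j powr (q * A - B))"
    unfolding a_def by (intro mult_left_mono restricted_level_bound w w0 q C RC Ln Gz Gb) auto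
   also have "... = ennreal (?k * (C * L (Suc j) powr q * a j powr (q * A - B)))" using C by (intro ennreal_mult[symmetric]) auto
   also have "... \<le> ennreal (?k * (C * (4 powr (q / r) * J powr (q / r) * a j powr (- (q / r))) * a j powr (q * A - B)))"
    using C by (intro ennreal_leI mult_left_mono mult_right_mono Lle) auto
   also have "?k * (C * (4 powr (q / r) * J powr (q / r) * a j powr (- (q / r))) * a j powr (q * A - B)) = E * J powr (q / r) * mu ^ j"
   proof -
    have "a j powr (- (q / r)) * a j powr (q * A - B) = a j powr (ep * q)"
    proof -
     have "- (q / r) + (q * A - B) = ep * q" using q by (simp add: ep_def field_simps)
     then show ?thesis by (metis powr_add)
    qed
    also have "... = (2 * pi) powr (ep * q) * 2 powr (- (real j * (ep * q)))" by (rule apw)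
    finally have 1: "a j powr (- (q / r)) * a j powr (q * A - B) = (2 * pi) powr (ep * q) * 2 powr (- (real j * (ep * q)))" .
    have 2: "?k * 2 powr (- (real j * (ep * q))) = mu ^ j"
    proof -
     have k: "?k = 2 powr (real j * ep * q / 2)" unfolding kj powr_minus by (simp only: inverse_eq_divide divide_divide_eq_right mult_1 div_by_1)
     have e: "real j * ep * q / 2 + - (real j * (ep * q)) = - (real j * ep * q / 2)" unfolding mult.assoc by linarith
     show ?thesis unfolding mj k powr_add[symmetric] e ..
    qed
    have "?k * (C * (4 powr (q / r) * J powr (q / r) * a j powr (- (q / r))) * a j powr (q * A - B))
     = ?k * (C * 4 powr (q / r) * J powr (q / r) * (a j powr (- (q / r)) * a j powr (q * A - B)))" by (simp only: mult_ac)
    also have "... = C * 4 powr (q / r) * (2 * pi) powr (ep * q) * J powr (q / r) * (?k * 2 powr (- (real j * (ep * q))))"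
     unfolding 1 by (simp only: mult_ac)
    finally show ?thesis unfolding 2 E_def .
   qed
   finally show ?thesis .
  qed
  have "(LEB z. ennreal ((w z * cmod (Ext F z)) powr q))
   \<le> (LEB z. ennreal ((1 / (1 - ka)) powr q) * (\<Sum>j. ennreal ((w z * cmod (Ext (G j) z) / ka ^ j) powr q)))"
  proof (intro nn_integral_mono powr_suminf_le)
   fix z
   have "ennreal (w z) * ennreal (cmod (Ext F z)) \<le> ennreal (w z) * (\<Sum>j. ennreal (cmod (Ext (G j) z)))"
    by (intro mult_left_mono le) auto
   also have "... = (\<Sum>j. ennreal (w z) * ennreal (cmod (Ext (G j) z)))" by (rule ennreal_suminf_cmult[symmetric])
   finally show "ennreal (w z * cmod (Ext F z)) \<le> (\<Sum>j. ennreal (w z * cmod (Ext (G j) z)))"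
    using w0 by (simp add: ennreal_mult)
  qed (use w0 ka q in auto)
  also have "... = ennreal ((1 / (1 - ka)) powr q) * (\<Sum>j. LEB z. ennreal ((w z * cmod (Ext (G j) z) / ka ^ j) powr q))"
   by (subst nn_integral_cmult, simp, subst nn_integral_suminf) auto
  also have "... \<le> ennreal ((1 / (1 - ka)) powr q) * (\<Sum>j. ennreal (E * J powr (q / r) * mu ^ j))"
   by (intro mult_left_mono suminf_le piece summableI) auto
  also have "(\<Sum>j. ennreal (E * J powr (q / r) * mu ^ j)) = ennreal (E * J powr (q / r) * (1 / (1 - mu)))"
   using E mu by (subst suminf_ennreal2) (auto intro!: summable_mult summable_geometric simp: suminf_mult suminf_geometric)
  also have "ennreal ((1 / (1 - ka)) powr q) * ennreal (E * J powr (q / r) * (1 / (1 - mu))) = ennreal (K * J powr (q / r))"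
   using E mu by (subst ennreal_mult[symmetric]) (auto simp: K_def mult_ac)
  finally show "(LEB z. ennreal ((w z * cmod (Ext F z)) powr q)) \<le> ennreal (K * J powr (q / r))" .
 qed
qed

text \<open>At equality the geometric decay is gone. Put c_j = L_(j+1) a_j^(1/r), the L^r size of
  piece j. The two restricted bounds say that the weighted extension of piece j behaves at
  \<open>q0\<close> and \<open>q1\<close> like the height c_j 2^(-j B/q) on a set of measure 2^(j
  B), which is the situation of \<open>marcinkiewicz_sum\<close> with \<open>b = B\<close>.\<close>

lemma restricted_endpoint:
 assumes w[measurable]: "w \<in> borel_measurable borel" and w0: "\<And>z. w z \<ge> 0" "\<And>z. w z \<le> 1"
  and q: "0 < q0" "q0 < q" "q < q1" and r: "1 < r" "r \<le> q" and B: "B > 0"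
  and R0: "restricted_bound w q0 A B" and R1: "restricted_bound w q1 A B" and ex: "1 / r = A - B / q"
 shows "strong_bound w q r"
proof -
 obtain C0 where C0: "C0 \<ge> 0" and RC0: "\<And>F a. circle_bound F a \<Longrightarrow> (LEB z. ennreal ((w z * cmod (Ext F z)) powr q0)) \<le> ennreal (C0 * a powr (q0 * A - B))"
  using R0 unfolding restricted_bound_def by auto
 obtain C1 where C1: "C1 \<ge> 0" and RC1: "\<And>F a. circle_bound F a \<Longrightarrow> (LEB z. ennreal ((w z * cmod (Ext F z)) powr q1)) \<le> ennreal (C1 * a powr (q1 * A - B))"
  using R1 unfolding restricted_bound_def by auto
 define K0 where "K0 = C0 * (2 * pi) powr (B * (q0 / q - 1)) + C1 * (2 * pi) powr (B * (q1 / q - 1))"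
 have K0: "K0 \<ge> 0" "C0 * (2 * pi) powr (B * (q0 / q - 1)) \<le> K0" "C1 * (2 * pi) powr (B * (q1 / q - 1)) \<le> K0"
  using C0 C1 by (auto simp: K0_def)
 \<comment> \<open>Piece j is bounded by L_(j+1) a_j = c_j a_j^(1 - 1/r). This sup bound decays
   relative to c_j because r > 1.\<close>
 define et where "et = 1 - 1 / r"
 have et: "et > 0" using r by (simp add: et_def)
 define D where "D = max 1 ((2 * pi) powr et)"
 have D: "D \<ge> 1" "(2 * pi) powr et \<le> D" by (auto simp: D_def)
 obtain K' where K': "K' \<ge> 0" and MS: "\<And>g c f S. marcinkiewicz_data (lborel :: (real \<times> real) measure) q0 q q1 B K0 et D g c f S \<Longrightarrow>
   (LEB om. ennreal (f om powr q)) \<le> ennreal (K' * S)"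
  by (rule marcinkiewicz_sum[OF q B K0(1) et D(1)]) (rule that)
 show ?thesis unfolding strong_bound_def
 proof (intro exI[of _ "K' * 4 powr (q / r)"] conjI allI impI)
  show "0 \<le> K' * 4 powr (q / r)" using K' by simp
  fix F J assume Fm[measurable]: "F \<in> borel_measurable \<sigma>" and J0: "J \<ge> 0"
   and J: "(ARC om. ennreal (cmod (F om) powr r)) \<le> ennreal J"
  have r1: "r \<ge> 1" using r by simp
  obtain L G where Ln: "\<And>j. L j \<ge> 0" and Gm[measurable]: "\<And>j. G j \<in> borel_measurable \<sigma>"
   and Gz: "\<And>j. L (Suc j) = 0 \<Longrightarrow> G j = (\<lambda>_. 0)"
   and Gb: "\<And>j. L (Suc j) > 0 \<Longrightarrow> circle_bound (\<lambda>om. G j om / of_real (L (Suc j))) (2 * pi / 2 ^ j)"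
   and le: "\<And>z. ennreal (cmod (Ext F z)) \<le> (\<Sum>j. ennreal (cmod (Ext (G j) z)))"
   and sumL: "\<And>n. (\<Sum>j\<le>n. 2 * pi / 2 ^ j * L j powr r) \<le> 2 * J" by (rule extension_levels[OF Fm r1 J0 J]) (rule that)
  define a where "a j = 2 * pi / 2 ^ j" for j :: nat
  have a: "a j > 0" for j by (simp add: a_def)
  have apw: "a j powr x = (2 * pi) powr x * 2 powr (- (real j * x))" for j x unfolding a_def by (rule dyadic_arc_powr)
  define c where "c j = L (Suc j) * a j powr (1 / r)" for j
  have c: "c j \<ge> 0" for j using Ln by (simp add: c_def)
  have cr: "c j powr r = L (Suc j) powr r * a j" for j using Ln[of "Suc j"] r a[of j] by (simp add: c_def powr_mult powr_powr)
  have sumc: "(\<Sum>j\<le>n. c j powr r) \<le> 4 * J" for n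
  proof -
   have "(\<Sum>j\<le>n. c j powr r) = 2 * (\<Sum>j\<le>n. a (Suc j) * L (Suc j) powr r)"
    unfolding sum_distrib_left by (intro sum.cong refl) (simp add: cr a_def field_simps)
   also have "(\<Sum>j\<le>n. a (Suc j) * L (Suc j) powr r) \<le> a 0 * L 0 powr r + (\<Sum>j\<le>n. a (Suc j) * L (Suc j) powr r)"
    using a[of 0] by simp
   also have "... = (\<Sum>j\<le>Suc n. a j * L j powr r)" by (rule sum.atMost_Suc_shift[symmetric])
   also have "... \<le> 2 * J" using sumL[of "Suc n"] by (simp only: a_def)
   finally show ?thesis by simp
  qed
  \<comment> \<open>The rearrangement controls the l^r norm of \<open>c\<close>; the embedding of
    l^r in l^q, available for r \<le> q, gives what the interpolation needs.\<close>
  have sumcq: "(\<Sum>j. ennreal (c j powr q)) \<le> ennreal ((4 * J) powr (q / r))"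
  proof (rule suminf_le_const[OF summableI])
   fix n
   have "(\<Sum>j<n. c j powr q) \<le> (4 * J) powr (q / r)"
   proof (cases "J = 0")
    case True
    have "c j powr r \<le> 0" for j
    proof -
     have "c j powr r \<le> (\<Sum>i\<le>j. c i powr r)" by (rule member_le_sum) auto
     then show ?thesis using sumc[of j] True by linarith
    qed
    then have "c j powr r = 0" for j using powr_ge_zero[of "c j" r] by (meson antisym)
    then have "c j = 0" for j by simp
    then show ?thesis using q by simp
   next
    case False
    have cj: "c j \<le> (4 * J) powr (1 / r)" for j
    proof -
     have "c j powr r \<le> (\<Sum>i\<le>j. c i powr r)" by (rule member_le_sum) auto
     then have "c j powr r \<le> 4 * J" using sumc[of j] by linarith
     then have "(c j powr r) powr (1 / r) \<le> (4 * J) powr (1 / r)" using r by (intro powr_mono2) auto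
     then show ?thesis using r c by (simp add: powr_powr)
    qed
    have "(\<Sum>j<n. c j powr q) \<le> (\<Sum>j<n. c j powr r * (4 * J) powr ((q - r) / r))"
    proof (rule sum_mono)
     fix j
     have "c j powr q = c j powr r * c j powr (q - r)" by (simp add: powr_add[symmetric])
     also have "c j powr (q - r) \<le> ((4 * J) powr (1 / r)) powr (q - r)" using r c cj by (intro powr_mono2) auto
     also have "... = (4 * J) powr ((q - r) / r)" by (simp add: powr_powr)
     finally show "c j powr q \<le> c j powr r * (4 * J) powr ((q - r) / r)" by (simp add: mult_left_mono)
    qed
    also have "... = (\<Sum>j<n. c j powr r) * (4 * J) powr ((q - r) / r)" by (simp add: sum_distrib_right)
    also have "... \<le> (4 * J) * (4 * J) powr ((q - r) / r)"
    proof (rule mult_right_mono)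
     have "(\<Sum>j<n. c j powr r) \<le> (\<Sum>j\<le>n. c j powr r)" by (intro sum_mono2) auto
     then show "(\<Sum>j<n. c j powr r) \<le> 4 * J" using sumc[of n] by linarith
    qed simp
    also have "... = (4 * J) powr (1 + (q - r) / r)" using False J0 by (simp add: powr_add)
    also have "1 + (q - r) / r = q / r" using r by (simp add: field_simps)
    finally show ?thesis .
   qed
   then show "(\<Sum>j<n. ennreal (c j powr q)) \<le> ennreal ((4 * J) powr (q / r))" by (subst sum_ennreal) (auto intro: ennreal_leI)
  qed
  \<comment> \<open>The endpoint equality turns the power p A - B of a_j into p/r + B (p/q - 1): the
    first part completes c_j^p, the second is the factor 2^(j B (1 - p/q)) up to a constant.\<close>
  have lev: "(LEB z. ennreal ((w z * cmod (Ext (G j) z)) powr p)) \<le> ennreal (K0 * c j powr p * 2 powr (real j * B * (1 - p / q)))"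
   if p: "p > 0" and Cp: "Cp \<ge> 0" and RC: "\<And>F a. circle_bound F a \<Longrightarrow> (LEB z. ennreal ((w z * cmod (Ext F z)) powr p)) \<le> ennreal (Cp * a powr (p * A - B))"
    and CK: "Cp * (2 * pi) powr (B * (p / q - 1)) \<le> K0" for p Cp j
  proof -
   have "(LEB z. ennreal ((w z * cmod (Ext (G j) z)) powr p)) \<le> ennreal (Cp * L (Suc j) powr p * a j powr (p * A - B))"
    unfolding a_def by (intro restricted_level_bound w w0 p Cp RC Ln Gz Gb)
   also have "Cp * L (Suc j) powr p * a j powr (p * A - B) = Cp * (2 * pi) powr (B * (p / q - 1)) * c j powr p * 2 powr (real j * B * (1 - p / q))"
   proof -
    have cp: "c j powr p = L (Suc j) powr p * a j powr (p / r)" using Ln[of "Suc j"] a[of j] by (simp add: c_def powr_mult powr_powr)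
    have x: "p * A - B = p / r + B * (p / q - 1)"
    proof -
     have "A = 1 / r + B / q" using ex by simp
     then show ?thesis by (simp add: algebra_simps)
    qed
    have "a j powr (p * A - B) = a j powr (p / r) * ((2 * pi) powr (B * (p / q - 1)) * 2 powr (real j * B * (1 - p / q)))"
     unfolding x powr_add apw[of j "B * (p / q - 1)"] by (simp add: algebra_simps)
    then show ?thesis unfolding cp by simp
   qed
   also have "ennreal ... \<le> ennreal (K0 * c j powr p * 2 powr (real j * B * (1 - p / q)))"
    using CK by (intro ennreal_leI mult_right_mono) auto
   finally show ?thesis .
  qed
  have "(LEB z. ennreal ((w z * cmod (Ext F z)) powr q)) \<le> ennreal (K' * (4 * J) powr (q / r))"
  proof (rule MS[where g = "\<lambda>j z. w z * cmod (Ext (G j) z)" and c = c], unfold marcinkiewicz_data_def, intro conjI allI)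
   show "(LEB z. ennreal ((w z * cmod (Ext (G j) z)) powr q0)) \<le> ennreal (K0 * c j powr q0 * 2 powr (real j * B * (1 - q0 / q)))" for j
    by (rule lev[OF q(1) C0 RC0 K0(2)])
   have "0 < q1" using q by simp
   then show "(LEB z. ennreal ((w z * cmod (Ext (G j) z)) powr q1)) \<le> ennreal (K0 * c j powr q1 * 2 powr (real j * B * (1 - q1 / q)))" for j
    by (rule lev[OF _ C1 RC1 K0(3)])
   show "w z * cmod (Ext (G j) z) \<le> D * c j * 2 powr (- et * real j)" for j z
   proof -
    have "cmod (Ext (G j) z) \<le> L (Suc j) * a j"
    proof (cases "L (Suc j) = 0")
     case True
     then show ?thesis using Gz[OF True] by (simp add: extension_op_def)
    next
     case False
     then have Lp: "L (Suc j) > 0" using Ln[of "Suc j"] by simp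
     let ?H = "\<lambda>om. G j om / of_real (L (Suc j))"
     have "Ext (G j) z = of_real (L (Suc j)) * Ext ?H z" using extension_op_scale[of "of_real (L (Suc j))" ?H z] Lp by simp
     moreover have "cmod (Ext ?H z) \<le> a j" unfolding a_def by (rule extension_op_le[OF Gb[OF Lp]])
     ultimately show ?thesis using Lp by (simp add: norm_mult)
    qed
    moreover have "w z * cmod (Ext (G j) z) \<le> 1 * cmod (Ext (G j) z)" using w0 by (intro mult_right_mono) auto
    ultimately have "w z * cmod (Ext (G j) z) \<le> L (Suc j) * a j" by linarith
    also have "... = c j * a j powr et"
    proof -
     have "a j powr (1 / r) * a j powr et = a j" using a[of j] by (simp add: powr_add[symmetric] et_def)
     then show ?thesis by (simp add: c_def)
    qed
    also have "... = (2 * pi) powr et * c j * 2 powr (- et * real j)" unfolding apw by (simp add: mult_ac)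
    also have "... \<le> D * c j * 2 powr (- et * real j)" using D c by (intro mult_right_mono) auto
    finally show ?thesis .
   qed
   show "ennreal (w z * cmod (Ext F z)) \<le> (\<Sum>j. ennreal (w z * cmod (Ext (G j) z)))" for z
   proof -
    have "ennreal (w z) * ennreal (cmod (Ext F z)) \<le> ennreal (w z) * (\<Sum>j. ennreal (cmod (Ext (G j) z)))"
     by (intro mult_left_mono le) auto
    also have "... = (\<Sum>j. ennreal (w z) * ennreal (cmod (Ext (G j) z)))" by (rule ennreal_suminf_cmult[symmetric])
    finally show ?thesis using w0 by (simp add: ennreal_mult)
   qed
   show "(\<Sum>j. ennreal (c j powr q)) \<le> ennreal ((4 * J) powr (q / r))" by (rule sumcq)
  qed (use w0 c in auto)
  also have "K' * (4 * J) powr (q / r) = K' * 4 powr (q / r) * J powr (q / r)" using J0 by (simp add: powr_mult)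
  finally show "(LEB z. ennreal ((w z * cmod (Ext F z)) powr q)) \<le> ennreal (K' * 4 powr (q / r) * J powr (q / r))" .
 qed
qed

section \<open>Boundedness of the weighted operator\<close>

lemma cmod_weighted_extension_op:
 "cmod (weighted_extension_op al be F z) = plane_weight al be z * cmod (Ext F z)"
 by (cases z) (simp add: weighted_extension_op_def plane_weight_def norm_mult mult.commute)

lemma borel_measurable_weighted_extension_op [measurable]:
 assumes [measurable]: "F \<in> borel_measurable \<sigma>"
 shows "weighted_extension_op al be F \<in> borel_measurable borel"
proof -
 have "weighted_extension_op al be F = (\<lambda>z. Ext F z * of_real (plane_weight al be z))"
  by (auto simp: weighted_extension_op_def plane_weight_def fun_eq_iff)
 then show ?thesis by simp
qed

lemma Lp_norm_leI:
 assumes p: "p > 0" and S: "S \<ge> 0" and I: "(\<integral>\<^sup>+x. ennreal (cmod (f x) powr p) \<partial>M) \<le> ennreal (S powr p)"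
 shows "Lp_norm M (ennreal p) f \<le> ennreal S"
proof -
 let ?I = "\<integral>\<^sup>+x. ennreal (cmod (f x) powr p) \<partial>M"
 have fin: "?I \<noteq> \<infinity>" using I by (auto simp: top_unique)
 have "enn2real ?I \<le> S powr p" using enn2real_mono[OF I] by simp
 then have "enn2real ?I powr (1 / p) \<le> (S powr p) powr (1 / p)" using p by (intro powr_mono2) auto
 also have "... = S" using p S by (simp add: powr_powr)
 finally show ?thesis using fin p by (auto simp: Lp_norm_def Let_def intro: ennreal_leI)
qed

lemma Lp_normD:
 assumes p: "p > 0" and S: "S \<ge> 0" and N: "Lp_norm M (ennreal p) f \<le> ennreal S"
 shows "(\<integral>\<^sup>+x. ennreal (cmod (f x) powr p) \<partial>M) \<le> ennreal (S powr p)"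
proof -
 let ?I = "\<integral>\<^sup>+x. ennreal (cmod (f x) powr p) \<partial>M"
 have fin: "?I \<noteq> \<infinity>" using N p by (auto simp: Lp_norm_def Let_def top_unique split: if_splits)
 then have "ennreal (enn2real ?I powr (1 / p)) \<le> ennreal S" using N p by (simp add: Lp_norm_def Let_def)
 then have "enn2real ?I powr (1 / p) \<le> S" using S by (simp add: ennreal_le_iff)
 then have "(enn2real ?I powr (1 / p)) powr p \<le> S powr p" using p by (intro powr_mono2) auto
 then have "enn2real ?I \<le> S powr p" using p by (simp add: powr_powr)
 then have "ennreal (enn2real ?I) \<le> ennreal (S powr p)" by (rule ennreal_leI)
 moreover have "ennreal (enn2real ?I) = ?I" using fin by (simp add: less_top)
 ultimately show ?thesis by simp
qed

lemma Lp_norm_infinity_le_iff: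
 assumes [measurable]: "f \<in> borel_measurable M" and S: "S \<ge> 0"
 shows "Lp_norm M \<infinity> f \<le> ennreal S \<longleftrightarrow> (AE x in M. cmod (f x) \<le> S)"
proof
 assume N: "Lp_norm M \<infinity> f \<le> ennreal S"
 have "AE x in M. ennreal (cmod (f x)) \<le> esssup M (\<lambda>x. ennreal (cmod (f x)))" by (rule esssup_AE)
 then show "AE x in M. cmod (f x) \<le> S"
 proof eventually_elim
  case (elim x)
  then have "ennreal (cmod (f x)) \<le> ennreal S" using N by (auto simp: Lp_norm_def)
  then show ?case using S by (simp add: ennreal_le_iff)
 qed
next
 assume "AE x in M. cmod (f x) \<le> S"
 then have "AE x in M. ennreal (cmod (f x)) \<le> ennreal S" by eventually_elim (rule ennreal_leI)
 then show "Lp_norm M \<infinity> f \<le> ennreal S" by (auto simp: Lp_norm_def intro: esssup_I)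
qed

text \<open>Assuming the estimate for real bounds \<open>N > 0\<close> avoids arithmetic with
  extended norms. Functions of norm 0 are reached by letting \<open>N\<close> decrease to the
  norm.\<close>

lemma weighted_extension_boundedI:
 assumes C: "C > 0" and B: "\<And>F N. F \<in> borel_measurable \<sigma> \<Longrightarrow> N > 0 \<Longrightarrow>
   Lp_norm \<sigma> r F \<le> ennreal N \<Longrightarrow> Lp_norm lborel q (weighted_extension_op al be F) \<le> ennreal (C * N)"
 shows "weighted_extension_bounded al be r q" unfolding weighted_extension_bounded_def bounded_Lp_op_def
proof (intro exI[of _ C] conjI ballI C)
 fix F assume "F \<in> Lp_space \<sigma> r"
 then have Fm[measurable]: "F \<in> borel_measurable \<sigma>" and fin: "Lp_norm \<sigma> r F < \<infinity>" by (auto simp: Lp_space_def)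
 define N where "N = enn2real (Lp_norm \<sigma> r F)"
 have N: "N \<ge> 0" "Lp_norm \<sigma> r F = ennreal N" using fin by (auto simp: N_def less_top)
 have le: "Lp_norm lborel q (weighted_extension_op al be F) \<le> ennreal (C * N)"
 proof (rule ennreal_le_epsilon)
  fix e :: real assume e: "e > 0"
  have "Lp_norm lborel q (weighted_extension_op al be F) \<le> ennreal (C * (N + e / C))"
   using e C N by (intro B Fm) (auto intro: add_nonneg_pos ennreal_leI)
  also have "C * (N + e / C) = C * N + e" using C by (simp add: field_simps)
  also have "ennreal ... = ennreal (C * N) + ennreal e" using C N e by (intro ennreal_plus) auto
  finally show "Lp_norm lborel q (weighted_extension_op al be F) \<le> ennreal (C * N) + ennreal e" .
 qed
 then show "Lp_norm lborel q (weighted_extension_op al be F) \<le> ennreal C * Lp_norm \<sigma> r F"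
  using C N by (simp add: ennreal_mult)
 have "Lp_norm lborel q (weighted_extension_op al be F) < \<infinity>" using le by (rule le_less_trans) simp
 then show "weighted_extension_op al be F \<in> Lp_space lborel q" by (simp add: Lp_space_def)
qed

lemma weighted_extension_boundedD:
 assumes "weighted_extension_bounded al be r q"
 obtains C where "C > 0" "\<And>F N. F \<in> borel_measurable \<sigma> \<Longrightarrow> N \<ge> 0 \<Longrightarrow>
   Lp_norm \<sigma> r F \<le> ennreal N \<Longrightarrow> Lp_norm lborel q (weighted_extension_op al be F) \<le> ennreal (C * N)"
proof -
 obtain C where C: "C > 0" and B: "\<And>F. F \<in> Lp_space \<sigma> r \<Longrightarrow>
   Lp_norm lborel q (weighted_extension_op al be F) \<le> ennreal C * Lp_norm \<sigma> r F"
  using assms unfolding weighted_extension_bounded_def bounded_Lp_op_def by auto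
 show thesis
 proof (rule that[OF C])
  fix F N assume F: "F \<in> borel_measurable \<sigma>" and N: "(N::real) \<ge> 0"
   and le: "Lp_norm \<sigma> r F \<le> ennreal N"
  have "Lp_norm \<sigma> r F < \<infinity>" using le by (rule le_less_trans) simp
  then have "Lp_norm lborel q (weighted_extension_op al be F) \<le> ennreal C * Lp_norm \<sigma> r F"
   using F by (intro B) (simp add: Lp_space_def)
  also have "... \<le> ennreal C * ennreal N" by (intro mult_left_mono le) simp
  also have "... = ennreal (C * N)" using C N by (simp add: ennreal_mult)
  finally show "Lp_norm lborel q (weighted_extension_op al be F) \<le> ennreal (C * N)" .
 qed
qed

lemma weighted_extension_bounded_finite:
 assumes q: "q > 0" and r: "r > 0" and sb: "strong_bound (plane_weight al be) q r"
 shows "weighted_extension_bounded al be (ennreal r) (ennreal q)"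
proof -
 obtain K where K: "K \<ge> 0" and B: "\<And>F J. F \<in> borel_measurable \<sigma> \<Longrightarrow> J \<ge> 0 \<Longrightarrow> (ARC om. ennreal (cmod (F om) powr r)) \<le> ennreal J \<Longrightarrow>
   (LEB z. ennreal ((plane_weight al be z * cmod (Ext F z)) powr q)) \<le> ennreal (K * J powr (q / r))"
  using sb unfolding strong_bound_def by blast
 show ?thesis
proof (rule weighted_extension_boundedI)
 show "(K + 1) powr (1 / q) > 0" using K by simp
 fix F N assume Fm: "F \<in> borel_measurable \<sigma>" and N: "(N::real) > 0"
  and le: "Lp_norm \<sigma> (ennreal r) F \<le> ennreal N"
 have "(ARC om. ennreal (cmod (F om) powr r)) \<le> ennreal (N powr r)" using r N by (intro Lp_normD le) auto
 then have "(LEB z. ennreal ((plane_weight al be z * cmod (Ext F z)) powr q)) \<le> ennreal (K * (N powr r) powr (q / r))"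
  by (intro B Fm) auto
 also have "... \<le> ennreal (((K + 1) powr (1 / q) * N) powr q)"
 proof (intro ennreal_leI)
  have "((K + 1) powr (1 / q) * N) powr q = (K + 1) * N powr q" using q K N by (subst powr_mult) (auto simp: powr_powr)
  moreover have "(N powr r) powr (q / r) = N powr q" using r by (simp add: powr_powr)
  ultimately show "K * (N powr r) powr (q / r) \<le> ((K + 1) powr (1 / q) * N) powr q" by (simp add: mult_right_mono)
 qed
 finally show "Lp_norm lborel (ennreal q) (weighted_extension_op al be F) \<le> ennreal ((K + 1) powr (1 / q) * N)"
  using q N by (intro Lp_norm_leI) (auto simp: cmod_weighted_extension_op)
qed
qed

text \<open>On a set of finite length L^infinity embeds in L^s, so the case r = infinity is deduced
  from a large finite exponent.\<close>

lemma weighted_extension_bounded_infinite: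
 assumes s: "s > 0" and b: "weighted_extension_bounded al be (ennreal s) q"
 shows "weighted_extension_bounded al be \<infinity> q"
proof -
 obtain C where C: "C > 0" and B: "\<And>F N. F \<in> borel_measurable \<sigma> \<Longrightarrow> N \<ge> 0 \<Longrightarrow>
   Lp_norm \<sigma> (ennreal s) F \<le> ennreal N \<Longrightarrow> Lp_norm lborel q (weighted_extension_op al be F) \<le> ennreal (C * N)"
  by (rule weighted_extension_boundedD[OF b]) (rule that)
 let ?c = "(2 * pi) powr (1 / s)"
 show ?thesis
 proof (rule weighted_extension_boundedI)
  show "C * ?c > 0" using C by simp
  fix F N assume Fm: "F \<in> borel_measurable \<sigma>" and N: "(N::real) > 0" and le: "Lp_norm \<sigma> \<infinity> F \<le> ennreal N"
  have "AE om in \<sigma>. cmod (F om) \<le> N" using le N Fm by (subst (asm) Lp_norm_infinity_le_iff) auto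
  then have "AE om in \<sigma>. ennreal (cmod (F om) powr s) \<le> ennreal (N powr s)"
   by eventually_elim (use s in \<open>auto intro!: ennreal_leI powr_mono2\<close>)
  then have "(ARC om. ennreal (cmod (F om) powr s)) \<le> (ARC om. ennreal (N powr s))" by (rule nn_integral_mono_AE)
  also have "... = ennreal (N powr s * (2 * pi))" by (simp add: emeasure_circle_measure ennreal_mult)
  also have "N powr s * (2 * pi) = (?c * N) powr s" using s by (simp add: powr_mult powr_powr)
  finally have "Lp_norm \<sigma> (ennreal s) F \<le> ennreal (?c * N)" using s N by (intro Lp_norm_leI) auto
  then show "Lp_norm lborel q (weighted_extension_op al be F) \<le> ennreal (C * ?c * N)" using B[OF Fm, of "?c * N"] N by (simp add: mult.assoc)
 qed
qed

text \<open>No integrability is assumed: for a non-integrable density the Bochner integral is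
  0.\<close>

lemma cmod_extension_op_le:
 "ennreal (cmod (Ext F z)) \<le> (ARC om. ennreal (cmod (F om)))"
proof -
 have "ennreal (cmod (Ext F z)) \<le> ennreal (norm (\<integral>om. exp (\<i> * of_real (z \<bullet> om)) * F om \<partial>\<sigma>))"
  unfolding extension_op_def by (intro ennreal_leI norm_extension_le)
 also have "... \<le> (ARC om. ennreal (norm (exp (\<i> * of_real (z \<bullet> om)) * F om)))"
 proof (cases "integrable \<sigma> (\<lambda>om. exp (\<i> * of_real (z \<bullet> om)) * F om)")
  case True
  then show ?thesis by (rule integral_norm_bound_ennreal)
 qed (simp add: not_integrable_integral_eq)
 finally show ?thesis by (simp add: norm_mult)
qed

lemma weighted_extension_bounded_sup:
 assumes ab: "0 \<le> al" "0 \<le> be" and r: "1 \<le> r"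
 shows "weighted_extension_bounded al be r \<infinity>"
proof (rule weighted_extension_boundedI)
 show "2 * pi + 1 > 0" by (simp add: add_pos_pos)
 fix F N assume Fm[measurable]: "F \<in> borel_measurable \<sigma>" and N: "(N::real) > 0"
  and le: "Lp_norm \<sigma> r F \<le> ennreal N"
 have L1: "(ARC om. ennreal (cmod (F om))) \<le> ennreal ((2 * pi + 1) * N)"
 proof (cases r)
  case (real s)
  have s: "s \<ge> 1" using r real by (simp add: ennreal_le_iff flip: ennreal_1)
  have "(ARC om. ennreal (cmod (F om) powr s)) \<le> ennreal (N powr s)" using s N le real by (intro Lp_normD) auto
  then show ?thesis by (rule circle_Lp_L1[OF Fm s N])
 next
  case top
  then have "AE om in \<sigma>. cmod (F om) \<le> N"
   using le N by (subst (asm) top, subst (asm) infinity_ennreal_def[symmetric], subst (asm) Lp_norm_infinity_le_iff) auto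
  then have "(ARC om. ennreal (cmod (F om))) \<le> (ARC om. ennreal N)"
   by (intro nn_integral_mono_AE) (auto elim!: eventually_mono intro: ennreal_leI)
  also have "... = ennreal (N * (2 * pi))" using N by (simp add: emeasure_circle_measure space_circle_measure ennreal_mult)
  also have "... \<le> ennreal ((2 * pi + 1) * N)" using N by (intro ennreal_leI) (simp add: algebra_simps)
  finally show ?thesis .
 qed
 have "cmod (weighted_extension_op al be F z) \<le> (2 * pi + 1) * N" for z
 proof -
  have "ennreal (cmod (Ext F z)) \<le> ennreal ((2 * pi + 1) * N)" by (rule order_trans[OF cmod_extension_op_le L1])
  then have "cmod (Ext F z) \<le> (2 * pi + 1) * N" using N by (subst (asm) ennreal_le_iff) auto
  moreover have "plane_weight al be z * cmod (Ext F z) \<le> 1 * cmod (Ext F z)"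
   by (intro mult_right_mono plane_weight_bounds ab) simp
  ultimately show ?thesis by (simp add: cmod_weighted_extension_op)
 qed
 then show "Lp_norm lborel \<infinity> (weighted_extension_op al be F) \<le> ennreal ((2 * pi + 1) * N)"
  using N by (subst Lp_norm_infinity_le_iff) auto
qed

section \<open>The sufficient conditions\<close>

lemma restricted_bound_mono:
 assumes "\<And>z. 0 \<le> v z" "\<And>z. v z \<le> w z" "q > 0" "restricted_bound w q A B"
 shows "restricted_bound v q A B"
proof -
 obtain C where C: "C \<ge> 0" and R: "\<And>F a. circle_bound F a \<Longrightarrow>
   (LEB z. ennreal ((w z * cmod (Ext F z)) powr q)) \<le> ennreal (C * a powr (q * A - B))"
  using assms(4) unfolding restricted_bound_def by auto
 have "(LEB z. ennreal ((v z * cmod (Ext F z)) powr q)) \<le> ennreal (C * a powr (q * A - B))"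
  if "circle_bound F a" for F a by (rule order_trans[OF nn_integral_mono R[OF that]])
   (use assms in \<open>auto intro!: ennreal_leI powr_mono2 mult_right_mono\<close>)
 then show ?thesis using C unfolding restricted_bound_def by auto
qed

text \<open>For r = infinity the condition reads 0 < A - B/q, and any finite \<open>s\<close> with
  1/s below the right side is admissible.\<close>

lemma weighted_extension_bounded_strict:
 assumes q: "q > 0" and r: "1 \<le> r" and R: "restricted_bound (plane_weight al be) q A B"
  and ex: "enn2real (1 / r) < A - B / q"
 shows "weighted_extension_bounded al be r (ennreal q)"
proof -
 have fin: "weighted_extension_bounded al be (ennreal s) (ennreal q)" if "s \<ge> 1" "1 / s < A - B / q" for s
  using that by (intro weighted_extension_bounded_finite q restricted_strict[OF _ _ q _ R]) (auto simp: plane_weight_bounds)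
 show ?thesis
 proof (cases r)
  case (real s)
  have s: "s \<ge> 1" using r real by (simp add: ennreal_le_iff flip: ennreal_1)
  have "1 / r = ennreal (1 / s)" using s real by (simp add: divide_ennreal flip: ennreal_1)
  then show ?thesis using fin[OF s] ex s real by simp
 next
  case top
  then have e: "A - B / q > 0" using ex by simp
  define s where "s = max 1 (2 / (A - B / q))"
  have s: "s \<ge> 1" "2 / (A - B / q) \<le> s" by (auto simp: s_def)
  have "1 / s \<le> (A - B / q) / 2" using s e by (simp add: divide_le_eq le_divide_eq mult.commute)
  moreover have "(A - B / q) / 2 < A - B / q" using e by simp
  ultimately have "1 / s < A - B / q" by (rule le_less_trans)
  then show ?thesis using top s weighted_extension_bounded_infinite[OF _ fin[OF s(1)]] by simp
 qed
qed

lemma weighted_extension_bounded_plane: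
 assumes ab: "0 \<le> al" "0 \<le> be" and q: "q > 0" and r: "1 \<le> r"
  and c: "al + be > 2 / q - 1 / 2" and m: "max al be < 1 / q"
  and ex: "al + be + min al be > 3 / q - (1 - enn2real (1 / r))"
 shows "weighted_extension_bounded al be r (ennreal q)"
proof (rule weighted_extension_bounded_strict[OF q r])
 show "restricted_bound (plane_weight al be) q (1 + al + be + min al be) 3"
  using q m by (intro restricted_bound_plane ab c) (auto simp: field_simps)
qed (use ex in simp)

text \<open>When a weight exponent reaches 1/q, both exponents are lowered until they are below 1/q
  and the plane estimate applies. Lowering enlarges the weight, so nothing is lost but
  \<open>ep\<close>, and the strict inequality in the hypothesis leaves room for it.\<close>

lemma weighted_extension_bounded_axis:
 assumes ab: "0 \<le> al" "0 \<le> be" and q: "q > 0" and r: "1 \<le> r" and rh: "enn2real (1 / r) < 1"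
  and m: "max al be \<ge> 1 / q"
  and ex: "2 * min al be > 2 / q - (1 - enn2real (1 / r))"
 shows "weighted_extension_bounded al be r (ennreal q)"
proof -
 define rh where "rh = enn2real (1 / r)"
 have rh: "0 \<le> rh" "rh < 1" using rh by (auto simp: rh_def)
 define p where "p = 1 / q"
 have p: "p > 0" "2 / q = 2 * p" "3 / q = 3 * p" using q by (auto simp: p_def)
 define n where "n = min al be"
 have n: "2 * n > 2 * p - (1 - rh)" "n \<ge> 0" using ex ab by (auto simp: n_def rh_def p)
 \<comment> \<open>The fourth condition leaves the smaller exponent untouched if it is below 1/q.
   The third and the fifth keep the decay condition and the plane condition valid after
   lowering.\<close>
 obtain ep where ep: "ep > 0" "ep < p" "ep < (1 - rh) / 4" "n < p \<Longrightarrow> ep < p - n" "ep < (2 * n - 2 * p + (1 - rh)) / 2"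
 proof -
  define e where "e = min (min p ((1 - rh) / 4)) (min (if n < p then p - n else 1) ((2 * n - 2 * p + (1 - rh)) / 2))"
  have "e > 0" using p rh n by (auto simp: e_def)
  moreover have "e \<le> p" "e \<le> (1 - rh) / 4" "n < p \<Longrightarrow> e \<le> p - n" "e \<le> (2 * n - 2 * p + (1 - rh)) / 2"
   unfolding e_def by (auto simp only: min.coboundedI1 min.coboundedI2 order_refl if_True intro: min.coboundedI1 min.coboundedI2)
  moreover from calculation have "e / 2 > 0" "e / 2 < e" by simp_all
  ultimately show thesis by (intro that[of "e / 2"]) (meson less_le_trans)+
 qed
 define al' be' where "al' = min al (p - ep)" and "be' = min be (p - ep)"
 have ab': "0 \<le> al'" "0 \<le> be'" "al' \<le> al" "be' \<le> be" "max al' be' < p"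
  using ab ep by (auto simp: al'_def be'_def)
 have s: "al' + be' > 2 * p - 1 / 2 \<and> al' + be' + min al' be' > 3 * p - (1 - rh)"
 proof (cases "n < p")
  case True
  have "al' + be' = n + (p - ep)" "min al' be' = n"
   using True ep(4)[OF True] ep(1) m by (auto simp: al'_def be'_def n_def p_def min_def max_def split: if_splits)
  then show ?thesis using n ep rh by auto
 next
  case False
  then have "al' = p - ep" "be' = p - ep" using ep(1) by (auto simp: al'_def be'_def n_def)
  then show ?thesis using ep rh by auto
 qed
 have "restricted_bound (plane_weight al' be') q (1 + al' + be' + min al' be') 3"
 proof (rule restricted_bound_plane[OF ab'(1) _ ab'(2) _ q])
  have "x * q < 1" if "x < p" for x using that q by (simp only: p_def pos_less_divide_eq)
  then show "al' * q < 1" "be' * q < 1" using ab'(5) by auto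
  show "al' + be' > 2 / q - 1 / 2" using s unfolding p by simp
 qed
 then have "restricted_bound (plane_weight al be) q (1 + al' + be' + min al' be') 3"
  by (rule restricted_bound_mono[rotated -1]) (use ab' q in \<open>auto intro: plane_weight_bounds plane_weight_antimono\<close>)
 then show ?thesis using s p by (intro weighted_extension_bounded_strict[OF q r]) (auto simp: rh_def)
qed

text \<open>For r = 1 no gain from a small support is available, so the extension is bounded by the
  L^1 norm of the data. The weight itself lies in L^q, since it is a product of two integrable
  powers.\<close>

lemma weighted_extension_bounded_L1:
 assumes ab: "al * q > 1" "be * q > 1" and q: "q > 0"
 shows "weighted_extension_bounded al be 1 (ennreal q)"
proof -
 define K where "K = (2 + 2 / (al * q - 1)) * (2 + 2 / (be * q - 1))"
 have K: "K \<ge> 0" using ab by (auto simp: K_def)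
 have I: "(LEB z. ennreal (plane_weight al be z powr q)) \<le> ennreal K"
 proof -
  have "(LEB z. ennreal (plane_weight al be z powr q))
   = (LEB x. LEB y. ennreal ((1 + \<bar>x\<bar>) powr (- (al * q))) * ennreal ((1 + \<bar>y\<bar>) powr (- (be * q))))"
   by (subst nn_integral_plane(1)) (auto simp: plane_weight_powr ennreal_mult)
  also have "... = (LEB x. ennreal ((1 + \<bar>x\<bar>) powr (- (al * q))) * (LEB y. ennreal ((1 + \<bar>y\<bar>) powr (- (be * q)))))"
   by (intro nn_integral_cong nn_integral_cmult) auto
  also have "... = (LEB x. ennreal ((1 + \<bar>x\<bar>) powr (- (al * q)))) * (LEB y. ennreal ((1 + \<bar>y\<bar>) powr (- (be * q))))"
   by (rule nn_integral_multc) auto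
  also have "... \<le> ennreal (2 + 2 / (al * q - 1)) * ennreal (2 + 2 / (be * q - 1))"
   by (intro mult_mono nn_integral_weight_line ab) auto
  also have "... = ennreal K" unfolding K_def using ab by (intro ennreal_mult[symmetric]) auto
  finally show ?thesis .
 qed
 have "weighted_extension_bounded al be (ennreal 1) (ennreal q)"
 proof (rule weighted_extension_bounded_finite[OF q], simp, unfold strong_bound_def, intro exI[of _ K] conjI allI impI K)
  fix F J assume [measurable]: "F \<in> borel_measurable \<sigma>" and J: "(J::real) \<ge> 0"
   and le: "(ARC om. ennreal (cmod (F om) powr 1)) \<le> ennreal J"
  have E: "cmod (Ext F z) \<le> J" for z
  proof -
   have "ennreal (cmod (Ext F z)) \<le> ennreal J" by (rule order_trans[OF cmod_extension_op_le]) (use le in simp)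
   then show ?thesis using J by (subst (asm) ennreal_le_iff) auto
  qed
  have "(LEB z. ennreal ((plane_weight al be z * cmod (Ext F z)) powr q))
   \<le> (LEB z. ennreal (J powr q) * ennreal (plane_weight al be z powr q))"
  proof (intro nn_integral_mono)
   fix z
   have "(plane_weight al be z * cmod (Ext F z)) powr q \<le> (J * plane_weight al be z) powr q"
    using E[of z] J plane_weight_bounds(1)[of al be z] q by (intro powr_mono2) (auto simp: mult.commute[of J] intro!: mult_left_mono)
   also have "... = J powr q * plane_weight al be z powr q" using J plane_weight_bounds(1)[of al be z] by (simp add: powr_mult)
   finally show "ennreal ((plane_weight al be z * cmod (Ext F z)) powr q) \<le> ennreal (J powr q) * ennreal (plane_weight al be z powr q)"
    by (subst ennreal_mult[symmetric]) (auto intro: ennreal_leI)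
  qed
  also have "... = ennreal (J powr q) * (LEB z. ennreal (plane_weight al be z powr q))" by (rule nn_integral_cmult) auto
  also have "... \<le> ennreal (J powr q) * ennreal K" by (intro mult_left_mono I) auto
  also have "... = ennreal (K * J powr (q / 1))" using K by (simp add: ennreal_mult mult.commute)
  finally show "(LEB z. ennreal ((plane_weight al be z * cmod (Ext F z)) powr q)) \<le> ennreal (K * J powr (q / 1))" .
 qed
 then show ?thesis by simp
qed

text \<open>This lemma and the next one move \<open>q\<close> a little to either side without
  violating finitely many strict inequalities, as the interpolation at an endpoint requires.\<close>

lemma exists_exponent_above:
 fixes c q :: real
 assumes "c \<ge> 0" "c * q < 1"
 obtains q1 where "q < q1" "c * q1 < 1"
proof (cases "c = 0")
 case True
 then show ?thesis using that[of "q + 1"] by simp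
next
 case False
 then have c: "c > 0" using assms by simp
 then have "q < 1 / c" using assms by (simp add: field_simps)
 then obtain q1 where "q < q1" "q1 < 1 / c" using dense by blast
 then show ?thesis using that[of q1] c by (simp add: field_simps)
qed

lemma exists_exponent_below:
 fixes c d q :: real
 assumes "q > 0" "c * q > 1" "d * q > 1"
 obtains q0 where "0 < q0" "q0 < q" "c * q0 > 1" "d * q0 > 1"
proof -
 have cd: "c > 0" "d > 0" using assms by (metis less_trans zero_less_mult_pos2 zero_less_one)+
 have "max (1 / c) (1 / d) < q" using assms cd by (simp add: field_simps)
 then obtain q0 where q0: "max (1 / c) (1 / d) < q0" "q0 < q" using dense by blast
 have "0 < 1 / c" using cd by simp
 then have "0 < q0" using q0 by linarith
 then show ?thesis using that[of q0] q0 cd by (simp add: field_simps)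
qed

lemma weighted_extension_bounded_endpoint:
 assumes ab: "0 \<le> al" "0 \<le> be" and q: "0 < q0" "q0 < q" "q < q1" and r: "1 < r" "r \<le> ennreal q" and B: "B > 0"
  and R: "restricted_bound (plane_weight al be) q0 A B" "restricted_bound (plane_weight al be) q1 A B"
  and ex: "enn2real (1 / r) = A - B / q"
 shows "weighted_extension_bounded al be r (ennreal q)"
proof -
 have q0: "0 < q" using q by simp
 obtain s where s: "r = ennreal s" "s \<ge> 0" using r by (cases r) (auto simp: top_unique)
 have s1: "s > 1" "s \<le> q" using r s q0 by (auto simp: ennreal_le_iff ennreal_less_iff simp flip: ennreal_1)
 have "1 / r = ennreal (1 / s)" using s s1 by (simp add: divide_ennreal flip: ennreal_1)
 then have e: "1 / s = A - B / q" using ex s by simp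
 have "strong_bound (plane_weight al be) q s"
  by (rule restricted_endpoint[OF borel_measurable_plane_weight plane_weight_bounds(1) plane_weight_bounds(2)[OF ab] q s1 B R e])
 then show ?thesis unfolding s(1) using s1 by (intro weighted_extension_bounded_finite[OF q0]) auto
qed

text \<open>The decay condition and max < 1/q are strict and persist at nearby exponents, with the
  same \<open>A\<close> and \<open>B = 3\<close>; the equality is needed only at
  \<open>q\<close>.\<close>

lemma weighted_extension_bounded_plane_endpoint:
 assumes ab: "0 \<le> al" "0 \<le> be" and q: "q > 0" and r: "1 < r" "r \<le> ennreal q"
  and c: "al + be > 2 / q - 1 / 2" and m: "max al be < 1 / q"
  and ex: "al + be + min al be = 3 / q - (1 - enn2real (1 / r))"
 shows "weighted_extension_bounded al be r (ennreal q)"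
proof -
 have m1: "max al be * q < 1" using q m by (simp only: pos_less_divide_eq)
 obtain q1 where q1: "q < q1" "max al be * q1 < 1" by (rule exists_exponent_above[OF _ m1]) (use ab in auto)
 \<comment> \<open>Chosen so that c p > 1 is the decay condition al + be > 2/p - 1/2.\<close>
 define c where "c = (al + be + 1 / 2) / 2"
 have "c * q > 1" using c q by (simp add: c_def field_simps)
 then obtain q0 where q0: "0 < q0" "q0 < q" "c * q0 > 1" using exists_exponent_below[OF q, of c c] by auto
 have "c > 0" using ab by (simp add: c_def)
 then have "c * q < c * q1" using q1 by simp
 then have c1: "c * q1 > 1" using \<open>c * q > 1\<close> by linarith
 have "max al be * q0 \<le> max al be * q" using q0 ab by (intro mult_left_mono) auto
 then have m0: "max al be * q0 < 1" using m1 by linarith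
 have R: "restricted_bound (plane_weight al be) p (1 + al + be + min al be) 3"
  if p: "0 < p" "max al be * p < 1" "c * p > 1" for p
 proof (rule restricted_bound_plane)
  have le: "al * p \<le> max al be * p" "be * p \<le> max al be * p" using p by (auto intro!: mult_right_mono)
  show "al * p < 1" using le(1) p(2) by (rule le_less_trans)
  show "be * p < 1" using le(2) p(2) by (rule le_less_trans)
  show "al + be > 2 / p - 1 / 2" using p by (simp add: c_def field_simps)
 qed (use ab p in auto)
 show ?thesis using q0 q1 q m0 c1 ex by (intro weighted_extension_bounded_endpoint[OF ab q0(1,2) q1(1) r _ R R]) auto
qed

text \<open>With max > 1/q the line estimate with \<open>B = 2\<close> is available. Its other two
  conditions at \<open>q\<close> come from the equality, which says that the smaller exponent lies
  below 1/q by (1 - 1/r)/2, a number strictly between 0 and 1/2 for finite r > 1.\<close>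

lemma weighted_extension_bounded_axis_endpoint:
 assumes ab: "0 \<le> al" "0 \<le> be" and q: "q > 0" and r: "1 < r" "r \<le> ennreal q"
  and m: "max al be > 1 / q"
  and ex: "2 * min al be = 2 / q - (1 - enn2real (1 / r))"
 shows "weighted_extension_bounded al be r (ennreal q)"
proof -
 obtain s where s: "r = ennreal s" "s \<ge> 0" using r by (cases r) (auto simp: top_unique)
 have s1: "s > 1" using r s by (auto simp: ennreal_less_iff simp flip: ennreal_1)
 have "1 / r = ennreal (1 / s)" using s s1 by (simp add: divide_ennreal flip: ennreal_1)
 then have rh: "enn2real (1 / r) < 1" "enn2real (1 / r) > 0" using s1 by auto
 have m1: "max al be * q > 1" using q m by (simp only: pos_divide_less_eq)
 define n where "n = min al be"
 have n: "n \<ge> 0" "n < 1 / q" "n + 1 / 2 > 1 / q" using ab ex rh by (auto simp: n_def)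
 have n1: "n * q < 1" "(n + 1 / 2) * q > 1" using n q by (auto simp: field_simps)
 obtain q1 where q1: "q < q1" "n * q1 < 1" using exists_exponent_above[OF n(1) n1(1)] by auto
 obtain q0 where q0: "0 < q0" "q0 < q" "max al be * q0 > 1" "(n + 1 / 2) * q0 > 1" using exists_exponent_below[OF q m1 n1(2)] by auto
 have "max al be * q \<le> max al be * q1" using q1 ab by (intro mult_left_mono) auto
 then have mm: "max al be * q1 > 1" using m1 by linarith
 have "(n + 1 / 2) * q \<le> (n + 1 / 2) * q1" using q1 n by (intro mult_left_mono) auto
 then have nn: "(n + 1 / 2) * q1 > 1" using n1 by linarith
 have "n * q0 \<le> n * q" using q0 n by (intro mult_left_mono) auto
 then have n0: "n * q0 < 1" using n1 by linarith
 have R: "restricted_bound (plane_weight al be) p (1 + 2 * min al be) 2"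
  if p: "0 < p" "max al be * p > 1" "n * p < 1" "(n + 1 / 2) * p > 1" for p
  using p unfolding n_def by (intro restricted_bound_line ab) (auto simp: algebra_simps)
 show ?thesis using q0 q1 q n0 mm nn ex by (intro weighted_extension_bounded_endpoint[OF ab q0(1,2) q1(1) r _ R R]) auto
qed

section \<open>Knapp examples\<close>

text \<open>\<open>rh\<close> stands for 1/r, and \<open>rh = 0\<close> encodes r = infinity. Test
  functions are Borel on the whole plane, so sums of indicators and exchanges of the axes stay
  within the definition.\<close>

definition test_function :: "real \<Rightarrow> (real \<times> real \<Rightarrow> complex) \<Rightarrow> real \<Rightarrow> bool" where
 "test_function rh F N \<longleftrightarrow> F \<in> borel_measurable borel \<and> N > 0 \<and>
  (if rh = 0 then \<forall>om. cmod (F om) \<le> N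
   else (ARC om. ennreal (cmod (F om) powr (1 / rh))) \<le> ennreal (N powr (1 / rh)))"

definition extension_estimate :: "real \<Rightarrow> real \<Rightarrow> real \<Rightarrow> real \<Rightarrow> bool" where
 "extension_estimate al be rh q \<longleftrightarrow> (\<exists>C>0. \<forall>F N. test_function rh F N \<longrightarrow> (LEB z. ennreal ((plane_weight al be z * cmod (Ext F z)) powr q)) \<le> ennreal ((C * N) powr q))"

lemma extension_estimateI:
 assumes b: "weighted_extension_bounded al be r (ennreal q)" and r: "1 \<le> r" and q: "q > 0"
 shows "extension_estimate al be (enn2real (1 / r)) q"
proof -
 obtain C where C: "C > 0" and B: "\<And>F N. F \<in> borel_measurable \<sigma> \<Longrightarrow> N \<ge> 0 \<Longrightarrow>
   Lp_norm \<sigma> r F \<le> ennreal N \<Longrightarrow> Lp_norm lborel (ennreal q) (weighted_extension_op al be F) \<le> ennreal (C * N)"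
  by (rule weighted_extension_boundedD[OF b]) (rule that)
 have "(LEB z. ennreal ((plane_weight al be z * cmod (Ext F z)) powr q)) \<le> ennreal ((C * N) powr q)"
  if tf: "test_function (enn2real (1 / r)) F N" for F N
 proof -
  have Fm: "F \<in> borel_measurable \<sigma>" and N: "N > 0" and h: "if enn2real (1 / r) = 0 then \<forall>om. cmod (F om) \<le> N
   else (ARC om. ennreal (cmod (F om) powr (1 / enn2real (1 / r)))) \<le> ennreal (N powr (1 / enn2real (1 / r)))"
   using tf unfolding test_function_def by auto
  have "Lp_norm \<sigma> r F \<le> ennreal N"
  proof (cases r)
   case (real s)
   have s: "s \<ge> 1" using r real by (simp add: ennreal_le_iff flip: ennreal_1)
   have "1 / r = ennreal (1 / s)" using s real by (simp add: divide_ennreal flip: ennreal_1)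
   then have "enn2real (1 / r) = 1 / s" using s by simp
   then have "(ARC om. ennreal (cmod (F om) powr s)) \<le> ennreal (N powr s)" using h s by simp
   then have "Lp_norm \<sigma> (ennreal s) F \<le> ennreal N" using s N by (intro Lp_norm_leI) auto
   then show ?thesis using real by simp
  next
   case top
   have "cmod (F om) \<le> N" for om using h top by (cases om) simp
   then have "AE om in \<sigma>. cmod (F om) \<le> N" by (rule AE_I2)
   then have "Lp_norm \<sigma> \<infinity> F \<le> ennreal N" using Fm N by (subst Lp_norm_infinity_le_iff) auto
   then show ?thesis using top by simp
  qed
  then have "Lp_norm lborel (ennreal q) (weighted_extension_op al be F) \<le> ennreal (C * N)" using N by (intro B Fm) auto
  then have "(LEB z. ennreal (cmod (weighted_extension_op al be F z) powr q)) \<le> ennreal ((C * N) powr q)"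
   using C N q by (intro Lp_normD) auto
  then show ?thesis by (simp add: cmod_weighted_extension_op)
 qed
 then show ?thesis using C unfolding extension_estimate_def by blast
qed

lemma extension_estimate_swap:
 assumes "extension_estimate al be rh q"
 shows "extension_estimate be al rh q"
proof -
 obtain C where C: "C > 0" and B: "\<And>F N. test_function rh F N \<Longrightarrow>
  (LEB z. ennreal ((plane_weight al be z * cmod (Ext F z)) powr q)) \<le> ennreal ((C * N) powr q)"
  using assms unfolding extension_estimate_def by blast
 have sw: "(\<lambda>om::real \<times> real. (snd om, fst om)) \<in> borel_measurable borel"
  by (intro borel_measurable_continuous_onI continuous_intros)
 have "(LEB z. ennreal ((plane_weight be al z * cmod (Ext F z)) powr q)) \<le> ennreal ((C * N) powr q)"
  if tf: "test_function rh F N" for F N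
 proof -
  let ?F = "\<lambda>om. F (snd om, fst om)"
  have Fm[measurable]: "F \<in> borel_measurable borel" using tf by (simp add: test_function_def)
  have "(ARC om. ennreal (cmod (?F om) powr (1 / rh))) = (ARC om. ennreal (cmod (F om) powr (1 / rh)))"
   by (rule nn_integral_circle_swap) measurable
  then have "test_function rh ?F N" using tf measurable_compose[OF sw Fm] by (auto simp: test_function_def)
  then have "(LEB z. ennreal ((plane_weight al be z * cmod (Ext ?F z)) powr q)) \<le> ennreal ((C * N) powr q)" by (rule B)
  also have "(LEB z. ennreal ((plane_weight al be z * cmod (Ext ?F z)) powr q))
   = (LEB z. ennreal ((plane_weight be al (snd z, fst z) * cmod (Ext F (snd z, fst z))) powr q))"
   by (simp add: extension_op_swap plane_weight_def mult_ac)
  also have "... = (LEB z. ennreal ((plane_weight be al z * cmod (Ext F z)) powr q))"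
   by (rule nn_integral_plane_swap) measurable
  finally show ?thesis .
 qed
 then show ?thesis using C unfolding extension_estimate_def by blast
qed

text \<open>A set in the plane whose trace on the circle is the arc around \<open>(0, 1)\<close>;
  the condition on the second coordinate removes the opposite arc.\<close>

definition cap :: "real \<Rightarrow> (real \<times> real) set" where
 "cap a = {om. \<bar>fst om\<bar> \<le> a \<and> 0 < snd om}"

lemma sets_cap [measurable]: "cap a \<in> sets borel"
proof -
 have "{om :: real \<times> real. \<bar>fst om\<bar> \<le> a} \<in> sets borel" by (intro borel_closed closed_Collect_le continuous_intros)
 moreover have "{om :: real \<times> real. 0 < snd om} \<in> sets borel" by (intro borel_open open_Collect_less continuous_intros)
 moreover have "cap a = {om. \<bar>fst om\<bar> \<le> a} \<inter> {om. 0 < snd om}" by (auto simp: cap_def)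
 ultimately show ?thesis by (simp add: sets.Int)
qed

lemma cap_mono: "a \<le> b \<Longrightarrow> cap a \<subseteq> cap b" by (auto simp: cap_def)

lemma sets_circle_Int [measurable]: "S \<in> sets borel \<Longrightarrow> S \<inter> sphere 0 1 \<in> sets \<sigma>"
 by (auto simp: sets_circle_measure sets_restrict_space)

lemma measure_cap_le:
 assumes "a \<ge> 0"
 shows "measure \<sigma> (cap a \<inter> sphere 0 1) \<le> 20 * a"
proof -
 interpret C: finite_measure \<sigma> by (rule finite_measure_circle)
 have m: "{om'. \<bar>cross (0, 1) om'\<bar> \<le> a} \<in> sets borel" by measurable
 have "emeasure \<sigma> (cap a \<inter> sphere 0 1) = (ARC om. indicator (cap a \<inter> sphere 0 1) om)" by simp
 also have "... \<le> (ARC om'. indicator {om'. \<bar>cross (0, 1) om'\<bar> \<le> a} om')"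
  by (intro nn_integral_mono) (auto simp: cap_def cross_def indicator_def)
 also have "... \<le> ennreal (20 * a)" by (rule emeasure_cross_small) (use assms in \<open>auto simp: norm_Pair\<close>)
 finally show ?thesis using assms by (simp add: C.emeasure_eq_measure)
qed

lemma measure_cap_ge:
 assumes a: "0 < a" "a \<le> 1"
 shows "2 * a \<le> measure \<sigma> (cap a \<inter> sphere 0 1)"
proof -
 interpret C: finite_measure \<sigma> by (rule finite_measure_circle)
 have sub: "indicator {pi / 2 - a..pi / 2 + a} t \<le> (indicator (cap a) (cos t, sin t) * indicator {0..<2 * pi} t :: ennreal)" for t
 proof (cases "t \<in> {pi / 2 - a..pi / 2 + a}")
  case True
  define u where "u = t - pi / 2"
  have u: "\<bar>u\<bar> \<le> a" "t = u + pi / 2" using True by (auto simp: u_def)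
  have "\<bar>sin u\<bar> \<le> \<bar>u\<bar>" by (rule abs_sin_x_le_abs_x)
  then have "\<bar>cos t\<bar> \<le> a" using u by (simp add: cos_add)
  moreover have "cos u > 0" by (rule cos_gt_zero_pi) (use u(1) a pi_gt3 in linarith)+
  then have "sin t > 0" using u by (simp add: sin_add)
  moreover have "0 \<le> t" "t < 2 * pi" using u a pi_gt3 by linarith+
  ultimately show ?thesis using True by (simp add: cap_def)
 qed simp
 have "ennreal (2 * a) = (LEB t. indicator {pi / 2 - a..pi / 2 + a} t)" using a by simp
 also have "... \<le> (LEB t. indicator (cap a) (cos t, sin t) * indicator {0..<2 * pi} t)" by (intro nn_integral_mono sub)
 also have "... = (ARC om. indicator (cap a) om)" by (rule nn_integral_circle[symmetric]) measurable
 also have "... = (ARC om. indicator (cap a \<inter> sphere 0 1) om)" by (intro nn_integral_cong) (auto simp: indicator_def)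
 also have "... = ennreal (measure \<sigma> (cap a \<inter> sphere 0 1))" by (simp add: C.emeasure_eq_measure)
 finally show ?thesis by (subst (asm) ennreal_le_iff) auto
qed

text \<open>Near \<open>(0, 1)\<close> the phase differs from \<open>y\<close> by x om_1 + y (om_2 -
  1), with |om_1| at most \<open>a\<close> and |om_2 - 1| at most a^2. On the stated box this is at
  most 1, and cos 1 is at least 1/2 because 1 \<le> pi/3: no cancellation occurs. The subset
  \<open>S\<close> is arbitrary so that caps with smaller caps removed are covered.\<close>

lemma extension_op_cap_lower:
 assumes S[measurable]: "S \<in> sets borel" and sub: "S \<subseteq> cap a" and a: "0 < a"
  and x: "\<bar>x\<bar> \<le> 1 / (2 * a)" and y: "\<bar>y\<bar> \<le> 1 / (2 * a\<^sup>2)"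
 shows "measure \<sigma> (S \<inter> sphere 0 1) / (4 * pi) \<le> cmod (Ext (indicator S) (x, y))"
proof -
 interpret C: finite_measure \<sigma> by (rule finite_measure_circle)
 let ?m = "measure \<sigma> (S \<inter> sphere 0 1)"
 define tt where "tt om = x * fst om + y * (snd om - 1)" for om :: "real \<times> real"
 have ttm[measurable]: "tt \<in> borel_measurable \<sigma>" unfolding tt_def by measurable
 have tt: "\<bar>tt om\<bar> \<le> 1" if w: "om \<in> S" "om \<in> sphere 0 1" for om
 proof -
  have c: "\<bar>fst om\<bar> \<le> a" "0 < snd om" using w sub by (auto simp: cap_def)
  have n: "(fst om)\<^sup>2 + (snd om)\<^sup>2 = 1" using w by (cases om) (simp add: norm_Pair)
  have "(snd om)\<^sup>2 \<le> 1" using n zero_le_power2[of "fst om"] by linarith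
  then have s1: "snd om \<le> 1" by (simp add: abs_square_le_1)
  have "(snd om)\<^sup>2 \<le> snd om" using s1 c by (simp add: power2_eq_square mult_left_le)
  then have "1 - snd om \<le> (fst om)\<^sup>2" using n by linarith
  also have "... \<le> a\<^sup>2" using power_mono[OF c(1), of 2] by simp
  finally have s2: "\<bar>snd om - 1\<bar> \<le> a\<^sup>2" using s1 by simp
  have "\<bar>x * fst om\<bar> \<le> 1 / (2 * a) * a" unfolding abs_mult using x c a by (intro mult_mono) auto
  moreover have "\<bar>y * (snd om - 1)\<bar> \<le> 1 / (2 * a\<^sup>2) * a\<^sup>2" unfolding abs_mult using y s2 a by (intro mult_mono) auto
  ultimately show ?thesis using a unfolding tt_def by simp
 qed
 have c1: "cos (1::real) \<ge> 1 / 2" using cos_monotone_0_pi_le[of 1 "pi / 3"] pi_gt3 by (simp add: cos_60)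
 have cs: "cos (tt om) \<ge> 1 / 2" if w: "om \<in> S" "om \<in> sphere 0 1" for om
 proof -
  have "cos \<bar>tt om\<bar> \<ge> cos 1" using tt[OF w] pi_gt3 by (intro cos_monotone_0_pi_le) auto
  then show ?thesis using c1 by simp
 qed
 let ?f = "\<lambda>om. exp (\<i> * of_real ((x, y) \<bullet> om)) * indicator S om :: complex"
 let ?g = "\<lambda>om. exp (\<i> * of_real (tt om)) * indicator S om :: complex"
 have ig: "integrable \<sigma> ?g" by (rule C.integrable_const_bound[where B = 1]) (auto simp: norm_mult indicator_def)
 have fg: "?f om = exp (\<i> * of_real y) * ?g om" for om by (simp add: tt_def inner_prod_def mult_exp_exp algebra_simps flip: of_real_add)
 have "?m / 2 = (\<integral>om. 1 / 2 * indicator S om \<partial>\<sigma>)" by simp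
 also have "... \<le> (\<integral>om. Re (?g om) \<partial>\<sigma>)"
 proof (rule integral_mono)
  show "integrable \<sigma> (\<lambda>om. 1 / 2 * indicator S om :: real)"
   by (rule C.integrable_const_bound[where B = 1]) (auto simp: indicator_def)
  show "integrable \<sigma> (\<lambda>om. Re (?g om))" using ig by (rule integrable_Re)
  show "1 / 2 * indicator S om \<le> Re (?g om)" if "om \<in> space \<sigma>" for om using cs[of om] that by (auto simp: indicator_def Re_exp)
 qed
 also have "... = Re (\<integral>om. ?g om \<partial>\<sigma>)" by (rule integral_Re[OF ig])
 also have "... \<le> cmod (\<integral>om. ?g om \<partial>\<sigma>)" by (rule complex_Re_le_cmod)
 also have "... = cmod (\<integral>om. ?f om \<partial>\<sigma>)" unfolding fg by (simp add: norm_mult)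
 finally have "?m / 2 \<le> cmod (\<integral>om. ?f om \<partial>\<sigma>)" .
 then have "?m / 2 / (2 * pi) \<le> cmod (\<integral>om. ?f om \<partial>\<sigma>) / (2 * pi)" by (rule divide_right_mono) simp
 then show ?thesis unfolding extension_op_def by (simp add: norm_mult norm_divide)
qed

text \<open>A negative \<open>s\<close> removes nothing from the interval |x| \<le> R; the value -1
  is used for this. Positive \<open>s\<close> cuts out the middle, which makes boxes of different
  scales disjoint.\<close>

definition weight_mass :: "real \<Rightarrow> real \<Rightarrow> real \<Rightarrow> ennreal" where
 "weight_mass ga s R = (LEB x. ennreal ((1 + \<bar>x\<bar>) powr (- ga)) * indicator {x. s < \<bar>x\<bar> \<and> \<bar>x\<bar> \<le> R} x)"

lemma weight_mass_mono:
 "s' \<le> s \<Longrightarrow> R \<le> R' \<Longrightarrow> weight_mass ga s R \<le> weight_mass ga s' R'"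
 unfolding weight_mass_def by (intro nn_integral_mono mult_left_mono) (auto simp: indicator_def)

text \<open>Only the part X/4 < x \<le> X/2 is kept, where the weight is comparable to X^(-ga). It
  survives every cut-off \<open>s\<close> up to X/4.\<close>

lemma weight_mass_ge:
 assumes X: "X \<ge> 1" and s: "s \<le> X / 4" and ga: "ga \<ge> 0"
 shows "ennreal (2 powr (- ga) / 4 * X powr (1 - ga)) \<le> weight_mass ga s (X / 2)"
proof -
 have "X powr (1 - ga) = X powr (1 + - ga)" by simp
 also have "... = X * X powr (- ga)" using X unfolding powr_add by simp
 finally have "2 powr (- ga) / 4 * X powr (1 - ga) = (2 * X) powr (- ga) * (X / 2 - X / 4)" using X by (simp add: powr_mult)
 then have "ennreal (2 powr (- ga) / 4 * X powr (1 - ga)) = ennreal ((2 * X) powr (- ga)) * ennreal (X / 2 - X / 4)"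
  using X by (simp only:) (intro ennreal_mult, auto)
 also have "ennreal (X / 2 - X / 4) = emeasure lborel {X / 4<..X / 2}" using X by simp
 also have "ennreal ((2 * X) powr (- ga)) * emeasure lborel {X / 4<..X / 2} = (LEB x. ennreal ((2 * X) powr (- ga)) * indicator {X / 4<..X / 2} x)"
  by (rule nn_integral_cmult_indicator[symmetric]) simp
 also have "... \<le> weight_mass ga s (X / 2)" unfolding weight_mass_def
 proof (intro nn_integral_mono)
  fix x :: real
  show "ennreal ((2 * X) powr (- ga)) * indicator {X / 4<..X / 2} x
   \<le> ennreal ((1 + \<bar>x\<bar>) powr (- ga)) * indicator {x. s < \<bar>x\<bar> \<and> \<bar>x\<bar> \<le> X / 2} x"
  proof (cases "x \<in> {X / 4<..X / 2}")
   case True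
   have x: "x > X / 4" "x \<le> X / 2" using True by auto
   have "(2 * X) powr (- ga) \<le> (1 + \<bar>x\<bar>) powr (- ga)" using x X ga by (intro powr_mono2') linarith+
   moreover have "s < \<bar>x\<bar>" "\<bar>x\<bar> \<le> X / 2" using x X s by linarith+
   ultimately show ?thesis using True by (simp add: ennreal_leI)
  qed simp
 qed
 finally show ?thesis .
qed

lemma weight_mass_log:
 assumes "R \<ge> 0" "s < 0"
 shows "ennreal (ln (1 + R)) \<le> weight_mass 1 s R"
proof -
 have "(LEB x. ennreal (1 / (1 + x)) * indicator {0..R} x) = ennreal (ln (1 + R) - ln (1 + 0))"
  by (rule nn_integral_FTC_Icc) (use assms in \<open>auto intro!: derivative_eq_intros\<close>)
 then have "ennreal (ln (1 + R)) = (LEB x. ennreal (1 / (1 + x)) * indicator {0..R} x)" by simp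
 also have "... \<le> weight_mass 1 s R" unfolding weight_mass_def using assms
  by (intro nn_integral_mono) (auto simp: indicator_def powr_minus divide_inverse)
 finally show ?thesis .
qed

lemma nn_integral_weight_box:
 "(LEB z. ennreal (plane_weight al be z powr q) * indicator {z. \<bar>fst z\<bar> \<le> R \<and> s < \<bar>snd z\<bar> \<and> \<bar>snd z\<bar> \<le> T} z)
  = weight_mass (al * q) (-1) R * weight_mass (be * q) s T"
proof -
 let ?f = "\<lambda>x. ennreal ((1 + \<bar>x\<bar>) powr (- (al * q))) * indicator {x. -1 < \<bar>x\<bar> \<and> \<bar>x\<bar> \<le> R} x"
 let ?g = "\<lambda>y. ennreal ((1 + \<bar>y\<bar>) powr (- (be * q))) * indicator {y. s < \<bar>y\<bar> \<and> \<bar>y\<bar> \<le> T} y"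
 have fm[measurable]: "?f \<in> borel_measurable borel" and gm[measurable]: "?g \<in> borel_measurable borel" by measurable
 have "(\<lambda>z. ?f (fst z) * ?g (snd z)) \<in> borel_measurable (borel \<Otimes>\<^sub>M borel)" by measurable
 then have m: "(\<lambda>z. ?f (fst z) * ?g (snd z)) \<in> borel_measurable borel" by (simp add: borel_prod)
 have "(LEB z. ennreal (plane_weight al be z powr q) * indicator {z. \<bar>fst z\<bar> \<le> R \<and> s < \<bar>snd z\<bar> \<and> \<bar>snd z\<bar> \<le> T} z)
  = (LEB z. ?f (fst z) * ?g (snd z))" by (intro nn_integral_cong) (auto simp: plane_weight_powr ennreal_mult indicator_def)
 also have "... = (LEB x. LEB y. ?f x * ?g y)" by (subst nn_integral_plane(1)[OF m]) simp
 also have "... = (LEB x. ?f x * (LEB y. ?g y))" by (intro nn_integral_cong nn_integral_cmult) simp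
 also have "... = (LEB x. ?f x) * (LEB y. ?g y)" by (rule nn_integral_multc) simp
 finally show ?thesis by (simp add: weight_mass_def)
qed

lemma sets_plane_box [measurable]:
 "{z :: real \<times> real. \<bar>fst z\<bar> \<le> R \<and> s < \<bar>snd z\<bar> \<and> \<bar>snd z\<bar> \<le> T} \<in> sets borel"
proof -
 have "{z :: real \<times> real. \<bar>fst z\<bar> \<le> R} \<in> sets borel" "{z :: real \<times> real. \<bar>snd z\<bar> \<le> T} \<in> sets borel"
  by (intro borel_closed closed_Collect_le continuous_intros)+
 moreover have "{z :: real \<times> real. s < \<bar>snd z\<bar>} \<in> sets borel" by (intro borel_open open_Collect_less continuous_intros)
 moreover have "{z :: real \<times> real. \<bar>fst z\<bar> \<le> R \<and> s < \<bar>snd z\<bar> \<and> \<bar>snd z\<bar> \<le> T}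
  = {z. \<bar>fst z\<bar> \<le> R} \<inter> {z. \<bar>snd z\<bar> \<le> T} \<inter> {z. s < \<bar>snd z\<bar>}" by auto
 ultimately show ?thesis by (simp add: sets.Int)
qed

text \<open>The choices \<open>A\<close> and \<open>A\<close> with \<open>j\<close> toggled are paired: one of the two sums has modulus at least \<open>cmod (g j)\<close>.\<close>

lemma random_signs:
 fixes g :: "'a \<Rightarrow> complex"
 assumes J: "finite J" "j \<in> J" and q: "q > 0"
 shows "2 ^ card J / 2 * cmod (g j) powr q \<le> (\<Sum>A\<in>Pow J. cmod (\<Sum>k\<in>J. if k \<in> A then g k else - g k) powr q)"
proof -
 define f where "f A = (\<Sum>k\<in>J. if k \<in> A then g k else - g k)" for A
 define R where "R A = (\<Sum>k\<in>J - {j}. if k \<in> A then g k else - g k)" for A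
 define T where "T A = (A - {j}) \<union> ({j} - A)" for A
 have f: "f A = (if j \<in> A then g j else - g j) + R A" for A unfolding f_def R_def by (rule sum.remove[OF J])
 have RT: "R (T A) = R A" for A unfolding R_def by (intro sum.cong) (auto simp: T_def)
 have TT: "T (T A) = A" for A by (auto simp: T_def)
 have TP: "T A \<in> Pow J" if "A \<in> Pow J" for A using that J by (auto simp: T_def)
 have re: "(\<Sum>A\<in>Pow J. cmod (f (T A)) powr q) = (\<Sum>A\<in>Pow J. cmod (f A) powr q)"
  by (rule sum.reindex_bij_witness[where i = T and j = T]) (auto simp only: TT TP)
 have pt: "cmod (g j) powr q \<le> cmod (f A) powr q + cmod (f (T A)) powr q" for A
 proof -
  have "f A - f (T A) = (if j \<in> A then 2 * g j else - (2 * g j))" unfolding f[of A] f[of "T A"] RT by (auto simp: T_def)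
  then have "cmod (f A - f (T A)) = 2 * cmod (g j)" by (simp add: norm_mult)
  then have "2 * cmod (g j) \<le> cmod (f A) + cmod (f (T A))" using norm_triangle_ineq4[of "f A" "f (T A)"] by simp
  then consider "cmod (g j) \<le> cmod (f A)" | "cmod (g j) \<le> cmod (f (T A))" by linarith
  then show ?thesis
  proof cases
   case 1
   then have "cmod (g j) powr q \<le> cmod (f A) powr q" using q by (intro powr_mono2) auto
   then show ?thesis by (simp add: add_increasing2)
  next
   case 2
   then have "cmod (g j) powr q \<le> cmod (f (T A)) powr q" using q by (intro powr_mono2) auto
   then show ?thesis by (simp add: add_increasing)
  qed
 qed
 have "2 ^ card J * cmod (g j) powr q = (\<Sum>A\<in>Pow J. cmod (g j) powr q)" using J by (simp add: card_Pow)
 also have "... \<le> (\<Sum>A\<in>Pow J. cmod (f A) powr q + cmod (f (T A)) powr q)" by (intro sum_mono pt)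
 also have "... = 2 * (\<Sum>A\<in>Pow J. cmod (f A) powr q)" unfolding sum.distrib re by simp
 finally show ?thesis unfolding f_def by simp
qed

lemma ennreal_mult_leD:
 assumes "0 < D" "0 \<le> V" "ennreal D * t \<le> ennreal V"
 shows "t \<le> ennreal (V / D)"
proof -
 have inv: "ennreal (1 / D) * ennreal D = 1" using assms by (subst ennreal_mult[symmetric]) auto
 have "t = (ennreal (1 / D) * ennreal D) * t" unfolding inv by simp
 also have "... = ennreal (1 / D) * (ennreal D * t)" by (rule mult.assoc)
 also have "... \<le> ennreal (1 / D) * ennreal V" by (intro mult_left_mono assms) simp
 also have "... = ennreal (V / D)" using assms by (subst ennreal_mult[symmetric]) auto
 finally show ?thesis .
qed

lemma extension_op_sum:
 assumes "\<And>k. k \<in> J \<Longrightarrow> S k \<in> sets borel"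
 shows "Ext (\<lambda>om. \<Sum>k\<in>J. c k * indicator (S k) om) z = (\<Sum>k\<in>J. c k * Ext (indicator (S k)) z)"
proof -
 have i: "integrable \<sigma> (\<lambda>om. exp (\<i> * of_real (z \<bullet> om)) * (c k * indicator (S k) om))" if "k \<in> J" for k
 proof (rule integrable_extension)
  show "(\<lambda>om. c k * indicator (S k) om) \<in> borel_measurable \<sigma>" using assms[OF that] by simp
  show "cmod (c k * indicator (S k) om) \<le> cmod (c k)" for om by (simp add: norm_mult indicator_def)
 qed
 have "Ext (\<lambda>om. \<Sum>k\<in>J. c k * indicator (S k) om) z = (\<Sum>k\<in>J. Ext (\<lambda>om. c k * indicator (S k) om) z)"
  unfolding extension_op_def sum_distrib_left by (subst Bochner_Integration.integral_sum) (use i in \<open>auto simp: sum_distrib_left\<close>)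
 then show ?thesis by (simp add: extension_op_scale)
qed

section \<open>Disjoint caps with random signs\<close>

text \<open>\<open>S j\<close> fills a fixed proportion of the cap of width 1/X_j, and the cut-offs
  \<open>s\<close> keep the boxes on which the extensions are large disjoint. Disjointness is asked
  only below \<open>n\<close>, so constant sequences with \<open>n = 1\<close> describe a single
  Knapp example.\<close>

definition cap_family :: "nat \<Rightarrow> (nat \<Rightarrow> real) \<Rightarrow> (nat \<Rightarrow> (real \<times> real) set) \<Rightarrow> (nat \<Rightarrow> real) \<Rightarrow> bool" where
 "cap_family n X S s \<longleftrightarrow> n \<ge> 1 \<and> (\<forall>j. 1 \<le> X j \<and> S j \<in> sets borel \<and> S j \<subseteq> cap (1 / X j) \<and>
   1 / X j \<le> measure \<sigma> (S j \<inter> sphere 0 1)) \<and>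
  (\<forall>om i k. i < n \<longrightarrow> k < n \<longrightarrow> om \<in> S i \<longrightarrow> om \<in> S k \<longrightarrow> i = k) \<and>
  (\<forall>i k. i < k \<longrightarrow> k < n \<longrightarrow> (X i)\<^sup>2 / 2 \<le> s k)"

text \<open>The test functions are signed sums of the indicators of \<open>S k\<close>, each
  normalised to L^r norm of order 1; by disjointness their norm is of order n^(1/r) for every choice
  of signs. On box j the average over the signs is at least of the size of the j-th term alone, so
  the weighted contributions of the boxes add up.\<close>

lemma cap_family_estimate:
 assumes est: "extension_estimate al be rh q" and rh: "rh \<ge> 0" and q: "q > 0"
 obtains K where "K > 0"
  "\<And>n X S s. cap_family n X S s \<Longrightarrow>
   (\<Sum>j<n. ennreal (X j powr (- (q * (1 - rh)))) *
    (weight_mass (al * q) (-1) (X j / 2) * weight_mass (be * q) (s j) ((X j)\<^sup>2 / 2))) \<le> ennreal (K * real n powr (rh * q))"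
proof -
 obtain C where C: "C > 0" and B: "\<And>F N. test_function rh F N \<Longrightarrow> (LEB z. ennreal ((plane_weight al be z * cmod (Ext F z)) powr q)) \<le> ennreal ((C * N) powr q)"
  using est unfolding extension_estimate_def by blast
 interpret C: finite_measure \<sigma> by (rule finite_measure_circle)
 define ka where "ka = (1 / (4 * pi)) powr q"
 have ka: "ka > 0" by (simp add: ka_def)
 define K where "K = 2 * (C * 20 powr rh) powr q / ka"
 show thesis
 proof (rule that[of K])
  show "K > 0" using ka C by (simp add: K_def)
  fix n X S s assume cf: "cap_family n X S s"
  have n: "n \<ge> 1" and X1: "1 \<le> X j" and Sm[measurable]: "S j \<in> sets borel" and Ssub: "S j \<subseteq> cap (1 / X j)"
   and mge': "1 / X j \<le> measure \<sigma> (S j \<inter> sphere 0 1)" for j using cf by (auto simp: cap_family_def)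
  have Suniq: "i < n \<Longrightarrow> k < n \<Longrightarrow> om \<in> S i \<Longrightarrow> om \<in> S k \<Longrightarrow> i = k"
   and sep: "i < k \<Longrightarrow> k < n \<Longrightarrow> (X i)\<^sup>2 / 2 \<le> s k" for om i k using cf unfolding cap_family_def by blast+
  have X0: "X j > 0" for j using X1[of j] by simp
  define b where "b j = 1 / X j" for j
  have b: "0 < b j" "b j \<le> 1" for j using X1[of j] X0[of j] by (auto simp: b_def)
  define m where "m j = measure \<sigma> (S j \<inter> sphere 0 1)" for j
  have mge: "b j \<le> m j" for j using mge' by (simp add: b_def m_def)
  have mle: "m j \<le> 20 * b j" for j
  proof -
   have "m j \<le> measure \<sigma> (cap (b j) \<inter> sphere 0 1)" unfolding m_def b_def using Ssub[of j] by (intro C.finite_measure_mono) auto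
   also have "... \<le> 20 * b j" using b[of j] by (intro measure_cap_le) simp
   finally show ?thesis .
  qed
  \<comment> \<open>With this height, b_j^(-1/r), the r-th power of the norm of one cap is m_j /
    b_j, at most 20.\<close>
  define U where "U j = b j powr (- rh)" for j
  have U: "U j > 0" for j using b[of j] by (simp add: U_def)
  define box where "box j = {z :: real \<times> real. \<bar>fst z\<bar> \<le> X j / 2 \<and> s j < \<bar>snd z\<bar> \<and> \<bar>snd z\<bar> \<le> (X j)\<^sup>2 / 2}" for j
  have boxm[measurable]: "box j \<in> sets borel" for j unfolding box_def by measurable
  have boxuniq: "i = k" if z: "z \<in> box i" "z \<in> box k" "i < n" "k < n" for z i k
  proof (rule ccontr)
   assume "i \<noteq> k"
   then consider "i < k" | "k < i" by linarith
   then show False using z sep[of i k] sep[of k i] by cases (auto simp: box_def)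
  qed
  define g where "g j z = of_real (U j) * Ext (indicator (S j)) z" for j z
  have gge: "(1 / (4 * pi)) powr q * X j powr (- (q * (1 - rh))) \<le> cmod (g j z) powr q" if z: "z \<in> box j" for j z
  proof -
   have "m j / (4 * pi) \<le> cmod (Ext (indicator (S j)) (fst z, snd z))" unfolding m_def by (rule extension_op_cap_lower[where a = "b j"])
     (use z b X0[of j] Ssub[of j] in \<open>auto simp: box_def b_def power_divide\<close>)
   then have "b j / (4 * pi) \<le> cmod (Ext (indicator (S j)) z)" using divide_right_mono[OF mge[of j], of "4 * pi"] by simp
   then have "U j * (b j / (4 * pi)) \<le> U j * cmod (Ext (indicator (S j)) z)" using U[of j] by (intro mult_left_mono) auto
   also have "... = cmod (g j z)" using U[of j] by (simp add: g_def norm_mult)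
   finally have "U j * (b j / (4 * pi)) \<le> cmod (g j z)" .
   then have "(U j * (b j / (4 * pi))) powr q \<le> cmod (g j z) powr q" using q U[of j] b(1)[of j] by (intro powr_mono2) auto
   also have "U j * (b j / (4 * pi)) = 1 / (4 * pi) * X j powr (- (1 - rh))"
   proof -
    have "X j powr (- (1 - rh)) = X j powr (rh + - 1)" by (rule arg_cong[where f = "\<lambda>e. X j powr e"]) simp
    also have "... = X j powr rh * (1 / X j)" unfolding powr_add using X0[of j] by (simp add: powr_minus_divide)
    also have "X j powr rh = U j" using X0[of j] by (simp add: U_def b_def powr_divide powr_minus_divide)
    finally show ?thesis by (simp add: b_def)
   qed
   also have "(1 / (4 * pi) * X j powr (- (1 - rh))) powr q = (1 / (4 * pi)) powr q * (X j powr (- (1 - rh))) powr q" by (rule powr_mult)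
   also have "(X j powr (- (1 - rh))) powr q = X j powr (- (q * (1 - rh)))"
    unfolding powr_powr by (rule arg_cong[where f = "\<lambda>e. X j powr e"]) (simp add: algebra_simps)
   finally show ?thesis .
  qed
  define sg where "sg A k = complex_of_real (if k \<in> A then U k else - U k)" for A :: "nat set" and k
  define F where "F A om = (\<Sum>k<n. sg A k * indicator (S k) om)" for A om
  have Fm[measurable]: "F A \<in> borel_measurable borel" for A unfolding F_def by measurable
  have EF: "Ext (F A) z = (\<Sum>k<n. if k \<in> A then g k z else - g k z)" for A z
   unfolding F_def by (subst extension_op_sum) (auto simp: sg_def g_def intro!: sum.cong)
  have Fin: "F A om = sg A k" if k: "k < n" "om \<in> S k" for A om k
  proof -
   have "F A om = (\<Sum>i<n. if i = k then sg A k else 0)" unfolding F_def using k by (intro sum.cong) (auto simp: indicator_def dest: Suniq)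
   then show ?thesis using k(1) by simp
  qed
  have Fout: "F A om = 0" if "\<And>k. k < n \<Longrightarrow> om \<notin> S k" for A om unfolding F_def using that by (intro sum.neutral) auto
  have cs: "cmod (sg A k) = U k" for A k using U[of k] by (auto simp: sg_def)
  define N where "N = (20 * real n) powr rh"
  have N: "N > 0" using n by (simp add: N_def)
  have up: "(LEB z. ennreal ((plane_weight al be z * cmod (Ext (F A) z)) powr q)) \<le> ennreal ((C * N) powr q)" for A
  proof (rule B, unfold test_function_def, intro conjI Fm N)
   show "if rh = 0 then \<forall>om. cmod (F A om) \<le> N
    else (ARC om. ennreal (cmod (F A om) powr (1 / rh))) \<le> ennreal (N powr (1 / rh))"
   proof (cases "rh = 0")
    case True
    have "cmod (F A om) \<le> 1" for om
    proof (cases "\<exists>k<n. om \<in> S k")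
     case k: True
     then obtain k where "k < n" "om \<in> S k" by blast
     then show ?thesis using True b[of k] by (simp add: Fin cs U_def)
    next
     case False
     then show ?thesis using Fout[of om] by simp
    qed
    then show ?thesis using True n by (simp add: N_def)
   next
    case False
    have pt: "ennreal (cmod (F A om) powr (1 / rh)) \<le> (\<Sum>k<n. ennreal (1 / b k) * indicator (S k) om)" for om
    proof (cases "\<exists>k<n. om \<in> S k")
     case True
     then obtain k where k: "k < n" "om \<in> S k" by blast
     have "cmod (F A om) powr (1 / rh) = b k powr (- 1)" using k False by (simp add: Fin cs U_def powr_powr)
     also have "... = 1 / b k" using b[of k] by (simp add: powr_minus_divide)
     finally have "ennreal (cmod (F A om) powr (1 / rh)) = ennreal (1 / b k) * indicator (S k) om" using k by simp
     also have "... \<le> (\<Sum>k<n. ennreal (1 / b k) * indicator (S k) om)" using k by (intro member_le_sum) auto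
     finally show ?thesis .
    next
     case F: False
     then show ?thesis using Fout[of om] by simp
    qed
    have "(ARC om. ennreal (cmod (F A om) powr (1 / rh))) \<le> (ARC om. (\<Sum>k<n. ennreal (1 / b k) * indicator (S k) om))"
     by (intro nn_integral_mono pt)
    also have "... = (ARC om. (\<Sum>k<n. ennreal (1 / b k) * indicator (S k \<inter> sphere 0 1) om))"
     by (intro nn_integral_cong sum.cong) (auto simp: indicator_def)
    also have "... = (\<Sum>k<n. ennreal (1 / b k) * ennreal (m k))"
     by (subst nn_integral_sum) (auto simp: nn_integral_cmult_indicator m_def C.emeasure_eq_measure)
    also have "... \<le> (\<Sum>k<n. ennreal 20)"
    proof (intro sum_mono)
     fix k
     have "1 / b k * m k \<le> 20" using mle[of k] b(1)[of k] by (simp add: divide_le_eq)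
     moreover have "ennreal (1 / b k) * ennreal (m k) = ennreal (1 / b k * m k)"
      using b(1)[of k] by (intro ennreal_mult[symmetric]) (auto simp: m_def)
     ultimately show "ennreal (1 / b k) * ennreal (m k) \<le> ennreal 20" by (simp add: ennreal_leI del: ennreal_numeral)
    qed
    also have "... = ennreal (20 * real n)" by (simp add: ennreal_mult'' ennreal_of_nat_eq_real_of_nat mult.commute)
    also have "20 * real n = N powr (1 / rh)" using False by (simp add: N_def powr_powr)
    finally show ?thesis using False by simp
   qed
  qed
  define W where "W j = weight_mass (al * q) (-1) (X j / 2) * weight_mass (be * q) (s j) ((X j)\<^sup>2 / 2)" for j
  define D where "D = 2 ^ n / 2 * ka"
  have D: "D > 0" using ka by (simp add: D_def)
  define c where "c j = X j powr (- (q * (1 - rh)))" for j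
  have c: "c j \<ge> 0" for j by (simp add: c_def)
  \<comment> \<open>At most one box contains z, so the left side is a single term.
    \<open>random_signs\<close> bounds it by the sum over all \<open>2 ^ n\<close> choices of sign,
    half of which is the factor in \<open>D\<close>.\<close>
  have pt: "(\<Sum>j<n. ennreal (D * c j) * (ennreal (plane_weight al be z powr q) * indicator (box j) z))
   \<le> (\<Sum>A\<in>Pow {..<n}. ennreal ((plane_weight al be z * cmod (Ext (F A) z)) powr q))" for z
  proof (cases "\<exists>j<n. z \<in> box j")
   case True
   then obtain j where j: "j < n" "z \<in> box j" by blast
   have "(\<Sum>i<n. ennreal (D * c i) * (ennreal (plane_weight al be z powr q) * indicator (box i) z))
    = (\<Sum>i<n. if i = j then ennreal (D * c j) * ennreal (plane_weight al be z powr q) else 0)"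
    using j by (intro sum.cong) (auto simp: indicator_def dest: boxuniq)
   also have "... = ennreal (D * c j) * ennreal (plane_weight al be z powr q)" using j(1) by simp
   also have "... = ennreal (D * c j * plane_weight al be z powr q)" using D c by (intro ennreal_mult[symmetric]) auto
   also have "... \<le> ennreal (\<Sum>A\<in>Pow {..<n}. (plane_weight al be z * cmod (Ext (F A) z)) powr q)"
   proof (intro ennreal_leI)
    have "D * c j = 2 ^ n / 2 * (ka * c j)" by (simp add: D_def)
    also have "... \<le> 2 ^ n / 2 * cmod (g j z) powr q" using gge[OF j(2)] by (intro mult_left_mono) (auto simp: ka_def c_def)
    also have "... \<le> (\<Sum>A\<in>Pow {..<n}. cmod (Ext (F A) z) powr q)"
     unfolding EF using random_signs[of "{..<n}" j q "\<lambda>k. g k z"] j q by simp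
    finally have "D * c j * plane_weight al be z powr q \<le> (\<Sum>A\<in>Pow {..<n}. cmod (Ext (F A) z) powr q) * plane_weight al be z powr q"
     by (rule mult_right_mono) simp
    also have "... = (\<Sum>A\<in>Pow {..<n}. (plane_weight al be z * cmod (Ext (F A) z)) powr q)"
     unfolding sum_distrib_right by (intro sum.cong refl, subst powr_mult) (auto simp: mult.commute plane_weight_bounds)
    finally show "D * c j * plane_weight al be z powr q \<le> (\<Sum>A\<in>Pow {..<n}. (plane_weight al be z * cmod (Ext (F A) z)) powr q)" .
   qed
   also have "... = (\<Sum>A\<in>Pow {..<n}. ennreal ((plane_weight al be z * cmod (Ext (F A) z)) powr q))"
    by (rule sum_ennreal[symmetric]) simp
   finally show ?thesis .
  next
   case False
   then have "(\<Sum>j<n. ennreal (D * c j) * (ennreal (plane_weight al be z powr q) * indicator (box j) z)) = 0"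
    by (intro sum.neutral) auto
   then show ?thesis by (simp only: zero_le)
  qed
  have "ennreal D * (\<Sum>j<n. ennreal (c j) * W j) = (\<Sum>j<n. ennreal (D * c j) * W j)"
   unfolding sum_distrib_left using D c by (intro sum.cong refl) (simp add: ennreal_mult mult.assoc)
  also have "... = (\<Sum>j<n. LEB z. ennreal (D * c j) * (ennreal (plane_weight al be z powr q) * indicator (box j) z))"
   unfolding W_def nn_integral_weight_box[symmetric] box_def by (intro sum.cong refl nn_integral_cmult[symmetric]) auto
  also have "... = (LEB z. (\<Sum>j<n. ennreal (D * c j) * (ennreal (plane_weight al be z powr q) * indicator (box j) z)))"
   by (rule nn_integral_sum[symmetric]) auto
  also have "... \<le> (LEB z. (\<Sum>A\<in>Pow {..<n}. ennreal ((plane_weight al be z * cmod (Ext (F A) z)) powr q)))"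
   by (intro nn_integral_mono pt)
  also have "... = (\<Sum>A\<in>Pow {..<n}. LEB z. ennreal ((plane_weight al be z * cmod (Ext (F A) z)) powr q))"
   by (rule nn_integral_sum) auto
  also have "... \<le> (\<Sum>A\<in>Pow {..<n}. ennreal ((C * N) powr q))" by (intro sum_mono up)
  also have "... = ennreal (2 ^ n * (C * N) powr q)" by (subst sum_ennreal) (auto simp: card_Pow)
  finally have "(\<Sum>j<n. ennreal (c j) * W j) \<le> ennreal (2 ^ n * (C * N) powr q / D)" by (intro ennreal_mult_leD D) auto
  also have "2 ^ n * (C * N) powr q / D = K * real n powr (rh * q)"
  proof -
   have "C * N = C * 20 powr rh * real n powr rh" by (simp add: N_def powr_mult)
   then have "(C * N) powr q = (C * 20 powr rh) powr q * real n powr (rh * q)" using C by (simp add: powr_mult powr_powr)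
   then show ?thesis by (simp add: K_def D_def)
  qed
  finally show "(\<Sum>j<n. ennreal (X j powr (- (q * (1 - rh)))) *
    (weight_mass (al * q) (-1) (X j / 2) * weight_mass (be * q) (s j) ((X j)\<^sup>2 / 2))) \<le> ennreal (K * real n powr (rh * q))"
   unfolding c_def W_def .
 qed
qed

text \<open>The caps are the differences of concentric caps of widths 32^(-j) and 32^(-j-1); the
  boxes are cut off at \<open>(X j)\<^sup>2 / 2048\<close> in the second coordinate.\<close>

lemma multiscale_estimate:
 fixes X :: "nat \<Rightarrow> real"
 assumes est: "extension_estimate al be rh q" and rh: "rh \<ge> 0" and q: "q > 0"
 defines "X \<equiv> \<lambda>j. 32 ^ j"
 obtains K where "K > 0"
  "\<And>n. n \<ge> 1 \<Longrightarrow> (\<Sum>j<n. ennreal (X j powr (- (q * (1 - rh)))) *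
    (weight_mass (al * q) (-1) (X j / 2) * weight_mass (be * q) ((X j)\<^sup>2 / 2048) ((X j)\<^sup>2 / 2))) \<le> ennreal (K * real n powr (rh * q))"
proof -
 obtain K where K: "K > 0" and le: "\<And>n X S s. cap_family n X S s \<Longrightarrow>
   (\<Sum>j<n. ennreal (X j powr (- (q * (1 - rh)))) *
    (weight_mass (al * q) (-1) (X j / 2) * weight_mass (be * q) (s j) ((X j)\<^sup>2 / 2))) \<le> ennreal (K * real n powr (rh * q))"
  by (rule cap_family_estimate[OF est rh q]) (rule that)
 interpret C: finite_measure \<sigma> by (rule finite_measure_circle)
 define b where "b j = 1 / X j" for j
 have X1: "X j \<ge> 1" and X0: "X j > 0" for j by (auto simp: X_def)
 have b: "0 < b j" "b j \<le> 1" for j using X1[of j] X0[of j] by (auto simp: b_def)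
 have bS: "b (Suc j) = b j / 32" for j by (simp add: b_def X_def)
 have bmono: "b k \<le> b j" if "j \<le> k" for j k using that by (auto simp: b_def X_def intro!: divide_left_mono power_increasing)
 define S where "S j = cap (b j) - cap (b (Suc j))" for j
 have Suniq: "i = k" if "om \<in> S i" "om \<in> S k" for om i k
 proof (rule ccontr)
  assume "i \<noteq> k"
  then consider "Suc i \<le> k" | "Suc k \<le> i" by linarith
  then show False using that cap_mono[OF bmono, of "Suc i" k] cap_mono[OF bmono, of "Suc k" i] by cases (auto simp: S_def)
 qed
 \<comment> \<open>The ratio 32 is large enough for the lower bound 2b of the large cap to beat the
   upper bound 20b/32 of the small one by at least b.\<close>
 have mge: "b j \<le> measure \<sigma> (S j \<inter> sphere 0 1)" for j
 proof -
  have "measure \<sigma> (cap (b j) \<inter> sphere 0 1) - measure \<sigma> (cap (b (Suc j)) \<inter> sphere 0 1)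
   = measure \<sigma> (cap (b j) \<inter> sphere 0 1 - cap (b (Suc j)) \<inter> sphere 0 1)"
   using cap_mono[OF bmono, of j "Suc j"] by (intro C.finite_measure_Diff[symmetric]) auto
  also have "cap (b j) \<inter> sphere 0 1 - cap (b (Suc j)) \<inter> sphere 0 1 = S j \<inter> sphere 0 1" by (auto simp: S_def)
  finally have "measure \<sigma> (S j \<inter> sphere 0 1) = measure \<sigma> (cap (b j) \<inter> sphere 0 1) - measure \<sigma> (cap (b (Suc j)) \<inter> sphere 0 1)"
   by simp
  moreover have "2 * b j \<le> measure \<sigma> (cap (b j) \<inter> sphere 0 1)" by (rule measure_cap_ge[OF b])
  moreover have "measure \<sigma> (cap (b (Suc j)) \<inter> sphere 0 1) \<le> 20 * b (Suc j)"
   using b[of "Suc j"] by (intro measure_cap_le) simp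
  ultimately show ?thesis using bS[of j] b(1)[of j] by linarith
 qed
 \<comment> \<open>2048 is 2 times 32^2: each box starts where the box of the previous scale
   ends.\<close>
 have sep: "(X i)\<^sup>2 / 2 \<le> (X k)\<^sup>2 / 2048" if "i < k" for i k
 proof -
  have "X (Suc i) \<le> X k" unfolding X_def using that by (intro power_increasing) auto
  then have "(X (Suc i))\<^sup>2 \<le> (X k)\<^sup>2" using X0[of "Suc i"] by (intro power_mono) auto
  moreover have "(X (Suc i))\<^sup>2 = 1024 * (X i)\<^sup>2" by (simp add: X_def power_mult_distrib)
  ultimately show ?thesis by simp
 qed
 show thesis
 proof (rule that[OF K])
  fix n :: nat assume "n \<ge> 1"
  then show "(\<Sum>j<n. ennreal (X j powr (- (q * (1 - rh)))) *
    (weight_mass (al * q) (-1) (X j / 2) * weight_mass (be * q) ((X j)\<^sup>2 / 2048) ((X j)\<^sup>2 / 2))) \<le> ennreal (K * real n powr (rh * q))"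
   using X1 mge sep Suniq by (intro le[where S = S]) (auto simp: cap_family_def S_def b_def)
 qed
qed

section \<open>The conditions forced by one and by many caps\<close>

lemma powr_growth:
 fixes c C e :: real
 assumes c: "c > 0" and le: "\<And>X. X \<ge> 1 \<Longrightarrow> c * X powr e \<le> C"
 shows "e \<le> 0"
proof (rule ccontr)
 assume "\<not> e \<le> 0"
 then have e: "e > 0" by simp
 define M where "M = \<bar>C\<bar> / c + 1"
 have M: "M \<ge> 1" using c by (simp add: M_def)
 have "1 \<le> M powr (1 / e)" using M e by (intro ge_one_powr_ge_zero) auto
 then have "c * (M powr (1 / e)) powr e \<le> C" by (rule le)
 then have "c * M \<le> C" using e M by (simp add: powr_powr)
 moreover have "c * M = \<bar>C\<bar> + c" using c by (simp add: M_def field_simps)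
 ultimately show False using c by linarith
qed

lemma powr_log_growth:
 fixes c C e :: real
 assumes c: "c > 0" and le: "\<And>X. X \<ge> 1 \<Longrightarrow> ln (1 + X / 2) * (c * X powr e) \<le> C"
 shows "e < 0"
proof (rule ccontr)
 assume "\<not> e < 0"
 then have e: "e \<ge> 0" by simp
 define M where "M = \<bar>C\<bar> / c + 1"
 have M: "M > 0" using c by (simp add: M_def add_nonneg_pos)
 define X where "X = 2 * exp M"
 have X: "X \<ge> 1" using M one_le_exp_iff[of M] unfolding X_def by linarith
 have "M = ln (exp M)" by simp
 also have "... \<le> ln (1 + X / 2)" unfolding X_def by (subst ln_le_cancel_iff) (auto simp: add_pos_pos)
 finally have 1: "M \<le> ln (1 + X / 2)" .
 have "1 \<le> X powr e" using X e by (intro ge_one_powr_ge_zero) auto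
 then have "c \<le> c * X powr e" using c by simp
 then have "M * c \<le> ln (1 + X / 2) * (c * X powr e)" using 1 M c by (intro mult_mono) auto
 also have "... \<le> C" using X by (rule le)
 finally have "M * c \<le> C" .
 moreover have "M * c = \<bar>C\<bar> + c" using c by (simp add: M_def field_simps)
 ultimately show False using c by linarith
qed

lemma linear_growth:
 fixes c K e :: real
 assumes c: "c > 0" and K: "K > 0" and le: "\<And>n::nat. n \<ge> 1 \<Longrightarrow> c * real n \<le> K * real n powr e"
 shows "e \<ge> 1"
proof (rule ccontr)
 assume e: "\<not> 1 \<le> e"
 have "1 - e \<le> 0"
 proof (rule powr_growth[OF c])
  fix X :: real assume X: "X \<ge> 1"
  define n where "n = nat \<lceil>X\<rceil>"
  have n1: "X \<le> real n" by (simp add: n_def real_nat_ceiling_ge)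
  then have "1 \<le> real n" using X by linarith
  then have n: "X \<le> real n" "n \<ge> 1" using n1 by auto
  have "X powr (1 - e) \<le> real n powr (1 - e)" using n X e by (intro powr_mono2) auto
  then have "c * X powr (1 - e) \<le> c * real n powr (1 - e)" using c by simp
  also have "... = c * real n * real n powr (- e)"
  proof -
   have "real n powr (1 - e) = real n powr (1 + - e)" by simp
   also have "... = real n * real n powr (- e)" unfolding powr_add using n by simp
   finally show ?thesis by simp
  qed
  also have "... \<le> K * real n powr e * real n powr (- e)" by (intro mult_right_mono le n) simp
  also have "... = K * (real n powr e * real n powr (- e))" by (rule mult.assoc)
  also have "real n powr e * real n powr (- e) = 1" using n unfolding powr_add[symmetric] by simp
  finally show "c * X powr (1 - e) \<le> K" by simp
 qed
 then show False using e by simp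
qed

lemma weight_mass_ge_const:
 assumes X: "X \<ge> 1" and s: "s < 0" and ga: "ga \<ge> 0"
 shows "ennreal (2 powr (- ga) / 4) \<le> weight_mass ga s (X / 2)"
proof -
 have "ennreal (2 powr (- ga) / 4) = ennreal (2 powr (- ga) / 4 * 1 powr (1 - ga))" by simp
 also have "... \<le> weight_mass ga s (1 / 2)" using s ga by (intro weight_mass_ge) auto
 also have "... \<le> weight_mass ga s (X / 2)" using X by (intro weight_mass_mono) auto
 finally show ?thesis .
qed

context
 fixes al be rh q :: real
 assumes est: "extension_estimate al be rh q" and ab: "0 \<le> al" "0 \<le> be" and rh: "0 \<le> rh" and q: "q > 0"
begin

text \<open>The single-cap estimate with lower bounds \<open>f\<close> and \<open>g\<close> for the
  weight masses of the two sides of the Knapp box left open: powers, constants and logarithms are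
  inserted below.\<close>

lemma knapp_product:
 assumes mx: "\<And>X. X \<ge> 1 \<Longrightarrow> ennreal (f X) \<le> weight_mass (al * q) (-1) (X / 2)"
  and my: "\<And>X. X \<ge> 1 \<Longrightarrow> ennreal (g X) \<le> weight_mass (be * q) (-1) (X\<^sup>2 / 2)"
  and fg: "\<And>X. X \<ge> 1 \<Longrightarrow> 0 \<le> f X" "\<And>X. X \<ge> 1 \<Longrightarrow> 0 \<le> g X"
 obtains K where "K > 0" "\<And>X. X \<ge> 1 \<Longrightarrow> f X * g X * X powr (- (q * (1 - rh))) \<le> K"
proof -
 obtain K where K: "K > 0" and le: "\<And>n X S s. cap_family n X S s \<Longrightarrow>
   (\<Sum>j<n. ennreal (X j powr (- (q * (1 - rh)))) *
    (weight_mass (al * q) (-1) (X j / 2) * weight_mass (be * q) (s j) ((X j)\<^sup>2 / 2))) \<le> ennreal (K * real n powr (rh * q))"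
  by (rule cap_family_estimate[OF est rh q]) (rule that)
 show thesis
 proof (rule that[OF K])
  fix X :: real assume X: "X \<ge> 1"
  have "1 / X \<le> 2 * (1 / X)" using X by (simp add: field_simps)
  also have "... \<le> measure \<sigma> (cap (1 / X) \<inter> sphere 0 1)" using X by (intro measure_cap_ge) auto
  finally have m: "1 / X \<le> measure \<sigma> (cap (1 / X) \<inter> sphere 0 1)" .
  let ?e = "X powr (- (q * (1 - rh)))"
  have "ennreal (f X * g X * ?e) = ennreal ?e * (ennreal (f X) * ennreal (g X))"
   using fg X by (subst ennreal_mult[symmetric], simp, simp, subst ennreal_mult[symmetric]) (auto simp: mult_ac)
  also have "... \<le> ennreal ?e * (weight_mass (al * q) (-1) (X / 2) * weight_mass (be * q) (-1) (X\<^sup>2 / 2))"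
   using X by (intro mult_left_mono mult_mono mx my) auto
  also have "... \<le> ennreal K" using le[of 1 "\<lambda>_. X" "\<lambda>_. cap (1 / X)" "\<lambda>_. -1"] X m by (simp add: cap_family_def)
  finally show "f X * g X * ?e \<le> K" using K by (subst (asm) ennreal_le_iff) auto
 qed
qed

lemma weight_mass_x:
 assumes X: "X \<ge> 1"
 shows "ennreal (2 powr (- (al * q)) / 4 * X powr (1 - al * q)) \<le> weight_mass (al * q) (-1) (X / 2)"
  "ennreal (2 powr (- (al * q)) / 4) \<le> weight_mass (al * q) (-1) (X / 2)"
 by (rule weight_mass_ge weight_mass_ge_const; use X ab q in simp)+

lemma weight_mass_y:
 assumes X: "X \<ge> 1" and s: "s \<le> X\<^sup>2 / 4"
 shows "ennreal (2 powr (- (be * q)) / 4 * X powr (2 * (1 - be * q))) \<le> weight_mass (be * q) s (X\<^sup>2 / 2)"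
proof -
 have "X powr (2 * (1 - be * q)) = (X powr 2) powr (1 - be * q)" by (simp add: powr_powr)
 also have "X powr 2 = X\<^sup>2" using X by (simp add: powr_numeral)
 finally show ?thesis using X s ab q by (simp only:) (intro weight_mass_ge, auto simp: one_le_power)
qed

text \<open>Both sides of the box contribute powers of X. Divided by q, this is the inequality
  between al + 2 be and 3/q - 1/r' without its strictness.\<close>

lemma knapp_plane: "1 - al * q + 2 * (1 - be * q) - q * (1 - rh) \<le> 0"
proof -
 let ?c = "2 powr (- (al * q)) / 4 * (2 powr (- (be * q)) / 4)"
 obtain K where "K > 0" and K: "\<And>X. X \<ge> 1 \<Longrightarrow> (2 powr (- (al * q)) / 4 * X powr (1 - al * q))
   * (2 powr (- (be * q)) / 4 * X powr (2 * (1 - be * q))) * X powr (- (q * (1 - rh))) \<le> K"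
  by (rule knapp_product[OF weight_mass_x(1) weight_mass_y]) (use that in \<open>auto intro: order_trans[of _ 0]\<close>)
 show ?thesis
 proof (rule powr_growth)
  show "?c > 0" by simp
  fix X :: real assume X: "X \<ge> 1"
  have "X powr (1 - al * q + 2 * (1 - be * q) - q * (1 - rh)) = X powr (1 - al * q) * X powr (2 * (1 - be * q)) * X powr (- (q * (1 - rh)))"
   unfolding powr_add[symmetric] by simp
  then show "?c * X powr (1 - al * q + 2 * (1 - be * q) - q * (1 - rh)) \<le> K" using K[OF X] by (simp only: mult_ac)
 qed
qed

text \<open>The short side contributes only the mass near 0, the right order when al q > 1. Divided
  by q, this is the inequality between 2 be and 2/q - 1/r'.\<close>

lemma knapp_axis: "2 * (1 - be * q) - q * (1 - rh) \<le> 0"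
proof -
 let ?c = "2 powr (- (al * q)) / 4 * (2 powr (- (be * q)) / 4)"
 obtain K where "K > 0" and K: "\<And>X. X \<ge> 1 \<Longrightarrow> (2 powr (- (al * q)) / 4)
   * (2 powr (- (be * q)) / 4 * X powr (2 * (1 - be * q))) * X powr (- (q * (1 - rh))) \<le> K"
  by (rule knapp_product[OF weight_mass_x(2) weight_mass_y]) (use that in \<open>auto intro: order_trans[of _ 0]\<close>)
 show ?thesis
 proof (rule powr_growth)
  show "?c > 0" by simp
  fix X :: real assume X: "X \<ge> 1"
  have "X powr (2 * (1 - be * q) - q * (1 - rh)) = X powr (2 * (1 - be * q)) * X powr (- (q * (1 - rh)))"
   unfolding powr_add[symmetric] by simp
  then show "?c * X powr (2 * (1 - be * q) - q * (1 - rh)) \<le> K" using K[OF X] by (simp only: mult_ac)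
 qed
qed

text \<open>At the critical exponent the mass along x grows like a logarithm, which rules out
  equality in \<open>knapp_axis\<close>.\<close>

lemma knapp_log_x:
 assumes "al * q = 1"
 shows "2 * (1 - be * q) - q * (1 - rh) < 0"
proof -
 let ?c = "2 powr (- (be * q)) / 4"
 have lx: "ennreal (ln (1 + X / 2)) \<le> weight_mass (al * q) (-1) (X / 2)" if "X \<ge> 1" for X
  using weight_mass_log[of "X / 2" "-1"] that assms by simp
 obtain K where "K > 0" and K: "\<And>X. X \<ge> 1 \<Longrightarrow> ln (1 + X / 2)
   * (2 powr (- (be * q)) / 4 * X powr (2 * (1 - be * q))) * X powr (- (q * (1 - rh))) \<le> K"
  by (rule knapp_product[OF lx weight_mass_y]) (use that in \<open>auto intro: order_trans[of _ 0]\<close>)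
 show ?thesis
 proof (rule powr_log_growth)
  show "?c > 0" by simp
  fix X :: real assume X: "X \<ge> 1"
  have "X powr (2 * (1 - be * q) - q * (1 - rh)) = X powr (2 * (1 - be * q)) * X powr (- (q * (1 - rh)))"
   unfolding powr_add[symmetric] by simp
  then show "ln (1 + X / 2) * (?c * X powr (2 * (1 - be * q) - q * (1 - rh))) \<le> K" using K[OF X] by (simp only: mult_ac)
 qed
qed

text \<open>Here the logarithm comes from the long side and forces rh < 1. The conclusion is written
  as in \<open>knapp_log_x\<close>, its first summand being 0.\<close>

lemma knapp_log_y:
 assumes "be * q = 1"
 shows "2 * (1 - be * q) - q * (1 - rh) < 0"
proof -
 let ?c = "2 powr (- (al * q)) / 4"
 have ly: "ennreal (ln (1 + X / 2)) \<le> weight_mass (be * q) (-1) (X\<^sup>2 / 2)" if X: "X \<ge> 1" for X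
 proof -
  have "X \<le> X\<^sup>2" using X by (simp add: self_le_power)
  then have "weight_mass 1 (-1) (X / 2) \<le> weight_mass 1 (-1) (X\<^sup>2 / 2)" by (intro weight_mass_mono) auto
  moreover have "ennreal (ln (1 + X / 2)) \<le> weight_mass 1 (-1) (X / 2)" using X by (intro weight_mass_log) auto
  ultimately show ?thesis using assms by simp
 qed
 obtain K where "K > 0" and K: "\<And>X. X \<ge> 1 \<Longrightarrow> 2 powr (- (al * q)) / 4 * ln (1 + X / 2) * X powr (- (q * (1 - rh))) \<le> K"
  by (rule knapp_product[OF weight_mass_x(2) ly]) (use that in auto)
 have "- (q * (1 - rh)) < 0"
 proof (rule powr_log_growth)
  show "?c > 0" by simp
  show "ln (1 + X / 2) * (?c * X powr (- (q * (1 - rh)))) \<le> K" if X: "X \<ge> 1" for X using K[OF X] by (simp only: mult_ac)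
 qed
 then show ?thesis using assms by simp
qed

text \<open>At an endpoint the powers of X cancel, so each of the n scales contributes at least the
  same constant. Comparing c n with K n^(rh q) gives rh q \<ge> 1, that is r \<le> q. The parameter
  \<open>e\<close> is the power contributed by the short side and covers both kinds of
  endpoint.\<close>

lemma multiscale_exponent:
 assumes mx: "\<And>X. X \<ge> 1 \<Longrightarrow> ennreal (2 powr (- (al * q)) / 4 * X powr e) \<le> weight_mass (al * q) (-1) (X / 2)"
  and e: "e + 2 * (1 - be * q) - q * (1 - rh) = 0"
 shows "rh * q \<ge> 1"
proof -
 let ?c = "2 powr (- (al * q)) / 4 * (2 powr (- (be * q)) / 4)"
 obtain K where K: "K > 0" and le: "\<And>n. n \<ge> 1 \<Longrightarrow> (\<Sum>j<n. ennreal ((32 ^ j) powr (- (q * (1 - rh)))) *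
    (weight_mass (al * q) (-1) (32 ^ j / 2) * weight_mass (be * q) ((32 ^ j)\<^sup>2 / 2048) ((32 ^ j)\<^sup>2 / 2))) \<le> ennreal (K * real n powr (rh * q))"
  by (rule multiscale_estimate[OF est rh q]) (rule that)
 show ?thesis
 proof (rule linear_growth[OF _ K])
  show "?c > 0" by simp
  fix n :: nat assume n: "n \<ge> 1"
  have pt: "ennreal ?c \<le> ennreal ((32 ^ j) powr (- (q * (1 - rh)))) *
    (weight_mass (al * q) (-1) (32 ^ j / 2) * weight_mass (be * q) ((32 ^ j)\<^sup>2 / 2048) ((32 ^ j)\<^sup>2 / 2))" for j
  proof -
   define X where "X = (32::real) ^ j"
   have X: "X \<ge> 1" by (simp add: X_def)
   have "X powr (- (q * (1 - rh))) * (X powr e * X powr (2 * (1 - be * q))) = X powr (- (q * (1 - rh)) + (e + 2 * (1 - be * q)))"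
    by (simp only: powr_add)
   also have "- (q * (1 - rh)) + (e + 2 * (1 - be * q)) = 0" using e by linarith
   finally have 1: "X powr (- (q * (1 - rh))) * (X powr e * X powr (2 * (1 - be * q))) = 1" using X by simp
   have "?c = ?c * (X powr (- (q * (1 - rh))) * (X powr e * X powr (2 * (1 - be * q))))" unfolding 1 by simp
   also have "... = X powr (- (q * (1 - rh))) * ((2 powr (- (al * q)) / 4 * X powr e) * (2 powr (- (be * q)) / 4 * X powr (2 * (1 - be * q))))"
    by (simp only: mult_ac)
   finally have "ennreal ?c = ennreal ..." by (rule arg_cong)
   also have "... = ennreal (X powr (- (q * (1 - rh)))) * (ennreal (2 powr (- (al * q)) / 4 * X powr e) * ennreal (2 powr (- (be * q)) / 4 * X powr (2 * (1 - be * q))))"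
    by (subst ennreal_mult, simp, simp, subst ennreal_mult, auto)
   also have "... \<le> ennreal (X powr (- (q * (1 - rh)))) * (weight_mass (al * q) (-1) (X / 2) * weight_mass (be * q) (X\<^sup>2 / 2048) (X\<^sup>2 / 2))"
    using X by (intro mult_left_mono mult_mono mx weight_mass_y) auto
   finally show ?thesis unfolding X_def .
  qed
  have "ennreal (?c * real n) = (\<Sum>j<n. ennreal ?c)" by (subst sum_ennreal) (auto simp: mult.commute)
  also have "... \<le> ennreal (K * real n powr (rh * q))" by (rule order_trans[OF sum_mono[OF pt] le[OF n]])
  finally show "?c * real n \<le> K * real n powr (rh * q)" using K by (subst (asm) ennreal_le_iff) auto
 qed
qed

lemma multiscale_plane: "1 - al * q + 2 * (1 - be * q) - q * (1 - rh) = 0 \<Longrightarrow> rh * q \<ge> 1"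
 by (rule multiscale_exponent[OF weight_mass_x(1)]) auto

lemma multiscale_axis: "2 * (1 - be * q) - q * (1 - rh) = 0 \<Longrightarrow> rh * q \<ge> 1"
 by (rule multiscale_exponent[of 0]) (use weight_mass_x(2) in auto)

end

section \<open>The extension of the constant function\<close>

text \<open>This is 2 pi times the Bessel function J_0.\<close>

definition circle_cos :: "real \<Rightarrow> real" where
 "circle_cos r = integral {0..2 * pi} (\<lambda>t. cos (r * cos t))"

text \<open>The derivative of \<open>circle_cos\<close>, that is -2 pi times J_1.\<close>

definition circle_sin :: "real \<Rightarrow> real" where
 "circle_sin r = - integral {0..2 * pi} (\<lambda>t. cos t * sin (r * cos t))"

lemma circle_cos_deriv: "(circle_cos has_real_derivative circle_sin r) (at r)"
proof -
 have "((\<lambda>x. integral (cbox 0 (2 * pi)) (\<lambda>t. cos (x * cos t))) has_field_derivative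
   integral (cbox 0 (2 * pi)) (\<lambda>t. - (cos t * sin (r * cos t)))) (at r within UNIV)"
  by (rule leibniz_rule_field_derivative[where fx = "\<lambda>x t. - (cos t * sin (x * cos t))"])
   (auto intro!: derivative_eq_intros integrable_continuous_real continuous_intros simp: split_beta)
 then show ?thesis unfolding circle_cos_def[abs_def] circle_sin_def by (simp add: cbox_interval)
qed

text \<open>Bessel's equation of order 0. Differentiation under the integral produces cos^2; this is
  rewritten by sin^2, and the integral with sin^2 is computed by integrating the derivative of sin t
  sin(r cos t) over a period.\<close>

lemma circle_sin_deriv:
 assumes r: "r \<noteq> 0"
 shows "(circle_sin has_real_derivative (- circle_cos r - circle_sin r / r)) (at r)"
proof -
 have "((\<lambda>x. integral (cbox 0 (2 * pi)) (\<lambda>t. - (cos t * sin (x * cos t)))) has_field_derivative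
   integral (cbox 0 (2 * pi)) (\<lambda>t. - (cos t * (cos t * cos (r * cos t))))) (at r within UNIV)"
  by (rule leibniz_rule_field_derivative[where fx = "\<lambda>x t. - (cos t * (cos t * cos (x * cos t)))"])
   (auto intro!: derivative_eq_intros integrable_continuous_real continuous_intros simp: split_beta)
 then have D: "(circle_sin has_real_derivative integral {0..2 * pi} (\<lambda>t. - (cos t * (cos t * cos (r * cos t))))) (at r)"
  unfolding circle_sin_def[abs_def] by (simp add: cbox_interval)
 define J where "J = integral {0..2 * pi} (\<lambda>t. sin t * (sin t * cos (r * cos t)))"
 have J: "((\<lambda>t. sin t * (sin t * cos (r * cos t))) has_integral J) {0..2 * pi}"
  unfolding J_def by (intro integrable_integral integrable_continuous_real continuous_intros)
 have S: "((\<lambda>t. cos t * sin (r * cos t)) has_integral (- circle_sin r)) {0..2 * pi}"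
  unfolding circle_sin_def minus_minus by (intro integrable_integral integrable_continuous_real continuous_intros)
 have C: "((\<lambda>t. cos (r * cos t)) has_integral circle_cos r) {0..2 * pi}"
  unfolding circle_cos_def by (intro integrable_integral integrable_continuous_real continuous_intros)
 have 1: "((\<lambda>t. cos t * sin (r * cos t) - r * (sin t * (sin t * cos (r * cos t)))) has_integral
   (sin (2 * pi) * sin (r * cos (2 * pi)) - sin 0 * sin (r * cos 0))) {0..2 * pi}" by (rule fundamental_theorem_of_calculus)
   (auto intro!: derivative_eq_intros simp: has_real_derivative_iff_has_vector_derivative[symmetric])
 have 2: "((\<lambda>t. cos t * sin (r * cos t) - r * (sin t * (sin t * cos (r * cos t)))) has_integral (- circle_sin r - r * J)) {0..2 * pi}"
  by (intro has_integral_diff S has_integral_mult_right J)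
 have "- circle_sin r - r * J = 0" using has_integral_unique[OF 2 1] by simp
 then have Je: "J = - circle_sin r / r" using r by (simp add: field_simps)
 have "((\<lambda>t. sin t * (sin t * cos (r * cos t)) - cos (r * cos t)) has_integral (J - circle_cos r)) {0..2 * pi}"
  by (intro has_integral_diff J C)
 moreover have "sin t * (sin t * cos (r * cos t)) - cos (r * cos t) = - (cos t * (cos t * cos (r * cos t)))" for t
 proof -
  have "sin t * sin t = 1 - cos t * cos t" using sin_squared_eq[of t] by (simp add: power2_eq_square)
  then have "sin t * sin t * cos (r * cos t) = (1 - cos t * cos t) * cos (r * cos t)" by simp
  then show ?thesis by (simp add: algebra_simps)
 qed
 ultimately have "integral {0..2 * pi} (\<lambda>t. - (cos t * (cos t * cos (r * cos t)))) = J - circle_cos r" by (simp only: integral_unique)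
 also have "J - circle_cos r = - circle_cos r - circle_sin r / r" unfolding Je by simp
 finally show ?thesis using D by simp
qed

text \<open>The energy r (y^2 + y'^2) of a solution of Bessel's equation stays between positive
  constants. This gives the decay r^(-1/2) on average without an asymptotic expansion.\<close>

lemma circle_cos_energy:
 obtains c M where "c > 0" "M > 0"
  "\<And>r. r \<ge> 1 \<Longrightarrow> c \<le> r * (circle_cos r)\<^sup>2 + r * (circle_sin r)\<^sup>2"
  "\<And>r. r \<ge> 1 \<Longrightarrow> r * (circle_cos r)\<^sup>2 + r * (circle_sin r)\<^sup>2 \<le> M"
proof -
 define E where "E r = r * (circle_cos r)\<^sup>2 + r * (circle_sin r)\<^sup>2" for r
 \<comment> \<open>The derivative of the energy is y^2 - y'^2, which is not small compared with E/r.
   Adding y y' cancels it up to -y y'/r, at most Q/r^2 in size. Hence Q exp(-1/r) increases and Q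
   exp(1/r) decreases.\<close>
 define Q where "Q r = E r + circle_cos r * circle_sin r" for r
 have AB: "\<bar>r * (circle_cos r * circle_sin r)\<bar> \<le> E r / 2" if "r \<ge> 1" for r
 proof -
  have "2 * \<bar>circle_cos r\<bar> * \<bar>circle_sin r\<bar> \<le> \<bar>circle_cos r\<bar>\<^sup>2 + \<bar>circle_sin r\<bar>\<^sup>2" by (rule sum_squares_bound)
  then have "\<bar>circle_cos r * circle_sin r\<bar> \<le> ((circle_cos r)\<^sup>2 + (circle_sin r)\<^sup>2) / 2" by (simp add: abs_mult)
  then have "r * \<bar>circle_cos r * circle_sin r\<bar> \<le> r * (((circle_cos r)\<^sup>2 + (circle_sin r)\<^sup>2) / 2)"
   using that by (intro mult_left_mono) auto
  then show ?thesis using that by (simp add: E_def abs_mult distrib_left)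
 qed
 have AB1: "\<bar>circle_cos r * circle_sin r\<bar> \<le> E r / 2" if r: "r \<ge> 1" for r
 proof -
  have "1 * \<bar>circle_cos r * circle_sin r\<bar> \<le> r * \<bar>circle_cos r * circle_sin r\<bar>" using r by (intro mult_right_mono) auto
  also have "... = \<bar>r * (circle_cos r * circle_sin r)\<bar>" using r by (simp add: abs_mult)
  finally show ?thesis using AB[OF r] by linarith
 qed
 have EQ: "E r \<le> 2 * Q r" "Q r \<le> 2 * E r" if "r \<ge> 1" for r
 proof -
  have *: "a \<le> 2 * (a + x)" "a + x \<le> 2 * a" if "\<bar>x\<bar> \<le> a / 2" for a x :: real
  proof -
   have "- (a / 2) \<le> x" "x \<le> a / 2" using that by (simp_all only: abs_le_iff minus_le_iff)
   then show "a \<le> 2 * (a + x)" "a + x \<le> 2 * a" by (simp_all add: field_simps)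
  qed
  show "E r \<le> 2 * Q r" "Q r \<le> 2 * E r" unfolding Q_def by (rule *[OF AB1[OF that]])+
 qed
 have dQ: "(Q has_real_derivative - (circle_cos r * circle_sin r) / r) (at r)" if r: "r \<ge> 1" for r
 proof -
  have r0: "r \<noteq> 0" using r by simp
  note dA = circle_cos_deriv[of r] and dB = circle_sin_deriv[OF r0]
  note d = DERIV_add[OF DERIV_add[OF DERIV_mult[OF DERIV_ident DERIV_power[OF dA, of 2]] DERIV_mult[OF DERIV_ident DERIV_power[OF dB, of 2]]] DERIV_mult[OF dA dB]]
  have eq: "1 * a\<^sup>2 + of_nat 2 * (b * a ^ (2 - Suc 0)) * r + (1 * b\<^sup>2 + of_nat 2 * ((- a - b / r) * b ^ (2 - Suc 0)) * r)
   + (b * b + (- a - b / r) * a) = - (a * b) / r" for a b :: real using r0 by (simp add: field_simps power2_eq_square)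
  show ?thesis unfolding Q_def E_def by (rule DERIV_cong[OF d eq])
 qed
 have dQle: "\<bar>(circle_cos r * circle_sin r) / r\<bar> \<le> Q r / r\<^sup>2" if r: "r \<ge> 1" for r
 proof -
  have "\<bar>(circle_cos r * circle_sin r) / r\<bar> = \<bar>r * (circle_cos r * circle_sin r)\<bar> / r\<^sup>2"
   using r by (simp add: abs_mult field_simps power2_eq_square)
  also have "... \<le> Q r / r\<^sup>2" using AB[OF r] EQ[OF r] by (intro divide_right_mono) auto
  finally show ?thesis .
 qed
 have ge: "Q 1 * exp (- 1) \<le> Q r * exp (- (1 / r))" if r: "r \<ge> 1" for r
 proof -
  have "Q 1 * exp (- (1 / 1)) \<le> Q r * exp (- (1 / r))"
  proof (rule DERIV_nonneg_imp_nondecreasing[OF r])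
   fix x :: real assume x: "1 \<le> x" "x \<le> r"
   have "((\<lambda>r. exp (- (1 / r))) has_real_derivative exp (- (1 / x)) * (1 / x\<^sup>2)) (at x)"
    using x by (auto intro!: derivative_eq_intros simp: power2_eq_square)
   note d = DERIV_mult[OF dQ[OF x(1)] this]
   have "0 \<le> exp (- (1 / x)) * (- (circle_cos x * circle_sin x) / x + Q x / x\<^sup>2)"
    using abs_le_D1[OF dQle[OF x(1)]] by (intro mult_nonneg_nonneg) simp_all
   also have "... = - (circle_cos x * circle_sin x) / x * exp (- (1 / x)) + exp (- (1 / x)) * (1 / x\<^sup>2) * Q x"
    unfolding distrib_left by simp
   finally show "\<exists>y. ((\<lambda>r. Q r * exp (- (1 / r))) has_real_derivative y) (at x) \<and> 0 \<le> y" using d by blast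
  qed
  then show ?thesis by simp
 qed
 have le: "Q r * exp (1 / r) \<le> Q 1 * exp 1" if r: "r \<ge> 1" for r
 proof -
  have "Q r * exp (1 / r) \<le> Q 1 * exp (1 / 1)"
  proof (rule DERIV_nonpos_imp_nonincreasing[OF r])
   fix x :: real assume x: "1 \<le> x" "x \<le> r"
   have "((\<lambda>r. exp (1 / r)) has_real_derivative exp (1 / x) * (- (1 / x\<^sup>2))) (at x)"
    using x by (auto intro!: derivative_eq_intros simp: power2_eq_square)
   note d = DERIV_mult[OF dQ[OF x(1)] this]
   have "- (circle_cos x * circle_sin x) / x * exp (1 / x) + exp (1 / x) * (- (1 / x\<^sup>2)) * Q x
    = exp (1 / x) * (- (circle_cos x * circle_sin x) / x - Q x / x\<^sup>2)" unfolding right_diff_distrib by simp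
   also have "... \<le> 0" using abs_le_D2[OF dQle[OF x(1)]] by (intro mult_nonneg_nonpos) simp_all
   finally show "\<exists>y. ((\<lambda>r. Q r * exp (1 / r)) has_real_derivative y) (at x) \<and> y \<le> 0" using d by blast
  qed
  then show ?thesis by simp
 qed
 have Q1: "Q 1 > 0"
 proof -
  have "cos 1 * (2 * pi) \<le> circle_cos 1"
  proof -
   have c: "cos 1 \<le> cos (1 * cos t)" for t :: real
   proof -
    have "cos \<bar>cos t\<bar> \<ge> cos 1" using pi_gt3 by (intro cos_monotone_0_pi_le) auto
    then show ?thesis by simp
   qed
   have "integral {0..2 * pi} (\<lambda>t::real. cos (1::real)) \<le> circle_cos 1"
    unfolding circle_cos_def by (intro integral_le integrable_continuous_real continuous_intros c)
   then show ?thesis by (simp add: mult.commute)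
  qed
  moreover have "cos (1::real) > 0" using pi_gt3 by (intro cos_gt_zero_pi) auto
  then have "0 < cos 1 * (2 * pi)" by simp
  ultimately have "circle_cos 1 > 0" by linarith
  then have "E 1 > 0" by (simp add: E_def add_pos_nonneg)
  then show ?thesis using EQ(1)[of 1] by linarith
 qed
 show thesis
 proof (rule that[of "Q 1 * exp (- 1) / 2" "2 * (Q 1 * exp 1)"])
  show "Q 1 * exp (- 1) / 2 > 0" "2 * (Q 1 * exp 1) > 0" using Q1 by auto
  fix r :: real assume r: "r \<ge> 1"
  have E0: "E r \<ge> 0" using r by (simp add: E_def)
  then have Q0: "Q r \<ge> 0" using EQ(1)[OF r] by linarith
  have "Q r * exp (- (1 / r)) \<le> Q r * 1" using Q0 r by (intro mult_left_mono) auto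
  then have "Q 1 * exp (- 1) / 2 \<le> E r" using ge[OF r] EQ(2)[OF r] by linarith
  then show "Q 1 * exp (- 1) / 2 \<le> r * (circle_cos r)\<^sup>2 + r * (circle_sin r)\<^sup>2" by (simp add: E_def)
  have "Q r * 1 \<le> Q r * exp (1 / r)" using Q0 r by (intro mult_left_mono) auto
  then have "E r \<le> 2 * (Q 1 * exp 1)" using le[OF r] EQ(1)[OF r] by linarith
  then show "r * (circle_cos r)\<^sup>2 + r * (circle_sin r)\<^sup>2 \<le> 2 * (Q 1 * exp 1)" by (simp add: E_def)
 qed
qed

lemma continuous_circle_cos [continuous_intros]: "continuous_on S circle_cos"
 by (intro continuous_at_imp_continuous_on ballI DERIV_isCont[OF circle_cos_deriv])

text \<open>The energy controls y^2 only together with y'^2. With P = r y y' one has P' = r y'^2 - r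
  y^2, so on long intervals the two parts have nearly the same integral and neither can be
  small.\<close>

lemma circle_cos_block:
 assumes p: "p > 0"
 obtains T c where "T > 0" "c > 0"
  "\<And>X. X \<ge> 1 \<Longrightarrow> ennreal c \<le> (LEB s. ennreal ((s * (circle_cos s)\<^sup>2) powr p) * indicator {X..X + T} s)"
proof -
 obtain c0 M where c0: "c0 > 0" and M: "M > 0"
  and lo: "\<And>r. r \<ge> 1 \<Longrightarrow> c0 \<le> r * (circle_cos r)\<^sup>2 + r * (circle_sin r)\<^sup>2"
  and hi: "\<And>r. r \<ge> 1 \<Longrightarrow> r * (circle_cos r)\<^sup>2 + r * (circle_sin r)\<^sup>2 \<le> M"
  by (rule circle_cos_energy) (rule that)
 \<comment> \<open>Integrating 2G + P' \<ge> c0 with |P| \<le> M/2 gives an integral of G of at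
   least (c0 T - M)/2, which is 3M/2 for this length.\<close>
 define T where "T = 4 * M / c0"
 have T: "T > 0" "c0 * T = 4 * M" using c0 M by (auto simp: T_def)
 \<comment> \<open>The constant of the linear minorant k (G - c0/8) of G^p, which treats p < 1 and p
   \<ge> 1 alike: the minorant is not positive below c0/8, and between c0/8 and M the factor G^(p -
   1) is at least k.\<close>
 define k where "k = min ((c0 / 8) powr (p - 1)) (M powr (p - 1))"
 have k: "k > 0" using c0 M by (simp add: k_def)
 define G where "G r = r * (circle_cos r)\<^sup>2" for r
 define P where "P r = r * (circle_cos r * circle_sin r)" for r
 have G0: "0 \<le> G r" "G r \<le> M" if "r \<ge> 1" for r
 proof -
  show "0 \<le> G r" using that by (simp add: G_def)
  have "0 \<le> r * (circle_sin r)\<^sup>2" using that by simp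
  then show "G r \<le> M" using hi[OF that] by (simp add: G_def)
 qed
 have Pb: "\<bar>P r\<bar> \<le> M / 2" if r: "r \<ge> 1" for r
 proof -
  have "2 * \<bar>circle_cos r\<bar> * \<bar>circle_sin r\<bar> \<le> \<bar>circle_cos r\<bar>\<^sup>2 + \<bar>circle_sin r\<bar>\<^sup>2" by (rule sum_squares_bound)
  then have "\<bar>circle_cos r * circle_sin r\<bar> \<le> ((circle_cos r)\<^sup>2 + (circle_sin r)\<^sup>2) / 2" by (simp add: abs_mult)
  then have "r * \<bar>circle_cos r * circle_sin r\<bar> \<le> r * (((circle_cos r)\<^sup>2 + (circle_sin r)\<^sup>2) / 2)"
   using r by (intro mult_left_mono) auto
  then show ?thesis using r hi[OF r] by (simp add: P_def abs_mult distrib_left)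
 qed
 have dP: "(P has_real_derivative (r * (circle_sin r)\<^sup>2 - G r)) (at r)" if r: "r \<ge> 1" for r
 proof -
  have r0: "r \<noteq> 0" using r by simp
  note d = DERIV_mult[OF DERIV_ident DERIV_mult[OF circle_cos_deriv circle_sin_deriv[OF r0]]]
  have eq: "1 * (a * b) + (b * b + (- a - b / r) * a) * r = r * b\<^sup>2 - r * a\<^sup>2" for a b :: real
   using r0 by (simp add: field_simps power2_eq_square)
  show ?thesis unfolding P_def G_def by (rule DERIV_cong[OF d eq])
 qed
 have pw: "k * (G r - c0 / 8) \<le> G r powr p" if r: "r \<ge> 1" for r
 proof (cases "G r \<ge> c0 / 8")
  case True
  then have Gp: "G r > 0" using c0 by linarith
  have "k \<le> G r powr (p - 1)"
  proof (cases "p \<ge> 1")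
   case p1: True
   have "(c0 / 8) powr (p - 1) \<le> G r powr (p - 1)" using True c0 p1 by (intro powr_mono2) auto
   then show ?thesis by (simp add: k_def min.coboundedI1)
  next
   case False
   have "M powr (p - 1) \<le> G r powr (p - 1)" using Gp G0(2)[OF r] False by (intro powr_mono2') auto
   then show ?thesis by (simp add: k_def min.coboundedI2)
  qed
  then have "k * G r \<le> G r powr (p - 1) * G r" using Gp by (intro mult_right_mono) auto
  also have "... = G r powr (p - 1 + 1)" unfolding powr_add using Gp by simp
  also have "p - 1 + 1 = p" by simp
  finally have "k * G r \<le> G r powr p" .
  moreover have "k * (G r - c0 / 8) \<le> k * G r" using k c0 by (intro mult_left_mono) auto
  ultimately show ?thesis by linarith
 next
  case False
  then have "k * (G r - c0 / 8) \<le> 0" using k by (intro mult_nonneg_nonpos) auto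
  then show ?thesis using powr_ge_zero[of "G r" p] by linarith
 qed
 show thesis
 proof (rule that[of T "k * (M / 4)"])
  show "T > 0" "k * (M / 4) > 0" using T k M by auto
  fix X :: real assume X: "X \<ge> 1"
  have Gc: "continuous_on {X..X + T} G" unfolding G_def by (intro continuous_intros)
  define I where "I = integral {X..X + T} G"
  have I: "(G has_integral I) {X..X + T}" unfolding I_def by (intro integrable_integral integrable_continuous_real Gc)
  have dPi: "((\<lambda>r. r * (circle_sin r)\<^sup>2 - G r) has_integral (P (X + T) - P X)) {X..X + T}" by (rule fundamental_theorem_of_calculus)
    (use X T dP in \<open>auto simp: has_real_derivative_iff_has_vector_derivative[symmetric] intro: has_field_derivative_at_within\<close>)
  have h1: "((\<lambda>r. 2 * G r + (r * (circle_sin r)\<^sup>2 - G r)) has_integral (2 * I + (P (X + T) - P X))) {X..X + T}"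
   by (intro has_integral_add has_integral_mult_right I dPi)
  have h2: "((\<lambda>r. c0) has_integral (c0 * T)) {X..X + T}" using has_integral_const_real[of c0 X "X + T"] T by (simp add: mult.commute)
  have "c0 * T \<le> 2 * I + (P (X + T) - P X)"
  proof (rule has_integral_le[OF h2 h1])
   fix r assume "r \<in> {X..X + T}"
   then have "r \<ge> 1" using X by auto
   then show "c0 \<le> 2 * G r + (r * (circle_sin r)\<^sup>2 - G r)" using lo[of r] by (simp add: G_def)
  qed
  moreover have "1 \<le> X + T" using X T by simp
  ultimately have I1: "3 / 2 * M \<le> I" using abs_le_D2[OF Pb[OF X]] abs_le_D1[OF Pb[of "X + T"]] T by linarith
  have Ip: "((\<lambda>r. G r powr p) has_integral integral {X..X + T} (\<lambda>r. G r powr p)) {X..X + T}"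
   using G0(1) X p by (intro integrable_integral integrable_continuous_real continuous_on_powr' Gc continuous_intros) auto
  have "((\<lambda>r. k * (G r - c0 / 8)) has_integral (k * (I - c0 / 8 * T))) {X..X + T}" using has_integral_const_real[of "c0 / 8" X "X + T"] T
   by (intro has_integral_mult_right has_integral_diff I) (simp add: mult.commute)
  from has_integral_le[OF this Ip] have "k * (I - c0 / 8 * T) \<le> integral {X..X + T} (\<lambda>r. G r powr p)" using pw X by auto
  moreover have "k * (M / 4) \<le> k * (I - c0 / 8 * T)" using I1 T k M by (intro mult_left_mono) auto
  ultimately have "k * (M / 4) \<le> integral {X..X + T} (\<lambda>r. G r powr p)" by linarith
  moreover have "(LEB s. ennreal (G s powr p) * indicator {X..X + T} s) = ennreal (integral {X..X + T} (\<lambda>r. G r powr p))"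
   by (rule nn_integral_has_integral_lebesgue'[OF _ Ip]) simp
  ultimately show "ennreal (k * (M / 4)) \<le> (LEB s. ennreal ((s * (circle_cos s)\<^sup>2) powr p) * indicator {X..X + T} s)"
   unfolding G_def by (simp add: ennreal_leI)
 qed
qed

text \<open>Rotating the circle so that z points along the first axis leaves the angular integral
  that defines \<open>circle_cos\<close>.\<close>

lemma circle_integral_cos:
 "(\<integral>om. cos (z \<bullet> om) \<partial>\<sigma>) = circle_cos (norm z)"
proof -
 interpret C: finite_measure \<sigma> by (rule finite_measure_circle)
 let ?R = "norm z"
 obtain ph where ph: "0 \<le> ph" "ph < 2 * pi" "z = (?R * cos ph, ?R * sin ph)"
 proof (cases "z = 0")
  case True
  then show ?thesis using that[of 0] by (simp add: zero_prod_def)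
 next
  case False
  then have "(1 / ?R) *\<^sub>R z \<in> sphere 0 1" by simp
  then obtain t where t: "0 \<le> t" "t < 2 * pi" "(1 / ?R) *\<^sub>R z = (cos t, sin t)" by (rule circle_polar)
  have "z = ?R *\<^sub>R ((1 / ?R) *\<^sub>R z)" using False by simp
  then have "z = (?R * cos t, ?R * sin t)" unfolding t(3) by simp
  then show ?thesis using t that by blast
 qed
 \<comment> \<open>The summand 1 makes the integrand nonnegative, so the rotation can be done with
   the nonnegative integral.\<close>
 define f where "f t = ennreal (1 + cos (?R * cos (t - ph)))" for t
 have fm: "f \<in> borel_measurable borel" unfolding f_def by measurable
 have cm: "(\<lambda>om. ennreal (1 + cos (z \<bullet> om))) \<in> borel_measurable \<sigma>" by measurable
 have dot: "z \<bullet> (cos t, sin t) = ?R * cos (t - ph)" for t by (subst ph(3)) (simp add: inner_prod_def cos_diff algebra_simps)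
 have per: "f (t + 2 * pi) = f t" for t
 proof -
  have "cos (t + 2 * pi - ph) = cos (t - ph)" using cos_periodic[of "t - ph"] by (simp add: algebra_simps)
  then show ?thesis by (simp add: f_def)
 qed
 have I: "((\<lambda>t. 1 + cos (?R * cos t)) has_integral (2 * pi + circle_cos ?R)) {0..2 * pi}"
 proof (rule has_integral_add)
  show "((\<lambda>t. 1) has_integral 2 * pi) {0..2 * pi}" using has_integral_const_real[of "1::real" 0 "2 * pi"] by simp
  show "((\<lambda>t. cos (?R * cos t)) has_integral circle_cos ?R) {0..2 * pi}"
   unfolding circle_cos_def by (intro integrable_integral integrable_continuous_real continuous_intros)
 qed
 have g0: "0 \<le> 1 + cos x" for x :: real using cos_ge_minus_one[of x] by linarith
 have "(ARC om. ennreal (1 + cos (z \<bullet> om))) = (\<integral>\<^sup>+t\<in>{0..<2 * pi}. f t \<partial>lborel)"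
  unfolding nn_integral_circle[OF cm] dot f_def ..
 also have "... = (\<integral>\<^sup>+t\<in>{0..<2 * pi}. f (t + ph) \<partial>lborel)"
  by (rule nn_integral_periodic_shift[OF fm per ph(1) less_imp_le[OF ph(2)], symmetric])
 also have "... = (LEB t. ennreal (1 + cos (?R * cos t)) * indicator {0..2 * pi} t)"
 proof (rule nn_integral_cong_AE)
  show "AE t in lborel. f (t + ph) * indicator {0..<2 * pi} t = ennreal (1 + cos (?R * cos t)) * indicator {0..2 * pi} t"
   using AE_lborel_singleton[of "2 * pi"] by eventually_elim (auto simp: f_def indicator_def)
 qed
 also have "... = ennreal (2 * pi + circle_cos ?R)" by (rule nn_integral_has_integral_lebesgue'[OF g0 I])
 finally have 1: "(ARC om. ennreal (1 + cos (z \<bullet> om))) = ennreal (2 * pi + circle_cos ?R)" .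
 have ic: "integrable \<sigma> (\<lambda>om. cos (z \<bullet> om))" by (rule C.integrable_const_bound[where B = 1]) auto
 have "(ARC om. ennreal (1 + cos (z \<bullet> om))) = ennreal (\<integral>om. 1 + cos (z \<bullet> om) \<partial>\<sigma>)"
  using ic g0 by (intro nn_integral_eq_integral) auto
 also have "(\<integral>om. 1 + cos (z \<bullet> om) \<partial>\<sigma>) = 2 * pi + (\<integral>om. cos (z \<bullet> om) \<partial>\<sigma>)"
  using ic by (subst Bochner_Integration.integral_add) (auto simp: circle_measure_total)
 finally have 2: "ennreal (2 * pi + circle_cos ?R) = ennreal (2 * pi + (\<integral>om. cos (z \<bullet> om) \<partial>\<sigma>))" unfolding 1 .
 have "0 \<le> 2 * pi + circle_cos ?R" using I g0 by (auto intro: has_integral_nonneg)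
 moreover have "0 \<le> (\<integral>om. 1 + cos (z \<bullet> om) \<partial>\<sigma>)" using g0 by (intro integral_nonneg_AE) auto
 then have "0 \<le> 2 * pi + (\<integral>om. cos (z \<bullet> om) \<partial>\<sigma>)"
  using ic by (subst (asm) Bochner_Integration.integral_add) (auto simp: circle_measure_total)
 ultimately show ?thesis using 2 by simp
qed

lemma extension_op_one_ge:
 "\<bar>circle_cos (norm z)\<bar> / (2 * pi) \<le> cmod (Ext (\<lambda>_. 1) z)"
proof -
 interpret C: finite_measure \<sigma> by (rule finite_measure_circle)
 let ?f = "\<lambda>om. exp (\<i> * of_real (z \<bullet> om)) * 1 :: complex"
 have i: "integrable \<sigma> ?f" by (rule integrable_extension[of _ 1]) auto
 have "circle_cos (norm z) = (\<integral>om. Re (?f om) \<partial>\<sigma>)" by (simp add: circle_integral_cos[symmetric] Re_exp)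
 also have "... = Re (\<integral>om. ?f om \<partial>\<sigma>)" by (rule integral_Re[OF i])
 finally have "\<bar>circle_cos (norm z)\<bar> \<le> cmod (\<integral>om. ?f om \<partial>\<sigma>)" by (simp only: abs_Re_le_cmod)
 then have "\<bar>circle_cos (norm z)\<bar> / (2 * pi) \<le> cmod (\<integral>om. ?f om \<partial>\<sigma>) / (2 * pi)" by (rule divide_right_mono) simp
 then show ?thesis unfolding extension_op_def by (simp add: norm_mult norm_divide)
qed

text \<open>The blocks of length \<open>T\<close> at spacing \<open>2 * T\<close> are disjoint, each
  carries at least the mass \<open>c\<close>, and the factor 1/(2s) on block k is at least a
  multiple of 1/(k + 1). This yields the harmonic sum.\<close>

lemma circle_cos_divergence:
 assumes p: "p > 0"
 obtains c where "c > 0"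
  "\<And>n. ennreal (c * harm n) \<le> (LEB s. ennreal (1 / (2 * s) * (s * (circle_cos s)\<^sup>2) powr p) * indicator {2..} s)"
proof -
 obtain T c where T: "T > 0" and c: "c > 0" and blk: "\<And>X. X \<ge> 1 \<Longrightarrow>
   ennreal c \<le> (LEB s. ennreal ((s * (circle_cos s)\<^sup>2) powr p) * indicator {X..X + T} s)" by (rule circle_cos_block[OF p]) (rule that)
 define X where "X k = 2 + 2 * real k * T" for k
 define a where "a k = inverse (real (Suc k)) / (4 * (1 + T))" for k
 have X2: "X k \<ge> 2" for k using T by (simp add: X_def)
 have uniq: "i = k" if z: "s \<in> {X i..X i + T}" "s \<in> {X k..X k + T}" for s i k
 proof (rule ccontr)
  have *: False if ik: "Suc i \<le> k" and z: "s \<in> {X i..X i + T}" "s \<in> {X k..X k + T}" for i k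
  proof -
   have "real (Suc i) * T \<le> real k * T" using ik T by (intro mult_right_mono) auto
   then show False using z T by (simp add: X_def algebra_simps)
  qed
  assume "i \<noteq> k"
  then consider "Suc i \<le> k" | "Suc k \<le> i" by linarith
  then show False using * z by cases blast+
 qed
 have a0: "a k \<ge> 0" for k using T by (simp add: a_def)
 have ale: "a k \<le> 1 / (2 * s)" if s: "s \<in> {X k..X k + T}" for s k
 proof -
  have s2: "s \<ge> 2" using s X2[of k] by auto
  have "s \<le> 2 + 2 * real k * T + T" using s by (simp add: X_def)
  also have "... \<le> 2 * (1 + T) * real (Suc k)" using T by (simp add: algebra_simps)
  finally have "2 * s \<le> 4 * (1 + T) * real (Suc k)" by (simp add: algebra_simps)
  then have "1 / (4 * (1 + T) * real (Suc k)) \<le> 1 / (2 * s)" using s2 by (intro divide_left_mono) auto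
  moreover have "a k = 1 / (4 * (1 + T) * real (Suc k))" unfolding a_def by (simp only: inverse_eq_divide divide_divide_eq_left mult.commute)
  ultimately show ?thesis by (simp only:)
 qed
 let ?g = "\<lambda>s. (s * (circle_cos s)\<^sup>2) powr p"
 have cm[measurable]: "circle_cos \<in> borel_measurable borel" by (rule borel_measurable_continuous_onI[OF continuous_circle_cos])
 have pt: "(\<Sum>k<n. ennreal (a k) * (ennreal (?g s) * indicator {X k..X k + T} s)) \<le> ennreal (1 / (2 * s) * ?g s) * indicator {2..} s" for n s
 proof (cases "\<exists>k<n. s \<in> {X k..X k + T}")
  case True
  then obtain j where j: "j < n" "s \<in> {X j..X j + T}" by blast
  have "(\<Sum>k<n. ennreal (a k) * (ennreal (?g s) * indicator {X k..X k + T} s)) = (\<Sum>k<n. if k = j then ennreal (a j) * ennreal (?g s) else 0)"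
   using j(2) by (intro sum.cong refl) (auto simp del: atLeastAtMost_iff simp: indicator_def dest: uniq)
  also have "... = ennreal (a j) * ennreal (?g s)" using j(1) by simp
  also have "... = ennreal (a j * ?g s)" using a0 by (intro ennreal_mult[symmetric]) auto
  also have "... \<le> ennreal (1 / (2 * s) * ?g s)" by (intro ennreal_leI mult_right_mono ale[OF j(2)]) simp
  also have "... = ennreal (1 / (2 * s) * ?g s) * indicator {2..} s" using j(2) X2[of j] by (simp add: indicator_def)
  finally show ?thesis .
 next
  case False
  then have "(\<Sum>k<n. ennreal (a k) * (ennreal (?g s) * indicator {X k..X k + T} s)) = 0"
   by (intro sum.neutral) (auto simp del: atLeastAtMost_iff simp: indicator_def)
  then show ?thesis by (simp only: zero_le)
 qed
 show thesis
 proof (rule that[of "c / (4 * (1 + T))"])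
  show "c / (4 * (1 + T)) > 0" using c T by simp
  fix n :: nat
  have "ennreal (c / (4 * (1 + T)) * harm n) = (\<Sum>k<n. ennreal (a k * c))"
  proof -
   have "c / (4 * (1 + T)) * harm n = (\<Sum>k<n. a k * c)" unfolding harm_altdef sum_distrib_left a_def by (intro sum.cong refl) simp
   moreover have "0 \<le> a k * c" for k using a0 c by simp
   ultimately show ?thesis by (simp only: sum_ennreal)
  qed
  also have "... = (\<Sum>k<n. ennreal (a k) * ennreal c)" using a0 c by (intro sum.cong refl ennreal_mult) auto
  also have "... \<le> (\<Sum>k<n. ennreal (a k) * (LEB s. ennreal (?g s) * indicator {X k..X k + T} s))"
   using X2 by (intro sum_mono mult_left_mono blk) (auto intro: order_trans[of 1 2])
  also have "... = (\<Sum>k<n. LEB s. ennreal (a k) * (ennreal (?g s) * indicator {X k..X k + T} s))"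
   by (intro sum.cong refl nn_integral_cmult[symmetric]) auto
  also have "... = (LEB s. (\<Sum>k<n. ennreal (a k) * (ennreal (?g s) * indicator {X k..X k + T} s)))"
   by (rule nn_integral_sum[symmetric]) auto
  also have "... \<le> (LEB s. ennreal (1 / (2 * s) * ?g s) * indicator {2..} s)" by (intro nn_integral_mono pt)
  finally show "ennreal (c / (4 * (1 + T)) * harm n) \<le> (LEB s. ennreal (1 / (2 * s) * ?g s) * indicator {2..} s)" .
 qed
qed

text \<open>The constant function is tested on the sector 0 \<le> y \<le> x, foliated by the rays y
  = t x. There the weight is at least (2x)^(-(al + be)), the extension is about x^(-1/2) on average,
  and the area element brings a factor x. If the claim fails, the resulting power of x is at least
  -1 and the integral diverges, logarithmically in the case of equality.\<close>

lemma extension_estimate_decay: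
 assumes est: "extension_estimate al be rh q" and ab: "0 \<le> al" "0 \<le> be" and q: "q > 0"
 shows "al + be > 2 / q - 1 / 2"
proof (rule ccontr)
 assume "\<not> al + be > 2 / q - 1 / 2"
 then have "(al + be) * q \<le> (2 / q - 1 / 2) * q" using q by (intro mult_right_mono) auto
 then have e: "- ((al + be) * q) - q / 2 + 1 \<ge> - 1" using q by (simp add: left_diff_distrib)
 obtain C where C: "C > 0" and B: "\<And>F N. test_function rh F N \<Longrightarrow> (LEB z. ennreal ((plane_weight al be z * cmod (Ext F z)) powr q)) \<le> ennreal ((C * N) powr q)"
  using est unfolding extension_estimate_def by blast
 define V where "V = (C * (2 * pi) powr rh) powr q"
 have V: "V > 0" using C by (simp add: V_def)
 define h where "h z = ennreal ((plane_weight al be z * cmod (Ext (\<lambda>_. 1) z)) powr q)" for z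
 have hm[measurable]: "h \<in> borel_measurable borel" unfolding h_def by measurable
 have up: "(LEB z. h z) \<le> ennreal V" unfolding h_def V_def by (rule B) (auto simp: test_function_def powr_powr emeasure_circle_measure)
 obtain c where c: "c > 0" and div: "\<And>n. ennreal (c * harm n) \<le>
   (LEB s. ennreal (1 / (2 * s) * (s * (circle_cos s)\<^sup>2) powr (q / 2)) * indicator {2..} s)"
  by (rule circle_cos_divergence[of "q / 2"]) (use q that in auto)
 have cm[measurable]: "circle_cos \<in> borel_measurable borel" by (rule borel_measurable_continuous_onI[OF continuous_circle_cos])
 define k where "k = (2 * pi) powr (- q) / 2"
 have k: "k > 0" by (simp add: k_def)
 \<comment> \<open>The factor x on the right is the Jacobian of (x, t) -> (x, x t); \<open>m\<close>
   is the ratio of the norm to the first coordinate on the ray of slope \<open>t\<close>, between 1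
   and 2.\<close>
 have pt: "ennreal (k * (1 / (2 * x) * (m * x * (circle_cos (m * x))\<^sup>2) powr (q / 2))) \<le> ennreal x * h (x, x * t)"
  if x: "x \<ge> 1" and t: "0 \<le> t" "t \<le> 1" and m: "m = sqrt (1 + t\<^sup>2)" for x t m
 proof -
  have t2: "t\<^sup>2 \<le> 1" using t by (simp add: power_le_one)
  have m12: "1 \<le> m" "m \<le> 2" unfolding m using t2 by (auto intro: real_le_lsqrt)
  have "norm (x, x * t) = sqrt (x\<^sup>2 * (1 + t\<^sup>2))" by (simp add: norm_Pair algebra_simps)
  also have "... = m * x" unfolding real_sqrt_mult using x m by simp
  finally have n: "norm (x, x * t) = m * x" .
  define A where "A = \<bar>circle_cos (m * x)\<bar>"
  have A: "A \<ge> 0" by (simp add: A_def)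
  have E: "A / (2 * pi) \<le> cmod (Ext (\<lambda>_. 1) (x, x * t))" using extension_op_one_ge[of "(x, x * t)"] unfolding n A_def .
  have xt: "0 \<le> x * t" "x * t \<le> x" using x t by (auto simp: mult_left_le)
  have w: "(2 * x) powr (- (al + be)) \<le> plane_weight al be (x, x * t)"
  proof -
   have "(2 * x) powr (- (al + be)) = (2 * x) powr (- al) * (2 * x) powr (- be)" unfolding powr_add[symmetric] by simp
   also have "... \<le> (1 + x) powr (- al) * (1 + x * t) powr (- be)"
   proof (intro mult_mono powr_mono2')
    show "1 + x \<le> 2 * x" "1 + x * t \<le> 2 * x" using x xt(2) by linarith+
   qed (use x xt ab in auto)
   finally show ?thesis using x xt by (simp add: plane_weight_def)
  qed
  have "((2 * x) powr (- (al + be)) * (A / (2 * pi))) powr q \<le> (plane_weight al be (x, x * t) * cmod (Ext (\<lambda>_. 1) (x, x * t))) powr q"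
   using w E A q by (intro powr_mono2 mult_mono) (auto simp: plane_weight_bounds)
  then have 1: "x * ((2 * x) powr (- (al + be)) * (A / (2 * pi))) powr q \<le> x * (plane_weight al be (x, x * t) * cmod (Ext (\<lambda>_. 1) (x, x * t))) powr q"
   using x by (intro mult_left_mono) auto
  have 2: "((2 * x) powr (- (al + be)) * (A / (2 * pi))) powr q = (2 * x) powr (- ((al + be) * q)) * (A powr q * (2 * pi) powr (- q))"
  proof -
   have *: "(A / (2 * pi)) powr q = A powr q * (2 * pi) powr (- q)" using A by (simp add: powr_divide powr_minus_divide)
   show ?thesis unfolding powr_mult[of "(2 * x) powr (- (al + be))"] * powr_powr mult_minus_left ..
  qed
  have 3: "(m * x * (circle_cos (m * x))\<^sup>2) powr (q / 2) \<le> (2 * x) powr (q / 2) * A powr q"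
  proof -
   have "A powr q = (A powr 2) powr (q / 2)" by (simp add: powr_powr)
   also have "A powr 2 = (circle_cos (m * x))\<^sup>2" using A by (simp add: A_def powr_numeral)
   finally have a: "A powr q = ((circle_cos (m * x))\<^sup>2) powr (q / 2)" .
   have "(m * x) powr (q / 2) \<le> (2 * x) powr (q / 2)" using m12 x q by (intro powr_mono2 mult_right_mono) auto
   then show ?thesis unfolding powr_mult[of "m * x"] a by (intro mult_right_mono) auto
  qed
  have 4: "1 / (2 * x) * (2 * x) powr (q / 2) \<le> (2 * x) * (2 * x) powr (- ((al + be) * q))"
  proof -
   have x2: "2 * x \<ge> 1" "2 * x > 0" using x by auto
   have "1 / (2 * x) * (2 * x) powr (q / 2) = (2 * x) powr (- 1) * (2 * x) powr (q / 2)" using x2 by (simp add: powr_minus_divide)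
   also have "... = (2 * x) powr (- 1 + q / 2)" by (rule powr_add[symmetric])
   also have "... \<le> (2 * x) powr (1 + - ((al + be) * q))" using e x2 by (intro powr_mono) auto
   also have "... = (2 * x) powr 1 * (2 * x) powr (- ((al + be) * q))" by (rule powr_add)
   finally show ?thesis using x2 by simp
  qed
  have "k * (1 / (2 * x) * (m * x * (circle_cos (m * x))\<^sup>2) powr (q / 2)) \<le> k * (1 / (2 * x) * ((2 * x) powr (q / 2) * A powr q))"
   using k x by (intro mult_left_mono 3) auto
  also have "... = k * A powr q * (1 / (2 * x) * (2 * x) powr (q / 2))" by (simp only: mult_ac)
  also have "... \<le> k * A powr q * ((2 * x) * (2 * x) powr (- ((al + be) * q)))" using k by (intro mult_left_mono 4) auto
  also have "... = x * ((2 * x) powr (- (al + be)) * (A / (2 * pi))) powr q" unfolding 2 by (simp add: k_def mult_ac)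
  finally have 5: "k * (1 / (2 * x) * (m * x * (circle_cos (m * x))\<^sup>2) powr (q / 2)) \<le> x * (plane_weight al be (x, x * t) * cmod (Ext (\<lambda>_. 1) (x, x * t))) powr q"
   using 1 by linarith
  have "ennreal x * h (x, x * t) = ennreal (x * (plane_weight al be (x, x * t) * cmod (Ext (\<lambda>_. 1) (x, x * t))) powr q)"
   unfolding h_def using x by (intro ennreal_mult[symmetric]) auto
  then show ?thesis using 5 by (simp only: ennreal_leI)
 qed
 have ray: "ennreal (k * (c * harm n)) \<le> (LEB x. indicator {1..} x * (ennreal x * h (x, x * t)))"
  if t: "0 \<le> t" "t \<le> 1" for t n
 proof -
  define m where "m = sqrt (1 + t\<^sup>2)"
  have t2: "t\<^sup>2 \<le> 1" using t by (simp add: power_le_one)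
  have m12: "1 \<le> m" "m \<le> 2" unfolding m_def using t2 by (auto intro: real_le_lsqrt)
  let ?G = "\<lambda>s. (s * (circle_cos s)\<^sup>2) powr (q / 2)"
  have "ennreal (c * harm n) \<le> (LEB s. ennreal (1 / (2 * s) * ?G s) * indicator {2..} s)" by (rule div)
  also have "... \<le> (LEB s. ennreal (1 / (2 * s) * ?G s) * indicator {m..} s)"
   using m12 by (intro nn_integral_mono mult_left_mono) (auto simp: indicator_def)
  also have "... = ennreal \<bar>m\<bar> * (LEB x. ennreal (1 / (2 * (0 + m * x)) * ?G (0 + m * x)) * indicator {m..} (0 + m * x))"
   using m12 by (intro nn_integral_real_affine) auto
  also have "... = (LEB x. ennreal m * (ennreal (1 / (2 * (m * x)) * ?G (m * x)) * indicator {m..} (m * x)))"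
   using m12 by (subst nn_integral_cmult) auto
  also have "... = (LEB x. indicator {1..} x * ennreal (1 / (2 * x) * ?G (m * x)))"
  proof (intro nn_integral_cong)
   fix x :: real
   show "ennreal m * (ennreal (1 / (2 * (m * x)) * ?G (m * x)) * indicator {m..} (m * x)) = indicator {1..} x * ennreal (1 / (2 * x) * ?G (m * x))"
   proof (cases "x \<ge> 1")
    case True
    then have "m \<le> m * x" using m12 by simp
    moreover have "ennreal m * ennreal (1 / (2 * (m * x)) * ?G (m * x)) = ennreal (m * (1 / (2 * (m * x)) * ?G (m * x)))"
     using True m12 by (intro ennreal_mult[symmetric]) auto
    moreover have "m * (1 / (2 * (m * x)) * ?G (m * x)) = 1 / (2 * x) * ?G (m * x)" using m12 by simp
    ultimately show ?thesis using True by (simp only: indicator_simps atLeast_iff mult_1 mult_1_right)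
   next
    case False
    then have "\<not> m \<le> m * x" using m12 by simp
    then show ?thesis using False by simp
   qed
  qed
  finally have 1: "ennreal (c * harm n) \<le> (LEB x. indicator {1..} x * ennreal (1 / (2 * x) * ?G (m * x)))" .
  have "ennreal (k * (c * harm n)) = ennreal k * ennreal (c * harm n)" using k c harm_nonneg[of n, where 'a = real] by (intro ennreal_mult) auto
  also have "... \<le> ennreal k * (LEB x. indicator {1..} x * ennreal (1 / (2 * x) * ?G (m * x)))" by (intro mult_left_mono 1) simp
  also have "... = (LEB x. ennreal k * (indicator {1..} x * ennreal (1 / (2 * x) * ?G (m * x))))" by (rule nn_integral_cmult[symmetric]) auto
  also have "... \<le> (LEB x. indicator {1..} x * (ennreal x * h (x, x * t)))"
  proof (intro nn_integral_mono)
   fix x :: real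
   show "ennreal k * (indicator {1..} x * ennreal (1 / (2 * x) * ?G (m * x))) \<le> indicator {1..} x * (ennreal x * h (x, x * t))"
   proof (cases "x \<ge> 1")
    case True
    have "ennreal k * ennreal (1 / (2 * x) * ?G (m * x)) = ennreal (k * (1 / (2 * x) * ?G (m * x)))"
     using k True by (intro ennreal_mult[symmetric]) auto
    also have "... \<le> ennreal x * h (x, x * t)" by (rule pt[OF True t m_def])
    finally show ?thesis using True by (simp only: indicator_simps atLeast_iff mult_1)
   qed simp
  qed
  finally show ?thesis .
 qed
 have le: "ennreal (k * (c * harm n)) \<le> ennreal V" for n
 proof -
  have shm: "(\<lambda>z :: real \<times> real. (fst z, fst z * snd z)) \<in> borel_measurable borel"
   by (intro borel_measurable_continuous_onI continuous_intros)
  have i1: "(\<lambda>z :: real \<times> real. ennreal (fst z)) \<in> borel_measurable borel" by measurable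
  have i2: "(\<lambda>z :: real \<times> real. indicator {1..} (fst z) :: ennreal) \<in> borel_measurable borel"
   by (rule measurable_compose[OF borel_measurable_plane_coords(1)]) simp
  have jm: "(\<lambda>z. indicator {1..} (fst z) * (ennreal (fst z) * h (fst z, fst z * snd z))) \<in> borel_measurable borel"
   by (intro borel_measurable_times_ennreal i1 i2 measurable_compose[OF shm hm])
  have slice[measurable]: "(\<lambda>y. h (x, y)) \<in> borel_measurable borel" for x
   by (rule measurable_compose[OF _ hm]) (intro borel_measurable_continuous_onI continuous_intros)
  have "ennreal (k * (c * harm n)) = (LEB t. ennreal (k * (c * harm n)) * indicator {0..1::real} t)" by (subst nn_integral_cmult_indicator) auto
  also have "... \<le> (LEB t. LEB x. indicator {1..} x * (ennreal x * h (x, x * t)))"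
  proof (intro nn_integral_mono)
   fix t :: real
   show "ennreal (k * (c * harm n)) * indicator {0..1} t \<le> (LEB x. indicator {1..} x * (ennreal x * h (x, x * t)))"
    using ray[of t n] by (cases "t \<in> {0..1}") auto
  qed
  also have "... = (LEB x. LEB t. indicator {1..} x * (ennreal x * h (x, x * t)))" using nn_integral_plane[OF jm] by simp
  also have "... \<le> (LEB x. LEB y. h (x, y))"
  proof (rule nn_integral_mono)
   fix x :: real
   show "(LEB t. indicator {1..} x * (ennreal x * h (x, x * t))) \<le> (LEB y. h (x, y))"
   proof (cases "x \<ge> 1")
    case True
    have "(LEB y. h (x, y)) = ennreal \<bar>x\<bar> * (LEB t. h (x, 0 + x * t))" using True by (intro nn_integral_real_affine) auto
    also have "... = (LEB t. ennreal x * h (x, x * t))" using True by (subst nn_integral_cmult) auto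
    finally show ?thesis using True by simp
   qed simp
  qed
  also have "... = (LEB z. h z)" by (rule nn_integral_plane(1)[symmetric]) measurable
  also have "... \<le> ennreal V" by (rule up)
  finally show ?thesis .
 qed
 have "k * c * ln (real n + 1) \<le> V" for n
 proof -
  have "k * c * ln (real n + 1) \<le> k * c * harm n" using k c by (intro mult_left_mono ln_le_harm) auto
  also have "... \<le> V" using le[of n] V by (subst (asm) ennreal_le_iff) (auto simp: mult.assoc)
  finally show ?thesis .
 qed
 note ln_le = this
 define n where "n = nat \<lceil>exp (V / (k * c) + 1)\<rceil>"
 have "exp (V / (k * c) + 1) \<le> real n" unfolding n_def by (rule real_nat_ceiling_ge)
 then have "exp (V / (k * c) + 1) \<le> real n + 1" by linarith
 then have "ln (exp (V / (k * c) + 1)) \<le> ln (real n + 1)" by (subst ln_le_cancel_iff) auto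
 then have "V / (k * c) + 1 \<le> ln (real n + 1)" by simp
 then have "k * c * (V / (k * c) + 1) \<le> k * c * ln (real n + 1)" using k c by (intro mult_left_mono) auto
 then have "V + k * c \<le> V" using ln_le[of n] k c by (simp add: distrib_left)
 then show False using k c by (simp add: mult_le_0_iff)
qed

text \<open>\<open>d2\<close> and \<open>d3\<close> measure the violation of the axis and the plane
  condition. The single-cap estimates make both nonpositive, so only equality in the one that is
  relevant for the size of \<open>al\<close> needs further arguments. The larger exponent is assumed
  on x, along the short side of the boxes; this gives the stronger conditions.\<close>

lemma extension_estimate_exponents:
 assumes est: "extension_estimate al be rh q" and ab: "0 \<le> be" "be \<le> al" and rh: "0 \<le> rh" "rh \<le> 1" and q: "q > 0"
 shows "(al \<ge> 1 / q \<and> 2 * be > 2 / q - (1 - rh)) \<or> (al < 1 / q \<and> al + 2 * be > 3 / q - (1 - rh)) \<or>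
  (rh < 1 \<and> 1 \<le> rh * q \<and> ((al > 1 / q \<and> 2 * be = 2 / q - (1 - rh)) \<or> (al < 1 / q \<and> al + 2 * be = 3 / q - (1 - rh))))"
proof -
 have a0: "0 \<le> al" using ab by simp
 define p where "p = 1 / q"
 have p: "2 / q = 2 * p" "3 / q = 3 * p" "p * q = 1" using q by (auto simp: p_def)
 define d2 where "d2 = 2 * p - 2 * be - (1 - rh)"
 define d3 where "d3 = 3 * p - (al + 2 * be) - (1 - rh)"
 have "q * d2 = 2 * (p * q) - 2 * (be * q) - q * (1 - rh)" by (simp add: d2_def algebra_simps)
 then have E2: "2 * (1 - be * q) - q * (1 - rh) = q * d2" unfolding p by simp
 have "q * d3 = 3 * (p * q) - (al * q + 2 * (be * q)) - q * (1 - rh)" by (simp add: d3_def algebra_simps)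
 then have E3: "1 - al * q + 2 * (1 - be * q) - q * (1 - rh) = q * d3" unfolding p by simp
 note facts = knapp_plane[OF est a0 ab(1) rh(1) q] knapp_axis[OF est a0 ab(1) rh(1) q]
  knapp_log_x[OF est a0 ab(1) rh(1) q] knapp_log_y[OF est a0 ab(1) rh(1) q]
  multiscale_plane[OF est a0 ab(1) rh(1) q] multiscale_axis[OF est a0 ab(1) rh(1) q]
 have d3: "d3 \<le> 0" and d2: "d2 \<le> 0" using facts(1,2) q unfolding E2 E3 by (auto simp: mult_le_0_iff)
 have lx: "d2 < 0" if "al = p" using facts(3) that q p(3) unfolding E2 by (auto simp: mult_less_0_iff)
 have ly: "d2 < 0" if "be = p" using facts(4) that q p(3) unfolding E2 by (auto simp: mult_less_0_iff)
 have m3: "1 \<le> rh * q" if "d3 = 0" using facts(5) that unfolding E3 by simp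
 have m2: "1 \<le> rh * q" if "d2 = 0" using facts(6) that unfolding E2 by simp
 show ?thesis
 proof (cases "al \<ge> p")
  case True
  show ?thesis
  proof (cases "d2 = 0")
   case z: True
   have "al \<noteq> p" using lx z by auto
   \<comment> \<open>For r = 1 the equality says be = 1/q, which the logarithm along the long side
     excludes.\<close>
   moreover have "rh \<noteq> 1" using ly z by (auto simp: d2_def)
   ultimately have "rh < 1 \<and> 1 \<le> rh * q \<and> al > 1 / q \<and> 2 * be = 2 / q - (1 - rh)"
    using True z m2 rh unfolding p p_def[symmetric] by (auto simp: d2_def)
   then show ?thesis by blast
  next
   case False
   then have "2 * be > 2 / q - (1 - rh)" using d2 unfolding p by (simp add: d2_def)
   then show ?thesis using True by (simp add: p_def)
  qed
 next
  case False
  show ?thesis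
  proof (cases "d3 = 0")
   case z: True
   \<comment> \<open>For r = 1 the equality says al + 2 be = 3/q, impossible for be \<le> al <
     1/q.\<close>
   have "rh \<noteq> 1" using z False ab by (auto simp: d3_def)
   then have "rh < 1 \<and> 1 \<le> rh * q \<and> al < 1 / q \<and> al + 2 * be = 3 / q - (1 - rh)"
    using False z m3 rh unfolding p p_def[symmetric] by (auto simp: d3_def)
   then show ?thesis by blast
  next
   case z: False
   then have "al + 2 * be > 3 / q - (1 - rh)" using d3 unfolding p by (simp add: d3_def)
   then show ?thesis using False by (simp add: p_def)
  qed
 qed
qed

theorem theorem3:
 fixes \<alpha> \<beta> :: real and r r' :: ennreal
 assumes "0 \<le> \<alpha>" and "0 \<le> \<beta>"
  and "1 \<le> r" and "1 / r + 1 / r' = 1"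
 shows
  "(\<forall>q::real. 0 < q \<longrightarrow> \<alpha> + \<beta> > 2 / q - 1 / 2 \<longrightarrow>
    (max \<alpha> \<beta> \<ge> 1 / q \<and> 2 * min \<alpha> \<beta> > 2 / q - enn2real (1 / r')) \<or>
    (max \<alpha> \<beta> < 1 / q \<and> \<alpha> + \<beta> + min \<alpha> \<beta> > 3 / q - enn2real (1 / r')) \<or>
    (1 < r \<and> r \<le> ennreal q \<and>
     ((max \<alpha> \<beta> > 1 / q \<and> 2 * min \<alpha> \<beta> = 2 / q - enn2real (1 / r')) \<or>
     (max \<alpha> \<beta> < 1 / q \<and> \<alpha> + \<beta> + min \<alpha> \<beta> = 3 / q - enn2real (1 / r')))) \<longrightarrow>
    weighted_extension_bounded \<alpha> \<beta> r (ennreal q)) \<and>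
  weighted_extension_bounded \<alpha> \<beta> r \<infinity> \<and>
  (\<forall>q::real. 0 < q \<longrightarrow> weighted_extension_bounded \<alpha> \<beta> r (ennreal q) \<longrightarrow>
    \<alpha> + \<beta> > 2 / q - 1 / 2 \<and>
    ((max \<alpha> \<beta> \<ge> 1 / q \<and> 2 * min \<alpha> \<beta> > 2 / q - enn2real (1 / r')) \<or>
    (max \<alpha> \<beta> < 1 / q \<and> \<alpha> + \<beta> + min \<alpha> \<beta> > 3 / q - enn2real (1 / r')) \<or>
    (1 < r \<and> r \<le> ennreal q \<and>
     ((max \<alpha> \<beta> > 1 / q \<and> 2 * min \<alpha> \<beta> = 2 / q - enn2real (1 / r')) \<or>
     (max \<alpha> \<beta> < 1 / q \<and> \<alpha> + \<beta> + min \<alpha> \<beta> = 3 / q - enn2real (1 / r'))))))"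
proof -
 define \<rho> where "\<rho> = enn2real (1 / r)"
 have "1 / r \<le> 1" "1 / r' \<le> 1" using assms(4) by (metis le_iff_add, metis le_iff_add add.commute)
 then have fin: "1 / r < \<top>" "1 / r' < \<top>" by (auto intro: le_less_trans)
 have "enn2real (1 / r + 1 / r') = \<rho> + enn2real (1 / r')" unfolding \<rho>_def by (rule enn2real_plus[OF fin])
 then have conj: "enn2real (1 / r') = 1 - \<rho>" unfolding assms(4) by simp
 have \<rho>: "0 \<le> \<rho>" "\<rho> \<le> 1" using conj enn2real_nonneg[of "1 / r'"] by (auto simp: \<rho>_def)
 have real_r: "\<rho> = 1 / s \<and> s \<ge> 1" if "r = ennreal s" "0 \<le> s" for s
 proof -
  have s: "s \<ge> 1" using assms(3) that by (simp add: ennreal_le_iff flip: ennreal_1)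
  have "1 / r = ennreal (1 / s)" using s that by (simp add: divide_ennreal flip: ennreal_1)
  then show ?thesis using s by (simp add: \<rho>_def)
 qed
 let ?P = "\<lambda>q. (max \<alpha> \<beta> \<ge> 1 / q \<and> 2 * min \<alpha> \<beta> > 2 / q - (1 - \<rho>)) \<or>
    (max \<alpha> \<beta> < 1 / q \<and> \<alpha> + \<beta> + min \<alpha> \<beta> > 3 / q - (1 - \<rho>)) \<or>
    (1 < r \<and> r \<le> ennreal q \<and>
     ((max \<alpha> \<beta> > 1 / q \<and> 2 * min \<alpha> \<beta> = 2 / q - (1 - \<rho>)) \<or>
     (max \<alpha> \<beta> < 1 / q \<and> \<alpha> + \<beta> + min \<alpha> \<beta> = 3 / q - (1 - \<rho>))))"
 have suff: "weighted_extension_bounded \<alpha> \<beta> r (ennreal q)"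
  if q: "0 < q" and c: "\<alpha> + \<beta> > 2 / q - 1 / 2"
   and h: "?P q" for q using h
 proof (elim disjE conjE)
  assume m: "max \<alpha> \<beta> \<ge> 1 / q" "2 * min \<alpha> \<beta> > 2 / q - (1 - \<rho>)"
  show ?thesis
  \<comment> \<open>For r = 1 the hypothesis puts both exponents above 1/q, where the weight alone
    is in L^q. For r > 1 the exponents may be lowered.\<close>
  proof (cases "\<rho> = 1")
   case True
   obtain s where s: "r = ennreal s" "0 \<le> s" by (cases r) (use True in \<open>auto simp: \<rho>_def\<close>)
   have "s = 1" using real_r[OF s] True by simp
   then have r1: "r = 1" using s by simp
   have "2 * (1 / q) = 2 / q" by simp
   then have "min \<alpha> \<beta> > 1 / q" using m(2) True by linarith
   then have "\<alpha> > 1 / q" "\<beta> > 1 / q" by auto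
   then have "\<alpha> * q > 1" "\<beta> * q > 1" using q by (simp_all only: pos_divide_less_eq)
   then show ?thesis unfolding r1 by (rule weighted_extension_bounded_L1[OF _ _ q])
  next
   case False
   then have "\<rho> < 1" using \<rho> by simp
   then show ?thesis using m(2) unfolding \<rho>_def by (rule weighted_extension_bounded_axis[OF assms(1,2) q assms(3) _ m(1)])
  qed
 next
  assume "max \<alpha> \<beta> < 1 / q" "\<alpha> + \<beta> + min \<alpha> \<beta> > 3 / q - (1 - \<rho>)"
  then show ?thesis unfolding \<rho>_def by (rule weighted_extension_bounded_plane[OF assms(1,2) q assms(3) c])
 next
  assume "1 < r" "r \<le> ennreal q" "max \<alpha> \<beta> > 1 / q" "2 * min \<alpha> \<beta> = 2 / q - (1 - \<rho>)"
  then show ?thesis unfolding \<rho>_def by (rule weighted_extension_bounded_axis_endpoint[OF assms(1,2) q])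
 next
  assume rr: "1 < r" "r \<le> ennreal q" and "max \<alpha> \<beta> < 1 / q" "\<alpha> + \<beta> + min \<alpha> \<beta> = 3 / q - (1 - \<rho>)"
  then show ?thesis unfolding \<rho>_def by (intro weighted_extension_bounded_plane_endpoint[OF assms(1,2) q rr c])
 qed
 have nec: "\<alpha> + \<beta> > 2 / q - 1 / 2 \<and>
    ?P q"
  if q: "0 < q" and b: "weighted_extension_bounded \<alpha> \<beta> r (ennreal q)" for q
 proof
  have est: "extension_estimate \<alpha> \<beta> \<rho> q" unfolding \<rho>_def by (rule extension_estimateI[OF b assms(3) q])
  show "\<alpha> + \<beta> > 2 / q - 1 / 2" by (rule extension_estimate_decay[OF est assms(1,2) q])
  have rq: "1 < r \<and> r \<le> ennreal q" if h: "\<rho> < 1" "1 \<le> \<rho> * q"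
  proof (cases r)
   case (real s)
   then have s: "\<rho> = 1 / s" "s \<ge> 1" using real_r[of s] by auto
   then have "s > 1" using h by (cases "s = 1") auto
   moreover have "s \<le> q" using h(2) s by (simp add: le_divide_eq)
   ultimately show ?thesis using real q by (auto simp: ennreal_leI ennreal_less_iff simp flip: ennreal_1)
  next
   case top
   then show ?thesis using h by (simp add: \<rho>_def)
  qed
  show "?P q"
  proof (cases "\<beta> \<le> \<alpha>")
   case True
   have mm: "max \<alpha> \<beta> = \<alpha>" "min \<alpha> \<beta> = \<beta>" "\<alpha> + \<beta> + \<beta> = \<alpha> + 2 * \<beta>" using True by auto
   show ?thesis unfolding mm using extension_estimate_exponents[OF est assms(2) True \<rho> q] rq by blast
  next
   case False
   then have le: "\<alpha> \<le> \<beta>" by simp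
   have mm: "max \<alpha> \<beta> = \<beta>" "min \<alpha> \<beta> = \<alpha>" "\<alpha> + \<beta> + \<alpha> = \<beta> + 2 * \<alpha>" using le by auto
   show ?thesis unfolding mm using extension_estimate_exponents[OF extension_estimate_swap[OF est] assms(1) le \<rho> q] rq by blast
  qed
 qed
 show ?thesis unfolding conj using suff nec weighted_extension_bounded_sup[OF assms(1,2,3)] by blast
qed

end
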